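(* Let $(X,\mu)$ be the Poisson boundary of the simple random walk on the free group $F_2$ and let $R$ be the equivalence relation generated by the natural action of $F_2$ on $(X,\mu)$. Then the measurable lamplighter $\mathrm{C}_\mu(R)\rtimes[R]$ is a contractible, hence locally generated, amenable Polish topological group without the Kesten property.
   Context: The simple random walk on $F_2=F_2(a,b)$ is driven by the measure assigning weight $1/4$ to each of $a,b,a^{-1},b^{-1}$. Its Poisson boundary may be realized as the space $X$ of infinite reduced words in $a^{\pm1},b^{\pm1}$, with the natural action of $F_2$ by left multiplication, and $\mu$ the hitting (harmonic) measure, which is $F_2$-quasi-invariant and non-atomic; $R$ is the orbit equivalence relation. For a countable Borel equivalence relation $R$ on $(X,\mu)$ with $\mu$ quasi-invariant: the full group $[R]$ is the group of Borel automorphisms of $X$ preserving the measure class of $\mu$ (identified when they agree $\mu$-a.e.) whose graph is contained in $R$ on a set of full measure; it carries the uniform topology generated by the metric $(g,h)\mapsto\mu(\{x\mid g(x)\ne h(x)\})$. For Borel $A\subseteq R$ put $A_x=\{y\mid(x,y)\in A\}$ and $\mu_R(A)=\int_X|A_x|\,\mathrm d\mu(x)$. $\mathrm{C}_\mu(R)$ is the abelian group, under symmetric difference, of $\mu_R$-equivalence classes of Borel $A\subseteq R$ with $\mu_R(A)<\infty$, with the $L^1$-topology generated by the metric $(A,B)\mapsto\mu_R(A\triangle B)$. The action $g(x,y)=(x,gy)$ induces an isometric action of $[R]$ on $\mathrm{C}_\mu(R)$, and the measurable lamplighter $\mathrm{C}_\mu(R)\rtimes[R]$ is the corresponding semidirect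 product, with multiplication $(c,g)(c',g')=(c+gc',gg')$, endowed with the product topology. A topological group $H$ is locally generated if every identity neighborhood generates $H$ as a group. With $\mathcal U(H)$ the identity neighborhood filter, $H$ is amenable if $\mathrm{RUCB}(H)=\{f\in\ell^\infty(H)\mid \forall\epsilon>0\ \exists U\in\mathcal U(H)\ \forall x\in H\ \forall y\in Ux\colon|f(x)-f(y)|\le\epsilon\}$ admits a positive unital linear functional $m$ with $m(f\circ\lambda_g)=m(f)$ for all $f$ and $g\in H$, where $\lambda_g(x)=gx$. $H$ has the Kesten property if for every open identity neighborhood $U$ and every symmetric regular Borel probability measure $\theta$ on $H$ with countable support (i.e. a countable convex combination of point masses), $\limsup_{n\to\infty}\theta^n(U^n)^{1/n}=1$, where $\theta^n$ is the $n$-fold convolution power and $U^n$ the $n$-fold product set. *)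

theory Defs
  imports "HOL-Probability.Probability" "HOL-Algebra.Algebra"
begin

section \<open>Topological groups\<close>

locale topological_group = group G for G :: "('a, 'b) monoid_scheme" (structure) +
  fixes T :: "'a topology"
  assumes topspace_eq_carrier: "topspace T = carrier G"
    and continuous_mult: "continuous_map (prod_topology T T) T (\<lambda>(x, y). x \<otimes> y)"
    and continuous_inv: "continuous_map T T (\<lambda>x. inv x)"

definition Polish_topology :: "'a topology \<Rightarrow> bool" where
  "Polish_topology T \<longleftrightarrow> completely_metrizable_space T \<and> separable_space T"

definition identity_nhds :: "('a, 'b) monoid_scheme \<Rightarrow> 'a topology \<Rightarrow> 'a set set" where
  "identity_nhds G T = {U. U \<subseteq> topspace T \<and> (\<exists>V. openin T V \<and> \<one>\<^bsub>G\<^esub> \<in> V \<and> V \<subseteq> U)}"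

definition locally_generated :: "('a, 'b) monoid_scheme \<Rightarrow> 'a topology \<Rightarrow> bool" where
  "locally_generated G T \<longleftrightarrow> (\<forall>U \<in> identity_nhds G T. generate G U = carrier G)"

text \<open>Elements of \<open>RUCB\<close> are total functions on the ambient type, constrained on the
  carrier only.  A positive linear functional on \<open>RUCB\<close> cannot see the values off the carrier:
  if \<open>f\<close> and \<open>g\<close> agree on the carrier, then both \<open>f - g\<close> and \<open>g - f\<close> are nonnegative there.\<close>

definition RUCB :: "('a, 'b) monoid_scheme \<Rightarrow> 'a topology \<Rightarrow> ('a \<Rightarrow> real) set" where
  "RUCB G T = {f. bounded (f ` carrier G) \<and>
     (\<forall>\<epsilon>>0. \<exists>U \<in> identity_nhds G T. \<forall>x \<in> carrier G. \<forall>y \<in> U #>\<^bsub>G\<^esub> x. \<bar>f x - f y\<bar> \<le> \<epsilon>)}"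

definition amenable_group :: "('a, 'b) monoid_scheme \<Rightarrow> 'a topology \<Rightarrow> bool" where
  "amenable_group G T \<longleftrightarrow> (\<exists>m :: ('a \<Rightarrow> real) \<Rightarrow> real.
     (\<forall>f \<in> RUCB G T. \<forall>h \<in> RUCB G T. m (\<lambda>x. f x + h x) = m f + m h) \<and>
     (\<forall>f \<in> RUCB G T. \<forall>c. m (\<lambda>x. c * f x) = c * m f) \<and>
     (\<forall>f \<in> RUCB G T. (\<forall>x \<in> carrier G. 0 \<le> f x) \<longrightarrow> 0 \<le> m f) \<and>
     m (\<lambda>x. 1) = 1 \<and>
     (\<forall>f \<in> RUCB G T. \<forall>g \<in> carrier G. m (\<lambda>x. f (g \<otimes>\<^bsub>G\<^esub> x)) = m f))"

primrec set_power :: "('a, 'b) monoid_scheme \<Rightarrow> 'a set \<Rightarrow> nat \<Rightarrow> 'a set" where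
  "set_power G U 0 = {\<one>\<^bsub>G\<^esub>}"
| "set_power G U (Suc n) = set_power G U n <#>\<^bsub>G\<^esub> U"

text \<open>The countable convex combinations of point masses on \<open>G\<close> are exactly the probability mass
  functions supported in the carrier.\<close>

primrec conv_power :: "('a, 'b) monoid_scheme \<Rightarrow> 'a pmf \<Rightarrow> nat \<Rightarrow> 'a pmf" where
  "conv_power G \<theta> 0 = return_pmf \<one>\<^bsub>G\<^esub>"
| "conv_power G \<theta> (Suc n) = map_pmf (\<lambda>(x, y). x \<otimes>\<^bsub>G\<^esub> y) (pair_pmf (conv_power G \<theta> n) \<theta>)"

definition Kesten_property :: "('a, 'b) monoid_scheme \<Rightarrow> 'a topology \<Rightarrow> bool" where
  "Kesten_property G T \<longleftrightarrow>
     (\<forall>U \<theta>. openin T U \<longrightarrow> \<one>\<^bsub>G\<^esub> \<in> U \<longrightarrow>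
        set_pmf \<theta> \<subseteq> carrier G \<longrightarrow> map_pmf (\<lambda>x. inv\<^bsub>G\<^esub> x) \<theta> = \<theta> \<longrightarrow>
        limsup (\<lambda>n. ereal (root n (measure_pmf.prob (conv_power G \<theta> n) (set_power G U n)))) = 1)"

definition semidirect_product ::
    "('c, 'm) monoid_scheme \<Rightarrow> ('g, 'n) monoid_scheme \<Rightarrow> ('g \<Rightarrow> 'c \<Rightarrow> 'c) \<Rightarrow> ('c \<times> 'g) monoid" where
  "semidirect_product C G act =
     \<lparr>carrier = carrier C \<times> carrier G,
      mult = (\<lambda>(c, g) (c', g'). (c \<otimes>\<^bsub>C\<^esub> act g c', g \<otimes>\<^bsub>G\<^esub> g')),
      one = (\<one>\<^bsub>C\<^esub>, \<one>\<^bsub>G\<^esub>)\<rparr>"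

section \<open>The measurable lamplighter of an equivalence relation\<close>

text \<open>Elements of the groups below are equivalence classes modulo null sets.  Operations and
  metrics on classes are computed on chosen representatives; for a quasi-invariant measure the
  results do not depend on the choice.\<close>

abbreviation repr :: "'a set \<Rightarrow> 'a" where
  "repr C \<equiv> (SOME x. x \<in> C)"

subsection \<open>The full group\<close>

definition Borel_automorphisms :: "'x measure \<Rightarrow> ('x \<Rightarrow> 'x) set" where
  "Borel_automorphisms M =
     {g. bij_betw g (space M) (space M) \<and> g \<in> M \<rightarrow>\<^sub>M M \<and> the_inv_into (space M) g \<in> M \<rightarrow>\<^sub>M M}"

definition preserves_measure_class :: "'x measure \<Rightarrow> ('x \<Rightarrow> 'x) \<Rightarrow> bool" where
  "preserves_measure_class M g \<longleftrightarrow>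
     (\<forall>A \<in> sets M. emeasure M (g -` A \<inter> space M) = 0 \<longleftrightarrow> emeasure M A = 0)"

definition full_maps :: "'x measure \<Rightarrow> ('x \<times> 'x) set \<Rightarrow> ('x \<Rightarrow> 'x) set" where
  "full_maps M R = {g \<in> Borel_automorphisms M. preserves_measure_class M g \<and> (AE x in M. (x, g x) \<in> R)}"

definition full_equiv :: "'x measure \<Rightarrow> ('x \<times> 'x) set \<Rightarrow> (('x \<Rightarrow> 'x) \<times> ('x \<Rightarrow> 'x)) set" where
  "full_equiv M R = {(g, h). g \<in> full_maps M R \<and> h \<in> full_maps M R \<and> (AE x in M. g x = h x)}"

definition full_group :: "'x measure \<Rightarrow> ('x \<times> 'x) set \<Rightarrow> ('x \<Rightarrow> 'x) set monoid" where
  "full_group M R =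
     \<lparr>carrier = full_maps M R // full_equiv M R,
      mult = (\<lambda>\<phi> \<psi>. full_equiv M R `` {repr \<phi> \<circ> repr \<psi>}),
      one = full_equiv M R `` {id}\<rparr>"

definition uniform_dist :: "'x measure \<Rightarrow> ('x \<Rightarrow> 'x) set \<Rightarrow> ('x \<Rightarrow> 'x) set \<Rightarrow> real" where
  "uniform_dist M \<phi> \<psi> = measure M {x \<in> space M. repr \<phi> x \<noteq> repr \<psi> x}"

definition uniform_topology :: "'x measure \<Rightarrow> ('x \<times> 'x) set \<Rightarrow> ('x \<Rightarrow> 'x) set topology" where
  "uniform_topology M R = Metric_space.mtopology (carrier (full_group M R)) (uniform_dist M)"

subsection \<open>The lamp group\<close>

definition rel_measure :: "'x measure \<Rightarrow> ('x \<times> 'x) set \<Rightarrow> ennreal" where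
  "rel_measure M A = (\<integral>\<^sup>+ x. emeasure (count_space UNIV) (A `` {x}) \<partial>M)"

definition lamp_sets :: "'x measure \<Rightarrow> ('x \<times> 'x) set \<Rightarrow> ('x \<times> 'x) set set" where
  "lamp_sets M R = {A \<in> sets (M \<Otimes>\<^sub>M M). A \<subseteq> R \<and> rel_measure M A < \<infinity>}"

definition lamp_equiv :: "'x measure \<Rightarrow> ('x \<times> 'x) set \<Rightarrow> (('x \<times> 'x) set \<times> ('x \<times> 'x) set) set" where
  "lamp_equiv M R = {(A, B). A \<in> lamp_sets M R \<and> B \<in> lamp_sets M R \<and> rel_measure M (sym_diff A B) = 0}"

definition lamp_group :: "'x measure \<Rightarrow> ('x \<times> 'x) set \<Rightarrow> ('x \<times> 'x) set set monoid" where
  "lamp_group M R =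
     \<lparr>carrier = lamp_sets M R // lamp_equiv M R,
      mult = (\<lambda>c d. lamp_equiv M R `` {sym_diff (repr c) (repr d)}),
      one = lamp_equiv M R `` {{}}\<rparr>"

definition lamp_dist :: "'x measure \<Rightarrow> ('x \<times> 'x) set set \<Rightarrow> ('x \<times> 'x) set set \<Rightarrow> real" where
  "lamp_dist M c d = enn2real (rel_measure M (sym_diff (repr c) (repr d)))"

definition lamp_topology :: "'x measure \<Rightarrow> ('x \<times> 'x) set \<Rightarrow> ('x \<times> 'x) set set topology" where
  "lamp_topology M R = Metric_space.mtopology (carrier (lamp_group M R)) (lamp_dist M)"

text \<open>A representative \<open>g\<close> need only satisfy \<open>(y, g y) \<in> R\<close> for almost every \<open>y\<close>, so the
  image of \<open>A \<subseteq> R\<close> may leave \<open>R\<close>; by quasi-invariance this affects only \<open>(x, y) \<in> A\<close> with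
  \<open>x\<close> in a null set, and intersecting with \<open>R\<close> does not change the class.\<close>

definition lamp_action ::
    "'x measure \<Rightarrow> ('x \<times> 'x) set \<Rightarrow> ('x \<Rightarrow> 'x) set \<Rightarrow> ('x \<times> 'x) set set \<Rightarrow> ('x \<times> 'x) set set" where
  "lamp_action M R \<phi> c = lamp_equiv M R `` {(\<lambda>(x, y). (x, repr \<phi> y)) ` repr c \<inter> R}"

definition lamplighter ::
    "'x measure \<Rightarrow> ('x \<times> 'x) set \<Rightarrow> (('x \<times> 'x) set set \<times> ('x \<Rightarrow> 'x) set) monoid" where
  "lamplighter M R = semidirect_product (lamp_group M R) (full_group M R) (lamp_action M R)"

definition lamplighter_topology ::
    "'x measure \<Rightarrow> ('x \<times> 'x) set \<Rightarrow> (('x \<times> 'x) set set \<times> ('x \<Rightarrow> 'x) set) topology" where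
  "lamplighter_topology M R = prod_topology (lamp_topology M R) (uniform_topology M R)"

section \<open>The Poisson boundary of the simple random walk on the free group of rank two\<close>

datatype letter = La | Lb | La' | Lb'

primrec inv_letter :: "letter \<Rightarrow> letter" where
  "inv_letter La = La'"
| "inv_letter Lb = Lb'"
| "inv_letter La' = La"
| "inv_letter Lb' = Lb"

definition reduced :: "letter list \<Rightarrow> bool" where
  "reduced w \<longleftrightarrow> (\<forall>i. Suc i < length w \<longrightarrow> w ! Suc i \<noteq> inv_letter (w ! i))"

fun push :: "letter \<Rightarrow> letter list \<Rightarrow> letter list" where
  "push s [] = [s]"
| "push s (t # w) = (if t = inv_letter s then w else s # t # w)"

definition F2 :: "letter list monoid" where
  "F2 = \<lparr>carrier = {w. reduced w}, mult = (\<lambda>u v. foldr push u v), one = []\<rparr>"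

definition boundary :: "letter stream set" where
  "boundary = {x. \<forall>i. x !! Suc i \<noteq> inv_letter (x !! i)}"

definition boundary_space :: "letter stream measure" where
  "boundary_space = restrict_space (stream_space (count_space UNIV)) boundary"

definition push_boundary :: "letter \<Rightarrow> letter stream \<Rightarrow> letter stream" where
  "push_boundary s x = (if shd x = inv_letter s then stl x else s ## x)"

definition boundary_action :: "letter list \<Rightarrow> letter stream \<Rightarrow> letter stream" where
  "boundary_action w x = foldr push_boundary w x"

definition orbit_relation :: "(letter stream \<times> letter stream) set" where
  "orbit_relation = {(x, boundary_action w x) | x w. x \<in> boundary \<and> w \<in> carrier F2}"

definition srw_step :: "letter list pmf" where
  "srw_step = pmf_of_set {[La], [Lb], [La'], [Lb']}"

primrec walk :: "letter list stream \<Rightarrow> nat \<Rightarrow> letter list" where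
  "walk \<omega> 0 = \<one>\<^bsub>F2\<^esub>"
| "walk \<omega> (Suc n) = walk \<omega> n \<otimes>\<^bsub>F2\<^esub> (\<omega> !! n)"

definition converges_to_boundary :: "(nat \<Rightarrow> letter list) \<Rightarrow> letter stream \<Rightarrow> bool" where
  "converges_to_boundary Z x \<longleftrightarrow> x \<in> boundary \<and> (\<forall>k. eventually (\<lambda>n. take k (Z n) = stake k x) sequentially)"

text \<open>The Poisson boundary of the simple random walk is realized concretely as the space of
  infinite reduced words with the law of the limit of the right random walk
  \<open>Z n = s 0 \<otimes> \<dots> \<otimes> s (n - 1)\<close>.  The exit point is the limit of a trajectory; the default value covers the null set of trajectories that do
  not converge.\<close>

definition exit_point :: "letter list stream \<Rightarrow> letter stream" where
  "exit_point \<omega> = (if \<exists>x. converges_to_boundary (walk \<omega>) x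
     then (THE x. converges_to_boundary (walk \<omega>) x) else sconst La)"

definition hitting_measure :: "letter stream measure" where
  "hitting_measure = distr (stream_space (measure_pmf srw_step)) boundary_space exit_point"

end

(* Repeating the first letter of a boundary point is an injective map that stays inside the orbit and
   raises a height function by one.  Conjugating by this map, applied only below height t, turns an
   element of the full group or a lamp configuration into one living on the points of height at
   least t; for t = 0 nothing changes, and as t tends to infinity everything becomes trivial, which
   gives the contraction.  Amenability comes from the description of the orbit relation as tail
   equivalence: it is approximated by relations with finite classes of bounded size, on which
   finitely many elements generate a finite group.  Kesten's property fails because the edges of the
   Cayley tree define a cocycle into the lamp group whose norm is at least proportional to the word
   length.  The resulting copy of the free group meets the n-th power of a small ball of lamps only in
   words of length at most n / 8, and the simple random walk is that short only with exponentially
   small probability. *)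
theory Submission imports Defs
begin

text \<open>The measure is only quasi-invariant, so right translations and inversion of the full
  group need not be isometric. Estimates therefore pull a small set back through one fixed map,
  whose image measure is absolutely continuous. Saturations of null sets are null, so almost every
  point has a class on which all almost-everywhere identities hold without exception.

  The height has an integer part, counting repetitions of the first letter, and a fractional part,
  coding the rest. A point is raised by a number of steps depending on the fractional part alone.
  The level sets of that part are null, which makes the contraction continuous in t.

  Orbit equivalence compares tails at different positions, so cutting at position n does not give an
  equivalence relation. Instead each stage selects a point of the orbit through least recurrent
  words, and points are related when their selections agree.

  The constant 8 compares two rates: a step multiplies the mean of 2^(-length) by at most 7/8, and
  (7/8)^8 < 1/2. The same mean gives convergence of the walk. Quasi-invariance and absence of atoms
  both come from stationarity under the first step.\<close>

section \<open>Criteria for continuity, completeness and separability in metric spaces\<close>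

lemma continuous_map_prod_metricI:
  assumes "Metric_space A d1" "Metric_space B d2" "Metric_space C d3"
    and f: "\<And>a b. a \<in> A \<Longrightarrow> b \<in> B \<Longrightarrow> f (a, b) \<in> C"
    and cont: "\<And>a b \<epsilon>. a \<in> A \<Longrightarrow> b \<in> B \<Longrightarrow> \<epsilon> > 0 \<Longrightarrow>
      \<exists>\<delta>>0. \<forall>x\<in>A. \<forall>y\<in>B. d1 a x < \<delta> \<longrightarrow> d2 b y < \<delta> \<longrightarrow> d3 (f (a, b)) (f (x, y)) < \<epsilon>"
  shows "continuous_map (prod_topology (Metric_space.mtopology A d1) (Metric_space.mtopology B d2))
           (Metric_space.mtopology C d3) f"
proof -
  interpret A: Metric_space A d1 by fact
  interpret B: Metric_space B d2 by fact
  interpret C: Metric_space C d3 by fact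
  show ?thesis
    unfolding C.continuous_map_to_metric
  proof (intro ballI allI impI)
    fix p and \<epsilon> :: real
    assume p: "p \<in> topspace (prod_topology A.mtopology B.mtopology)" and \<epsilon>: "\<epsilon> > 0"
    obtain a b where ab: "p = (a, b)" "a \<in> A" "b \<in> B" using p by auto
    from cont[OF ab(2,3) \<epsilon>] obtain \<delta> where \<delta>: "\<delta> > 0"
      "\<And>x y. x \<in> A \<Longrightarrow> y \<in> B \<Longrightarrow> d1 a x < \<delta> \<Longrightarrow> d2 b y < \<delta> \<Longrightarrow> d3 (f (a, b)) (f (x, y)) < \<epsilon>"
      by blast
    show "\<exists>U. openin (prod_topology A.mtopology B.mtopology) U \<and> p \<in> U \<and>
        (\<forall>y\<in>U. f y \<in> C.mball (f p) \<epsilon>)"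
      by (intro exI[of _ "A.mball a \<delta> \<times> B.mball b \<delta>"])
        (use ab \<delta> f in \<open>auto simp: openin_prod_Times_iff\<close>)
  qed
qed

lemma continuous_map_metricI:
  assumes "Metric_space A d1" "Metric_space C d3"
    and f: "\<And>a. a \<in> A \<Longrightarrow> f a \<in> C"
    and cont: "\<And>a \<epsilon>. a \<in> A \<Longrightarrow> \<epsilon> > 0 \<Longrightarrow>
      \<exists>\<delta>>0. \<forall>x\<in>A. d1 a x < \<delta> \<longrightarrow> d3 (f a) (f x) < \<epsilon>"
  shows "continuous_map (Metric_space.mtopology A d1) (Metric_space.mtopology C d3) f"
  unfolding Metric_space.metric_continuous_map[OF assms(1,2)]
proof (intro conjI ballI allI impI)
  show "f ` A \<subseteq> C" using f by auto
next
  fix a and \<epsilon> :: real assume "a \<in> A" "\<epsilon> > 0"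
  from cont[OF this] show "\<exists>\<delta>>0. \<forall>x. x \<in> A \<and> d1 a x < \<delta> \<longrightarrow> d3 (f a) (f x) < \<epsilon>" by meson
qed

text \<open>A Cauchy sequence converges as soon as a subsequence does, so only sequences with
  geometrically small steps matter. For these, Borel-Cantelli arguments apply directly.\<close>

lemma mcompleteI_fast:
  assumes "Metric_space A d"
    and lim: "\<And>s. range s \<subseteq> A \<Longrightarrow> (\<And>n. d (s n) (s (Suc n)) < (1/2) ^ n) \<Longrightarrow>
      \<exists>x\<in>A. (\<lambda>n. d (s n) x) \<longlonglongrightarrow> 0"
  shows "Metric_space.mcomplete A d"
proof -
  interpret Metric_space A d by fact
  show ?thesis
    unfolding mcomplete_def
  proof (intro allI impI)
    fix s assume s: "MCauchy s"
    then have sA: "range s \<subseteq> A" by (simp add: MCauchy_def)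
    have "\<exists>N. \<forall>m\<ge>N. \<forall>n\<ge>N. d (s m) (s n) < (1/2) ^ k" for k
    proof -
      have "(1/2 :: real) ^ k > 0" by simp
      with s show ?thesis unfolding MCauchy_def by meson
    qed
    then obtain N where N: "\<And>k m n. m \<ge> N k \<Longrightarrow> n \<ge> N k \<Longrightarrow> d (s m) (s n) < (1/2) ^ k"
      by metis
    define r where "r = rec_nat (N 0) (\<lambda>k p. max (Suc p) (N (Suc k)))"
    have r: "r (Suc k) > r k" "r k \<ge> N k" for k
      unfolding r_def by (simp, cases k) auto
    then have mono: "strict_mono r" by (simp add: strict_mono_Suc_iff)
    have "d ((s \<circ> r) n) ((s \<circ> r) (Suc n)) < (1/2) ^ n" for n
      using N[of n "r n" "r (Suc n)"] r[of n] by simp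
    with lim[of "s \<circ> r"] sA obtain x where x: "x \<in> A" "(\<lambda>n. d ((s \<circ> r) n) x) \<longlonglongrightarrow> 0"
      by auto
    have "limitin mtopology (s \<circ> r) x sequentially"
      unfolding limitin_metric_dist_null using x sA by (auto simp: image_subset_iff)
    then show "\<exists>x. limitin mtopology s x sequentially"
      using MCauchy_convergent_subsequence[OF s mono] by blast
  qed
qed

text \<open>One chosen point in each fibre of the code for precision 1/(n+1), taken over all n,
  forms a countable dense set. This avoids exhibiting a dense set of classes by hand.\<close>

lemma separable_spaceI_countable_code:
  assumes "Metric_space A d"
    and code: "\<And>\<epsilon>. \<epsilon> > 0 \<Longrightarrow> \<exists>c :: 'a \<Rightarrow> 'c. countable (c ` A) \<and>
      (\<forall>x\<in>A. \<forall>y\<in>A. c x = c y \<longrightarrow> d x y < \<epsilon>)"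
  shows "separable_space (Metric_space.mtopology A d)"
proof -
  interpret Metric_space A d by fact
  have "\<exists>c :: 'a \<Rightarrow> 'c. countable (c ` A) \<and>
      (\<forall>x\<in>A. \<forall>y\<in>A. c x = c y \<longrightarrow> d x y < inverse (real (Suc n)))" for n
    by (rule code) simp
  then obtain c :: "nat \<Rightarrow> 'a \<Rightarrow> 'c" where c: "\<And>n. countable (c n ` A)"
     "\<And>n x y. x \<in> A \<Longrightarrow> y \<in> A \<Longrightarrow> c n x = c n y \<Longrightarrow> d x y < inverse (real (Suc n))"
    by metis
  define D where "D = (\<Union>n. (inv_into A (c n)) ` (c n ` A))"
  have DA: "D \<subseteq> A" by (auto simp: D_def inv_into_into)
  have "countable D" unfolding D_def by (intro countable_UN countable_image c) auto
  moreover have "x \<in> mtopology closure_of D" if x: "x \<in> A" for x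
    unfolding metric_closure_of
  proof (clarsimp simp: x)
    fix r :: real assume "r > 0"
    then obtain n where n: "inverse (real (Suc n)) < r" using reals_Archimedean by blast
    have "inv_into A (c n) (c n x) \<in> D" using x by (auto simp: D_def)
    moreover have "d x (inv_into A (c n) (c n x)) < r"
      by (rule less_trans[OF c(2)[of _ _ n] n]) (use x in \<open>auto simp: inv_into_into f_inv_into_f\<close>)
    ultimately show "\<exists>y\<in>D. y \<in> A \<and> d x y < r" using DA by blast
  qed
  ultimately show ?thesis
    unfolding separable_space_def using DA closure_of_subset_topspace[of mtopology D]
    by (intro exI[of _ D]) auto
qed

section \<open>Local generation and amenability of topological groups\<close>

context topological_group
begin

lemma continuous_map_left_mult:
  assumes "g \<in> carrier G" shows "continuous_map T T (\<lambda>x. g \<otimes> x)"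
proof -
  have "continuous_map T (prod_topology T T) (\<lambda>x. (g, x))"
    using assms topspace_eq_carrier by (intro continuous_map_pairedI) auto
  from continuous_map_compose[OF this continuous_mult] show ?thesis by (simp add: o_def)
qed

lemma open_left_translate:
  assumes "g \<in> carrier G" "openin T U"
  shows "openin T ((\<lambda>x. g \<otimes> x) ` U)"
proof -
  have U: "U \<subseteq> carrier G" using assms(2) openin_subset topspace_eq_carrier by blast
  have "(\<lambda>x. g \<otimes> x) ` U = {x \<in> topspace T. inv g \<otimes> x \<in> U}"
  proof (intro equalityI subsetI)
    fix y assume "y \<in> (\<lambda>x. g \<otimes> x) ` U"
    then show "y \<in> {x \<in> topspace T. inv g \<otimes> x \<in> U}"
      using U assms(1) by (auto simp: topspace_eq_carrier subset_iff m_assoc[symmetric])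
  next
    fix y assume y: "y \<in> {x \<in> topspace T. inv g \<otimes> x \<in> U}"
    then have "y = g \<otimes> (inv g \<otimes> y)"
      using assms(1) by (simp add: topspace_eq_carrier m_assoc[symmetric])
    then show "y \<in> (\<lambda>x. g \<otimes> x) ` U" using y by blast
  qed
  also have "openin T \<dots>"
    using continuous_map_left_mult[of "inv g"] assms by (intro openin_continuous_map_preimage) auto
  finally show ?thesis .
qed

text \<open>The subgroup generated by a neighbourhood is open, and its complement is a union of
  cosets and hence open as well. A connected space has no other nonempty clopen set than
  itself.\<close>

lemma connected_imp_locally_generated:
  assumes "connected_space T"
  shows "locally_generated G T"
  unfolding locally_generated_def
proof
  fix U assume "U \<in> identity_nhds G T"
  then obtain V where V: "U \<subseteq> carrier G" "openin T V" "\<one> \<in> V" "V \<subseteq> U"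
    unfolding identity_nhds_def topspace_eq_carrier by auto
  let ?H = "generate G U"
  have H: "subgroup ?H G" using V generate_is_subgroup by blast
  have HG: "?H \<subseteq> carrier G" using H by (rule subgroup.subset)
  have VH: "V \<subseteq> ?H" using V by (auto intro: generate.incl)
  have op: "openin T (\<Union>h\<in>A. (\<lambda>x. h \<otimes> x) ` V)" if "A \<subseteq> carrier G" for A
    using that V by (intro openin_Union) (auto intro!: open_left_translate)
  have eq1: "?H = (\<Union>h\<in>?H. (\<lambda>x. h \<otimes> x) ` V)"
  proof (intro equalityI subsetI)
    fix h assume "h \<in> ?H"
    then show "h \<in> (\<Union>h\<in>?H. (\<lambda>x. h \<otimes> x) ` V)"
      using V(3) HG by (intro UN_I[of h]) (auto simp: subset_iff intro!: image_eqI[of _ _ \<one>])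
  next
    fix y assume "y \<in> (\<Union>h\<in>?H. (\<lambda>x. h \<otimes> x) ` V)"
    then show "y \<in> ?H" using VH subgroup.m_closed[OF H] by blast
  qed
  have 1: "openin T ?H" by (subst eq1) (rule op[OF HG])
  have eq2: "carrier G - ?H = (\<Union>h\<in>carrier G - ?H. (\<lambda>x. h \<otimes> x) ` V)"
  proof (intro equalityI subsetI)
    fix h assume "h \<in> carrier G - ?H"
    then show "h \<in> (\<Union>h\<in>carrier G - ?H. (\<lambda>x. h \<otimes> x) ` V)"
      using V(3) by (intro UN_I[of h]) (auto intro!: image_eqI[of _ _ \<one>])
  next
    fix y assume "y \<in> (\<Union>h\<in>carrier G - ?H. (\<lambda>x. h \<otimes> x) ` V)"
    then obtain h v where hv: "h \<in> carrier G" "h \<notin> ?H" "v \<in> V" "y = h \<otimes> v" by auto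
    have v: "v \<in> carrier G" using hv VH HG by auto
    have "h = y \<otimes> inv v" using hv v by (simp add: m_assoc)
    moreover have "inv v \<in> ?H" using hv VH subgroup.m_inv_closed[OF H] by auto
    ultimately show "y \<in> carrier G - ?H"
      using hv v subgroup.m_closed[OF H, of y "inv v"] by auto
  qed
  have 2: "openin T (carrier G - ?H)" by (subst eq2) (rule op, auto)
  have "closedin T ?H" using 2 HG by (simp add: closedin_def topspace_eq_carrier)
  with 1 have "?H = {} \<or> ?H = topspace T"
    using assms connected_space_clopen_in by blast
  then show "?H = carrier G" using generate.one[of G U] by (auto simp: topspace_eq_carrier)
qed


text \<open>Averaging over a finite submonoid \<open>H\<close> is invariant under \<open>H\<close>,
  and a function in \<open>RUCB\<close> barely distinguishes s from a point of \<open>H\<close>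
  close to s. So finitely many invariance conditions hold up to \<epsilon>; compactness of the set
  of means yields all of them at once and exactly.\<close>

lemma amenableI_finite_submonoids:
  assumes fin: "\<And>S N. finite S \<Longrightarrow> S \<subseteq> carrier G \<Longrightarrow> (\<And>s. s \<in> S \<Longrightarrow> openin T (N s) \<and> s \<in> N s) \<Longrightarrow>
     \<exists>H. finite H \<and> H \<noteq> {} \<and> H \<subseteq> carrier G \<and> (\<forall>x\<in>H. \<forall>y\<in>H. x \<otimes> y \<in> H) \<and> (\<forall>s\<in>S. H \<inter> N s \<noteq> {})"
  shows "amenable_group G T"
proof -
  define Bd :: "('a \<Rightarrow> real) \<Rightarrow> bool" where "Bd f = bounded (f ` carrier G)" for f
  have Bd_ex: "\<exists>b\<ge>0. Bd f \<longrightarrow> (\<forall>x\<in>carrier G. \<bar>f x\<bar> \<le> b)" for f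
  proof (cases "Bd f")
    case True
    then obtain b where "\<forall>x\<in>carrier G. \<bar>f x\<bar> \<le> b" by (auto simp: Bd_def bounded_iff)
    then show ?thesis by (intro exI[of _ "max b 0"]) fastforce
  qed auto
  obtain B where B: "\<And>f. B f \<ge> 0" "\<And>f x. Bd f \<Longrightarrow> x \<in> carrier G \<Longrightarrow> \<bar>f x\<bar> \<le> B f"
    using Bd_ex by metis
  have BdT: "Bd (\<lambda>x. f (s \<otimes> x))" if "Bd f" "s \<in> carrier G" for f s
    unfolding Bd_def by (rule bounded_subset[OF that(1)[unfolded Bd_def]]) (use that in auto)
  have BdA: "Bd (\<lambda>x. f x + h x)" if "Bd f" "Bd h" for f h
    using bounded_plus_comp[of f "carrier G" h] that by (simp add: Bd_def)
  have BdC: "Bd (\<lambda>x. c * f x)" if "Bd f" for f c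
    using bounded_scaleR_comp[of f "carrier G" c] that by (simp add: Bd_def)
  \<comment> \<open>The means on all bounded functions. They form a closed subset of a product of
    compact intervals, so Tychonoff's theorem applies.\<close>
  define K where "K = PiE UNIV (\<lambda>f. {- B f .. B f}) \<inter>
     {m. \<forall>f h. Bd f \<and> Bd h \<longrightarrow> m (\<lambda>x. f x + h x) = m f + m h} \<inter>
     {m. \<forall>f c. Bd f \<longrightarrow> m (\<lambda>x. c * f x) = c * m f} \<inter>
     {m. \<forall>f. Bd f \<and> (\<forall>x\<in>carrier G. 0 \<le> f x) \<longrightarrow> 0 \<le> m f} \<inter> {m. m (\<lambda>x. 1) = 1}"
  have "compact (PiE UNIV (\<lambda>f. {- B f .. B f}))"
  proof -
    have "compactin (product_topology (\<lambda>_. euclidean) UNIV) (PiE UNIV (\<lambda>f. {- B f .. B f}))"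
      by (subst compactin_PiE) auto
    then show ?thesis by (simp add: euclidean_product_topology)
  qed
  moreover have ev: "continuous_on UNIV (\<lambda>m :: ('a \<Rightarrow> real) \<Rightarrow> real. m f)" for f
    by (rule continuous_on_product_coordinates)
  have "closed {m :: ('a \<Rightarrow> real) \<Rightarrow> real. \<forall>f h. Bd f \<and> Bd h \<longrightarrow> m (\<lambda>x. f x + h x) = m f + m h}"
    by (intro closed_Collect_all closed_Collect_imp, simp, intro closed_Collect_eq ev continuous_on_add)
  moreover have "closed {m :: ('a \<Rightarrow> real) \<Rightarrow> real. \<forall>f c. Bd f \<longrightarrow> m (\<lambda>x. c * f x) = c * m f}"
    by (intro closed_Collect_all closed_Collect_imp, simp, intro closed_Collect_eq ev continuous_on_mult_left)
  moreover have "closed {m :: ('a \<Rightarrow> real) \<Rightarrow> real. \<forall>f. Bd f \<and> (\<forall>x\<in>carrier G. 0 \<le> f x) \<longrightarrow> 0 \<le> m f}"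
    by (intro closed_Collect_all closed_Collect_imp, simp, intro closed_Collect_le ev continuous_on_const)
  moreover have "closed {m :: ('a \<Rightarrow> real) \<Rightarrow> real. m (\<lambda>x. 1) = 1}"
    by (rule closed_Collect_eq[OF ev continuous_on_const])
  ultimately have K: "compact K"
    unfolding K_def by (intro compact_Int_closed)
  define C where "C = (\<lambda>(f, s, \<epsilon>). {m :: ('a \<Rightarrow> real) \<Rightarrow> real. \<bar>m (\<lambda>x. f (s \<otimes> x)) - m f\<bar> \<le> \<epsilon>})"
  define I where "I = RUCB G T \<times> carrier G \<times> {0::real<..}"
  have "K \<inter> \<Inter> (C ` I) \<noteq> {}"
  proof (rule compact_imp_fip_image[OF K])
    fix i show "closed (C i)" unfolding C_def
      by (cases i, simp) (intro closed_Collect_le continuous_on_const continuous_on_rabs continuous_on_diff ev)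
  next
    fix J assume J: "finite J" "J \<subseteq> I"
    have "\<exists>V. openin T V \<and> \<one> \<in> V \<and> (\<forall>x\<in>carrier G. \<forall>y\<in>V. \<bar>f x - f (y \<otimes> x)\<bar> \<le> \<epsilon>)"
      if "(f, s, \<epsilon>) \<in> J" for f s \<epsilon>
    proof -
      have "f \<in> RUCB G T" "\<epsilon> > 0" using that J by (auto simp: I_def)
      then have "\<exists>U \<in> identity_nhds G T. \<forall>x \<in> carrier G. \<forall>y \<in> U #> x. \<bar>f x - f y\<bar> \<le> \<epsilon>"
        by (simp add: RUCB_def)
      then obtain U V where V: "openin T V" "\<one> \<in> V" "V \<subseteq> U"
          "\<And>x y. x \<in> carrier G \<Longrightarrow> y \<in> U #> x \<Longrightarrow> \<bar>f x - f y\<bar> \<le> \<epsilon>"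
        by (auto simp: identity_nhds_def)
      then show ?thesis by (intro exI[of _ V]) (auto simp: r_coset_def)
    qed
    then have "\<forall>j\<in>J. \<exists>V. openin T V \<and> \<one> \<in> V \<and>
        (\<forall>x\<in>carrier G. \<forall>y\<in>V. \<bar>fst j x - fst j (y \<otimes> x)\<bar> \<le> snd (snd j))" by auto
    then obtain V where "\<forall>j\<in>J. openin T (V j) \<and> \<one> \<in> V j \<and>
        (\<forall>x\<in>carrier G. \<forall>y\<in>V j. \<bar>fst j x - fst j (y \<otimes> x)\<bar> \<le> snd (snd j))" by (rule bchoice[THEN exE])
    then have V: "openin T (V j)" "\<one> \<in> V j"
        "x \<in> carrier G \<Longrightarrow> y \<in> V j \<Longrightarrow> \<bar>fst j x - fst j (y \<otimes> x)\<bar> \<le> snd (snd j)" if "j \<in> J" for j x y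
      using that by auto
    define W where "W = topspace T \<inter> (\<Inter>j\<in>J. V j)"
    have W: "openin T W" "\<one> \<in> W" unfolding W_def
    proof -
      show "openin T (topspace T \<inter> (\<Inter>j\<in>J. V j))"
        using J V by (cases "J = {}") (auto intro!: openin_Int openin_Inter)
    qed (use V in \<open>auto simp: topspace_eq_carrier\<close>)
    have WG: "W \<subseteq> carrier G" by (auto simp: W_def topspace_eq_carrier)
    \<comment> \<open>This is the closeness that \<open>RUCB\<close> controls, because translates in
      its definition are taken on the left: s x = (s h^(-1)) (h x) with s h^(-1) in
      \<open>W\<close>.\<close>
    define N where "N s = {h \<in> topspace T. s \<otimes> inv h \<in> W}" for s
    have N: "openin T (N s) \<and> s \<in> N s" if s: "s \<in> carrier G" for s
    proof
      have "continuous_map T T (\<lambda>h. s \<otimes> inv h)"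
        using continuous_map_compose[OF continuous_inv continuous_map_left_mult[OF s]] by (simp add: o_def)
      then show "openin T (N s)" unfolding N_def by (rule openin_continuous_map_preimage) (fact W)
      show "s \<in> N s" using s W by (simp add: N_def topspace_eq_carrier)
    qed
    define S where "S = (fst \<circ> snd) ` J"
    have S: "finite S" "S \<subseteq> carrier G" using J by (auto simp: S_def I_def)
    have "\<exists>H. finite H \<and> H \<noteq> {} \<and> H \<subseteq> carrier G \<and> (\<forall>x\<in>H. \<forall>y\<in>H. x \<otimes> y \<in> H) \<and> (\<forall>s\<in>S. H \<inter> N s \<noteq> {})"
      by (rule fin[OF S]) (rule N, use S in auto)
    then obtain H where H: "finite H" "H \<noteq> {}" "H \<subseteq> carrier G" "\<forall>x\<in>H. \<forall>y\<in>H. x \<otimes> y \<in> H"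
        "\<forall>s\<in>S. H \<inter> N s \<noteq> {}" by (elim exE conjE)
    \<comment> \<open>The value 0 at unbounded functions keeps \<open>m\<close> inside the product
      of intervals.\<close>
    define m where "m f = (if Bd f then (\<Sum>x\<in>H. f x) / card H else 0)" for f
    have cH: "card H > 0" using H by (simp add: card_gt_0_iff)
    have "m \<in> K"
    proof -
      have "\<bar>m f\<bar> \<le> B f" for f
      proof (cases "Bd f")
        case True
        have "\<bar>\<Sum>x\<in>H. f x\<bar> \<le> (\<Sum>x\<in>H. B f)"
          by (rule order_trans[OF sum_abs sum_mono]) (use True B H in auto)
        then show ?thesis using True cH by (simp add: m_def field_simps)
      qed (simp add: m_def B)
      then have "m f \<in> {- B f .. B f}" for f by (simp add: abs_le_iff) (smt (verit))
      moreover have "Bd (\<lambda>x. 1)" by (auto simp: Bd_def bounded_iff intro!: exI[of _ 1])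
      ultimately show ?thesis using cH H(1,3)
        unfolding K_def by (auto simp: m_def BdA BdC sum.distrib add_divide_distrib
          sum_distrib_left[symmetric] intro!: divide_nonneg_nonneg sum_nonneg)
    qed
    moreover have "m \<in> C j" if j: "j \<in> J" for j
    proof -
      obtain f s \<epsilon> where j': "j = (f, s, \<epsilon>)" by (cases j)
      have s: "s \<in> S" "s \<in> carrier G" using j S j' unfolding S_def by force+
      have f: "f \<in> RUCB G T" "\<epsilon> > 0" using j j' J by (auto simp: I_def)
      then have Bf: "Bd f" by (simp add: RUCB_def Bd_def)
      obtain h where h: "h \<in> H" "h \<in> N s" using H(5) s(1) by blast
      have hG: "h \<in> carrier G" using h H by auto
      have sh: "s \<otimes> inv h \<in> V j" using h j by (auto simp: N_def W_def)
      \<comment> \<open>Left multiplication by h maps the finite set \<open>H\<close> injectively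
        into itself, so it permutes \<open>H\<close> and leaves the sum unchanged.\<close>
      have "inj_on (\<lambda>x. h \<otimes> x) H" using hG H by (intro inj_onI) (auto simp: subset_iff)
      then have "bij_betw (\<lambda>x. h \<otimes> x) H H"
        using H h endo_inj_surj[of H "\<lambda>x. h \<otimes> x"] by (auto simp: bij_betw_def)
      from sum.reindex_bij_betw[OF this, of f] have "(\<Sum>x\<in>H. f x) = (\<Sum>x\<in>H. f (h \<otimes> x))" by simp
      then have "\<bar>(\<Sum>x\<in>H. f (s \<otimes> x)) - (\<Sum>x\<in>H. f x)\<bar> = \<bar>\<Sum>x\<in>H. f (s \<otimes> x) - f (h \<otimes> x)\<bar>"
        by (simp only: sum_subtractf)
      also have "\<dots> \<le> (\<Sum>x\<in>H. \<epsilon>)"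
      proof (rule order_trans[OF sum_abs sum_mono])
        fix x assume x: "x \<in> H"
        then have xG: "x \<in> carrier G" using H(3) by blast
        have "s \<otimes> x = s \<otimes> inv h \<otimes> (h \<otimes> x)"
          using m_assoc[of s "inv h" "h \<otimes> x"] m_assoc[of "inv h" h x] s hG xG by simp
        moreover have "\<bar>f (h \<otimes> x) - f (s \<otimes> inv h \<otimes> (h \<otimes> x))\<bar> \<le> \<epsilon>"
          using V(3)[OF j _ sh, of "h \<otimes> x"] j' hG x H(3) by auto
        ultimately show "\<bar>f (s \<otimes> x) - f (h \<otimes> x)\<bar> \<le> \<epsilon>" by simp
      qed
      finally have "\<bar>(\<Sum>x\<in>H. f (s \<otimes> x)) - (\<Sum>x\<in>H. f x)\<bar> / card H \<le> \<epsilon>"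
        using cH by (simp add: field_simps)
      then show ?thesis using BdT[OF Bf s(2)] Bf cH
        by (simp add: C_def j' m_def diff_divide_distrib[symmetric] abs_divide)
    qed
    ultimately show "K \<inter> (\<Inter>j\<in>J. C j) \<noteq> {}" by blast
  qed
  then obtain m where m: "m \<in> K" "\<And>j. j \<in> I \<Longrightarrow> m \<in> C j" by blast
  have R: "Bd f" if "f \<in> RUCB G T" for f using that by (simp add: RUCB_def Bd_def)
  have "m (\<lambda>x. f (g \<otimes> x)) = m f" if "f \<in> RUCB G T" "g \<in> carrier G" for f g
  proof -
    have "\<bar>m (\<lambda>x. f (g \<otimes> x)) - m f\<bar> \<le> \<epsilon>" if "\<epsilon> > 0" for \<epsilon>
      using m(2)[of "(f, g, \<epsilon>)"] that \<open>f \<in> _\<close> \<open>g \<in> _\<close> by (auto simp: I_def C_def)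
    then have "\<bar>m (\<lambda>x. f (g \<otimes> x)) - m f\<bar> \<le> 0" by (meson dense_ge)
    then show ?thesis by simp
  qed
  then show ?thesis unfolding amenable_group_def
    using m(1) R by (intro exI[of _ m]) (auto simp: K_def)
qed

end

section \<open>Small sets and absolute continuity\<close>

lemma emeasure_zero_iff_AE:
  "A \<in> sets M \<Longrightarrow> emeasure M A = 0 \<longleftrightarrow> (AE x in M. x \<notin> A)"
  by (auto simp: AE_iff_null_sets[symmetric] null_sets_def)

text \<open>The tail unions decrease to the limes superior, which is null by hypothesis; each set is
  contained in its tail union.\<close>

lemma (in finite_measure) measure_tendsto_zeroI:
  assumes [measurable]: "\<And>n. A n \<in> sets M" and ev: "AE x in M. eventually (\<lambda>n. x \<notin> A n) sequentially"
  shows "(\<lambda>n. measure M (A n)) \<longlonglongrightarrow> 0"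
proof -
  define L where "L n = (\<Union>k\<in>{n..}. A k)" for n :: nat
  have L[measurable]: "L n \<in> sets M" for n unfolding L_def by (rule sets.countable_UN) auto
  have "decseq L" unfolding decseq_def L_def by force
  then have "(\<lambda>n. measure M (L n)) \<longlonglongrightarrow> measure M (\<Inter>n. L n)"
    by (intro finite_Lim_measure_decseq) auto
  moreover have "AE x in M. x \<notin> (\<Inter>n. L n)"
    using ev by eventually_elim (auto simp: L_def eventually_sequentially)
  then have "(\<Inter>n. L n) \<in> null_sets M" by (subst AE_iff_null_sets) auto
  then have "measure M (\<Inter>n. L n) = 0" by (simp add: measure_def null_setsD1)
  ultimately have lim: "(\<lambda>n. measure M (L n)) \<longlonglongrightarrow> 0" by simp
  show ?thesis
    by (rule tendsto_sandwich[OF _ _ tendsto_const lim])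
      (auto intro!: always_eventually finite_measure_mono simp: L_def)
qed

text \<open>If it failed, there would be sets of \<open>M\<close>-measure below 2^(-n) with
  \<open>N\<close>-measure at least \<epsilon>. By Borel-Cantelli almost every point leaves these
  sets eventually, also with respect to \<open>N\<close>, so their \<open>N\<close>-measures tend to
  0.\<close>

lemma absolutely_continuous_small:
  assumes "finite_measure M" "finite_measure N" and sets: "sets N = sets M"
    and null: "\<And>A. A \<in> null_sets M \<Longrightarrow> emeasure N A = 0" and "\<epsilon> > 0"
  shows "\<exists>\<delta>>0. \<forall>A\<in>sets M. measure M A < \<delta> \<longrightarrow> measure N A < \<epsilon>"
proof (rule ccontr)
  interpret M: finite_measure M by fact
  interpret N: finite_measure N by fact
  assume "\<not> ?thesis"
  then have "\<exists>A\<in>sets M. measure M A < (1/2)^n \<and> measure N A \<ge> \<epsilon>" for n :: nat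
    by (metis linorder_not_less zero_less_divide_1_iff zero_less_numeral zero_less_power)
  then obtain A where A: "\<And>n. A n \<in> sets M" "\<And>n. measure M (A n) < (1/2)^n" "\<And>n. measure N (A n) \<ge> \<epsilon>"
    by metis
  have "summable (\<lambda>n. measure M (A n))"
    by (rule summable_comparison_test'[OF summable_geometric[of "1/2"], of 0]) (use A(2) less_imp_le in auto)
  then have "AE x in M. eventually (\<lambda>n. x \<in> space M - A n) sequentially"
    by (intro borel_cantelli_AE1) (auto simp: A M.emeasure_finite less_top[symmetric])
  then have "AE x in M. eventually (\<lambda>n. x \<notin> A n) sequentially"
    by (rule AE_mp) (auto elim: eventually_mono)
  then obtain Z where Z: "Z \<in> null_sets M" "{x\<in>space M. \<not> eventually (\<lambda>n. x \<notin> A n) sequentially} \<subseteq> Z"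
    by (auto elim!: AE_E simp: null_sets_def)
  have "Z \<in> null_sets N" using null[OF Z(1)] Z(1) sets by (auto simp: null_sets_def)
  then have "AE x in N. eventually (\<lambda>n. x \<notin> A n) sequentially"
    by (rule AE_I') (use Z sets_eq_imp_space_eq[OF sets] in auto)
  then have "(\<lambda>n. measure N (A n)) \<longlonglongrightarrow> 0" using A sets by (intro N.measure_tendsto_zeroI) auto
  from LIMSEQ_le_const[OF this, of \<epsilon>] A \<open>\<epsilon> > 0\<close> show False by auto
qed

lemma emeasure_count_space_bij_betw:
  assumes "bij_betw f A B"
  shows "emeasure (count_space UNIV) A = emeasure (count_space UNIV) B"
  using bij_betw_finite[OF assms] bij_betw_same_card[OF assms] by (simp add: emeasure_count_space)

section \<open>Countable nonsingular equivalence relations\<close>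

text \<open>The relation is a union of countably many graphs, so a quantifier over a class becomes
  one over \<open>nat\<close>. Pulling back null sets along every \<open>W n\<close> expresses
  quasi-invariance. A measurable diagonal makes equality of two measurable maps a measurable
  predicate.\<close>

locale nonsingular_relation = prob_space M for M :: "'x measure" +
  fixes W :: "nat \<Rightarrow> 'x \<Rightarrow> 'x" and R :: "('x \<times> 'x) set"
  assumes W_measurable [measurable]: "W n \<in> M \<rightarrow>\<^sub>M M"
    and W_null: "A \<in> null_sets M \<Longrightarrow> W n -` A \<inter> space M \<in> null_sets M"
    and R_eq: "R = {(x, W n x) | x n. x \<in> space M}"
    and equiv_R: "equiv (space M) R"
    and diagonal: "{p \<in> space (M \<Otimes>\<^sub>M M). fst p = snd p} \<in> sets (M \<Otimes>\<^sub>M M)"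
begin

lemma R_space: "(x, y) \<in> R \<Longrightarrow> x \<in> space M" "(x, y) \<in> R \<Longrightarrow> y \<in> space M"
  using equiv_R by (auto simp: equiv_def refl_on_def)

lemma R_refl: "x \<in> space M \<Longrightarrow> (x, x) \<in> R"
  using equiv_R by (auto simp: equiv_def refl_on_def)

lemma R_sym: "(x, y) \<in> R \<Longrightarrow> (y, x) \<in> R"
  using equiv_R by (auto simp: equiv_def sym_def)

lemma R_trans: "(x, y) \<in> R \<Longrightarrow> (y, z) \<in> R \<Longrightarrow> (x, z) \<in> R"
  using equiv_R by (auto simp: equiv_def dest: transD)

lemma W_R: "x \<in> space M \<Longrightarrow> (x, W n x) \<in> R"
  by (auto simp: R_eq)

lemma R_W: "(x, y) \<in> R \<Longrightarrow> \<exists>n. y = W n x"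
  by (auto simp: R_eq)

lemma pred_eq [measurable (raw)]:
  assumes "f \<in> N \<rightarrow>\<^sub>M M" "g \<in> N \<rightarrow>\<^sub>M M"
  shows "Measurable.pred N (\<lambda>x. f x = g x)"
proof -
  have "(\<lambda>x. (f x, g x)) \<in> N \<rightarrow>\<^sub>M M \<Otimes>\<^sub>M M" using assms by simp
  from measurable_sets[OF this diagonal]
  have "(\<lambda>x. (f x, g x)) -` {p \<in> space (M \<Otimes>\<^sub>M M). fst p = snd p} \<inter> space N \<in> sets N" .
  also have "(\<lambda>x. (f x, g x)) -` {p \<in> space (M \<Otimes>\<^sub>M M). fst p = snd p} \<inter> space N
      = {x \<in> space N. f x = g x}"
    using assms[THEN measurable_space] by (auto simp: space_pair_measure)
  finally show ?thesis by (simp add: pred_def)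
qed

lemma pred_R [measurable (raw)]:
  assumes [measurable]: "f \<in> N \<rightarrow>\<^sub>M M" "g \<in> N \<rightarrow>\<^sub>M M"
  shows "Measurable.pred N (\<lambda>x. (f x, g x) \<in> R)"
proof -
  have "(f x, g x) \<in> R \<longleftrightarrow> (\<exists>n. g x = W n (f x))" if "x \<in> space N" for x
    using measurable_space[OF assms(1) that] R_W W_R by metis
  moreover have "Measurable.pred N (\<lambda>x. \<exists>n. g x = W n (f x))" by measurable
  ultimately show ?thesis by (simp cong: measurable_cong)
qed

lemma sets_R: "R \<in> sets (M \<Otimes>\<^sub>M M)"
proof -
  have "Measurable.pred (M \<Otimes>\<^sub>M M) (\<lambda>p. (fst p, snd p) \<in> R)" by measurable
  moreover have "R = {p \<in> space (M \<Otimes>\<^sub>M M). (fst p, snd p) \<in> R}"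
    using R_space by (auto simp: space_pair_measure)
  ultimately show ?thesis by (simp add: pred_def)
qed

text \<open>Quasi-invariance in the form used throughout: the points whose class meets a null set
  lie in the countable union of its preimages under the maps \<open>W n\<close>.\<close>

lemma AE_R:
  assumes "AE x in M. P x"
  shows "AE x in M. \<forall>y. (x, y) \<in> R \<longrightarrow> P y"
proof -
  obtain Z where Z: "Z \<in> null_sets M" "{x\<in>space M. \<not> P x} \<subseteq> Z"
    using assms by (auto elim!: AE_E simp: null_sets_def)
  have "AE x in M. \<forall>n. P (W n x)"
    unfolding AE_all_countable
  proof
    fix n
    show "AE x in M. P (W n x)"
      by (rule AE_I'[OF W_null[OF Z(1), of n]]) (use Z W_measurable[THEN measurable_space] in auto)
  qed
  then show ?thesis by (rule AE_mp) (auto dest!: R_W)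
qed

lemma AE_compose:
  assumes "AE x in M. P x" "AE x in M. (x, f x) \<in> R"
  shows "AE x in M. P (f x)"
  using AE_R[OF assms(1)] assms(2) by eventually_elim auto

text \<open>Inverse pairs are the elements of the full group before the values on a null set are
  repaired.\<close>

definition inverse_pair :: "('x \<Rightarrow> 'x) \<Rightarrow> ('x \<Rightarrow> 'x) \<Rightarrow> bool" where
  "inverse_pair g k \<longleftrightarrow> g \<in> M \<rightarrow>\<^sub>M M \<and> k \<in> M \<rightarrow>\<^sub>M M \<and> (AE x in M. (x, g x) \<in> R) \<and>
     (AE x in M. (x, k x) \<in> R) \<and> (AE x in M. k (g x) = x) \<and> (AE x in M. g (k x) = x)"

lemma inverse_pair_sym: "inverse_pair g k \<Longrightarrow> inverse_pair k g"
  by (auto simp: inverse_pair_def)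

text \<open>At almost every x the identities hold on the whole class of x, so compositions of maps
  inside \<open>R\<close> can be computed there pointwise.\<close>

lemma inverse_pair_good:
  assumes "inverse_pair g k"
  shows "AE x in M. \<forall>y. (x, y) \<in> R \<longrightarrow> (y, g y) \<in> R \<and> (y, k y) \<in> R \<and> k (g y) = y \<and> g (k y) = y"
  using assms unfolding inverse_pair_def by (intro AE_R) auto

lemma inverse_pair_comp:
  assumes "inverse_pair g k" "inverse_pair g' k'"
  shows "inverse_pair (g \<circ> g') (k' \<circ> k)"
proof -
  have [measurable]: "g \<in> M \<rightarrow>\<^sub>M M" "k \<in> M \<rightarrow>\<^sub>M M" "g' \<in> M \<rightarrow>\<^sub>M M" "k' \<in> M \<rightarrow>\<^sub>M M"
    using assms by (auto simp: inverse_pair_def)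
  have "AE x in M. ((x, g (g' x)) \<in> R) \<and> ((x, k' (k x)) \<in> R) \<and> k' (k (g (g' x))) = x \<and> g (g' (k' (k x))) = x"
    using inverse_pair_good[OF assms(1)] inverse_pair_good[OF assms(2)] AE_space
    by eventually_elim (metis R_refl R_trans)
  then show ?thesis unfolding inverse_pair_def by (simp add: o_def) 
qed

lemma inverse_pair_id: "inverse_pair id id"
  by (auto simp: inverse_pair_def id_def R_refl)

lemma AE_eq_comp:
  assumes "AE x in M. g x = g' x" "AE x in M. h x = h' x" "AE x in M. (x, h x) \<in> R"
  shows "AE x in M. g (h x) = g' (h' x)"
  using AE_compose[OF assms(1,3)] assms(2) by eventually_elim simp

lemma inverse_pair_unique:
  assumes "inverse_pair g k" "inverse_pair g' k'" "AE x in M. g x = g' x"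
  shows "AE x in M. k x = k' x"
proof -
  have "AE x in M. \<forall>y. (x, y) \<in> R \<longrightarrow> g y = g' y" by (rule AE_R) fact
  then show ?thesis
    using inverse_pair_good[OF assms(1)] inverse_pair_good[OF assms(2)] AE_space
    by eventually_elim (metis R_refl)
qed

lemma preserves_measure_classI:
  assumes "bij_betw g (space M) (space M)" and [measurable]: "g \<in> M \<rightarrow>\<^sub>M M"
    and "AE x in M. (x, g x) \<in> R" "AE x in M. (x, the_inv_into (space M) g x) \<in> R"
  shows "preserves_measure_class M g"
  unfolding preserves_measure_class_def
proof (intro ballI iffI)
  fix A assume A[measurable]: "A \<in> sets M" and "emeasure M A = 0"
  then have "AE x in M. x \<notin> A" by (simp add: emeasure_zero_iff_AE)
  from AE_compose[OF this assms(3)] have "AE x in M. x \<notin> g -` A \<inter> space M" by eventually_elim auto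
  then show "emeasure M (g -` A \<inter> space M) = 0" by (subst emeasure_zero_iff_AE) auto
next
  fix A assume A[measurable]: "A \<in> sets M" and "emeasure M (g -` A \<inter> space M) = 0"
  then have "AE x in M. x \<notin> g -` A \<inter> space M" by (subst (asm) emeasure_zero_iff_AE) auto
  from AE_compose[OF this assms(4)] AE_space have "AE x in M. x \<notin> A"
  proof eventually_elim
    case (elim x)
    have "the_inv_into (space M) g x \<in> space M" "g (the_inv_into (space M) g x) = x"
      using bij_betwE[OF bij_betw_the_inv_into[OF assms(1)]] f_the_inv_into_f_bij_betw[OF assms(1)] elim
      by auto
    with elim show ?case by auto
  qed
  then show "emeasure M A = 0" by (simp add: emeasure_zero_iff_AE)
qed

text \<open>The inverse is a measurable bijection by assumption, but its graph lies in
  \<open>R\<close> almost everywhere only because g preserves the measure class: g pulls the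
  exceptional set of the inverse back to that of g.\<close>

lemma full_maps_inverse_pair:
  assumes "g \<in> full_maps M R"
  shows "inverse_pair g (the_inv_into (space M) g)"
proof -
  let ?k = "the_inv_into (space M) g"
  have g: "bij_betw g (space M) (space M)" "g \<in> M \<rightarrow>\<^sub>M M" "?k \<in> M \<rightarrow>\<^sub>M M" "AE x in M. (x, g x) \<in> R"
    "preserves_measure_class M g"
    using assms by (auto simp: full_maps_def Borel_automorphisms_def)
  note [measurable] = g(2,3)
  have kg: "x \<in> space M \<Longrightarrow> ?k (g x) = x" "x \<in> space M \<Longrightarrow> g (?k x) = x" for x
    using the_inv_into_f_f[of g "space M" x] f_the_inv_into_f_bij_betw[OF g(1), of x] g(1)
    by (auto simp: bij_betw_def)
  have "{x \<in> space M. (x, ?k x) \<notin> R} \<in> sets M" by measurable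
  moreover have "emeasure M (g -` {x \<in> space M. (x, ?k x) \<notin> R} \<inter> space M) = 0"
  proof -
    have "AE x in M. x \<notin> g -` {x \<in> space M. (x, ?k x) \<notin> R} \<inter> space M"
      using g(4) by eventually_elim (auto simp: kg intro: R_sym)
    then show ?thesis by (subst emeasure_zero_iff_AE) auto
  qed
  ultimately have "emeasure M {x \<in> space M. (x, ?k x) \<notin> R} = 0"
    using g(5) unfolding preserves_measure_class_def by blast
  then have "AE x in M. (x, ?k x) \<in> R"
    by (subst AE_iff_measurable[OF _ refl]) auto
  then show ?thesis unfolding inverse_pair_def using g kg by auto
qed

text \<open>The set \<open>Y\<close> of points whose entire class is good is conull and
  \<open>R\<close>-invariant. Keeping g on \<open>Y\<close> and the identity elsewhere gives a
  bijection at every point, as invariance prevents the two pieces from mixing.\<close>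

lemma inverse_pair_full_map:
  assumes "inverse_pair g k"
  shows "\<exists>g' \<in> full_maps M R. AE x in M. g' x = g x"
proof -
  have [measurable]: "g \<in> M \<rightarrow>\<^sub>M M" "k \<in> M \<rightarrow>\<^sub>M M" using assms by (auto simp: inverse_pair_def)
  define Q where "Q y \<longleftrightarrow> (y, g y) \<in> R \<and> (y, k y) \<in> R \<and> k (g y) = y \<and> g (k y) = y" for y
  have [measurable]: "Measurable.pred M Q" unfolding Q_def by measurable
  define Y where "Y = {x \<in> space M. \<forall>n. Q (W n x)}"
  have [measurable]: "Y \<in> sets M" unfolding Y_def by measurable
  have YQ: "Q y" if "x \<in> Y" "(x, y) \<in> R" for x y using that R_W unfolding Y_def by blast
  have YY: "y \<in> Y" if "x \<in> Y" "(x, y) \<in> R" for x y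
  proof -
    have y: "y \<in> space M" using that R_space by blast
    have "Q (W n y)" for n using YQ[OF that(1) R_trans[OF that(2) W_R[OF y]]] .
    with y show ?thesis by (simp add: Y_def)
  qed
  have Yx: "Q x" "x \<in> space M" if "x \<in> Y" for x
  proof -
    show "x \<in> space M" using that by (simp add: Y_def)
    then show "Q x" using YQ[OF that] R_refl by blast
  qed
  define g' where "g' x = (if x \<in> Y then g x else x)" for x
  define k' where "k' x = (if x \<in> Y then k x else x)" for x
  have [measurable]: "g' \<in> M \<rightarrow>\<^sub>M M" "k' \<in> M \<rightarrow>\<^sub>M M" unfolding g'_def k'_def by measurable
  have sp: "g' x \<in> space M" "k' x \<in> space M" if "x \<in> space M" for x
    using that by (auto intro: measurable_space)
  have k'g': "k' (g' x) = x" "g' (k' x) = x" for x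
    using Yx[of x] YY[of x "g x"] YY[of x "k x"] by (auto simp: g'_def k'_def Q_def)
  have bij: "bij_betw g' (space M) (space M)"
    by (rule bij_betw_byWitness[of _ k']) (auto simp: sp k'g')
  have inv: "the_inv_into (space M) g' x = k' x" if "x \<in> space M" for x
    by (rule the_inv_into_f_eq) (use bij that sp k'g' in \<open>auto simp: bij_betw_def\<close>)
  have "the_inv_into (space M) g' \<in> M \<rightarrow>\<^sub>M M"
    by (subst measurable_cong[OF inv]) auto
  moreover have "(x, g' x) \<in> R" "(x, k' x) \<in> R" if "x \<in> space M" for x
    using that Yx[of x] R_refl by (auto simp: g'_def k'_def Q_def)
  ultimately have "g' \<in> full_maps M R"
    using bij inv unfolding full_maps_def Borel_automorphisms_def
    by (auto intro!: preserves_measure_classI)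
  moreover have "AE x in M. x \<in> Y"
    using inverse_pair_good[OF assms] AE_space
    by eventually_elim (use W_R in \<open>auto simp: Y_def Q_def\<close>)
  then have "AE x in M. g' x = g x" by eventually_elim (simp add: g'_def)
  ultimately show ?thesis by blast
qed

end

section \<open>The full group with the uniform topology\<close>

context nonsingular_relation
begin

text \<open>The argument need not be a Borel automorphism itself; being invertible almost everywhere
  is enough to name an element of the full group. Constructions below thus leave null sets
  unrepaired.\<close>

definition cls :: "('x \<Rightarrow> 'x) \<Rightarrow> ('x \<Rightarrow> 'x) set" where
  "cls g = {h \<in> full_maps M R. AE x in M. h x = g x}"

definition invertible_map :: "('x \<Rightarrow> 'x) \<Rightarrow> bool" where
  "invertible_map g \<longleftrightarrow> (\<exists>k. inverse_pair g k)"

lemma invertible_mapD: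
  assumes "invertible_map g"
  shows "g \<in> M \<rightarrow>\<^sub>M M" "AE x in M. (x, g x) \<in> R"
  using assms by (auto simp: invertible_map_def inverse_pair_def)

lemma cls_eqI: "AE x in M. g x = h x \<Longrightarrow> cls g = cls h"
  unfolding cls_def by (auto elim: AE_mp)

lemma full_equiv_Image: "g \<in> full_maps M R \<Longrightarrow> full_equiv M R `` {g} = cls g"
  by (auto simp: full_equiv_def cls_def elim: AE_mp)

lemma full_maps_invertible: "g \<in> full_maps M R \<Longrightarrow> invertible_map g"
  using full_maps_inverse_pair by (auto simp: invertible_map_def)

lemma repr_cls:
  assumes "invertible_map g"
  shows "repr (cls g) \<in> full_maps M R" "AE x in M. repr (cls g) x = g x"
    "invertible_map (repr (cls g))"
proof -
  have "\<exists>h. h \<in> cls g" using assms inverse_pair_full_map unfolding invertible_map_def cls_def by blast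
  then have "repr (cls g) \<in> cls g" by (rule someI_ex)
  then show "repr (cls g) \<in> full_maps M R" "AE x in M. repr (cls g) x = g x" by (auto simp: cls_def)
  then show "invertible_map (repr (cls g))" by (simp add: full_maps_invertible)
qed

lemma cls_eq_iff:
  assumes "invertible_map g" "invertible_map h"
  shows "cls g = cls h \<longleftrightarrow> (AE x in M. g x = h x)"
proof
  assume eq: "cls g = cls h"
  show "AE x in M. g x = h x"
    using repr_cls(2)[OF assms(1)] repr_cls(2)[OF assms(2)] unfolding eq by eventually_elim simp
qed (rule cls_eqI)

lemma carrier_full_group: "carrier (full_group M R) = {cls g | g. invertible_map g}"
proof -
  have "carrier (full_group M R) = cls ` full_maps M R"
    by (auto simp: full_group_def quotient_def full_equiv_Image)
  also have "\<dots> = {cls g | g. invertible_map g}"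
  proof safe
    fix g assume g: "invertible_map g"
    have "cls (repr (cls g)) = cls g" by (intro cls_eqI repr_cls(2)[OF g])
    then show "cls g \<in> cls ` full_maps M R" using repr_cls(1)[OF g] by (metis imageI)
  qed (use full_maps_invertible in blast)
  finally show ?thesis .
qed

lemma cls_in_carrier: "invertible_map g \<Longrightarrow> cls g \<in> carrier (full_group M R)"
  by (auto simp: carrier_full_group)

lemma carrierE:
  assumes "\<phi> \<in> carrier (full_group M R)"
  obtains g k where "\<phi> = cls g" "inverse_pair g k" "invertible_map g" "invertible_map k"
proof -
  from assms obtain g k where "\<phi> = cls g" "inverse_pair g k"
    by (auto simp: carrier_full_group invertible_map_def)
  moreover from this have "invertible_map g" "invertible_map k"
    using inverse_pair_sym unfolding invertible_map_def by blast+
  ultimately show ?thesis by (rule that)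
qed

lemma invertible_map_comp: "invertible_map g \<Longrightarrow> invertible_map h \<Longrightarrow> invertible_map (g \<circ> h)"
  unfolding invertible_map_def by (blast intro: inverse_pair_comp)

lemma invertible_map_id: "invertible_map id"
  using inverse_pair_id by (auto simp: invertible_map_def)

lemma id_full_map: "id \<in> full_maps M R"
proof -
  have "the_inv_into (space M) id x = x" if "x \<in> space M" for x
    using that by (intro the_inv_into_f_eq) auto
  moreover from this have "the_inv_into (space M) id \<in> M \<rightarrow>\<^sub>M M"
    by (subst measurable_cong[where g = "\<lambda>x. x"]) auto
  ultimately show ?thesis
    unfolding full_maps_def Borel_automorphisms_def
    by (auto simp: id_def R_refl preserves_measure_class_def bij_betw_def)
qed

lemma full_map_comp:
  assumes "g \<in> full_maps M R" "h \<in> full_maps M R"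
  shows "g \<circ> h \<in> full_maps M R"
proof -
  let ?i = "the_inv_into (space M)"
  have gh: "bij_betw g (space M) (space M)" "bij_betw h (space M) (space M)"
    "g \<in> M \<rightarrow>\<^sub>M M" "h \<in> M \<rightarrow>\<^sub>M M" "?i g \<in> M \<rightarrow>\<^sub>M M" "?i h \<in> M \<rightarrow>\<^sub>M M"
    using assms by (auto simp: full_maps_def Borel_automorphisms_def)
  note [measurable] = gh(3-6)
  have bij: "bij_betw (g \<circ> h) (space M) (space M)" by (rule bij_betw_trans[OF gh(2,1)])
  have inv: "?i (g \<circ> h) x = ?i h (?i g x)" if "x \<in> space M" for x
  proof (rule the_inv_into_f_eq)
    show "inj_on (g \<circ> h) (space M)" using bij by (simp add: bij_betw_def)
    have "?i g x \<in> space M" using bij_betwE[OF bij_betw_the_inv_into[OF gh(1)]] that by blast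
    then show "?i h (?i g x) \<in> space M" "(g \<circ> h) (?i h (?i g x)) = x"
      using bij_betwE[OF bij_betw_the_inv_into[OF gh(2)]] f_the_inv_into_f_bij_betw[OF gh(2)]
        f_the_inv_into_f_bij_betw[OF gh(1)] that by auto
  qed
  have ip: "inverse_pair (g \<circ> h) (?i h \<circ> ?i g)"
    by (intro inverse_pair_comp full_maps_inverse_pair assms)
  have "AE x in M. (x, ?i h (?i g x)) \<in> R" using ip by (simp add: inverse_pair_def)
  with AE_space have "AE x in M. (x, ?i (g \<circ> h) x) \<in> R" by eventually_elim (simp add: inv)
  moreover have "?i (g \<circ> h) \<in> M \<rightarrow>\<^sub>M M" by (subst measurable_cong[OF inv]) auto
  moreover have "AE x in M. (x, (g \<circ> h) x) \<in> R" using ip by (simp add: inverse_pair_def)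
  ultimately show ?thesis
    using bij unfolding full_maps_def Borel_automorphisms_def
    by (auto intro!: preserves_measure_classI)
qed

lemma one_full_group: "\<one>\<^bsub>full_group M R\<^esub> = cls id"
  by (simp add: full_group_def full_equiv_Image id_full_map)

lemma mult_full_group:
  assumes "invertible_map g" "invertible_map h"
  shows "cls g \<otimes>\<^bsub>full_group M R\<^esub> cls h = cls (g \<circ> h)"
proof -
  have "cls g \<otimes>\<^bsub>full_group M R\<^esub> cls h = cls (repr (cls g) \<circ> repr (cls h))"
    by (simp add: full_group_def full_equiv_Image full_map_comp repr_cls assms)
  also have "\<dots> = cls (g \<circ> h)"
    using AE_eq_comp[OF repr_cls(2)[OF assms(1)] repr_cls(2)[OF assms(2)]
        invertible_mapD(2)[OF repr_cls(3)[OF assms(2)]]]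
    by (intro cls_eqI) simp
  finally show ?thesis .
qed

lemma group_full_group: "group (full_group M R)"
proof (rule groupI)
  fix x y assume "x \<in> carrier (full_group M R)" "y \<in> carrier (full_group M R)"
  then show "x \<otimes>\<^bsub>full_group M R\<^esub> y \<in> carrier (full_group M R)"
    by (auto elim!: carrierE simp: mult_full_group intro!: cls_in_carrier invertible_map_comp)
next
  fix x y z assume "x \<in> carrier (full_group M R)" "y \<in> carrier (full_group M R)" "z \<in> carrier (full_group M R)"
  then show "x \<otimes>\<^bsub>full_group M R\<^esub> y \<otimes>\<^bsub>full_group M R\<^esub> z = x \<otimes>\<^bsub>full_group M R\<^esub> (y \<otimes>\<^bsub>full_group M R\<^esub> z)"
    by (auto elim!: carrierE simp: mult_full_group invertible_map_comp o_assoc)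
next
  fix x assume "x \<in> carrier (full_group M R)"
  then show "\<one>\<^bsub>full_group M R\<^esub> \<otimes>\<^bsub>full_group M R\<^esub> x = x"
    by (auto elim!: carrierE simp: mult_full_group invertible_map_id one_full_group)
next
  fix x assume "x \<in> carrier (full_group M R)"
  then obtain g k where g: "x = cls g" "inverse_pair g k" "invertible_map g" "invertible_map k"
    by (rule carrierE)
  have "cls (k \<circ> g) = cls id" using g(2) by (intro cls_eqI) (simp add: inverse_pair_def)
  then show "\<exists>y\<in>carrier (full_group M R). y \<otimes>\<^bsub>full_group M R\<^esub> x = \<one>\<^bsub>full_group M R\<^esub>"
    using g by (intro bexI[of _ "cls k"]) (auto simp: mult_full_group one_full_group cls_in_carrier)
qed (simp add: one_full_group cls_in_carrier invertible_map_id)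

lemma inv_full_group:
  assumes "inverse_pair g k"
  shows "inv\<^bsub>full_group M R\<^esub> cls g = cls k"
proof -
  interpret group "full_group M R" by (rule group_full_group)
  have g: "invertible_map g" "invertible_map k"
    using assms inverse_pair_sym by (auto simp: invertible_map_def)
  have "cls (k \<circ> g) = cls id" using assms by (intro cls_eqI) (simp add: inverse_pair_def)
  then show ?thesis
    using g by (intro inv_equality) (auto simp: mult_full_group one_full_group cls_in_carrier)
qed

lemma uniform_dist_cls:
  assumes "invertible_map g" "invertible_map h"
  shows "uniform_dist M (cls g) (cls h) = prob {x \<in> space M. g x \<noteq> h x}"
proof -
  note [measurable] = assms[THEN invertible_mapD(1)] assms[THEN repr_cls(3), THEN invertible_mapD(1)]
  show ?thesis unfolding uniform_dist_def
    by (intro measure_eq_AE, use repr_cls(2)[OF assms(1)] repr_cls(2)[OF assms(2)] in eventually_elim) auto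
qed

lemma Metric_space_full_group: "Metric_space (carrier (full_group M R)) (uniform_dist M)"
proof
  fix x y show "0 \<le> uniform_dist M x y" "uniform_dist M x y = uniform_dist M y x"
    by (simp_all add: uniform_dist_def eq_commute)
next
  fix x y assume "x \<in> carrier (full_group M R)" "y \<in> carrier (full_group M R)"
  then obtain g h where g: "x = cls g" "y = cls h" "invertible_map g" "invertible_map h"
    by (auto elim!: carrierE)
  note [measurable] = g(3,4)[THEN invertible_mapD(1)]
  show "uniform_dist M x y = 0 \<longleftrightarrow> x = y"
    using g by (simp add: uniform_dist_cls cls_eq_iff prob_eq_0)
next
  fix x y z assume "x \<in> carrier (full_group M R)" "y \<in> carrier (full_group M R)" "z \<in> carrier (full_group M R)"
  then obtain g h l where g: "x = cls g" "y = cls h" "z = cls l" "invertible_map g" "invertible_map h" "invertible_map l"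
    by (auto elim!: carrierE)
  note [measurable] = g(4-6)[THEN invertible_mapD(1)]
  have "prob {x \<in> space M. g x \<noteq> l x} \<le> prob ({x \<in> space M. g x \<noteq> h x} \<union> {x \<in> space M. h x \<noteq> l x})"
    by (intro finite_measure_mono) auto
  also have "\<dots> \<le> prob {x \<in> space M. g x \<noteq> h x} + prob {x \<in> space M. h x \<noteq> l x}"
    by (intro measure_Un_le) auto
  finally show "uniform_dist M x z \<le> uniform_dist M x y + uniform_dist M y z"
    using g by (simp add: uniform_dist_cls)
qed

text \<open>The image of the measure under a map inside \<open>R\<close> is absolutely continuous,
  hence uniformly so. This replaces invariance of the measure in all continuity proofs.\<close>

lemma small_vimage:
  assumes [measurable]: "f \<in> M \<rightarrow>\<^sub>M M" and "AE x in M. (x, f x) \<in> R" "\<epsilon> > 0"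
  shows "\<exists>\<delta>>0. \<forall>E\<in>sets M. prob E < \<delta> \<longrightarrow> prob (f -` E \<inter> space M) < \<epsilon>"
proof -
  interpret N: prob_space "distr M M f" by (rule prob_space_distr) simp
  have "\<exists>\<delta>>0. \<forall>E\<in>sets M. prob E < \<delta> \<longrightarrow> measure (distr M M f) E < \<epsilon>"
  proof (rule absolutely_continuous_small[OF finite_measure_axioms N.finite_measure_axioms _ _ \<open>\<epsilon> > 0\<close>])
    fix A assume A: "A \<in> null_sets M"
    then have "AE x in M. x \<notin> A" by (rule AE_not_in)
    from AE_compose[OF this assms(2)] show "emeasure (distr M M f) A = 0"
      using A by (subst emeasure_distr) (auto simp: emeasure_zero_iff_AE null_sets_def)
  qed simp
  then show ?thesis by (simp add: measure_distr)
qed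

text \<open>If the inverses differ at a good point x, then g and g' differ at k x, since otherwise
  k' applied to g' (k x) = x would return k x.\<close>

lemma prob_inverse_neq_le:
  assumes "inverse_pair g k" "inverse_pair g' k'"
  shows "prob {x \<in> space M. k x \<noteq> k' x} \<le> prob (k -` {x \<in> space M. g x \<noteq> g' x} \<inter> space M)"
proof (rule finite_measure_mono_AE)
  have [measurable]: "g \<in> M \<rightarrow>\<^sub>M M" "k \<in> M \<rightarrow>\<^sub>M M" "g' \<in> M \<rightarrow>\<^sub>M M"
    using assms by (auto simp: inverse_pair_def)
  show "k -` {x \<in> space M. g x \<noteq> g' x} \<inter> space M \<in> events" by measurable
  show "AE x in M. x \<in> {x \<in> space M. k x \<noteq> k' x} \<longrightarrow> x \<in> k -` {x \<in> space M. g x \<noteq> g' x} \<inter> space M"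
    using inverse_pair_good[OF assms(1)] inverse_pair_good[OF assms(2)] AE_space
  proof eventually_elim
    case (elim x)
    have x: "(x, x) \<in> R" "(x, k x) \<in> R" using elim R_refl by auto
    then have "k' (g' (k x)) = k x" "g (k x) = x" using elim by auto
    then have "g' (k x) = g (k x) \<Longrightarrow> k x = k' x" by simp
    then show ?case using R_space x by auto
  qed
qed

lemma topological_group_full_group:
  "topological_group (full_group M R) (uniform_topology M R)"
proof -
  interpret G: group "full_group M R" by (rule group_full_group)
  interpret Metric_space "carrier (full_group M R)" "uniform_dist M" by (rule Metric_space_full_group)
  show ?thesis
  proof
    show "topspace (uniform_topology M R) = carrier (full_group M R)"
      by (simp add: uniform_topology_def)
    show "continuous_map (prod_topology (uniform_topology M R) (uniform_topology M R))
        (uniform_topology M R) (\<lambda>(x, y). x \<otimes>\<^bsub>full_group M R\<^esub> y)"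
      unfolding uniform_topology_def
    proof (rule continuous_map_prod_metricI[OF Metric_space_axioms Metric_space_axioms Metric_space_axioms])
      fix a b and \<epsilon> :: real
      assume "a \<in> carrier (full_group M R)" "b \<in> carrier (full_group M R)" "\<epsilon> > 0"
      then obtain g h where g: "a = cls g" "b = cls h" "invertible_map g" "invertible_map h"
        by (auto elim!: carrierE)
      \<comment> \<open>Only the fixed map h is used for the pullback, so \<delta> does not depend
        on the nearby elements x and y.\<close>
      from small_vimage[OF invertible_mapD[OF g(4)], of "\<epsilon>/2"] \<open>\<epsilon> > 0\<close> obtain \<delta> where
        \<delta>: "\<delta> > 0" "\<And>E. E \<in> sets M \<Longrightarrow> prob E < \<delta> \<Longrightarrow> prob (h -` E \<inter> space M) < \<epsilon>/2" by auto
      show "\<exists>\<delta>>0. \<forall>x\<in>carrier (full_group M R). \<forall>y\<in>carrier (full_group M R).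
          uniform_dist M a x < \<delta> \<longrightarrow> uniform_dist M b y < \<delta> \<longrightarrow>
          uniform_dist M (case (a, b) of (x, y) \<Rightarrow> x \<otimes>\<^bsub>full_group M R\<^esub> y)
            (case (x, y) of (x, y) \<Rightarrow> x \<otimes>\<^bsub>full_group M R\<^esub> y) < \<epsilon>"
      proof (intro exI[of _ "min \<delta> (\<epsilon>/2)"] conjI ballI impI)
        fix x y assume xy: "x \<in> carrier (full_group M R)" "y \<in> carrier (full_group M R)"
          "uniform_dist M a x < min \<delta> (\<epsilon>/2)" "uniform_dist M b y < min \<delta> (\<epsilon>/2)"
        obtain g' h' where g': "x = cls g'" "y = cls h'" "invertible_map g'" "invertible_map h'"
          using xy by (auto elim!: carrierE)
        note [measurable] = g(3,4)[THEN invertible_mapD(1)] g'(3,4)[THEN invertible_mapD(1)]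
        have "prob {x \<in> space M. g (h x) \<noteq> g' (h' x)}
            \<le> prob ({x \<in> space M. h x \<noteq> h' x} \<union> (h -` {x \<in> space M. g x \<noteq> g' x} \<inter> space M))"
          by (intro finite_measure_mono)
            (use g(4)[THEN invertible_mapD(1), THEN measurable_space] in auto)
        also have "\<dots> \<le> prob {x \<in> space M. h x \<noteq> h' x} + prob (h -` {x \<in> space M. g x \<noteq> g' x} \<inter> space M)"
          by (intro measure_Un_le) auto
        also have "\<dots> < \<epsilon>/2 + \<epsilon>/2"
          using xy g g' by (intro add_strict_mono \<delta>(2)) (auto simp: uniform_dist_cls)
        finally show "uniform_dist M (case (a, b) of (x, y) \<Rightarrow> x \<otimes>\<^bsub>full_group M R\<^esub> y)
            (case (x, y) of (x, y) \<Rightarrow> x \<otimes>\<^bsub>full_group M R\<^esub> y) < \<epsilon>"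
          using g g' by (simp add: mult_full_group uniform_dist_cls invertible_map_comp)
      qed (use \<delta> \<open>\<epsilon> > 0\<close> in auto)
    qed auto
    show "continuous_map (uniform_topology M R) (uniform_topology M R) (\<lambda>x. inv\<^bsub>full_group M R\<^esub> x)"
      unfolding uniform_topology_def
    proof (rule continuous_map_metricI[OF Metric_space_axioms Metric_space_axioms])
      fix a and \<epsilon> :: real
      assume "a \<in> carrier (full_group M R)" "\<epsilon> > 0"
      then obtain g k where g: "a = cls g" "inverse_pair g k" "invertible_map g" "invertible_map k"
        by (auto elim!: carrierE)
      from small_vimage[OF invertible_mapD[OF g(4)] \<open>\<epsilon> > 0\<close>] obtain \<delta> where
        \<delta>: "\<delta> > 0" "\<And>E. E \<in> sets M \<Longrightarrow> prob E < \<delta> \<Longrightarrow> prob (k -` E \<inter> space M) < \<epsilon>" by auto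
      show "\<exists>\<delta>>0. \<forall>x\<in>carrier (full_group M R). uniform_dist M a x < \<delta> \<longrightarrow>
          uniform_dist M (inv\<^bsub>full_group M R\<^esub> a) (inv\<^bsub>full_group M R\<^esub> x) < \<epsilon>"
      proof (intro exI[of _ \<delta>] conjI ballI impI)
        fix x assume x: "x \<in> carrier (full_group M R)" "uniform_dist M a x < \<delta>"
        obtain g' k' where g': "x = cls g'" "inverse_pair g' k'" "invertible_map g'" "invertible_map k'"
          using x by (auto elim!: carrierE)
        note [measurable] = g(3,4)[THEN invertible_mapD(1)] g'(3,4)[THEN invertible_mapD(1)]
        have "prob {x \<in> space M. k x \<noteq> k' x} \<le> prob (k -` {x \<in> space M. g x \<noteq> g' x} \<inter> space M)"
          by (rule prob_inverse_neq_le) fact+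
        also have "\<dots> < \<epsilon>" using x g g' by (intro \<delta>(2)) (auto simp: uniform_dist_cls)
        finally show "uniform_dist M (inv\<^bsub>full_group M R\<^esub> a) (inv\<^bsub>full_group M R\<^esub> x) < \<epsilon>"
          using g g' by (simp add: inv_full_group uniform_dist_cls)
      qed (use \<delta> in auto)
    qed auto
  qed
qed

end

section \<open>The measure on the relation and the lamp group\<close>

context nonsingular_relation
begin

text \<open>Intersecting with \<open>R\<close> makes every section countable, hence the count a
  measurable function. The resulting measure \<open>\<nu>\<close> is defined on the whole square, is
  carried by \<open>R\<close>, and agrees with \<open>rel_measure\<close> on measurable subsets of
  \<open>R\<close>.\<close>

definition rel_count :: "('x \<times> 'x) set \<Rightarrow> 'x \<Rightarrow> ennreal" where
  "rel_count A x = emeasure (count_space UNIV) ((A \<inter> R) `` {x})"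

definition \<nu> :: "('x \<times> 'x) measure" where
  "\<nu> = measure_of (space (M \<Otimes>\<^sub>M M)) (sets (M \<Otimes>\<^sub>M M)) (\<lambda>A. \<integral>\<^sup>+ x. rel_count A x \<partial>M)"

lemma space_\<nu> [simp]: "space \<nu> = space M \<times> space M"
  unfolding \<nu>_def space_measure_of_conv space_pair_measure ..

lemma sets_\<nu> [measurable_cong, simp]: "sets \<nu> = sets (M \<Otimes>\<^sub>M M)"
  by (simp only: \<nu>_def sets_measure_of_conv sets.space_closed if_True sets.sigma_sets_eq)

lemma rel_count_suminf:
  assumes "disjoint_family A"
  shows "rel_count (\<Union>i. A i) x = suminf (\<lambda>i. rel_count (A i) x)"
proof -
  have "((\<Union>i. A i) \<inter> R) `` {x} = (\<Union>i. (A i \<inter> R) `` {x})" by blast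
  moreover have "disjoint_family (\<lambda>i. (A i \<inter> R) `` {x})"
    using assms unfolding disjoint_family_on_def by blast
  ultimately show ?thesis unfolding rel_count_def by (simp only:) (rule suminf_emeasure[symmetric], auto)
qed

text \<open>A class is enumerated without repetition by counting each point only at the least index
  n with y = W n x.\<close>

lemma rel_count_eq:
  assumes "x \<in> space M"
  shows "rel_count A x = suminf (\<lambda>n. indicator {x. (x, W n x) \<in> A \<and> (\<forall>j<n. W j x \<noteq> W n x)} x)"
proof -
  define S where "S n = {y. y = W n x \<and> (x, y) \<in> A \<and> (\<forall>j<n. W j x \<noteq> y)}" for n
  have "(A \<inter> R) `` {x} = (\<Union>n. S n)"
  proof (intro equalityI subsetI)
    fix y assume "y \<in> (A \<inter> R) `` {x}"
    then have y: "(x, y) \<in> A" "\<exists>n. y = W n x" using R_W by auto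
    define n where "n = (LEAST n. y = W n x)"
    have "y = W n x" unfolding n_def by (rule LeastI_ex) (fact y)
    moreover have "W j x \<noteq> y" if "j < n" for j using not_less_Least[OF that[unfolded n_def]] by auto
    ultimately show "y \<in> (\<Union>n. S n)" using y by (auto simp: S_def)
  next
    fix y assume "y \<in> (\<Union>n. S n)"
    then show "y \<in> (A \<inter> R) `` {x}" using W_R[OF assms] by (auto simp: S_def)
  qed
  moreover have "S i \<inter> S j = {}" if "i < j" for i j using that by (auto simp: S_def)
  then have "disjoint_family S"
    unfolding disjoint_family_on_def by (metis Int_commute linorder_neqE_nat)
  moreover have "emeasure (count_space UNIV) (S n) =
      indicator {x. (x, W n x) \<in> A \<and> (\<forall>j<n. W j x \<noteq> W n x)} x" for n
  proof (cases "(x, W n x) \<in> A \<and> (\<forall>j<n. W j x \<noteq> W n x)")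
    case True
    then have "S n = {W n x}" by (auto simp: S_def)
    then show ?thesis using True by simp
  next
    case False
    then have "S n = {}" by (auto simp: S_def)
    then show ?thesis using False by simp
  qed
  ultimately show ?thesis unfolding rel_count_def by (simp add: suminf_emeasure[symmetric])
qed

lemma borel_measurable_rel_count [measurable]:
  assumes [measurable]: "A \<in> sets (M \<Otimes>\<^sub>M M)"
  shows "rel_count A \<in> borel_measurable M"
proof (subst measurable_cong[OF rel_count_eq])
  show "(\<lambda>x. suminf (\<lambda>n. indicator {x. (x, W n x) \<in> A \<and> (\<forall>j<n. W j x \<noteq> W n x)} x :: ennreal)) \<in> borel_measurable M"
    by measurable
qed

lemma emeasure_\<nu>:
  assumes "A \<in> sets (M \<Otimes>\<^sub>M M)"
  shows "emeasure \<nu> A = (\<integral>\<^sup>+ x. rel_count A x \<partial>M)"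
proof (rule emeasure_measure_of[OF \<nu>_def])
  show "sets (M \<Otimes>\<^sub>M M) \<subseteq> Pow (space (M \<Otimes>\<^sub>M M))" by (rule sets.space_closed)
  show "A \<in> sets \<nu>" using assms by simp
  show "positive (sets \<nu>) (\<lambda>A. \<integral>\<^sup>+ x. rel_count A x \<partial>M)"
    by (simp add: positive_def rel_count_def)
  show "countably_additive (sets \<nu>) (\<lambda>A. \<integral>\<^sup>+ x. rel_count A x \<partial>M)"
  proof (rule countably_additiveI)
    fix A :: "nat \<Rightarrow> ('x \<times> 'x) set"
    assume A: "range A \<subseteq> sets \<nu>" "disjoint_family A" "(\<Union>i. A i) \<in> sets \<nu>"
    then have "suminf (\<lambda>i. \<integral>\<^sup>+ x. rel_count (A i) x \<partial>M) = (\<integral>\<^sup>+ x. suminf (\<lambda>i. rel_count (A i) x) \<partial>M)"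
      by (intro nn_integral_suminf[symmetric] borel_measurable_rel_count) auto
    then show "suminf (\<lambda>i. \<integral>\<^sup>+ x. rel_count (A i) x \<partial>M) = (\<integral>\<^sup>+ x. rel_count (\<Union>i. A i) x \<partial>M)"
      using A by (simp add: rel_count_suminf)
  qed
qed

lemma rel_measure_eq_\<nu>: "A \<in> sets (M \<Otimes>\<^sub>M M) \<Longrightarrow> A \<subseteq> R \<Longrightarrow> rel_measure M A = emeasure \<nu> A"
  by (simp add: emeasure_\<nu> rel_measure_def rel_count_def Int_absorb2)

lemma \<nu>_zero_iff:
  assumes [measurable]: "A \<in> sets (M \<Otimes>\<^sub>M M)"
  shows "emeasure \<nu> A = 0 \<longleftrightarrow> (AE x in M. \<forall>y. (x, y) \<in> R \<longrightarrow> (x, y) \<notin> A)"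
proof -
  have "rel_count A x = 0 \<longleftrightarrow> (\<forall>y. (x, y) \<in> R \<longrightarrow> (x, y) \<notin> A)" for x
    unfolding rel_count_def emeasure_count_space_eq_0 by auto
  then show ?thesis by (simp add: emeasure_\<nu> nn_integral_0_iff_AE)
qed

lemma AE_\<nu>_iff:
  assumes [measurable]: "Measurable.pred (M \<Otimes>\<^sub>M M) P"
  shows "(AE p in \<nu>. P p) \<longleftrightarrow> (AE x in M. \<forall>y. (x, y) \<in> R \<longrightarrow> P (x, y))"
proof -
  have s: "{p \<in> space (M \<Otimes>\<^sub>M M). \<not> P p} \<in> sets (M \<Otimes>\<^sub>M M)" by measurable
  have "(AE p in \<nu>. P p) \<longleftrightarrow> emeasure \<nu> {p \<in> space (M \<Otimes>\<^sub>M M). \<not> P p} = 0"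
    using s by (intro AE_iff_measurable) (auto simp: space_pair_measure)
  also have "\<dots> \<longleftrightarrow> (AE x in M. \<forall>y. (x, y) \<in> R \<longrightarrow> P (x, y))"
    unfolding \<nu>_zero_iff[OF s] by (intro AE_cong) (auto simp: space_pair_measure dest: R_space)
  finally show ?thesis .
qed

text \<open>A graph meets almost every section in one point. This transfers measures of sets of
  points to measures of lamps, both for separability and for the edges of the Cayley tree.\<close>

lemma emeasure_\<nu>_graph:
  assumes "f \<in> M \<rightarrow>\<^sub>M M" "AE x in M. (x, f x) \<in> R" "B \<in> sets M"
  shows "emeasure \<nu> {p \<in> space M \<times> space M. fst p \<in> B \<and> snd p = f (fst p)} = emeasure M B"
proof -
  note [measurable] = assms(1,3)
  have "{p \<in> space (M \<Otimes>\<^sub>M M). fst p \<in> B \<and> snd p = f (fst p)} \<in> sets (M \<Otimes>\<^sub>M M)" by measurable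
  then have "emeasure \<nu> {p \<in> space M \<times> space M. fst p \<in> B \<and> snd p = f (fst p)} =
      (\<integral>\<^sup>+ x. rel_count {p \<in> space M \<times> space M. fst p \<in> B \<and> snd p = f (fst p)} x \<partial>M)"
    by (simp add: emeasure_\<nu> space_pair_measure)
  also have "\<dots> = (\<integral>\<^sup>+ x. indicator B x \<partial>M)"
  proof (rule nn_integral_cong_AE, use assms(2) AE_space in eventually_elim)
    case (elim x)
    then have "({p \<in> space M \<times> space M. fst p \<in> B \<and> snd p = f (fst p)} \<inter> R) `` {x}
      = (if x \<in> B then {f x} else {})" using R_space by auto
    then show ?case by (simp add: rel_count_def)
  qed
  finally show ?thesis by simp
qed

subsection \<open>The lamp group\<close>

text \<open>Any set of finite \<open>\<nu>\<close>-measure may name a lamp, even one not contained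
  in \<open>R\<close>; its part outside \<open>R\<close> is invisible to
  \<open>\<nu>\<close>.\<close>

definition lamp_cls :: "('x \<times> 'x) set \<Rightarrow> ('x \<times> 'x) set set" where
  "lamp_cls A = {B \<in> lamp_sets M R. emeasure \<nu> (sym_diff A B) = 0}"

lemma sets_sym_diff: "A \<in> sets N \<Longrightarrow> B \<in> sets N \<Longrightarrow> sym_diff A B \<in> sets N"
  by auto

lemma emeasure_sym_diff_zero_iff:
  assumes "A \<in> sets N" "B \<in> sets N"
  shows "emeasure N (sym_diff A B) = 0 \<longleftrightarrow> (AE p in N. p \<in> A \<longleftrightarrow> p \<in> B)"
  using assms by (subst emeasure_zero_iff_AE) (auto intro!: AE_cong)

lemma lamp_sets_fmeasurable: "A \<in> lamp_sets M R \<Longrightarrow> A \<in> fmeasurable \<nu>"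
  by (auto simp: lamp_sets_def fmeasurable_def rel_measure_eq_\<nu>)

lemma \<nu>_Int_R: "A \<in> sets (M \<Otimes>\<^sub>M M) \<Longrightarrow> emeasure \<nu> (A \<inter> R) = emeasure \<nu> A"
proof -
  assume A: "A \<in> sets (M \<Otimes>\<^sub>M M)"
  have "rel_count (A \<inter> R) = rel_count A" by (simp add: rel_count_def fun_eq_iff Int_assoc)
  then show ?thesis using A sets_R by (simp add: emeasure_\<nu>)
qed

lemma AE_\<nu>_R: "AE p in \<nu>. p \<in> R"
  using sets_R by (subst AE_\<nu>_iff) (auto simp: pred_def space_pair_measure Int_absorb1
    dest: sets.sets_into_space intro: sets.Int)

lemma fmeasurable_Int_R: "A \<in> fmeasurable \<nu> \<Longrightarrow> A \<inter> R \<in> lamp_sets M R"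
  using sets_R by (auto simp: lamp_sets_def fmeasurable_def rel_measure_eq_\<nu> \<nu>_Int_R)

lemma fmeasurable_sym_diff:
  "A \<in> fmeasurable N \<Longrightarrow> B \<in> fmeasurable N \<Longrightarrow> sym_diff A B \<in> fmeasurable N"
  by (intro fmeasurable.Un fmeasurable_Diff) (auto dest: fmeasurableD)

lemma lamp_cls_eq_iff:
  assumes "A \<in> fmeasurable \<nu>" "B \<in> fmeasurable \<nu>"
  shows "lamp_cls A = lamp_cls B \<longleftrightarrow> emeasure \<nu> (sym_diff A B) = 0"
proof -
  have *: "emeasure \<nu> (sym_diff A B) = 0 \<longleftrightarrow> (AE p in \<nu>. p \<in> A \<longleftrightarrow> p \<in> B)"
    if "A \<in> fmeasurable \<nu>" "B \<in> fmeasurable \<nu>" for A B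
    by (rule emeasure_sym_diff_zero_iff) (use that in \<open>auto dest: fmeasurableD\<close>)
  have AR: "A \<inter> R \<in> lamp_sets M R" by (rule fmeasurable_Int_R) fact
  then have "A \<inter> R \<in> lamp_cls A"
    unfolding lamp_cls_def using AE_\<nu>_R *[OF assms(1) lamp_sets_fmeasurable[OF AR]] by auto
  then have "emeasure \<nu> (sym_diff B (A \<inter> R)) = 0" if "lamp_cls A = lamp_cls B"
    using that by (auto simp: lamp_cls_def)
  moreover have "emeasure \<nu> (sym_diff A B) = 0" if "emeasure \<nu> (sym_diff B (A \<inter> R)) = 0"
    using that AE_\<nu>_R unfolding *[OF assms(2) lamp_sets_fmeasurable[OF AR]] *[OF assms]
    by eventually_elim auto
  moreover have "lamp_cls A = lamp_cls B" if "emeasure \<nu> (sym_diff A B) = 0"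
  proof -
    have "AE p in \<nu>. p \<in> A \<longleftrightarrow> p \<in> B" using that *[OF assms] by simp
    then have "(AE p in \<nu>. p \<in> A \<longleftrightarrow> p \<in> C) \<longleftrightarrow> (AE p in \<nu>. p \<in> B \<longleftrightarrow> p \<in> C)" for C
      by (auto elim: AE_mp)
    then show ?thesis unfolding lamp_cls_def
      using assms by (auto simp: * lamp_sets_fmeasurable)
  qed
  ultimately show ?thesis by blast
qed

lemma lamp_cls_eqI:
  assumes "A \<in> fmeasurable \<nu>" "B \<in> fmeasurable \<nu>"
    "AE x in M. \<forall>y. (x, y) \<in> R \<longrightarrow> ((x, y) \<in> A \<longleftrightarrow> (x, y) \<in> B)"
  shows "lamp_cls A = lamp_cls B"
proof -
  have "sym_diff A B \<in> sets (M \<Otimes>\<^sub>M M)" using assms by (auto dest!: fmeasurableD)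
  then show ?thesis
    using assms by (subst lamp_cls_eq_iff) (auto simp: \<nu>_zero_iff elim: AE_mp)
qed

lemma lamp_equiv_Image:
  assumes "A \<in> lamp_sets M R"
  shows "lamp_equiv M R `` {A} = lamp_cls A"
proof -
  have "rel_measure M (sym_diff A B) = emeasure \<nu> (sym_diff A B)" if "B \<in> lamp_sets M R" for B
    using assms that by (intro rel_measure_eq_\<nu>) (auto simp: lamp_sets_def)
  then show ?thesis using assms by (auto simp: lamp_equiv_def lamp_cls_def)
qed

lemma repr_lamp_cls:
  assumes "A \<in> fmeasurable \<nu>"
  shows "repr (lamp_cls A) \<in> lamp_sets M R" "emeasure \<nu> (sym_diff A (repr (lamp_cls A))) = 0"
    "repr (lamp_cls A) \<in> fmeasurable \<nu>" "AE p in \<nu>. p \<in> repr (lamp_cls A) \<longleftrightarrow> p \<in> A"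
    "lamp_cls (repr (lamp_cls A)) = lamp_cls A"
proof -
  have 0: "lamp_cls A = lamp_cls (A \<inter> R)"
    using assms AE_\<nu>_R by (intro lamp_cls_eqI) (auto simp: lamp_sets_fmeasurable fmeasurable_Int_R)
  have "A \<inter> R \<in> lamp_cls (A \<inter> R)"
    by (simp add: lamp_cls_def fmeasurable_Int_R assms)
  then have "\<exists>B. B \<in> lamp_cls A" using 0 by auto
  then have "repr (lamp_cls A) \<in> lamp_cls A" by (rule someI_ex)
  then show 1: "repr (lamp_cls A) \<in> lamp_sets M R" "emeasure \<nu> (sym_diff A (repr (lamp_cls A))) = 0"
    by (auto simp: lamp_cls_def)
  then show 2: "repr (lamp_cls A) \<in> fmeasurable \<nu>" by (simp add: lamp_sets_fmeasurable)
  show "lamp_cls (repr (lamp_cls A)) = lamp_cls A"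
    using lamp_cls_eq_iff[OF assms 2] 1 by simp
  show "AE p in \<nu>. p \<in> repr (lamp_cls A) \<longleftrightarrow> p \<in> A"
    using 1(2) assms 2 by (subst (asm) emeasure_sym_diff_zero_iff) (auto dest: fmeasurableD elim: AE_mp)
qed

lemma carrier_lamp_group: "carrier (lamp_group M R) = lamp_cls ` fmeasurable \<nu>"
proof -
  have "carrier (lamp_group M R) = lamp_cls ` lamp_sets M R"
    by (auto simp: lamp_group_def quotient_def lamp_equiv_Image)
  also have "\<dots> = lamp_cls ` fmeasurable \<nu>"
    using lamp_sets_fmeasurable repr_lamp_cls by (auto simp: image_iff) metis
  finally show ?thesis .
qed

lemma empty_fmeasurable: "{} \<in> fmeasurable \<nu>" by simp

lemma one_lamp_group: "\<one>\<^bsub>lamp_group M R\<^esub> = lamp_cls {}"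
proof -
  have "{} \<in> lamp_sets M R" using fmeasurable_Int_R[OF empty_fmeasurable] by simp
  then show ?thesis by (simp add: lamp_group_def lamp_equiv_Image)
qed

lemma lamp_sets_sym_diff: "A \<in> lamp_sets M R \<Longrightarrow> B \<in> lamp_sets M R \<Longrightarrow> sym_diff A B \<in> lamp_sets M R"
proof -
  assume AB: "A \<in> lamp_sets M R" "B \<in> lamp_sets M R"
  then have "sym_diff A B \<inter> R = sym_diff A B" by (auto simp: lamp_sets_def)
  then show ?thesis
    using fmeasurable_Int_R[OF fmeasurable_sym_diff[of A \<nu> B]] AB by (simp add: lamp_sets_fmeasurable)
qed

lemma mult_lamp_group:
  assumes "A \<in> fmeasurable \<nu>" "B \<in> fmeasurable \<nu>"
  shows "lamp_cls A \<otimes>\<^bsub>lamp_group M R\<^esub> lamp_cls B = lamp_cls (sym_diff A B)"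
proof -
  let ?A = "repr (lamp_cls A)" and ?B = "repr (lamp_cls B)"
  have "lamp_cls A \<otimes>\<^bsub>lamp_group M R\<^esub> lamp_cls B = lamp_cls (sym_diff ?A ?B)"
    using assms by (simp add: lamp_group_def lamp_equiv_Image lamp_sets_sym_diff repr_lamp_cls)
  also have "\<dots> = lamp_cls (sym_diff A B)"
  proof -
    have "AE p in \<nu>. p \<in> sym_diff ?A ?B \<longleftrightarrow> p \<in> sym_diff A B"
      using repr_lamp_cls(4)[OF assms(1)] repr_lamp_cls(4)[OF assms(2)] by eventually_elim auto
    moreover have fm: "sym_diff ?A ?B \<in> fmeasurable \<nu>" "sym_diff A B \<in> fmeasurable \<nu>"
      using assms by (auto intro!: fmeasurable_sym_diff repr_lamp_cls)
    ultimately show ?thesis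
      unfolding lamp_cls_eq_iff[OF fm] emeasure_sym_diff_zero_iff[OF fm[THEN fmeasurableD]] by blast
  qed
  finally show ?thesis .
qed

lemma sym_diff_assoc: "sym_diff (sym_diff A B) C = sym_diff A (sym_diff B C)"
  by auto

lemma group_lamp_group: "group (lamp_group M R)"
proof (rule groupI)
  fix x assume "x \<in> carrier (lamp_group M R)"
  then obtain A where A: "A \<in> fmeasurable \<nu>" "x = lamp_cls A" by (auto simp: carrier_lamp_group)
  then have "x \<otimes>\<^bsub>lamp_group M R\<^esub> x = \<one>\<^bsub>lamp_group M R\<^esub>"
    by (simp add: mult_lamp_group one_lamp_group)
  with \<open>x \<in> _\<close> show "\<exists>y\<in>carrier (lamp_group M R). y \<otimes>\<^bsub>lamp_group M R\<^esub> x = \<one>\<^bsub>lamp_group M R\<^esub>" by blast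
qed (auto simp: carrier_lamp_group one_lamp_group mult_lamp_group fmeasurable_sym_diff sym_diff_assoc)

lemma inv_lamp_group:
  assumes "x \<in> carrier (lamp_group M R)"
  shows "inv\<^bsub>lamp_group M R\<^esub> x = x"
proof -
  interpret group "lamp_group M R" by (rule group_lamp_group)
  obtain A where A: "A \<in> fmeasurable \<nu>" "x = lamp_cls A" using assms by (auto simp: carrier_lamp_group)
  then show ?thesis using assms by (intro inv_equality) (auto simp: mult_lamp_group one_lamp_group)
qed

lemma lamp_dist_cls:
  assumes "A \<in> fmeasurable \<nu>" "B \<in> fmeasurable \<nu>"
  shows "lamp_dist M (lamp_cls A) (lamp_cls B) = measure \<nu> (sym_diff A B)"
proof -
  let ?A = "repr (lamp_cls A)" and ?B = "repr (lamp_cls B)"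
  have "sym_diff ?A ?B \<in> lamp_sets M R" using assms by (intro lamp_sets_sym_diff repr_lamp_cls)
  then have "lamp_dist M (lamp_cls A) (lamp_cls B) = measure \<nu> (sym_diff ?A ?B)"
    by (simp add: lamp_dist_def measure_def rel_measure_eq_\<nu> lamp_sets_def)
  also have "\<dots> = measure \<nu> (sym_diff A B)"
    unfolding measure_def
  proof (intro arg_cong[of _ _ enn2real] emeasure_eq_AE)
    show "AE p in \<nu>. p \<in> sym_diff ?A ?B \<longleftrightarrow> p \<in> sym_diff A B"
      using repr_lamp_cls(4)[OF assms(1)] repr_lamp_cls(4)[OF assms(2)] by eventually_elim auto
  qed (intro sets_sym_diff fmeasurableD repr_lamp_cls assms)+
  finally show ?thesis .
qed

lemma measure_sym_diff_triangle:
  assumes "A \<in> fmeasurable N" "B \<in> fmeasurable N" "C \<in> fmeasurable N"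
  shows "measure N (sym_diff A C) \<le> measure N (sym_diff A B) + measure N (sym_diff B C)"
proof -
  have "measure N (sym_diff A C) \<le> measure N (sym_diff A B \<union> sym_diff B C)"
    using assms by (intro measure_mono_fmeasurable fmeasurable.Un fmeasurable_sym_diff) (auto dest: fmeasurableD)
  also have "\<dots> \<le> measure N (sym_diff A B) + measure N (sym_diff B C)"
    using assms by (intro measure_Un_le) (auto dest: fmeasurableD)
  finally show ?thesis .
qed

lemma Metric_space_lamp_group: "Metric_space (carrier (lamp_group M R)) (lamp_dist M)"
proof
  fix x y show "0 \<le> lamp_dist M x y" "lamp_dist M x y = lamp_dist M y x"
    by (simp_all add: lamp_dist_def Un_commute)
next
  fix x y assume "x \<in> carrier (lamp_group M R)" "y \<in> carrier (lamp_group M R)"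
  then obtain A B where A: "A \<in> fmeasurable \<nu>" "x = lamp_cls A" "B \<in> fmeasurable \<nu>" "y = lamp_cls B"
    by (auto simp: carrier_lamp_group)
  have "emeasure \<nu> (sym_diff A B) = 0 \<longleftrightarrow> measure \<nu> (sym_diff A B) = 0"
    using fmeasurable_sym_diff[OF A(1,3)] by (simp add: emeasure_eq_measure2 fmeasurableD2)
  then show "lamp_dist M x y = 0 \<longleftrightarrow> x = y"
    using A by (simp add: lamp_dist_cls lamp_cls_eq_iff)
next
  fix x y z assume "x \<in> carrier (lamp_group M R)" "y \<in> carrier (lamp_group M R)" "z \<in> carrier (lamp_group M R)"
  then show "lamp_dist M x z \<le> lamp_dist M x y + lamp_dist M y z"
    by (auto simp: carrier_lamp_group lamp_dist_cls intro!: measure_sym_diff_triangle)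
qed

lemma topological_group_lamp_group: "topological_group (lamp_group M R) (lamp_topology M R)"
proof -
  interpret G: group "lamp_group M R" by (rule group_lamp_group)
  interpret Metric_space "carrier (lamp_group M R)" "lamp_dist M" by (rule Metric_space_lamp_group)
  show ?thesis
  proof
    show t: "topspace (lamp_topology M R) = carrier (lamp_group M R)"
      by (simp add: lamp_topology_def)
    show "continuous_map (prod_topology (lamp_topology M R) (lamp_topology M R)) (lamp_topology M R)
      (\<lambda>(x, y). x \<otimes>\<^bsub>lamp_group M R\<^esub> y)"
      unfolding lamp_topology_def
    proof (rule continuous_map_prod_metricI[OF Metric_space_axioms Metric_space_axioms Metric_space_axioms])
      fix a b and \<epsilon> :: real
      assume ab: "a \<in> carrier (lamp_group M R)" "b \<in> carrier (lamp_group M R)" "\<epsilon> > 0"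
      have le: "lamp_dist M (a \<otimes>\<^bsub>lamp_group M R\<^esub> b) (x \<otimes>\<^bsub>lamp_group M R\<^esub> y) \<le> lamp_dist M a x + lamp_dist M b y"
        if xy: "x \<in> carrier (lamp_group M R)" "y \<in> carrier (lamp_group M R)" for x y
      proof -
        obtain A B where 1: "A \<in> fmeasurable \<nu>" "a = lamp_cls A" "B \<in> fmeasurable \<nu>" "b = lamp_cls B"
          using ab by (auto simp: carrier_lamp_group)
        obtain C D where 2: "C \<in> fmeasurable \<nu>" "x = lamp_cls C" "D \<in> fmeasurable \<nu>" "y = lamp_cls D"
          using xy by (auto simp: carrier_lamp_group)
        note A = 1 2
        have "sym_diff (sym_diff A B) (sym_diff C D) = sym_diff (sym_diff A C) (sym_diff B D)" by auto
        then have "measure \<nu> (sym_diff (sym_diff A B) (sym_diff C D)) \<le>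
            measure \<nu> (sym_diff (sym_diff A C) {}) + measure \<nu> (sym_diff {} (sym_diff B D))"
          using measure_sym_diff_triangle[of "sym_diff A C" \<nu> "{}" "sym_diff B D"] A
          by (simp add: fmeasurable_sym_diff)
        then show ?thesis using A by (simp add: mult_lamp_group lamp_dist_cls fmeasurable_sym_diff)
      qed
      show "\<exists>\<delta>>0. \<forall>x\<in>carrier (lamp_group M R). \<forall>y\<in>carrier (lamp_group M R).
          lamp_dist M a x < \<delta> \<longrightarrow> lamp_dist M b y < \<delta> \<longrightarrow>
          lamp_dist M (case (a, b) of (x, y) \<Rightarrow> x \<otimes>\<^bsub>lamp_group M R\<^esub> y)
            (case (x, y) of (x, y) \<Rightarrow> x \<otimes>\<^bsub>lamp_group M R\<^esub> y) < \<epsilon>"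
        by (intro exI[of _ "\<epsilon>/2"]) (use le ab in \<open>fastforce\<close>)
    qed auto
    show "continuous_map (lamp_topology M R) (lamp_topology M R) (\<lambda>x. inv\<^bsub>lamp_group M R\<^esub> x)"
      by (rule continuous_map_eq[OF continuous_map_id]) (simp add: t inv_lamp_group)
  qed
qed

end

section \<open>Semidirect products of topological groups\<close>

lemma semidirect_topological_group:
  fixes C :: "('c, 'm) monoid_scheme" and G :: "('g, 'n) monoid_scheme"
  assumes "topological_group C TC" "topological_group G TG"
    and closed: "\<And>g c. g \<in> carrier G \<Longrightarrow> c \<in> carrier C \<Longrightarrow> act g c \<in> carrier C"
    and hom: "\<And>g c d. g \<in> carrier G \<Longrightarrow> c \<in> carrier C \<Longrightarrow> d \<in> carrier C \<Longrightarrow>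
      act g (c \<otimes>\<^bsub>C\<^esub> d) = act g c \<otimes>\<^bsub>C\<^esub> act g d"
    and one: "\<And>c. c \<in> carrier C \<Longrightarrow> act \<one>\<^bsub>G\<^esub> c = c"
    and mult: "\<And>g h c. g \<in> carrier G \<Longrightarrow> h \<in> carrier G \<Longrightarrow> c \<in> carrier C \<Longrightarrow>
      act (g \<otimes>\<^bsub>G\<^esub> h) c = act g (act h c)"
    and cont: "continuous_map (prod_topology TG TC) TC (\<lambda>(g, c). act g c)"
  shows "topological_group (semidirect_product C G act) (prod_topology TC TG)"
    and "\<And>c g. c \<in> carrier C \<Longrightarrow> g \<in> carrier G \<Longrightarrow>
      inv\<^bsub>semidirect_product C G act\<^esub> (c, g) = (act (inv\<^bsub>G\<^esub> g) (inv\<^bsub>C\<^esub> c), inv\<^bsub>G\<^esub> g)"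
proof -
  interpret C: topological_group C TC by fact
  interpret G: topological_group G TG by fact
  let ?S = "semidirect_product C G act"
  have act_one: "act g \<one>\<^bsub>C\<^esub> = \<one>\<^bsub>C\<^esub>" if "g \<in> carrier G" for g
    using hom[OF that, of "\<one>\<^bsub>C\<^esub>" "\<one>\<^bsub>C\<^esub>"] closed[OF that, of "\<one>\<^bsub>C\<^esub>"] by (simp add: C.r_cancel_one')
  let ?inv = "\<lambda>(c, g). (act (inv\<^bsub>G\<^esub> g) (inv\<^bsub>C\<^esub> c), inv\<^bsub>G\<^esub> g)"
  have linv: "?inv x \<otimes>\<^bsub>?S\<^esub> x = \<one>\<^bsub>?S\<^esub>" if "x \<in> carrier ?S" for x
    using that by (auto simp: semidirect_product_def hom[symmetric] act_one)
  interpret S: group ?S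
  proof (rule groupI)
    fix x y z assume "x \<in> carrier ?S" "y \<in> carrier ?S" "z \<in> carrier ?S"
    then show "x \<otimes>\<^bsub>?S\<^esub> y \<otimes>\<^bsub>?S\<^esub> z = x \<otimes>\<^bsub>?S\<^esub> (y \<otimes>\<^bsub>?S\<^esub> z)"
      by (auto simp: semidirect_product_def hom mult closed C.m_assoc G.m_assoc)
  next
    fix x assume x: "x \<in> carrier ?S"
    then show "\<exists>y\<in>carrier ?S. y \<otimes>\<^bsub>?S\<^esub> x = \<one>\<^bsub>?S\<^esub>"
      using linv[OF x] by (intro bexI[of _ "?inv x"]) (auto simp: semidirect_product_def closed)
  qed (auto simp: semidirect_product_def closed one)
  have inv: "inv\<^bsub>?S\<^esub> x = ?inv x" if "x \<in> carrier ?S" for x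
    by (rule S.inv_equality[OF linv]) (use that in \<open>auto simp: semidirect_product_def closed\<close>)
  show "topological_group ?S (prod_topology TC TG)"
  proof
    show "topspace (prod_topology TC TG) = carrier ?S"
      by (simp add: semidirect_product_def C.topspace_eq_carrier G.topspace_eq_carrier)
    let ?P = "prod_topology (prod_topology TC TG) (prod_topology TC TG)"
    have f: "continuous_map ?P TC (\<lambda>p. fst (fst p))" "continuous_map ?P TG (\<lambda>p. snd (fst p))"
      "continuous_map ?P TC (\<lambda>p. fst (snd p))" "continuous_map ?P TG (\<lambda>p. snd (snd p))"
      using continuous_map_compose[OF continuous_map_fst[of "prod_topology TC TG" "prod_topology TC TG"] continuous_map_fst[of TC TG]]
        continuous_map_compose[OF continuous_map_fst[of "prod_topology TC TG" "prod_topology TC TG"] continuous_map_snd[of TC TG]]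
        continuous_map_compose[OF continuous_map_snd[of "prod_topology TC TG" "prod_topology TC TG"] continuous_map_fst[of TC TG]]
        continuous_map_compose[OF continuous_map_snd[of "prod_topology TC TG" "prod_topology TC TG"] continuous_map_snd[of TC TG]]
      by (simp_all add: o_def)
    have 1: "continuous_map ?P TC (\<lambda>p. act (snd (fst p)) (fst (snd p)))"
      using continuous_map_compose[OF continuous_map_pairedI[OF f(2,3)] cont] by (simp add: o_def)
    have 2: "continuous_map ?P TC (\<lambda>p. fst (fst p) \<otimes>\<^bsub>C\<^esub> act (snd (fst p)) (fst (snd p)))"
      using continuous_map_compose[OF continuous_map_pairedI[OF f(1) 1] C.continuous_mult] by (simp add: o_def)
    have 3: "continuous_map ?P TG (\<lambda>p. snd (fst p) \<otimes>\<^bsub>G\<^esub> snd (snd p))"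
      using continuous_map_compose[OF continuous_map_pairedI[OF f(2,4)] G.continuous_mult] by (simp add: o_def)
    show "continuous_map ?P (prod_topology TC TG) (\<lambda>(x, y). x \<otimes>\<^bsub>?S\<^esub> y)"
      using continuous_map_pairedI[OF 2 3] by (simp add: semidirect_product_def case_prod_unfold)
    let ?Q = "prod_topology TC TG"
    have g: "continuous_map ?Q TC fst" "continuous_map ?Q TG snd"
      by (rule continuous_map_fst continuous_map_snd)+
    have 4: "continuous_map ?Q TC (\<lambda>p. inv\<^bsub>C\<^esub> (fst p))"
      using continuous_map_compose[OF g(1) C.continuous_inv] by (simp add: o_def)
    have 5: "continuous_map ?Q TG (\<lambda>p. inv\<^bsub>G\<^esub> (snd p))"
      using continuous_map_compose[OF g(2) G.continuous_inv] by (simp add: o_def)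
    have 6: "continuous_map ?Q TC (\<lambda>p. act (inv\<^bsub>G\<^esub> (snd p)) (inv\<^bsub>C\<^esub> (fst p)))"
      using continuous_map_compose[OF continuous_map_pairedI[OF 5 4] cont] by (simp add: o_def)
    show "continuous_map ?Q ?Q (\<lambda>x. inv\<^bsub>?S\<^esub> x)"
    proof (rule continuous_map_eq[OF continuous_map_pairedI[OF 6 5]])
      fix p assume "p \<in> topspace ?Q"
      then have "p \<in> carrier ?S"
        by (auto simp: semidirect_product_def C.topspace_eq_carrier G.topspace_eq_carrier)
      from inv[OF this] show "(act (inv\<^bsub>G\<^esub> (snd p)) (inv\<^bsub>C\<^esub> (fst p)), inv\<^bsub>G\<^esub> (snd p)) = inv\<^bsub>?S\<^esub> p"
        by (simp add: case_prod_unfold)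
    qed
  qed
  show "inv\<^bsub>?S\<^esub> (c, g) = (act (inv\<^bsub>G\<^esub> g) (inv\<^bsub>C\<^esub> c), inv\<^bsub>G\<^esub> g)" if "c \<in> carrier C" "g \<in> carrier G" for c g
    using inv[of "(c, g)"] that by (simp add: semidirect_product_def)
qed

section \<open>The action on lamps\<close>

context nonsingular_relation
begin

text \<open>The image of \<open>A\<close> under (x, y) |-> (x, g y), written as a preimage under the
  inverse k of g, so that measurability is immediate.\<close>

definition act_set :: "('x \<Rightarrow> 'x) \<Rightarrow> ('x \<times> 'x) set \<Rightarrow> ('x \<times> 'x) set" where
  "act_set k A = {p \<in> space (M \<Otimes>\<^sub>M M). (fst p, k (snd p)) \<in> A}"

lemma sets_act_set [measurable]:
  assumes [measurable]: "k \<in> M \<rightarrow>\<^sub>M M" "A \<in> sets (M \<Otimes>\<^sub>M M)"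
  shows "act_set k A \<in> sets (M \<Otimes>\<^sub>M M)"
  unfolding act_set_def by measurable

text \<open>Over a good point the map k is a bijection between the two sections, so the counts
  agree. The first coordinate is not moved, which is why the action is isometric for a merely
  quasi-invariant measure.\<close>

lemma emeasure_act_set:
  assumes "inverse_pair g k" and A[measurable]: "A \<in> sets (M \<Otimes>\<^sub>M M)"
  shows "emeasure \<nu> (act_set k A) = emeasure \<nu> A"
proof -
  have [measurable]: "k \<in> M \<rightarrow>\<^sub>M M" using assms by (simp add: inverse_pair_def)
  have eq: "rel_count (act_set k A) x = rel_count A x"
    if x: "x \<in> space M" and good: "\<forall>y. (x, y) \<in> R \<longrightarrow> (y, g y) \<in> R \<and> (y, k y) \<in> R \<and> k (g y) = y \<and> g (k y) = y" for x
    unfolding rel_count_def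
  proof (rule emeasure_count_space_bij_betw)
    have "(x, g y) \<in> R" "(x, k y) \<in> R" "y \<in> space M" "g y \<in> space M" if "(x, y) \<in> R" for y
      using good that R_trans R_space by blast+
    then show "bij_betw k ((act_set k A \<inter> R) `` {x}) ((A \<inter> R) `` {x})"
      using good x by (intro bij_betw_byWitness[of _ g]) (auto simp: act_set_def space_pair_measure)
  qed
  have "AE x in M. rel_count (act_set k A) x = rel_count A x"
    using inverse_pair_good[OF assms(1)] AE_space by eventually_elim (rule eq)
  then show ?thesis by (simp add: emeasure_\<nu> cong: nn_integral_cong_AE)
qed

lemma fmeasurable_act_set:
  assumes "inverse_pair g k" "A \<in> fmeasurable \<nu>"
  shows "act_set k A \<in> fmeasurable \<nu>"
  using assms emeasure_act_set[OF assms(1)] by (auto simp: fmeasurable_def inverse_pair_def)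

lemma measure_act_set:
  "inverse_pair g k \<Longrightarrow> A \<in> fmeasurable \<nu> \<Longrightarrow> measure \<nu> (act_set k A) = measure \<nu> A"
  by (simp add: measure_def emeasure_act_set fmeasurable_def)

lemma lamp_action_cls:
  assumes gk: "inverse_pair g k" and A: "A \<in> fmeasurable \<nu>"
  shows "lamp_action M R (cls g) (lamp_cls A) = lamp_cls (act_set k A)"
proof -
  have g: "invertible_map g" using gk by (auto simp: invertible_map_def)
  define r where "r = repr (cls g)"
  define i where "i = the_inv_into (space M) r"
  define B where "B = repr (lamp_cls A)"
  note r = repr_cls[OF g, folded r_def]
  note B = repr_lamp_cls[OF A, folded B_def]
  have bij: "bij_betw r (space M) (space M)"
    using r(1) by (simp add: full_maps_def Borel_automorphisms_def)
  have ri: "inverse_pair r i" unfolding i_def by (rule full_maps_inverse_pair[OF r(1)])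
  have ir: "i (r x) = x" "r (i x) = x" "r x \<in> space M" "i x \<in> space M" if "x \<in> space M" for x
    using the_inv_into_f_f[of r "space M" x] f_the_inv_into_f_bij_betw[OF bij, of x] bij that
      bij_betwE[OF bij] bij_betwE[OF bij_betw_the_inv_into[OF bij]]
    by (auto simp: bij_betw_def i_def)
  have Bs: "B \<subseteq> space M \<times> space M" using B(3) by (auto dest!: fmeasurableD sets.sets_into_space)
  have eq: "(\<lambda>(x, y). (x, r y)) ` B = act_set i B"
  proof (intro equalityI subsetI)
    fix p assume "p \<in> (\<lambda>(x, y). (x, r y)) ` B"
    then show "p \<in> act_set i B" using Bs ir by (auto simp: act_set_def space_pair_measure)
  next
    fix p assume "p \<in> act_set i B"
    then show "p \<in> (\<lambda>(x, y). (x, r y)) ` B"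
      by (intro image_eqI[of _ _ "(fst p, i (snd p))"]) (auto simp: act_set_def space_pair_measure ir)
  qed
  have fm: "act_set i B \<in> fmeasurable \<nu>" by (rule fmeasurable_act_set[OF ri B(3)])
  have "lamp_action M R (cls g) (lamp_cls A) = lamp_cls (act_set i B \<inter> R)"
    unfolding lamp_action_def r_def[symmetric] B_def[symmetric] eq
    by (rule lamp_equiv_Image[OF fmeasurable_Int_R[OF fm]])
  also have "\<dots> = lamp_cls (act_set k A)"
  proof (rule lamp_cls_eqI)
    have "AE x in M. \<forall>y. (x, y) \<in> R \<longrightarrow> i y = k y"
      by (intro AE_R inverse_pair_unique[OF ri gk r(2)])
    moreover have "AE x in M. \<forall>y. (x, y) \<in> R \<longrightarrow> ((x, y) \<in> B \<longleftrightarrow> (x, y) \<in> A)"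
      using B(4) A B(3) by (subst (asm) AE_\<nu>_iff) (auto dest!: fmeasurableD)
    ultimately show "AE x in M. \<forall>y. (x, y) \<in> R \<longrightarrow> ((x, y) \<in> act_set i B \<inter> R \<longleftrightarrow> (x, y) \<in> act_set k A)"
      using inverse_pair_good[OF gk]
    proof eventually_elim
      case (elim x)
      then show ?case using R_trans R_space by (auto simp: act_set_def space_pair_measure)
    qed
  qed (use fm fmeasurable_act_set[OF gk A] fmeasurable_Int_R lamp_sets_fmeasurable in auto)
  finally show ?thesis .
qed

lemma act_set_sym_diff: "act_set k (sym_diff A B) = sym_diff (act_set k A) (act_set k B)"
  by (auto simp: act_set_def)

text \<open>The restriction of \<open>\<nu>\<close> to \<open>A\<close> is finite and its image
  under f is absolutely continuous. It is applied to both coordinate projections.\<close>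

lemma \<nu>_small_vimage:
  assumes A: "A \<in> fmeasurable \<nu>" and f[measurable]: "f \<in> M \<Otimes>\<^sub>M M \<rightarrow>\<^sub>M M"
    and null: "\<And>E. E \<in> null_sets M \<Longrightarrow> AE x in M. \<forall>y. (x, y) \<in> R \<longrightarrow> f (x, y) \<notin> E" and "\<epsilon> > 0"
  shows "\<exists>\<delta>>0. \<forall>E\<in>sets M. prob E < \<delta> \<longrightarrow> measure \<nu> (A \<inter> f -` E) < \<epsilon>"
proof -
  have [measurable]: "A \<in> sets (M \<Otimes>\<^sub>M M)" using A by (auto dest: fmeasurableD)
  have As: "A \<subseteq> space (M \<Otimes>\<^sub>M M)" by (rule sets.sets_into_space) simp
  define D where "D = distr (density \<nu> (indicator A)) M f"
  have fi: "A \<inter> f -` E \<in> sets (M \<Otimes>\<^sub>M M)" if "E \<in> sets M" for E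
  proof -
    have "A \<inter> f -` E = A \<inter> (f -` E \<inter> space (M \<Otimes>\<^sub>M M))" using As by auto
    then show ?thesis using that by simp
  qed
  have D: "emeasure D E = emeasure \<nu> (A \<inter> f -` E)" if [measurable]: "E \<in> sets M" for E
  proof -
    have f': "f \<in> density \<nu> (indicator A) \<rightarrow>\<^sub>M M" by simp
    have "emeasure D E = emeasure \<nu> (A \<inter> (f -` E \<inter> space (density \<nu> (indicator A))))"
      unfolding D_def emeasure_distr[OF f' that] using measurable_sets[OF f' that]
      by (subst emeasure_restricted) auto
    also have "A \<inter> (f -` E \<inter> space (density \<nu> (indicator A))) = A \<inter> f -` E"
      using As by (auto simp: space_pair_measure)
    finally show ?thesis .
  qed
  have sD: "sets D = sets M" "space D = space M" by (simp_all add: D_def)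
  have "\<exists>\<delta>>0. \<forall>E\<in>sets M. prob E < \<delta> \<longrightarrow> measure D E < \<epsilon>"
  proof (rule absolutely_continuous_small[OF finite_measure_axioms _ sD(1) _ \<open>\<epsilon> > 0\<close>])
    show "finite_measure D"
    proof
      have "emeasure D (space D) \<le> emeasure \<nu> A"
        using D[of "space M"] sD by (auto intro: emeasure_mono)
      also have "\<dots> < \<infinity>" using A by (auto simp: fmeasurable_def)
      finally show "emeasure D (space D) \<noteq> \<infinity>" by simp
    qed
    fix E assume E: "E \<in> null_sets M"
    then have "emeasure D E = emeasure \<nu> (A \<inter> f -` E)" using D by auto
    also have "\<dots> = 0" using null[OF E] fi E by (subst \<nu>_zero_iff) (auto elim: AE_mp)
    finally show "emeasure D E = 0" .
  qed
  then show ?thesis using D by (simp add: measure_def)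
qed

lemma \<nu>_small_snd:
  assumes "A \<in> fmeasurable \<nu>" "\<epsilon> > 0"
  shows "\<exists>\<delta>>0. \<forall>E\<in>sets M. prob E < \<delta> \<longrightarrow> measure \<nu> (A \<inter> snd -` E) < \<epsilon>"
  using assms by (intro \<nu>_small_vimage) (auto intro!: AE_R AE_not_in)

lemma \<nu>_small_fst:
  assumes "A \<in> fmeasurable \<nu>" "\<epsilon> > 0"
  shows "\<exists>\<delta>>0. \<forall>E\<in>sets M. prob E < \<delta> \<longrightarrow> measure \<nu> (A \<inter> fst -` E) < \<epsilon>"
  using assms by (intro \<nu>_small_vimage) (auto dest!: AE_not_in elim: AE_mp)

lemma measure_sym_diff_eq:
  assumes "A \<in> fmeasurable N" "B \<in> fmeasurable N" "measure N A = measure N B"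
  shows "measure N (sym_diff A B) = 2 * measure N (A - B)"
proof -
  have "measure N (sym_diff A B) = measure N (A - B) + measure N (B - A)"
    using fmeasurable_Diff[OF assms(1) fmeasurableD[OF assms(2)]] fmeasurable_Diff[OF assms(2) fmeasurableD[OF assms(1)]]
    by (intro measure_Union) (auto dest: fmeasurableD fmeasurableD2)
  moreover have "measure N (A - B) = measure N A - measure N (A \<inter> B)" "measure N (B - A) = measure N B - measure N (A \<inter> B)"
    using assms measure_Diff[of N A "A \<inter> B"] measure_Diff[of N B "A \<inter> B"]
    by (auto simp: fmeasurable_def Diff_Int Int_commute less_top[symmetric])
  ultimately show ?thesis using assms by simp
qed

text \<open>The lamp variable is handled by isometry. In the group variable, the two images of the
  fixed set \<open>A\<close> differ only above points where the inverse maps differ, and this is a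
  small set when the group elements are close.\<close>

lemma continuous_lamp_action:
  "continuous_map (prod_topology (uniform_topology M R) (lamp_topology M R)) (lamp_topology M R)
     (\<lambda>(g, c). lamp_action M R g c)"
  unfolding uniform_topology_def lamp_topology_def
proof (rule continuous_map_prod_metricI[OF Metric_space_full_group Metric_space_lamp_group Metric_space_lamp_group])
  fix \<phi> c assume "\<phi> \<in> carrier (full_group M R)" "c \<in> carrier (lamp_group M R)"
  then show "(case (\<phi>, c) of (g, c) \<Rightarrow> lamp_action M R g c) \<in> carrier (lamp_group M R)"
    by (auto elim!: carrierE simp: carrier_lamp_group lamp_action_cls intro!: imageI fmeasurable_act_set)
next
  fix \<phi> c and \<epsilon> :: real
  assume "\<phi> \<in> carrier (full_group M R)" "c \<in> carrier (lamp_group M R)" and \<epsilon>: "\<epsilon> > 0"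
  obtain g k where g: "\<phi> = cls g" "inverse_pair g k" "invertible_map g" "invertible_map k"
    using \<open>\<phi> \<in> _\<close> by (rule carrierE)
  obtain A where A: "c = lamp_cls A" "A \<in> fmeasurable \<nu>" using \<open>c \<in> _\<close> by (auto simp: carrier_lamp_group)
  from \<nu>_small_snd[OF fmeasurable_act_set[OF g(2) A(2)], of "\<epsilon>/4"] \<epsilon> obtain \<delta>1 where
    \<delta>1: "\<delta>1 > 0" "\<And>E. E \<in> sets M \<Longrightarrow> prob E < \<delta>1 \<Longrightarrow> measure \<nu> (act_set k A \<inter> snd -` E) < \<epsilon>/4" by auto
  from small_vimage[OF invertible_mapD[OF g(4)] \<delta>1(1)] obtain \<delta>2 where
    \<delta>2: "\<delta>2 > 0" "\<And>E. E \<in> sets M \<Longrightarrow> prob E < \<delta>2 \<Longrightarrow> prob (k -` E \<inter> space M) < \<delta>1" by auto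
  show "\<exists>\<delta>>0. \<forall>x\<in>carrier (full_group M R). \<forall>y\<in>carrier (lamp_group M R).
      uniform_dist M \<phi> x < \<delta> \<longrightarrow> lamp_dist M c y < \<delta> \<longrightarrow>
      lamp_dist M (case (\<phi>, c) of (g, c) \<Rightarrow> lamp_action M R g c)
        (case (x, y) of (g, c) \<Rightarrow> lamp_action M R g c) < \<epsilon>"
  proof (intro exI[of _ "min \<delta>2 (\<epsilon>/2)"] conjI ballI impI)
    fix x y assume xy: "x \<in> carrier (full_group M R)" "y \<in> carrier (lamp_group M R)"
      "uniform_dist M \<phi> x < min \<delta>2 (\<epsilon>/2)" "lamp_dist M c y < min \<delta>2 (\<epsilon>/2)"
    obtain g' k' where g': "x = cls g'" "inverse_pair g' k'" "invertible_map g'" "invertible_map k'"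
      using xy(1) by (rule carrierE)
    obtain A' where A': "y = lamp_cls A'" "A' \<in> fmeasurable \<nu>" using xy by (auto simp: carrier_lamp_group)
    note [measurable] = g(3,4)[THEN invertible_mapD(1)] g'(3,4)[THEN invertible_mapD(1)]
    note fm = fmeasurable_act_set[OF g(2) A(2)] fmeasurable_act_set[OF g'(2) A(2)] fmeasurable_act_set[OF g'(2) A'(2)]
    let ?E = "{x \<in> space M. k x \<noteq> k' x}"
    have "prob {x \<in> space M. g x \<noteq> g' x} < \<delta>2" using xy g g' by (simp add: uniform_dist_cls)
    then have "prob ?E < \<delta>1" using prob_inverse_neq_le[OF g(2) g'(2)] \<delta>2(2)[of "{x \<in> space M. g x \<noteq> g' x}"] by simp
    then have E: "measure \<nu> (act_set k A \<inter> snd -` ?E) < \<epsilon>/4" by (intro \<delta>1) auto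
    \<comment> \<open>Both sets have the measure of \<open>A\<close>, so the two differences have
      equal measure and only the one inside \<open>act_set k A\<close>, which does not depend on g',
      has to be estimated.\<close>
    have "measure \<nu> (sym_diff (act_set k A) (act_set k' A)) = 2 * measure \<nu> (act_set k A - act_set k' A)"
      using fm g(2) g'(2) A(2) by (intro measure_sym_diff_eq) (auto simp: measure_act_set)
    also have "\<dots> \<le> 2 * measure \<nu> (act_set k A \<inter> snd -` ?E)"
    proof -
      have "act_set k A \<inter> snd -` ?E = act_set k A \<inter> {p \<in> space (M \<Otimes>\<^sub>M M). k (snd p) \<noteq> k' (snd p)}"
        by (auto simp: act_set_def space_pair_measure)
      also have "\<dots> \<in> fmeasurable \<nu>" using fm by (intro fmeasurable_Int_fmeasurable) auto
      finally have "act_set k A \<inter> snd -` ?E \<in> fmeasurable \<nu>" .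
      moreover have "act_set k A - act_set k' A \<subseteq> act_set k A \<inter> snd -` ?E"
        by (auto simp: act_set_def space_pair_measure)
      ultimately show ?thesis using fm(1,2)[THEN fmeasurableD] sets.Diff
        by (intro mult_left_mono measure_mono_fmeasurable) (auto dest: fmeasurableD)
    qed
    finally have 1: "measure \<nu> (sym_diff (act_set k A) (act_set k' A)) < \<epsilon>/2" using E by simp
    have "measure \<nu> (sym_diff (act_set k' A) (act_set k' A')) < \<epsilon>/2"
      using xy A A' g'(2) by (simp add: act_set_sym_diff[symmetric] measure_act_set fmeasurable_sym_diff lamp_dist_cls)
    with 1 measure_sym_diff_triangle[OF fm] show "lamp_dist M (case (\<phi>, c) of (g, c) \<Rightarrow> lamp_action M R g c)
        (case (x, y) of (g, c) \<Rightarrow> lamp_action M R g c) < \<epsilon>"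
      using g g' A A' fm by (simp add: lamp_action_cls lamp_dist_cls)
  qed (use \<delta>2 \<epsilon> in auto)
qed

lemma lamp_action_closed:
  "\<phi> \<in> carrier (full_group M R) \<Longrightarrow> c \<in> carrier (lamp_group M R) \<Longrightarrow>
    lamp_action M R \<phi> c \<in> carrier (lamp_group M R)"
  by (auto elim!: carrierE simp: carrier_lamp_group lamp_action_cls intro!: imageI fmeasurable_act_set)

lemma lamp_action_hom:
  assumes "\<phi> \<in> carrier (full_group M R)" "c \<in> carrier (lamp_group M R)" "d \<in> carrier (lamp_group M R)"
  shows "lamp_action M R \<phi> (c \<otimes>\<^bsub>lamp_group M R\<^esub> d)
     = lamp_action M R \<phi> c \<otimes>\<^bsub>lamp_group M R\<^esub> lamp_action M R \<phi> d"
proof -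
  obtain g k where "\<phi> = cls g" "inverse_pair g k" using assms(1) by (rule carrierE)
  then show ?thesis using assms(2,3)
    by (auto simp: carrier_lamp_group mult_lamp_group lamp_action_cls fmeasurable_sym_diff
      fmeasurable_act_set act_set_sym_diff)
qed

lemma lamp_action_one:
  assumes "c \<in> carrier (lamp_group M R)"
  shows "lamp_action M R \<one>\<^bsub>full_group M R\<^esub> c = c"
proof -
  obtain A where A: "c = lamp_cls A" "A \<in> fmeasurable \<nu>" using assms by (auto simp: carrier_lamp_group)
  have "A \<subseteq> space (M \<Otimes>\<^sub>M M)" using A(2) by (intro sets.sets_into_space) (auto dest: fmeasurableD)
  then have "act_set id A = A" by (auto simp: act_set_def)
  then show ?thesis using A by (simp add: one_full_group lamp_action_cls[OF inverse_pair_id])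
qed

lemma lamp_action_mult:
  assumes "\<phi> \<in> carrier (full_group M R)" "\<psi> \<in> carrier (full_group M R)" "c \<in> carrier (lamp_group M R)"
  shows "lamp_action M R (\<phi> \<otimes>\<^bsub>full_group M R\<^esub> \<psi>) c = lamp_action M R \<phi> (lamp_action M R \<psi> c)"
proof -
  obtain g k where g: "\<phi> = cls g" "inverse_pair g k" "invertible_map g" "invertible_map k" using assms(1) by (rule carrierE)
  obtain h l where h: "\<psi> = cls h" "inverse_pair h l" "invertible_map h" "invertible_map l" using assms(2) by (rule carrierE)
  obtain A where A: "c = lamp_cls A" "A \<in> fmeasurable \<nu>" using assms by (auto simp: carrier_lamp_group)
  have "act_set (l \<circ> k) A = act_set k (act_set l A)"
    using g(4)[THEN invertible_mapD(1), THEN measurable_space] by (auto simp: act_set_def space_pair_measure)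
  then show ?thesis
    unfolding g(1) h(1) A(1) mult_full_group[OF g(3) h(3)] lamp_action_cls[OF h(2) A(2)]
      lamp_action_cls[OF inverse_pair_comp[OF g(2) h(2)] A(2)]
      lamp_action_cls[OF g(2) fmeasurable_act_set[OF h(2) A(2)]] by simp
qed

lemma topological_group_lamplighter:
  "topological_group (lamplighter M R) (lamplighter_topology M R)"
  and inv_lamplighter: "c \<in> carrier (lamp_group M R) \<Longrightarrow> \<phi> \<in> carrier (full_group M R) \<Longrightarrow>
    inv\<^bsub>lamplighter M R\<^esub> (c, \<phi>) = (lamp_action M R (inv\<^bsub>full_group M R\<^esub> \<phi>) c, inv\<^bsub>full_group M R\<^esub> \<phi>)"
proof -
  note sd = semidirect_topological_group[OF topological_group_lamp_group topological_group_full_group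
    lamp_action_closed lamp_action_hom lamp_action_one lamp_action_mult continuous_lamp_action]
  show "topological_group (lamplighter M R) (lamplighter_topology M R)"
    unfolding lamplighter_def lamplighter_topology_def by (rule sd(1))
  show "inv\<^bsub>lamplighter M R\<^esub> (c, \<phi>) = (lamp_action M R (inv\<^bsub>full_group M R\<^esub> \<phi>) c, inv\<^bsub>full_group M R\<^esub> \<phi>)"
    if "c \<in> carrier (lamp_group M R)" "\<phi> \<in> carrier (full_group M R)"
  proof -
    have "inv\<^bsub>lamplighter M R\<^esub> (c, \<phi>) =
        (lamp_action M R (inv\<^bsub>full_group M R\<^esub> \<phi>) (inv\<^bsub>lamp_group M R\<^esub> c), inv\<^bsub>full_group M R\<^esub> \<phi>)"
      unfolding lamplighter_def using that by - (rule sd(2); assumption)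
    then show ?thesis using that by (simp add: inv_lamp_group)
  qed
qed

end

section \<open>Criteria for contractibility, separability and approximation of sets\<close>

lemma contractible_space_metricI:
  fixes h :: "real \<Rightarrow> 'a \<Rightarrow> 'a"
  assumes "Metric_space A d"
    and h: "\<And>t x. t \<in> {0..1} \<Longrightarrow> x \<in> A \<Longrightarrow> h t x \<in> A" "\<And>x. x \<in> A \<Longrightarrow> h 0 x = x" "\<And>x. x \<in> A \<Longrightarrow> h 1 x = a"
    and cont: "\<And>t x \<epsilon>. t \<in> {0..1} \<Longrightarrow> x \<in> A \<Longrightarrow> \<epsilon> > 0 \<Longrightarrow>
      \<exists>\<delta>>0. \<forall>s\<in>{0..1}. \<forall>y\<in>A. \<bar>s - t\<bar> < \<delta> \<longrightarrow> d x y < \<delta> \<longrightarrow> d (h t x) (h s y) < \<epsilon>"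
  shows "contractible_space (Metric_space.mtopology A d)"
proof -
  interpret Metric_space A d by fact
  let ?I = "subtopology euclideanreal {0..1}"
  have "continuous_map (prod_topology ?I mtopology) mtopology (\<lambda>p. h (fst p) (snd p))"
    unfolding continuous_map_to_metric
  proof (intro ballI allI impI)
    fix p and \<epsilon> :: real
    assume p: "p \<in> topspace (prod_topology ?I mtopology)" and \<epsilon>: "\<epsilon> > 0"
    obtain t x where tx: "p = (t, x)" "t \<in> {0..1}" "x \<in> A" using p by (cases p) auto
    from cont[OF tx(2,3) \<epsilon>] obtain \<delta> where \<delta>: "\<delta> > 0"
      "\<And>s y. s \<in> {0..1} \<Longrightarrow> y \<in> A \<Longrightarrow> \<bar>s - t\<bar> < \<delta> \<Longrightarrow> d x y < \<delta> \<Longrightarrow> d (h t x) (h s y) < \<epsilon>" by blast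
    have "openin ?I ({0..1} \<inter> ball t \<delta>)" by (rule openin_open_Int) simp
    then show "\<exists>U. openin (prod_topology ?I mtopology) U \<and> p \<in> U \<and>
        (\<forall>q\<in>U. h (fst q) (snd q) \<in> mball (h (fst p) (snd p)) \<epsilon>)"
      by (intro exI[of _ "({0..1} \<inter> ball t \<delta>) \<times> mball x \<delta>"])
        (use tx \<delta> h(1) in \<open>auto simp: openin_prod_Times_iff dist_real_def abs_minus_commute\<close>)
  qed
  then have "homotopic_with (\<lambda>x. True) mtopology mtopology id (\<lambda>x. a)"
    by (subst homotopic_with) (auto intro!: exI[of _ "\<lambda>p. h (fst p) (snd p)"] simp: h)
  then show ?thesis by (auto simp: contractible_space_def)
qed

lemma separable_space_prod_topology:
  assumes "separable_space S" "separable_space T"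
  shows "separable_space (prod_topology S T)"
proof -
  obtain C D where "countable C" "C \<subseteq> topspace S" "S closure_of C = topspace S"
      "countable D" "D \<subseteq> topspace T" "T closure_of D = topspace T"
    using assms unfolding separable_space_def by blast
  then show ?thesis
    unfolding separable_space_def by (intro exI[of _ "C \<times> D"]) (auto simp: closure_of_Times)
qed

lemma sums_half_tail: "(\<lambda>i. (1/2::real) ^ (i + N)) sums (2 * (1/2) ^ N)"
  using sums_mult2[OF geometric_sums[of "1/2::real"], of "(1/2)^N"] by (simp add: power_add)

text \<open>The sets that can be approximated by the algebra form a sigma-algebra; a countable union
  is first replaced by a finite one, at the cost \<epsilon>/2.\<close>

lemma dense_algebra:
  assumes "finite_measure M" "Sigma_Algebra.algebra (space M) \<A>" "sets M = sigma_sets (space M) \<A>"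
    and A: "A \<in> sets M" and "\<epsilon> > 0"
  shows "\<exists>B\<in>\<A>. measure M (sym_diff A B) < \<epsilon>"
proof -
  interpret finite_measure M by fact
  interpret Sigma_Algebra.algebra "space M" \<A> by fact
  have sub: "B \<in> \<A> \<Longrightarrow> B \<in> sets M" for B using assms(3) by auto
  have "A \<in> sigma_sets (space M) \<A>" using A assms(3) by simp
  then have "\<forall>\<epsilon>>0. \<exists>B\<in>\<A>. measure M (sym_diff A B) < \<epsilon>"
  proof (induction rule: sigma_sets.induct)
    case (Basic a)
    then show ?case by (auto intro!: bexI[of _ a])
  next
    case Empty
    then show ?case by (auto intro!: bexI[of _ "{}"])
  next
    case (Compl a)
    show ?case
    proof (intro allI impI)
      fix \<epsilon> :: real assume "\<epsilon> > 0"
      with Compl obtain B where B: "B \<in> \<A>" "measure M (sym_diff a B) < \<epsilon>" by blast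
      have "a \<subseteq> space M" "B \<subseteq> space M" using Compl(1) B(1) sub sets.sets_into_space assms(3) by blast+
      then have "sym_diff (space M - a) (space M - B) = sym_diff a B" by auto
      with B show "\<exists>B\<in>\<A>. measure M (sym_diff (space M - a) B) < \<epsilon>"
        by (intro bexI[of _ "space M - B"]) (auto simp: compl_sets)
    qed
  next
    case (Union a)
    show ?case
    proof (intro allI impI)
      fix \<epsilon> :: real assume \<epsilon>: "\<epsilon> > 0"
      have a[measurable]: "a i \<in> sets M" for i using Union(1) assms(3) by simp
      let ?U = "\<Union>i. a i" and ?V = "\<lambda>n. \<Union>i<n. a i"
      have "incseq ?V" by (intro monoI UN_mono) auto
      then have "(\<lambda>n. measure M (?V n)) \<longlonglongrightarrow> measure M (\<Union>n. ?V n)"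
        by (intro finite_Lim_measure_incseq) auto
      moreover have "(\<Union>n. ?V n) = ?U" by auto
      ultimately have "eventually (\<lambda>n. dist (measure M (?V n)) (measure M ?U) < \<epsilon>/2) sequentially"
        using \<epsilon> by (intro tendstoD) auto
      then obtain n where "dist (measure M (?V n)) (measure M ?U) < \<epsilon>/2"
        by (auto simp: eventually_sequentially)
      moreover have "measure M (?U - ?V n) = measure M ?U - measure M (?V n)"
        by (intro finite_measure_Diff) auto
      ultimately have n: "measure M (?U - ?V n) < \<epsilon>/2" unfolding dist_real_def by linarith
      have "\<forall>i. \<exists>B\<in>\<A>. measure M (sym_diff (a i) B) < \<epsilon> / (2 * (real n + 1))"
        using Union(2) \<epsilon> by simp
      then obtain B where B: "\<And>i. B i \<in> \<A>" "\<And>i. measure M (sym_diff (a i) (B i)) < \<epsilon> / (2 * (real n + 1))"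
        by metis
      note [measurable] = sub[OF B(1)]
      have "measure M (sym_diff ?U (\<Union>i<n. B i)) \<le> measure M ((?U - ?V n) \<union> (\<Union>i<n. sym_diff (a i) (B i)))"
        by (intro finite_measure_mono) auto
      also have "\<dots> \<le> measure M (?U - ?V n) + measure M (\<Union>i<n. sym_diff (a i) (B i))"
        by (intro measure_Un_le) auto
      also have "measure M (\<Union>i<n. sym_diff (a i) (B i)) \<le> (\<Sum>i<n. measure M (sym_diff (a i) (B i)))"
        by (intro measure_UNION_le) auto
      also have "\<dots> \<le> (\<Sum>i<n. \<epsilon> / (2 * (real n + 1)))" by (intro sum_mono less_imp_le B)
      also have "\<dots> \<le> \<epsilon>/2" using \<epsilon> by (simp add: field_simps)
      finally have "measure M (sym_diff ?U (\<Union>i<n. B i)) < \<epsilon>" using n by simp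
      moreover have "(\<Union>i<n. B i) \<in> \<A>" using B(1) by (intro finite_UN) auto
      ultimately show "\<exists>B\<in>\<A>. measure M (sym_diff ?U B) < \<epsilon>" by blast
    qed
  qed
  then show ?thesis using \<open>\<epsilon> > 0\<close> by blast
qed

section \<open>Completeness and separability of the two factors\<close>

context nonsingular_relation
begin

text \<open>The limit is the limes superior of the representatives. Off the set \<open>D N\<close>
  of all later changes, membership is constant from index N on, and the measure of
  \<open>D N\<close> is at most 2 * (1/2)^N.\<close>

lemma mcomplete_lamp_group: "Metric_space.mcomplete (carrier (lamp_group M R)) (lamp_dist M)"
proof (rule mcompleteI_fast[OF Metric_space_lamp_group])
  fix s :: "nat \<Rightarrow> ('x \<times> 'x) set set"
  assume s: "range s \<subseteq> carrier (lamp_group M R)" "\<And>n. lamp_dist M (s n) (s (Suc n)) < (1/2)^n"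
  have "\<exists>A. A \<in> fmeasurable \<nu> \<and> s n = lamp_cls A" for n
    using s(1) by (auto simp: carrier_lamp_group image_subset_iff)
  then obtain A where A: "\<And>n. A n \<in> fmeasurable \<nu>" "\<And>n. s n = lamp_cls (A n)" by metis
  have [measurable]: "A n \<in> sets \<nu>" for n using A(1) by (rule fmeasurableD)
  define L where "L = (\<Inter>n. \<Union>i\<in>{n..}. A i)"
  define D where "D N = (\<Union>i. sym_diff (A (i + N)) (A (Suc (i + N))))" for N
  have LDs [measurable]: "L \<in> sets \<nu>" "D N \<in> sets \<nu>" for N unfolding L_def D_def by measurable
  have LD: "sym_diff (A N) L \<subseteq> D N" for N
  proof
    fix p assume p: "p \<in> sym_diff (A N) L"
    show "p \<in> D N"
    proof (rule ccontr)
      assume "p \<notin> D N"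
      then have "p \<in> A (i + N) \<longleftrightarrow> p \<in> A (Suc (i + N))" for i by (auto simp: D_def)
      then have "p \<in> A (i + N) \<longleftrightarrow> p \<in> A N" for i by (induction i) auto
      then have const: "p \<in> A i \<longleftrightarrow> p \<in> A N" if "i \<ge> N" for i
        using that by (metis le_add_diff_inverse2)
      have "p \<in> L \<longleftrightarrow> p \<in> A N"
      proof
        assume "p \<in> L"
        then obtain i where "i \<ge> N" "p \<in> A i" unfolding L_def by auto
        then show "p \<in> A N" using const by blast
      next
        assume pN: "p \<in> A N"
        have "\<exists>i\<ge>n. p \<in> A i" for n using const[of "max n N"] pN by (intro exI[of _ "max n N"]) simp
        then show "p \<in> L" unfolding L_def by auto
      qed
      with p show False by auto
    qed
  qed
  have D: "emeasure \<nu> (D N) \<le> ennreal (2 * (1/2)^N)" for N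
  proof -
    have "emeasure \<nu> (D N) \<le> suminf (\<lambda>i. emeasure \<nu> (sym_diff (A (i + N)) (A (Suc (i + N)))))"
      unfolding D_def
    proof (rule emeasure_subadditive_countably, rule image_subsetI, rule sets_sym_diff)
      show "A (i + N) \<in> sets \<nu>" "A (Suc (i + N)) \<in> sets \<nu>" for i by (rule fmeasurableD, rule A(1))+
    qed
    also have "\<dots> \<le> suminf (\<lambda>i. ennreal ((1/2)^(i + N)))"
    proof (rule suminf_le)
      fix i
      have "measure \<nu> (sym_diff (A (i + N)) (A (Suc (i + N)))) \<le> (1/2)^(i+N)"
        using s(2)[of "i + N"] A by (simp add: lamp_dist_cls)
      then show "emeasure \<nu> (sym_diff (A (i + N)) (A (Suc (i + N)))) \<le> ennreal ((1/2)^(i + N))"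
        using fmeasurable_sym_diff[OF A(1) A(1), of "i + N" "Suc (i + N)"]
        by (simp add: emeasure_eq_measure2 fmeasurableD2 ennreal_leI del: Un_Diff)
    qed auto
    also have "\<dots> = ennreal (2 * (1/2)^N)"
      using sums_half_tail[of N] by (subst suminf_ennreal2) (auto simp: sums_iff)
    finally show ?thesis .
  qed
  have Dfm: "D N \<in> fmeasurable \<nu>" for N
    using le_less_trans[OF D[of N] ennreal_less_top] LDs(2)[of N] by (simp add: fmeasurable_def)
  have "L \<subseteq> A 0 \<union> D 0" using LD[of 0] by auto
  then have L: "L \<in> fmeasurable \<nu>"
    using A(1) Dfm by (intro fmeasurableI2[OF fmeasurable.Un _ LDs(1)]) auto
  have le: "lamp_dist M (s n) (lamp_cls L) \<le> 2 * (1/2)^n" for n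
  proof -
    have "measure \<nu> (sym_diff (A n) L) \<le> measure \<nu> (D n)"
      by (rule measure_mono_fmeasurable[OF LD fmeasurableD[OF fmeasurable_sym_diff[OF A(1) L]] Dfm])
    also have "\<dots> \<le> 2 * (1/2)^n" unfolding measure_def by (rule enn2real_leI) (use D in auto)
    finally show ?thesis using A L by (simp add: lamp_dist_cls)
  qed
  have lim: "(\<lambda>n. 2 * (1/2)^n :: real) \<longlonglongrightarrow> 0"
    using tendsto_mult_right_zero[OF LIMSEQ_power_zero[of "1/2::real"]] by simp
  have "(\<lambda>n. lamp_dist M (s n) (lamp_cls L)) \<longlonglongrightarrow> 0"
    by (rule tendsto_sandwich[OF _ _ tendsto_const lim])
      (simp_all add: le Metric_space.nonneg[OF Metric_space_lamp_group])
  then show "\<exists>x\<in>carrier (lamp_group M R). (\<lambda>n. lamp_dist M (s n) x) \<longlonglongrightarrow> 0"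
    using L by (auto simp: carrier_lamp_group)
qed

text \<open>By Borel-Cantelli almost every point sees only finitely many changes, so the maps
  stabilise at almost every point.\<close>

lemma eventually_constant_limit:
  assumes f[measurable]: "\<And>n. f n \<in> M \<rightarrow>\<^sub>M M"
    and fast: "\<And>n. prob {x \<in> space M. f n x \<noteq> f (Suc n) x} < (1/2)^n"
  shows "\<exists>g. g \<in> M \<rightarrow>\<^sub>M M \<and> (AE x in M. eventually (\<lambda>n. f n x = g x) sequentially)"
proof -
  \<comment> \<open>The time of stabilisation. Where the sequence never settles it has an arbitrary
    value, but it is measurable everywhere, and so is the limit.\<close>
  define N where "N x = (LEAST m. \<forall>n\<ge>m. f n x = f m x)" for x
  have [measurable]: "N \<in> measurable M (count_space UNIV)" unfolding N_def by measurable
  define g where "g x = f (N x) x" for x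
  have "g \<in> M \<rightarrow>\<^sub>M M" unfolding g_def by (rule measurable_compose_countable) auto
  moreover have "summable (\<lambda>n. prob {x \<in> space M. f n x \<noteq> f (Suc n) x})"
    by (rule summable_comparison_test'[OF summable_geometric[of "1/2"], of 0]) (use fast less_imp_le in auto)
  then have "AE x in M. eventually (\<lambda>n. x \<in> space M - {x \<in> space M. f n x \<noteq> f (Suc n) x}) sequentially"
    by (intro borel_cantelli_AE1) (auto simp: less_top[symmetric])
  then have "AE x in M. eventually (\<lambda>n. f n x = g x) sequentially"
  proof eventually_elim
    case (elim x)
    then obtain m where m: "\<And>n. n \<ge> m \<Longrightarrow> f n x = f (Suc n) x"
      by (auto simp: eventually_sequentially)
    have "f n x = f m x" if "n \<ge> m" for n
      using that
    proof (induction rule: dec_induct)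
      case (step n)
      then show ?case using m[of n] by simp
    qed simp
    then have "\<forall>n\<ge>m. f n x = f m x" by blast
    then have "\<forall>n\<ge>N x. f n x = f (N x) x" unfolding N_def by (rule LeastI)
    then show ?case unfolding eventually_sequentially g_def by blast
  qed
  ultimately show ?thesis by (intro exI[of _ g] conjI)
qed

text \<open>A uniform limit of automorphisms may fail to be onto, so the uniform metric alone does
  not serve for completeness. Adding the distance of the inverses keeps the topology, as inversion
  is continuous, and forces the limit to be invertible.\<close>

definition two_sided_dist :: "('x \<Rightarrow> 'x) set \<Rightarrow> ('x \<Rightarrow> 'x) set \<Rightarrow> real" where
  "two_sided_dist \<phi> \<psi> = uniform_dist M \<phi> \<psi> +
     uniform_dist M (inv\<^bsub>full_group M R\<^esub> \<phi>) (inv\<^bsub>full_group M R\<^esub> \<psi>)"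

lemma Metric_space_two_sided: "Metric_space (carrier (full_group M R)) two_sided_dist"
proof -
  interpret Metric_space "carrier (full_group M R)" "uniform_dist M" by (rule Metric_space_full_group)
  interpret G: group "full_group M R" by (rule group_full_group)
  show ?thesis
  proof
    fix x y z assume "x \<in> carrier (full_group M R)" "y \<in> carrier (full_group M R)" "z \<in> carrier (full_group M R)"
    then show "two_sided_dist x z \<le> two_sided_dist x y + two_sided_dist y z"
      using triangle[of x y z] triangle[of "inv\<^bsub>full_group M R\<^esub> x" "inv\<^bsub>full_group M R\<^esub> y" "inv\<^bsub>full_group M R\<^esub> z"]
      by (simp add: two_sided_dist_def)
  qed (auto simp: two_sided_dist_def commute add_nonneg_eq_0_iff)
qed

lemma two_sided_topology:
  "Metric_space.mtopology (carrier (full_group M R)) two_sided_dist = uniform_topology M R"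
proof -
  interpret U: Metric_space "carrier (full_group M R)" "uniform_dist M" by (rule Metric_space_full_group)
  interpret V: Metric_space "carrier (full_group M R)" two_sided_dist by (rule Metric_space_two_sided)
  interpret G: topological_group "full_group M R" "uniform_topology M R" by (rule topological_group_full_group)
  have "continuous_map V.mtopology U.mtopology id"
    using U.nonneg V.nonneg
    by (intro continuous_map_metricI[OF V.Metric_space_axioms U.Metric_space_axioms])
      (auto simp: two_sided_dist_def intro: le_less_trans[rotated] intro!: exI[of _ "_ :: real"])
  moreover have "continuous_map U.mtopology V.mtopology id"
  proof (rule continuous_map_metricI[OF U.Metric_space_axioms V.Metric_space_axioms])
    fix a and \<epsilon> :: real assume a: "a \<in> carrier (full_group M R)" "\<epsilon> > 0"
    have "continuous_map U.mtopology U.mtopology (\<lambda>x. inv\<^bsub>full_group M R\<^esub> x)"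
      using G.continuous_inv by (simp add: uniform_topology_def)
    then obtain \<delta> where \<delta>: "\<delta> > 0" "\<And>x. x \<in> carrier (full_group M R) \<Longrightarrow> uniform_dist M a x < \<delta> \<Longrightarrow>
        uniform_dist M (inv\<^bsub>full_group M R\<^esub> a) (inv\<^bsub>full_group M R\<^esub> x) < \<epsilon>/2"
      unfolding U.metric_continuous_map[OF U.Metric_space_axioms] using a half_gt_zero by meson
    show "\<exists>\<delta>>0. \<forall>x\<in>carrier (full_group M R). uniform_dist M a x < \<delta> \<longrightarrow> two_sided_dist (id a) (id x) < \<epsilon>"
      by (intro exI[of _ "min \<delta> (\<epsilon>/2)"]) (use \<delta> a in \<open>fastforce simp: two_sided_dist_def\<close>)
  qed auto
  ultimately show ?thesis
    using topology_finer_continuous_id[of U.mtopology V.mtopology] topology_finer_continuous_id[of V.mtopology U.mtopology]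
    by (auto simp: topology_eq uniform_topology_def)
qed

lemma mcomplete_two_sided: "Metric_space.mcomplete (carrier (full_group M R)) two_sided_dist"
proof (rule mcompleteI_fast[OF Metric_space_two_sided])
  fix s :: "nat \<Rightarrow> ('x \<Rightarrow> 'x) set"
  assume s: "range s \<subseteq> carrier (full_group M R)" "\<And>n. two_sided_dist (s n) (s (Suc n)) < (1/2)^n"
  have "\<exists>g k. s n = cls g \<and> inverse_pair g k \<and> invertible_map g \<and> invertible_map k" for n
    using s(1) by (meson carrierE rangeI subsetD)
  then obtain g k where gk: "\<And>n. s n = cls (g n)" "\<And>n. inverse_pair (g n) (k n)"
    "\<And>n. invertible_map (g n)" "\<And>n. invertible_map (k n)" by metis
  note [measurable] = gk(3,4)[THEN invertible_mapD(1)]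
  have d: "prob {x \<in> space M. g n x \<noteq> g (Suc n) x} + prob {x \<in> space M. k n x \<noteq> k (Suc n) x} < (1/2)^n" for n
    using s(2)[of n] by (simp add: two_sided_dist_def gk inv_full_group[OF gk(2)] uniform_dist_cls)
  have "\<exists>h. h \<in> M \<rightarrow>\<^sub>M M \<and> (AE x in M. eventually (\<lambda>n. g n x = h x) sequentially)"
    "\<exists>l. l \<in> M \<rightarrow>\<^sub>M M \<and> (AE x in M. eventually (\<lambda>n. k n x = l x) sequentially)"
    by (intro eventually_constant_limit, simp, rule le_less_trans[OF _ d], simp)+
  then obtain h l where h[measurable]: "h \<in> M \<rightarrow>\<^sub>M M" and h_ev: "AE x in M. eventually (\<lambda>n. g n x = h x) sequentially"
    and l[measurable]: "l \<in> M \<rightarrow>\<^sub>M M" and l_ev: "AE x in M. eventually (\<lambda>n. k n x = l x) sequentially"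
    by auto
  have good: "AE x in M. \<forall>n. \<forall>y. (x, y) \<in> R \<longrightarrow> (y, g n y) \<in> R \<and> (y, k n y) \<in> R \<and> k n (g n y) = y \<and> g n (k n y) = y"
    unfolding AE_all_countable using inverse_pair_good[OF gk(2)] by blast
  have "AE x in M. (x, h x) \<in> R \<and> (x, l x) \<in> R \<and> l (h x) = x \<and> h (l x) = x"
    using AE_R[OF h_ev] AE_R[OF l_ev] good AE_space
  proof eventually_elim
    case (elim x)
    have x: "(x, x) \<in> R" using elim R_refl by simp
    have ev: "\<exists>m. \<forall>n\<ge>m. g n y = h y" "\<exists>m. \<forall>n\<ge>m. k n y = l y" if "(x, y) \<in> R" for y
      using elim that by (auto simp: eventually_sequentially)
    obtain m1 where m1: "\<And>n. n \<ge> m1 \<Longrightarrow> g n x = h x" using ev(1)[OF x] by blast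
    obtain m2 where m2: "\<And>n. n \<ge> m2 \<Longrightarrow> k n x = l x" using ev(2)[OF x] by blast
    have hR: "(x, h x) \<in> R" "(x, l x) \<in> R" 
    proof -
      have "(x, g m1 x) \<in> R" "(x, k m2 x) \<in> R" using elim(3) x by blast+
      then show "(x, h x) \<in> R" "(x, l x) \<in> R" using m1[of m1] m2[of m2] by simp_all
    qed
    obtain m3 where m3: "\<And>n. n \<ge> m3 \<Longrightarrow> k n (h x) = l (h x)" using ev(2)[OF hR(1)] by blast
    obtain m4 where m4: "\<And>n. n \<ge> m4 \<Longrightarrow> g n (l x) = h (l x)" using ev(1)[OF hR(2)] by blast
    \<comment> \<open>Beyond the stabilisation times at x and at h x, the limit maps agree with one
      and the same pair g n, k n, whose inverse identity they inherit.\<close>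
    have "l (h x) = k (m1 + m3) (g (m1 + m3) x)" using m1[of "m1+m3"] m3[of "m1+m3"] by simp
    moreover have "h (l x) = g (m2 + m4) (k (m2 + m4) x)" using m2[of "m2+m4"] m4[of "m2+m4"] by simp
    ultimately show ?case using hR elim x by simp
  qed
  then have hl: "inverse_pair h l" by (simp add: inverse_pair_def)
  then have inv: "invertible_map h" "invertible_map l"
    using inverse_pair_sym unfolding invertible_map_def by blast+
  have "(\<lambda>n. prob {x \<in> space M. g n x \<noteq> h x}) \<longlonglongrightarrow> 0"
    by (rule measure_tendsto_zeroI) (use h_ev in \<open>auto elim!: AE_mp intro!: AE_I2 elim: eventually_mono\<close>)
  moreover have "(\<lambda>n. prob {x \<in> space M. k n x \<noteq> l x}) \<longlonglongrightarrow> 0"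
    by (rule measure_tendsto_zeroI) (use l_ev in \<open>auto elim!: AE_mp intro!: AE_I2 elim: eventually_mono\<close>)
  ultimately have "(\<lambda>n. two_sided_dist (s n) (cls h)) \<longlonglongrightarrow> 0 + 0"
    unfolding two_sided_dist_def gk(1) inv_full_group[OF gk(2)] inv_full_group[OF hl]
    by (simp only: uniform_dist_cls gk inv) (rule tendsto_add)
  then show "\<exists>x\<in>carrier (full_group M R). (\<lambda>n. two_sided_dist (s n) x) \<longlonglongrightarrow> 0"
    using cls_in_carrier[OF inv(1)] by auto
qed

text \<open>A lamp is cut into slices along the enumeration \<open>W\<close>: the n-th slice holds
  the points x whose lamp at W n x is on, with n the first index of that point. Finitely many slices
  carry all but a small part, and each is approximated by a member of the countable algebra.\<close>

lemma lamp_code: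
  assumes "Sigma_Algebra.algebra (space M) \<A>" "sets M = sigma_sets (space M) \<A>" "countable \<A>" "\<epsilon> > 0"
  shows "\<exists>c :: ('x \<times> 'x) set set \<Rightarrow> nat \<times> 'x set list. countable (c ` carrier (lamp_group M R)) \<and>
    (\<forall>x\<in>carrier (lamp_group M R). \<forall>y\<in>carrier (lamp_group M R). c x = c y \<longrightarrow> lamp_dist M x y < \<epsilon>)"
proof -
  define G where "G N = {p \<in> space (M \<Otimes>\<^sub>M M). \<exists>n<N. snd p = W n (fst p)}" for N
  have Gs [measurable]: "G N \<in> sets \<nu>" for N unfolding G_def sets_\<nu> by measurable
  define sl where "sl A n = {x \<in> space M. (x, W n x) \<in> A \<and> (\<forall>j<n. W j x \<noteq> W n x)}" for A :: "('x \<times> 'x) set" and n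
  have sl[measurable]: "sl A n \<in> sets M" if "A \<in> fmeasurable \<nu>" for A n
  proof -
    have [measurable]: "A \<in> sets (M \<Otimes>\<^sub>M M)" using that by (auto dest: fmeasurableD)
    show ?thesis unfolding sl_def by measurable
  qed
  \<comment> \<open>The error budget for two lamps with the same code: each tail costs \<epsilon>/4,
    and the N slices together cost at most N * 2 * \<epsilon> / (4 * (N + 1)), which is at most
    \<epsilon>/2.\<close>
  define Q where "Q x N Bs A \<longleftrightarrow> A \<in> fmeasurable \<nu> \<and> x = lamp_cls A \<and> length Bs = N \<and> set Bs \<subseteq> \<A> \<and>
      measure \<nu> (A - G N) < \<epsilon>/4 \<and> (\<forall>n<N. prob (sym_diff (sl A n) (Bs ! n)) < \<epsilon> / (4 * (real N + 1)))"
    for x N Bs A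
  have code: "\<exists>N Bs A. Q x N Bs A"
    if x: "x \<in> carrier (lamp_group M R)" for x
  proof -
    obtain A where A: "A \<in> fmeasurable \<nu>" "x = lamp_cls A" using x by (auto simp: carrier_lamp_group)
    have [measurable]: "A \<in> sets \<nu>" using A(1) by (rule fmeasurableD)
    have fin: "A - G N \<in> fmeasurable \<nu>" for N by (rule fmeasurable_Diff[OF A(1) Gs])
    have "G m \<subseteq> G n" if "m \<le> n" for m n
      using order.strict_trans2[OF _ that] unfolding G_def by blast
    then have "decseq (\<lambda>N. A - G N)" unfolding decseq_def by blast
    then have "(\<lambda>N. measure \<nu> (A - G N)) \<longlonglongrightarrow> measure \<nu> (\<Inter>N. A - G N)"
      by (intro Lim_measure_decseq image_subsetI fin[THEN fmeasurableD])
        (simp_all add: fin[THEN fmeasurableD2])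
    moreover have "emeasure \<nu> (\<Inter>N. A - G N) = 0"
    proof (subst \<nu>_zero_iff)
      have "(\<Inter>N. A - G N) \<in> sets \<nu>" by measurable
      then show "(\<Inter>N. A - G N) \<in> sets (M \<Otimes>\<^sub>M M)" by simp
      show "AE x in M. \<forall>y. (x, y) \<in> R \<longrightarrow> (x, y) \<notin> (\<Inter>N. A - G N)"
      proof (intro AE_I2 allI impI)
        fix x y assume "(x, y) \<in> R"
        then obtain n where "y = W n x" "x \<in> space M" "y \<in> space M" using R_W R_space by blast
        then have "(x, y) \<in> G (Suc n)" by (auto simp: G_def space_pair_measure)
        then show "(x, y) \<notin> (\<Inter>N. A - G N)" by blast
      qed
    qed
    ultimately have "(\<lambda>N. measure \<nu> (A - G N)) \<longlonglongrightarrow> 0" by (simp add: measure_def)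
    from order_tendstoD(2)[OF this, of "\<epsilon>/4"] \<open>\<epsilon> > 0\<close> obtain N where N: "measure \<nu> (A - G N) < \<epsilon>/4"
      by (auto simp: eventually_sequentially)
    have "\<forall>n. \<exists>B\<in>\<A>. prob (sym_diff (sl A n) B) < \<epsilon> / (4 * (real N + 1))"
      using \<open>\<epsilon> > 0\<close> by (intro allI dense_algebra[OF finite_measure_axioms assms(1,2) sl[OF A(1)]]) simp
    then obtain B where B: "\<And>n. B n \<in> \<A>" "\<And>n. prob (sym_diff (sl A n) (B n)) < \<epsilon> / (4 * (real N + 1))"
      by metis
    show ?thesis unfolding Q_def
      by (intro exI[of _ N] exI[of _ "map B [0..<N]"] exI[of _ A]) (use A N B in auto)
  qed
  then obtain N Bs A where "\<And>x. x \<in> carrier (lamp_group M R) \<Longrightarrow> Q x (N x) (Bs x) (A x)"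
    by metis
  then have C: "\<And>x. x \<in> carrier (lamp_group M R) \<Longrightarrow> A x \<in> fmeasurable \<nu> \<and> x = lamp_cls (A x) \<and>
      length (Bs x) = N x \<and> set (Bs x) \<subseteq> \<A> \<and> measure \<nu> (A x - G (N x)) < \<epsilon>/4 \<and>
      (\<forall>n<N x. prob (sym_diff (sl (A x) n) (Bs x ! n)) < \<epsilon> / (4 * (real (N x) + 1)))"
    unfolding Q_def .
  define c where "c x = (N x, Bs x)" for x
  have "c ` carrier (lamp_group M R) \<subseteq> UNIV \<times> lists \<A>" using C by (force simp: c_def)
  then have "countable (c ` carrier (lamp_group M R))"
    by (rule countable_subset) (use assms(3) in auto)
  moreover have "lamp_dist M x y < \<epsilon>"
    if x: "x \<in> carrier (lamp_group M R)" and y: "y \<in> carrier (lamp_group M R)" and "c x = c y" for x y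
  proof -
    define n where "n = N x"
    define Cs where "Cs = Bs x"
    have eq: "N y = n" "N x = n" "Bs y = Cs" "Bs x = Cs" using that by (auto simp: c_def n_def Cs_def)
    note Cx = C[OF x, unfolded eq] and Cy = C[OF y, unfolded eq]
    note fm = Cx[THEN conjunct1] Cy[THEN conjunct1]
    have xy: "x = lamp_cls (A x)" "y = lamp_cls (A y)" using Cx Cy by blast+
    have len: "length Cs = n" "set Cs \<subseteq> \<A>" using Cx by blast+
    have tail: "measure \<nu> (A x - G n) < \<epsilon>/4" "measure \<nu> (A y - G n) < \<epsilon>/4" using Cx Cy by blast+
    have close: "prob (sym_diff (sl (A x) i) (Cs ! i)) < \<epsilon> / (4 * (real n + 1))"
      "prob (sym_diff (sl (A y) i) (Cs ! i)) < \<epsilon> / (4 * (real n + 1))" if "i < n" for i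
      using Cx Cy that by blast+
    have [measurable]: "A x \<in> sets \<nu>" "A y \<in> sets \<nu>" using fm by (auto dest: fmeasurableD)
    have Cs[measurable]: "Cs ! i \<in> sets M" if "i < n" for i
    proof -
      have "Cs ! i \<in> \<A>" using that len nth_mem[of i Cs] by auto
      then show ?thesis using assms(2) by auto
    qed
    define E where "E i = {p \<in> space M \<times> space M. fst p \<in> sym_diff (sl (A x) i) (sl (A y) i) \<and> snd p = W i (fst p)}" for i
    have slsd: "sym_diff (sl (A x) i) (sl (A y) i) \<in> sets M" for i using fm by (intro sets_sym_diff sl)
    have E: "emeasure \<nu> (E i) = emeasure M (sym_diff (sl (A x) i) (sl (A y) i))" for i
      unfolding E_def using slsd by (intro emeasure_\<nu>_graph) (auto simp: W_R)
    have Es [measurable]: "E i \<in> sets \<nu>" for i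
    proof -
      note [measurable] = slsd
      have "{p \<in> space (M \<Otimes>\<^sub>M M). fst p \<in> sym_diff (sl (A x) i) (sl (A y) i) \<and> snd p = W i (fst p)} \<in> sets (M \<Otimes>\<^sub>M M)"
        by measurable
      then show ?thesis by (simp add: E_def space_pair_measure)
    qed
    have Efm: "E i \<in> fmeasurable \<nu>" for i
      by (rule fmeasurableI[OF Es]) (simp add: E less_top[symmetric])
    have mE: "measure \<nu> (E i) \<le> 2 * (\<epsilon> / (4 * (real n + 1)))" if "i < n" for i
    proof -
      have "measure \<nu> (E i) = prob (sym_diff (sl (A x) i) (sl (A y) i))" by (simp add: measure_def E)
      also have "\<dots> \<le> prob (sym_diff (sl (A x) i) (Cs ! i)) + prob (sym_diff (Cs ! i) (sl (A y) i))"
        unfolding measure_def[symmetric] using sl[OF fm(1), of i] sl[OF fm(2), of i] Cs[OF that]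
        by (intro measure_sym_diff_triangle) (simp_all add: fmeasurable_eq_sets)
      also have "\<dots> \<le> 2 * (\<epsilon> / (4 * (real n + 1)))"
        using close[OF that] by (simp add: Un_commute)
      finally show ?thesis .
    qed
    define T where "T = (A x - G n) \<union> (A y - G n) \<union> (\<Union>i<n. E i)"
    have Tfm: "T \<in> fmeasurable \<nu>" unfolding T_def
      using fm Efm Gs by (intro fmeasurable.Un fmeasurable_Diff fmeasurable.finite_UN) blast+
    have "measure \<nu> (sym_diff (A x) (A y)) = measure \<nu> (sym_diff (A x) (A y) \<inter> R)"
      using \<nu>_Int_R[of "sym_diff (A x) (A y)"] fmeasurableD[OF fmeasurable_sym_diff[OF fm]]
      by (simp add: measure_def)
    also have "\<dots> \<le> measure \<nu> T"
    proof (rule measure_mono_fmeasurable[OF _ _ Tfm])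
      show "sym_diff (A x) (A y) \<inter> R \<in> sets \<nu>"
        using sets.Int[OF fmeasurableD[OF fmeasurable_sym_diff[OF fm]], of R] sets_R by simp
      show "sym_diff (A x) (A y) \<inter> R \<subseteq> T"
      proof
        fix p assume p: "p \<in> sym_diff (A x) (A y) \<inter> R"
        show "p \<in> T"
        proof (cases "p \<in> G n")
          case True
          \<comment> \<open>Slices refer to the first index of a point. It is at most j, hence below
            n, so \<open>p\<close> falls into one of the slices compared by the code.\<close>
          define i where "i = (LEAST i. snd p = W i (fst p))"
          obtain j where j: "j < n" "snd p = W j (fst p)" using True by (auto simp: G_def)
          then have i: "snd p = W i (fst p)" "i \<le> j" unfolding i_def by (auto intro: LeastI Least_le)
          have "W j (fst p) \<noteq> W i (fst p)" if "j < i" for j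
            using not_less_Least[OF that[unfolded i_def]] i(1) by auto
          moreover have "fst p \<in> space M" "snd p \<in> space M" using p R_space[of "fst p" "snd p"] by auto
          ultimately have "p \<in> E i" using p i(1) by (cases p) (auto simp: E_def sl_def)
          then show ?thesis using i(2) j(1) by (auto simp: T_def)
        qed (use p in \<open>auto simp: T_def\<close>)
      qed
    qed
    also have "\<dots> \<le> measure \<nu> (A x - G n) + measure \<nu> (A y - G n) + measure \<nu> (\<Union>i<n. E i)"
    proof -
      have ms: "A x - G n \<in> sets \<nu>" "A y - G n \<in> sets \<nu>" "(\<Union>i<n. E i) \<in> sets \<nu>" by measurable
      show ?thesis
        unfolding T_def
        using measure_Un_le[OF sets.Un[OF ms(1,2)] ms(3)] measure_Un_le[OF ms(1,2)] by linarith
    qed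
    also have "measure \<nu> (\<Union>i<n. E i) \<le> (\<Sum>i<n. measure \<nu> (E i))"
      by (intro measure_UNION_le finite_lessThan) (rule Es)
    also have "\<dots> \<le> (\<Sum>i<n. 2 * (\<epsilon> / (4 * (real n + 1))))" by (intro sum_mono mE) auto
    also have "\<dots> \<le> \<epsilon>/2" using \<open>\<epsilon> > 0\<close> by (simp add: field_simps)
    finally have "measure \<nu> (sym_diff (A x) (A y)) < \<epsilon>" using tail by simp
    then show ?thesis using lamp_dist_cls[OF fm] xy by metis
  qed
  ultimately show ?thesis by blast
qed

text \<open>The graph of an automorphism is a lamp of measure one, and the uniform distance is
  bounded by the lamp distance of the graphs; hence the code for lamps also serves for the full
  group.\<close>

lemma full_group_code:
  assumes "Sigma_Algebra.algebra (space M) \<A>" "sets M = sigma_sets (space M) \<A>" "countable \<A>" "\<epsilon> > 0"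
  shows "\<exists>c :: ('x \<Rightarrow> 'x) set \<Rightarrow> nat \<times> 'x set list. countable (c ` carrier (full_group M R)) \<and>
    (\<forall>x\<in>carrier (full_group M R). \<forall>y\<in>carrier (full_group M R). c x = c y \<longrightarrow> uniform_dist M x y < \<epsilon>)"
proof -
  obtain c :: "('x \<times> 'x) set set \<Rightarrow> nat \<times> 'x set list" where c: "countable (c ` carrier (lamp_group M R))"
    "\<And>x y. x \<in> carrier (lamp_group M R) \<Longrightarrow> y \<in> carrier (lamp_group M R) \<Longrightarrow> c x = c y \<Longrightarrow> lamp_dist M x y < \<epsilon>"
    using lamp_code[OF assms] by blast
  define \<Gamma> where "\<Gamma> g = {p \<in> space M \<times> space M. fst p \<in> space M \<and> snd p = g (fst p)}" for g :: "'x \<Rightarrow> 'x"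
  have \<Gamma>: "\<Gamma> g \<in> fmeasurable \<nu>" if "invertible_map g" for g
  proof -
    note [measurable] = that[THEN invertible_mapD(1)]
    have "{p \<in> space (M \<Otimes>\<^sub>M M). snd p = g (fst p)} \<in> sets (M \<Otimes>\<^sub>M M)" by measurable
    moreover have "{p \<in> space (M \<Otimes>\<^sub>M M). snd p = g (fst p)} = \<Gamma> g" by (auto simp: \<Gamma>_def space_pair_measure)
    moreover have "emeasure \<nu> (\<Gamma> g) = emeasure M (space M)"
      unfolding \<Gamma>_def using that by (intro emeasure_\<nu>_graph) (auto dest: invertible_mapD)
    ultimately show ?thesis by (auto simp: fmeasurable_def less_top[symmetric])
  qed
  have le: "uniform_dist M (cls g) (cls h) \<le> lamp_dist M (lamp_cls (\<Gamma> g)) (lamp_cls (\<Gamma> h))"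
    if g: "invertible_map g" and h: "invertible_map h" for g h
  proof -
    note [measurable] = g[THEN invertible_mapD(1)] h[THEN invertible_mapD(1)]
    let ?E = "{x \<in> space M. g x \<noteq> h x}"
    let ?F = "{p \<in> space M \<times> space M. fst p \<in> ?E \<and> snd p = g (fst p)}"
    have "prob ?E = measure \<nu> ?F"
      unfolding measure_def using g by (subst emeasure_\<nu>_graph) (auto dest: invertible_mapD)
    also have "\<dots> \<le> measure \<nu> (sym_diff (\<Gamma> g) (\<Gamma> h))"
    proof (rule measure_mono_fmeasurable)
      have "{p \<in> space (M \<Otimes>\<^sub>M M). fst p \<in> ?E \<and> snd p = g (fst p)} \<in> sets (M \<Otimes>\<^sub>M M)" by measurable
      then show "?F \<in> sets \<nu>" by (simp add: space_pair_measure)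
    qed (auto simp: \<Gamma>_def intro!: fmeasurable_sym_diff \<Gamma>[unfolded \<Gamma>_def] g h)
    finally show ?thesis using g h \<Gamma> by (simp add: uniform_dist_cls lamp_dist_cls)
  qed
  define f where "f \<phi> = lamp_cls (\<Gamma> (repr \<phi>))" for \<phi>
  have f: "f \<phi> \<in> carrier (lamp_group M R)" if "\<phi> \<in> carrier (full_group M R)" for \<phi>
    using that \<Gamma> repr_cls by (auto elim!: carrierE simp: f_def carrier_lamp_group)
  have "uniform_dist M \<phi> \<psi> \<le> lamp_dist M (f \<phi>) (f \<psi>)"
    if "\<phi> \<in> carrier (full_group M R)" "\<psi> \<in> carrier (full_group M R)" for \<phi> \<psi>
  proof -
    have *: "cls (repr \<phi>) = \<phi> \<and> invertible_map (repr \<phi>)" if "\<phi> \<in> carrier (full_group M R)" for \<phi>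
      using that by (auto elim!: carrierE simp: repr_cls intro!: cls_eqI)
    then show ?thesis using le[of "repr \<phi>" "repr \<psi>"] that by (simp add: f_def)
  qed
  note le' = this
  show ?thesis
  proof (intro exI[of _ "c \<circ> f"] conjI ballI impI)
    show "countable ((c \<circ> f) ` carrier (full_group M R))"
      by (rule countable_subset[OF _ c(1)]) (use f in auto)
    fix x y assume "x \<in> carrier (full_group M R)" "y \<in> carrier (full_group M R)" "(c \<circ> f) x = (c \<circ> f) y"
    then show "uniform_dist M x y < \<epsilon>" by (intro le_less_trans[OF le' c(2)] f) auto
  qed
qed

lemma Polish_lamplighter:
  assumes "Sigma_Algebra.algebra (space M) \<A>" "sets M = sigma_sets (space M) \<A>" "countable \<A>"
  shows "Polish_topology (lamplighter_topology M R)"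
proof -
  have "separable_space (lamp_topology M R)" unfolding lamp_topology_def
    by (rule separable_spaceI_countable_code[OF Metric_space_lamp_group lamp_code[OF assms]])
  moreover have "separable_space (uniform_topology M R)" unfolding uniform_topology_def
    by (rule separable_spaceI_countable_code[OF Metric_space_full_group full_group_code[OF assms]])
  moreover have "completely_metrizable_space (lamp_topology M R)" unfolding lamp_topology_def
    by (intro Metric_space.completely_metrizable_space_mtopology Metric_space_lamp_group mcomplete_lamp_group)
  moreover have "completely_metrizable_space (uniform_topology M R)" unfolding two_sided_topology[symmetric]
    by (intro Metric_space.completely_metrizable_space_mtopology Metric_space_two_sided mcomplete_two_sided)
  ultimately show ?thesis
    unfolding Polish_topology_def lamplighter_topology_def
    by (simp add: completely_metrizable_space_prod_topology separable_space_prod_topology)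
qed

end

section \<open>Contractibility\<close>

lemma pred_countable_pair:
  fixes f g :: "'a \<Rightarrow> nat"
  assumes "f \<in> measurable N (count_space UNIV)" "g \<in> measurable N (count_space UNIV)"
  shows "Measurable.pred N (\<lambda>x. P (f x) (g x))"
proof (rule measurable_compose_countable[OF _ assms(1)])
  fix i show "Measurable.pred N (\<lambda>x. P i (g x))"
    by (rule measurable_compose[OF assms(2)]) simp
qed

text \<open>The map \<open>T\<close> embeds the space into itself inside the relation.  The height
  \<open>l x + f x\<close> is increased by one under \<open>T\<close>, and the range of \<open>T\<close> is the set of points of height
  at least one.\<close>

locale shift_relation = nonsingular_relation M W R
  for M :: "'x measure" and W R +
  fixes T S :: "'x \<Rightarrow> 'x" and l :: "'x \<Rightarrow> nat" and f :: "'x \<Rightarrow> real" and Y :: "'x set"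
  assumes T_measurable [measurable]: "T \<in> M \<rightarrow>\<^sub>M M" and S_measurable [measurable]: "S \<in> M \<rightarrow>\<^sub>M M"
    and l_measurable [measurable]: "l \<in> measurable M (count_space UNIV)"
    and f_measurable [measurable]: "f \<in> borel_measurable M"
    and Y_sets [measurable]: "Y \<in> sets M" and AE_Y: "AE x in M. x \<in> Y"
    and T_R: "x \<in> space M \<Longrightarrow> (x, T x) \<in> R" and S_R: "x \<in> space M \<Longrightarrow> (x, S x) \<in> R"
    and S_T: "x \<in> space M \<Longrightarrow> S (T x) = x"
    and T_Y: "x \<in> Y \<Longrightarrow> T x \<in> Y \<and> l (T x) = Suc (l x) \<and> f (T x) = f x"
    and S_Y: "x \<in> Y \<Longrightarrow> l x > 0 \<Longrightarrow> S x \<in> Y \<and> T (S x) = x"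
    and f_range: "0 \<le> f x" "f x < 1"
    and f_atomless: "prob {x \<in> space M. f x = t} = 0"
begin

text \<open>The least natural number n with t \<le> f x + n. It depends on f x only, which
  \<open>T\<close> preserves, so it can be recomputed at the raised point. The condition
  \<open>steps t y \<le> l y\<close> says that the height l y + f y is at least t.\<close>

definition steps :: "real \<Rightarrow> 'x \<Rightarrow> nat" where
  "steps t x = nat \<lceil>t - f x\<rceil>"

definition raise :: "real \<Rightarrow> 'x \<Rightarrow> 'x" where
  "raise t x = (T ^^ steps t x) x"

definition lower :: "real \<Rightarrow> 'x \<Rightarrow> 'x" where
  "lower t x = (S ^^ steps t x) x"

text \<open>\<open>raise t\<close> maps \<open>Y\<close> bijectively onto the points of
  \<open>Y\<close> of height at least t. The element g is transported along this bijection and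
  extended by the identity.\<close>

definition conjugate :: "real \<Rightarrow> ('x \<Rightarrow> 'x) \<Rightarrow> 'x \<Rightarrow> 'x" where
  "conjugate t g y = (if y \<in> Y \<and> steps t y \<le> l y then raise t (g (lower t y)) else y)"

lemma Y_space: "x \<in> Y \<Longrightarrow> x \<in> space M"
  using Y_sets sets.sets_into_space by blast

lemma steps_measurable [measurable]: "steps t \<in> measurable M (count_space UNIV)"
  unfolding steps_def by measurable

lemma funpow_measurable [measurable (raw)]:
  "g \<in> M \<rightarrow>\<^sub>M M \<Longrightarrow> g ^^ n \<in> M \<rightarrow>\<^sub>M M"
  by (induction n) (auto intro: measurable_comp simp: id_def)

lemma raise_measurable [measurable]: "raise t \<in> M \<rightarrow>\<^sub>M M"
  unfolding raise_def by (rule measurable_compose_countable) auto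

lemma lower_measurable [measurable]: "lower t \<in> M \<rightarrow>\<^sub>M M"
  unfolding lower_def by (rule measurable_compose_countable) auto

lemma conjugate_measurable [measurable (raw)]:
  assumes [measurable]: "g \<in> M \<rightarrow>\<^sub>M M"
  shows "conjugate t g \<in> M \<rightarrow>\<^sub>M M"
proof -
  note [measurable] = pred_countable_pair[OF steps_measurable l_measurable, of "(\<le>)"]
  show ?thesis unfolding conjugate_def by measurable
qed

lemma funpow_R:
  assumes "\<And>x. x \<in> space M \<Longrightarrow> (x, g x) \<in> R" and x: "x \<in> space M"
  shows "(x, (g ^^ n) x) \<in> R"
proof (induction n)
  case (Suc n)
  then show ?case using assms(1)[OF R_space(2)[OF Suc]] R_trans by auto
qed (simp add: R_refl x)

lemma raise_R: "x \<in> space M \<Longrightarrow> (x, raise t x) \<in> R"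
  unfolding raise_def by (rule funpow_R[OF T_R])

lemma lower_R: "x \<in> space M \<Longrightarrow> (x, lower t x) \<in> R"
  unfolding lower_def by (rule funpow_R[OF S_R])

lemma T_funpow: "x \<in> Y \<Longrightarrow> (T ^^ n) x \<in> Y \<and> l ((T ^^ n) x) = l x + n \<and> f ((T ^^ n) x) = f x"
  by (induction n) (auto simp: T_Y)

lemma S_T_funpow: "x \<in> space M \<Longrightarrow> (S ^^ n) ((T ^^ n) x) = x"
proof (induction n arbitrary: x)
  case (Suc n)
  have "(T ^^ n) x \<in> space M" using funpow_R[OF T_R Suc.prems] R_space by blast
  then have "(S ^^ Suc n) ((T ^^ Suc n) x) = (S ^^ n) ((T ^^ n) x)"
    by (subst funpow_Suc_right) (simp add: S_T)
  then show ?case using Suc by simp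
qed simp

lemma S_funpow: "x \<in> Y \<Longrightarrow> n \<le> l x \<Longrightarrow> (S ^^ n) x \<in> Y \<and> (T ^^ n) ((S ^^ n) x) = x \<and> l x = l ((S ^^ n) x) + n \<and> f ((S ^^ n) x) = f x"
proof (induction n)
  case (Suc n)
  let ?y = "(S ^^ n) x"
  have y: "?y \<in> Y" "(T ^^ n) ?y = x" "l x = l ?y + n" "f ?y = f x" using Suc by auto
  then have "l ?y > 0" using Suc.prems by simp
  with S_Y[OF y(1)] have s: "S ?y \<in> Y" "T (S ?y) = ?y" by auto
  then have "(T ^^ Suc n) (S ?y) = x" by (subst funpow_Suc_right) (simp add: y)
  then show ?case using s T_Y[OF s(1)] y by simp
qed simp

lemma raise_Y:
  assumes "x \<in> Y"
  shows "raise t x \<in> Y" "steps t (raise t x) \<le> l (raise t x)" "lower t (raise t x) = x"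
proof -
  have "steps t (raise t x) = steps t x" using T_funpow[OF assms] by (simp add: steps_def raise_def)
  then show "raise t x \<in> Y" "steps t (raise t x) \<le> l (raise t x)" "lower t (raise t x) = x"
    using T_funpow[OF assms, of "steps t x"] S_T_funpow[OF Y_space[OF assms]]
    by (auto simp: raise_def lower_def)
qed

lemma lower_Y:
  assumes "y \<in> Y" "steps t y \<le> l y"
  shows "lower t y \<in> Y" "raise t (lower t y) = y"
proof -
  have "steps t (lower t y) = steps t y" using S_funpow[OF assms] by (simp add: steps_def lower_def)
  then show "lower t y \<in> Y" "raise t (lower t y) = y"
    using S_funpow[OF assms] by (auto simp: raise_def lower_def)
qed

lemma conjugate_conjugate:
  assumes y: "y \<in> space M" and good: "\<And>z. (y, z) \<in> R \<Longrightarrow> z \<in> Y \<and> (z, g z) \<in> R \<and> k (g z) = z"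
  shows "(y, conjugate t g y) \<in> R" "conjugate t k (conjugate t g y) = y"
proof -
  have "(y, conjugate t g y) \<in> R \<and> conjugate t k (conjugate t g y) = y"
  proof (cases "y \<in> Y \<and> steps t y \<le> l y")
    case True
    define z where "z = lower t y"
    have z: "(y, z) \<in> R" unfolding z_def by (rule lower_R[OF y])
    then have w: "(y, g z) \<in> R" using good R_trans by blast
    then have r: "(y, raise t (g z)) \<in> R" using raise_R R_trans R_space by blast
    have "conjugate t g y = raise t (g z)" using True by (simp add: conjugate_def z_def)
    moreover have "conjugate t k (raise t (g z)) = raise t (k (g z))"
      using raise_Y[of "g z" t] good[OF w] by (simp add: conjugate_def)
    moreover have "raise t (k (g z)) = y" using good[OF z] lower_Y(2) True by (simp add: z_def)
    ultimately show ?thesis using r by simp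
  qed (auto simp: conjugate_def R_refl y)
  then show "(y, conjugate t g y) \<in> R" "conjugate t k (conjugate t g y) = y" by auto
qed

lemma inverse_pair_conjugate:
  assumes "inverse_pair g k"
  shows "inverse_pair (conjugate t g) (conjugate t k)"
proof -
  have [measurable]: "g \<in> M \<rightarrow>\<^sub>M M" "k \<in> M \<rightarrow>\<^sub>M M" using assms by (auto simp: inverse_pair_def)
  have "AE y in M. (y, conjugate t g y) \<in> R \<and> (y, conjugate t k y) \<in> R \<and>
      conjugate t k (conjugate t g y) = y \<and> conjugate t g (conjugate t k y) = y"
    using inverse_pair_good[OF assms] AE_R[OF AE_Y] AE_space
    by eventually_elim (blast intro: conjugate_conjugate)
  then show ?thesis by (auto simp: inverse_pair_def)
qed

lemma invertible_map_conjugate: "invertible_map g \<Longrightarrow> invertible_map (conjugate t g)"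
  using inverse_pair_conjugate unfolding invertible_map_def by blast

lemma steps_mono: "s \<le> t \<Longrightarrow> steps s x \<le> steps t x"
  unfolding steps_def by (intro nat_mono ceiling_mono) simp

lemma AE_f_neq: "AE x in M. f x \<noteq> t"
  using f_atomless[of t] by (subst AE_iff_measurable[OF _ refl]) (auto simp: emeasure_eq_measure)

text \<open>As t varies, the number of steps at x can change only where t - f x is an integer. For
  fixed t this is a null condition, since each level set of f is null.\<close>

lemma steps_continuous:
  assumes "\<epsilon> > 0"
  shows "\<exists>\<delta>>0. \<forall>s. \<bar>s - t\<bar> < \<delta> \<longrightarrow> prob {x \<in> space M. steps s x \<noteq> steps t x} < \<epsilon>"
proof -
  define e where "e m = inverse (real (Suc m))" for m
  define F where "F m = {x \<in> space M. steps (t - e m) x \<noteq> steps (t + e m) x}" for m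
  have [measurable]: "F m \<in> sets M" for m
    using pred_countable_pair[OF steps_measurable steps_measurable, of "(\<noteq>)"] by (simp add: F_def pred_def)
  have "AE x in M. \<forall>j::int. f x \<noteq> t - j"
    unfolding AE_all_countable by (intro allI AE_f_neq)
  then have "AE x in M. eventually (\<lambda>m. x \<notin> F m) sequentially"
  proof eventually_elim
    case (elim x)
    define u where "u = t - f x"
    have "u \<noteq> of_int \<lfloor>u\<rfloor>"
    proof
      assume "u = of_int \<lfloor>u\<rfloor>"
      then have "f x = t - of_int \<lfloor>u\<rfloor>" by (simp add: u_def)
      with elim show False by blast
    qed
    then have fl: "of_int \<lfloor>u\<rfloor> < u" "u < of_int \<lfloor>u\<rfloor> + 1" using of_int_floor_le[of u] by linarith+
    \<comment> \<open>The distance from u to the nearest integer; perturbations of t by less than d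
      leave the ceiling at \<open>\<lfloor>u\<rfloor> + 1\<close>.\<close>
    define d where "d = min (u - of_int \<lfloor>u\<rfloor>) (of_int \<lfloor>u\<rfloor> + 1 - u)"
    have "d > 0" using fl by (simp add: d_def)
    have "e \<longlonglongrightarrow> 0" unfolding e_def by (rule LIMSEQ_inverse_real_of_nat)
    then have "eventually (\<lambda>m. e m < d) sequentially" using \<open>d > 0\<close> by (rule order_tendstoD)
    then show ?case
    proof eventually_elim
      case (elim m)
      have "e m > 0" by (simp add: e_def)
      have "\<lceil>u - e m\<rceil> = \<lfloor>u\<rfloor> + 1" "\<lceil>u + e m\<rceil> = \<lfloor>u\<rfloor> + 1"
        using elim fl \<open>e m > 0\<close> unfolding d_def by (auto simp: ceiling_eq_iff)
      then have "steps (t - e m) x = steps (t + e m) x"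
        by (simp add: steps_def u_def algebra_simps)
      then show ?case by (simp add: F_def)
    qed
  qed
  then have "(\<lambda>m. prob (F m)) \<longlonglongrightarrow> 0" by (intro measure_tendsto_zeroI) auto
  from order_tendstoD(2)[OF this \<open>\<epsilon> > 0\<close>] obtain m where m: "prob (F m) < \<epsilon>"
    by (auto simp: eventually_sequentially)
  show ?thesis
  proof (intro exI[of _ "e m"] conjI allI impI)
    fix s assume s: "\<bar>s - t\<bar> < e m"
    have "{x \<in> space M. steps s x \<noteq> steps t x} \<subseteq> F m"
    proof
      fix x assume x: "x \<in> {x \<in> space M. steps s x \<noteq> steps t x}"
      have "steps (t - e m) x \<le> steps s x" "steps s x \<le> steps (t + e m) x"
        "steps (t - e m) x \<le> steps t x" "steps t x \<le> steps (t + e m) x"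
        using s by (auto intro!: steps_mono)
      with x show "x \<in> F m" by (auto simp: F_def)
    qed
    then show "prob {x \<in> space M. steps s x \<noteq> steps t x} < \<epsilon>"
      by (intro le_less_trans[OF finite_measure_mono m]) auto
  qed (simp add: e_def)
qed

text \<open>The substitution s / (1 - s) stretches the interval from 0 to 1 onto all nonnegative
  heights, with the trivial element at infinity.\<close>

definition contract_full :: "real \<Rightarrow> ('x \<Rightarrow> 'x) set \<Rightarrow> ('x \<Rightarrow> 'x) set" where
  "contract_full s \<phi> = (if s < 1 then cls (conjugate (s / (1 - s)) (repr \<phi>)) else cls id)"

lemma contract_full_cls:
  assumes "invertible_map g" "s < 1"
  shows "contract_full s (cls g) = cls (conjugate (s / (1 - s)) g)"
proof -
  have "AE x in M. \<forall>y. (x, y) \<in> R \<longrightarrow> repr (cls g) y = g y" by (rule AE_R[OF repr_cls(2)[OF assms(1)]])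
  then have "AE x in M. conjugate (s / (1 - s)) (repr (cls g)) x = conjugate (s / (1 - s)) g x"
    using AE_space by eventually_elim (simp add: conjugate_def lower_R)
  then show ?thesis using assms by (simp add: contract_full_def cls_eqI)
qed

lemma contractible_uniform_topology: "contractible_space (uniform_topology M R)"
  unfolding uniform_topology_def
proof (rule contractible_space_metricI[OF Metric_space_full_group, of contract_full "cls id"])
  fix t \<phi> assume "\<phi> \<in> carrier (full_group M R)"
  then obtain g where g: "\<phi> = cls g" "invertible_map g" by (auto elim: carrierE)
  show "contract_full t \<phi> \<in> carrier (full_group M R)"
  proof (cases "t < 1")
    case True
    then show ?thesis using g by (simp add: contract_full_cls invertible_map_conjugate cls_in_carrier)
  qed (simp add: contract_full_def cls_in_carrier invertible_map_id)
next
  fix \<phi> assume "\<phi> \<in> carrier (full_group M R)"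
  then obtain g where g: "\<phi> = cls g" "invertible_map g" by (auto elim: carrierE)
  have "steps 0 x = 0" for x using f_range[of x] by (simp add: steps_def)
  then have "AE x in M. conjugate 0 g x = g x"
    using AE_Y by (auto simp: conjugate_def raise_def lower_def elim: AE_mp)
  then show "contract_full 0 \<phi> = \<phi>" using g by (simp add: contract_full_cls cls_eqI)
next
  fix \<phi> show "contract_full 1 \<phi> = cls id" by (simp add: contract_full_def)
next
  fix s \<epsilon> :: real and \<phi>
  assume s: "s \<in> {0..1}" and "\<phi> \<in> carrier (full_group M R)" and \<epsilon>: "\<epsilon> > 0"
  then obtain g where g: "\<phi> = cls g" "invertible_map g" by (auto elim: carrierE)
  note [measurable] = g(2)[THEN invertible_mapD(1)]
  show "\<exists>\<delta>>0. \<forall>s'\<in>{0..1}. \<forall>\<psi>\<in>carrier (full_group M R). \<bar>s' - s\<bar> < \<delta> \<longrightarrow> uniform_dist M \<phi> \<psi> < \<delta> \<longrightarrow>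
      uniform_dist M (contract_full s \<phi>) (contract_full s' \<psi>) < \<epsilon>"
  proof (cases "s < 1")
    case True
    define t where "t = s / (1 - s)"
    \<comment> \<open>The tolerances are chosen backwards: a small set is pulled back first through
      g and then through \<open>lower t\<close>, both belonging to the fixed pair of parameter and
      element.\<close>
    from small_vimage[OF lower_measurable AE_I2[OF lower_R], of "\<epsilon>/2" t] \<epsilon> obtain \<delta>1 where
      \<delta>1: "\<delta>1 > 0" "\<And>E. E \<in> sets M \<Longrightarrow> prob E < \<delta>1 \<Longrightarrow> prob (lower t -` E \<inter> space M) < \<epsilon>/2" by auto
    from small_vimage[OF invertible_mapD[OF g(2)], of "\<delta>1/2"] \<delta>1 obtain \<delta>2 where
      \<delta>2: "\<delta>2 > 0" "\<And>E. E \<in> sets M \<Longrightarrow> prob E < \<delta>2 \<Longrightarrow> prob (g -` E \<inter> space M) < \<delta>1/2" by auto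
    from steps_continuous[of "min \<delta>2 (\<epsilon>/2)" t] \<delta>2 \<epsilon> obtain \<delta>3 where
      \<delta>3: "\<delta>3 > 0" "\<And>s. \<bar>s - t\<bar> < \<delta>3 \<Longrightarrow> prob {x \<in> space M. steps s x \<noteq> steps t x} < min \<delta>2 (\<epsilon>/2)" by auto
    have "isCont (\<lambda>s::real. s / (1 - s)) s" using True by (intro continuous_intros) auto
    then obtain \<delta>4 where \<delta>4: "\<delta>4 > 0" "\<And>s'. \<bar>s' - s\<bar> < \<delta>4 \<Longrightarrow> \<bar>s' / (1 - s') - t\<bar> < \<delta>3"
      unfolding continuous_at_eps_delta using \<delta>3(1) by (auto simp: dist_real_def t_def)
    show ?thesis
    proof (intro exI[of _ "min (min \<delta>4 (1 - s)) (\<delta>1/2)"] conjI ballI impI)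
      fix s' \<psi> assume s': "\<bar>s' - s\<bar> < min (min \<delta>4 (1 - s)) (\<delta>1/2)"
        and \<psi>: "\<psi> \<in> carrier (full_group M R)" and d: "uniform_dist M \<phi> \<psi> < min (min \<delta>4 (1 - s)) (\<delta>1/2)"
      obtain g' where g': "\<psi> = cls g'" "invertible_map g'" using \<psi> by (auto elim: carrierE)
      note [measurable] = g'(2)[THEN invertible_mapD(1)]
      define t' where "t' = s' / (1 - s')"
      have "s' < 1" using s' by auto
      define E where "E = {x \<in> space M. steps t' x \<noteq> steps t x}"
      \<comment> \<open>With z = \<open>lower t y\<close>, the two conjugates agree at y unless the
        step counts differ at y, the maps g and g' differ at z, or the step counts differ at g z.
        The last two cases are collected in \<open>D\<close>.\<close>
      define D where "D = {x \<in> space M. g x \<noteq> g' x} \<union> (g -` E \<inter> space M)"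
      have [measurable]: "E \<in> sets M"
        using pred_countable_pair[OF steps_measurable steps_measurable, of "(\<noteq>)"] by (simp add: E_def pred_def)
      have [measurable]: "D \<in> sets M" unfolding D_def by measurable
      have E: "prob E < min \<delta>2 (\<epsilon>/2)" unfolding E_def t'_def using s' by (intro \<delta>3 \<delta>4) auto
      have "prob D \<le> prob {x \<in> space M. g x \<noteq> g' x} + prob (g -` E \<inter> space M)"
        unfolding D_def by (rule measure_Un_le) auto
      also have "\<dots> < \<delta>1/2 + \<delta>1/2"
        using d g g' E by (intro add_strict_mono \<delta>2(2)) (auto simp: uniform_dist_cls)
      finally have D: "prob (lower t -` D \<inter> space M) < \<epsilon>/2" by (intro \<delta>1(2)) auto
      have sub: "{x \<in> space M. conjugate t g x \<noteq> conjugate t' g' x} \<subseteq> E \<union> (lower t -` D \<inter> space M)"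
      proof
        fix y assume y': "y \<in> {x \<in> space M. conjugate t g x \<noteq> conjugate t' g' x}"
        show "y \<in> E \<union> (lower t -` D \<inter> space M)"
        proof (rule ccontr)
          assume "y \<notin> E \<union> (lower t -` D \<inter> space M)"
          with y' have y: "y \<in> space M" "conjugate t g y \<noteq> conjugate t' g' y" "lower t y \<notin> D"
            and "y \<notin> E" by auto
          then have st: "steps t' y = steps t y" using y by (simp add: E_def)
          then have low: "lower t' y = lower t y" by (simp add: lower_def)
          let ?z = "lower t y"
          have z: "?z \<in> space M" using lower_R[OF y(1)] R_space by blast
          then have gz: "g ?z = g' ?z" "g ?z \<notin> E" using y(3) by (auto simp: D_def)
          have "g ?z \<in> space M" using measurable_space[OF invertible_mapD(1)[OF g(2)] z] .
          then have "steps t' (g ?z) = steps t (g ?z)" using gz by (simp add: E_def)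
          then have "raise t' (g ?z) = raise t (g ?z)" by (simp add: raise_def)
          then show False using y(2) st low gz(1) by (simp add: conjugate_def split: if_splits)
        qed
      qed
      have "prob {x \<in> space M. conjugate t g x \<noteq> conjugate t' g' x} \<le> prob (E \<union> (lower t -` D \<inter> space M))"
        by (intro finite_measure_mono[OF sub]) measurable
      also have "\<dots> \<le> prob E + prob (lower t -` D \<inter> space M)" by (rule measure_Un_le) auto
      also have "\<dots> < \<epsilon>" using E D by simp
      finally show "uniform_dist M (contract_full s \<phi>) (contract_full s' \<psi>) < \<epsilon>"
        using g g' \<open>s' < 1\<close> True
        by (simp add: contract_full_cls uniform_dist_cls invertible_map_conjugate t_def t'_def)
    qed (use \<delta>4 \<delta>1 True in auto)
  next
    case False
    with s have "s = 1" by simp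
    \<comment> \<open>The points of height at least m. A conjugate at parameter m or larger is the
      identity off this set, whatever the element is; this gives continuity at s = 1 uniformly in
      \<psi>.\<close>
    define D where "D m = {y \<in> space M. steps (real m) y \<le> l y}" for m
    have Dm [measurable]: "D m \<in> sets M" for m
      using pred_countable_pair[OF steps_measurable l_measurable, of "(\<le>)"] by (simp add: D_def pred_def)
    have "eventually (\<lambda>m. x \<notin> D m) sequentially" for x
      unfolding eventually_sequentially
    proof (intro exI[of _ "l x + 2"] allI impI)
      fix m assume "m \<ge> l x + 2"
      then have "l x < steps (real m) x" unfolding steps_def using f_range[of x] by linarith
      then show "x \<notin> D m" by (simp add: D_def)
    qed
    then have "(\<lambda>m. prob (D m)) \<longlonglongrightarrow> 0" by (intro measure_tendsto_zeroI) auto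
    from order_tendstoD(2)[OF this \<epsilon>] obtain m where m: "prob (D m) < \<epsilon>"
      by (auto simp: eventually_sequentially)
    show ?thesis
    \<comment> \<open>If 1 - s' < 1 / (m + 1), then s' / (1 - s') is at least m.\<close>
    proof (intro exI[of _ "1 / (real m + 1)"] conjI ballI impI)
      fix s' \<psi> assume s': "s' \<in> {0..1}" "\<bar>s' - s\<bar> < 1 / (real m + 1)"
        and \<psi>: "\<psi> \<in> carrier (full_group M R)"
      obtain g' where g': "\<psi> = cls g'" "invertible_map g'" using \<psi> by (auto elim: carrierE)
      note [measurable] = g'(2)[THEN invertible_mapD(1)]
      show "uniform_dist M (contract_full s \<phi>) (contract_full s' \<psi>) < \<epsilon>"
      proof (cases "s' < 1")
        case True
        have "1 - s' < 1 / (real m + 1)" using s' \<open>s = 1\<close> by auto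
        then have "real m \<le> s' / (1 - s')" using True by (simp add: field_simps)
        then have "{x \<in> space M. x \<noteq> conjugate (s' / (1 - s')) g' x} \<subseteq> D m"
          using steps_mono[of "real m" "s' / (1 - s')"]
          by (auto simp: D_def conjugate_def split: if_splits intro: order_trans)
        then have "prob {x \<in> space M. x \<noteq> conjugate (s' / (1 - s')) g' x} \<le> prob (D m)"
          using Dm by (rule finite_measure_mono)
        then show ?thesis using m True \<open>s = 1\<close> g'
          by (simp add: contract_full_cls contract_full_def[of 1] uniform_dist_cls invertible_map_id invertible_map_conjugate)
      next
        case False
        then have "s' = 1" using s' by simp
        then show ?thesis using \<open>s = 1\<close> \<epsilon> by (simp add: contract_full_def uniform_dist_cls invertible_map_id)
      qed
    qed simp
  qed
qed

text \<open>Lamps are switched off above the base points with f x < t. Nothing is removed at t = 0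
  and everything at t = 1, by the range of f; null level sets of f give continuity in
  between.\<close>

definition contract_lamp :: "real \<Rightarrow> ('x \<times> 'x) set set \<Rightarrow> ('x \<times> 'x) set set" where
  "contract_lamp t c = lamp_cls (repr c \<inter> fst -` {x \<in> space M. t \<le> f x})"

lemma fmeasurable_Int_fst:
  assumes "A \<in> fmeasurable \<nu>" and [measurable]: "E \<in> sets M"
  shows "A \<inter> fst -` E \<in> fmeasurable \<nu>"
proof -
  have A: "A \<in> sets (M \<Otimes>\<^sub>M M)" using assms(1) by (auto dest: fmeasurableD)
  have "fst -` E \<inter> space (M \<Otimes>\<^sub>M M) \<in> sets \<nu>" by simp
  moreover have "A \<inter> fst -` E = A \<inter> (fst -` E \<inter> space (M \<Otimes>\<^sub>M M))"
    using sets.sets_into_space[OF A] by auto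
  ultimately show ?thesis using fmeasurable_Int_fmeasurable[OF assms(1)] by metis
qed

lemma contract_lamp_cls:
  assumes "A \<in> fmeasurable \<nu>"
  shows "contract_lamp t (lamp_cls A) = lamp_cls (A \<inter> fst -` {x \<in> space M. t \<le> f x})"
proof -
  have fm: "A' \<inter> fst -` {x \<in> space M. t \<le> f x} \<in> fmeasurable \<nu>" if "A' \<in> fmeasurable \<nu>" for A'
    by (rule fmeasurable_Int_fst[OF that]) measurable
  note r = repr_lamp_cls[OF assms]
  show ?thesis unfolding contract_lamp_def lamp_cls_eq_iff[OF fm[OF r(3)] fm[OF assms]]
      emeasure_sym_diff_zero_iff[OF fmeasurableD[OF fm[OF r(3)]] fmeasurableD[OF fm[OF assms]]]
    using r(4) by eventually_elim auto
qed

lemma contractible_lamp_topology: "contractible_space (lamp_topology M R)"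
  unfolding lamp_topology_def
proof (rule contractible_space_metricI[OF Metric_space_lamp_group, of contract_lamp "lamp_cls {}"])
  have fm: "A \<inter> fst -` {x \<in> space M. t \<le> f x} \<in> fmeasurable \<nu>" if "A \<in> fmeasurable \<nu>" for A t
    by (rule fmeasurable_Int_fst[OF that]) measurable
  {
    fix t c assume "c \<in> carrier (lamp_group M R)"
    then show "contract_lamp t c \<in> carrier (lamp_group M R)"
      by (auto simp: carrier_lamp_group contract_lamp_cls simp del: vimage_Collect_eq intro!: imageI fm)
  next
    fix c assume "c \<in> carrier (lamp_group M R)"
    then obtain A where A: "c = lamp_cls A" "A \<in> fmeasurable \<nu>" by (auto simp: carrier_lamp_group)
    have "A \<subseteq> space (M \<Otimes>\<^sub>M M)" using A(2) by (intro sets.sets_into_space) (auto dest: fmeasurableD)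
    then have "A \<inter> fst -` {x \<in> space M. 0 \<le> f x} = A" using f_range by (auto simp: space_pair_measure)
    then show "contract_lamp 0 c = c" using A by (simp add: contract_lamp_cls)
  next
    fix c assume "c \<in> carrier (lamp_group M R)"
    then obtain A where A: "c = lamp_cls A" "A \<in> fmeasurable \<nu>" by (auto simp: carrier_lamp_group)
    have "A \<inter> fst -` {x \<in> space M. 1 \<le> f x} = {}" using f_range(2) linorder_not_le by fastforce
    then show "contract_lamp 1 c = lamp_cls {}" using contract_lamp_cls[OF A(2), of 1] A(1) by simp
  next
    fix t c and \<epsilon> :: real assume "c \<in> carrier (lamp_group M R)" and \<epsilon>: "\<epsilon> > 0"
    then obtain A where A: "c = lamp_cls A" "A \<in> fmeasurable \<nu>" by (auto simp: carrier_lamp_group)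
    from \<nu>_small_fst[OF A(2), of "\<epsilon>/2"] \<epsilon> obtain \<delta>1 where
      \<delta>1: "\<delta>1 > 0" "\<And>E. E \<in> sets M \<Longrightarrow> prob E < \<delta>1 \<Longrightarrow> measure \<nu> (A \<inter> fst -` E) < \<epsilon>/2" by auto
    define F where "F m = {x \<in> space M. \<bar>f x - t\<bar> < inverse (real (Suc m))}" for m
    have [measurable]: "F m \<in> sets M" for m unfolding F_def by measurable
    have "AE x in M. eventually (\<lambda>m. x \<notin> F m) sequentially"
      using AE_f_neq[of t]
    proof eventually_elim
      case (elim x)
      then have "eventually (\<lambda>m. inverse (real (Suc m)) < \<bar>f x - t\<bar>) sequentially"
        by (intro order_tendstoD(2)[OF LIMSEQ_inverse_real_of_nat]) auto
      then show ?case by eventually_elim (simp add: F_def)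
    qed
    then have "(\<lambda>m. prob (F m)) \<longlonglongrightarrow> 0" by (intro measure_tendsto_zeroI) auto
    from order_tendstoD(2)[OF this \<delta>1(1)] obtain m where m: "prob (F m) < \<delta>1"
      by (auto simp: eventually_sequentially)
    show "\<exists>\<delta>>0. \<forall>s\<in>{0..1}. \<forall>d\<in>carrier (lamp_group M R). \<bar>s - t\<bar> < \<delta> \<longrightarrow> lamp_dist M c d < \<delta> \<longrightarrow>
        lamp_dist M (contract_lamp t c) (contract_lamp s d) < \<epsilon>"
    proof (intro exI[of _ "min (inverse (real (Suc m))) (\<epsilon>/2)"] conjI ballI impI)
      fix s d assume s: "\<bar>s - t\<bar> < min (inverse (real (Suc m))) (\<epsilon>/2)"
        and d: "d \<in> carrier (lamp_group M R)" "lamp_dist M c d < min (inverse (real (Suc m))) (\<epsilon>/2)"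
      obtain B where B: "d = lamp_cls B" "B \<in> fmeasurable \<nu>" using d(1) by (auto simp: carrier_lamp_group)
      let ?L = "\<lambda>A t. A \<inter> fst -` {x \<in> space M. t \<le> f x}"
      have "measure \<nu> (sym_diff (?L A t) (?L A s)) \<le> measure \<nu> (A \<inter> fst -` F m)"
      proof (rule measure_mono_fmeasurable)
        show "sym_diff (?L A t) (?L A s) \<subseteq> A \<inter> fst -` F m" using s by (auto simp: F_def)
        show "sym_diff (?L A t) (?L A s) \<in> sets \<nu>" by (intro sets_sym_diff fmeasurableD fm A)
        show "A \<inter> fst -` F m \<in> fmeasurable \<nu>" by (rule fmeasurable_Int_fst[OF A(2)]) measurable
      qed
      also have "\<dots> < \<epsilon>/2" by (intro \<delta>1(2) m) measurable
      finally have 1: "measure \<nu> (sym_diff (?L A t) (?L A s)) < \<epsilon>/2" .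
      have "measure \<nu> (sym_diff (?L A s) (?L B s)) \<le> measure \<nu> (sym_diff A B)"
        by (intro measure_mono_fmeasurable sets_sym_diff fmeasurable_sym_diff fmeasurableD fm A B) auto
      also have "\<dots> < \<epsilon>/2" using d A B by (simp add: lamp_dist_cls)
      finally have "measure \<nu> (sym_diff (?L A t) (?L B s)) < \<epsilon>"
        using 1 measure_sym_diff_triangle[OF fm[OF A(2), of t] fm[OF A(2), of s] fm[OF B(2), of s]] by linarith
      then show "lamp_dist M (contract_lamp t c) (contract_lamp s d) < \<epsilon>"
        unfolding A(1) B(1) contract_lamp_cls[OF A(2)] contract_lamp_cls[OF B(2)]
          lamp_dist_cls[OF fm[OF A(2)] fm[OF B(2)]] .
    qed (use \<epsilon> in auto)
  }
qed

lemma contractible_lamplighter: "contractible_space (lamplighter_topology M R)"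
  using contractible_lamp_topology contractible_uniform_topology
  by (simp add: lamplighter_topology_def contractible_space_prod_topology)

end

section \<open>Amenability\<close>

text \<open>Every point of a permuted set with at most K elements has a period of at most K, and
  such a period divides K!. One exponent thus serves all classes, which later gives a measurable
  inverse as a power.\<close>

lemma funpow_fact_eq_self:
  assumes fin: "finite C" "card C \<le> K" and h: "h ` C \<subseteq> C" "inj_on h C" and x: "x \<in> C"
  shows "(h ^^ fact K) x = x"
proof -
  have C: "(h ^^ n) y \<in> C" if "y \<in> C" for n y using that h(1) by (induction n) auto
  have inj: "y = z" if "(h ^^ n) y = (h ^^ n) z" "y \<in> C" "z \<in> C" for n y z
    using that
  proof (induction n)
    case (Suc n)
    then have "(h ^^ n) y = (h ^^ n) z" using C h(2) by (auto dest: inj_onD)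
    then show ?case using Suc by simp
  qed simp
  have "\<not> inj_on (\<lambda>n. (h ^^ n) x) {..card C}"
  proof
    assume "inj_on (\<lambda>n. (h ^^ n) x) {..card C}"
    then have "card {..card C} \<le> card C"
      by (rule card_inj_on_le) (use C x fin in auto)
    then show False by simp
  qed
  then obtain m n where "m < n" "n \<le> card C" "(h ^^ m) x = (h ^^ n) x"
    unfolding inj_on_def by (metis atMost_iff linorder_neqE_nat)
  moreover from this have "(h ^^ n) x = (h ^^ m) ((h ^^ (n - m)) x)"
    by (simp flip: funpow_add comp_apply[of "h ^^ m" "h ^^ (n - m)"])
  ultimately have p: "(h ^^ (n - m)) x = x" using inj[of m x "(h ^^ (n - m)) x"] C x by simp
  have "n - m dvd fact K" using \<open>m < n\<close> \<open>n \<le> card C\<close> fin by (intro dvd_fact) auto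
  then obtain q where q: "fact K = (n - m) * q" by blast
  have "((h ^^ (n - m)) ^^ q) x = x" by (induction q) (simp_all add: p)
  then show ?thesis by (simp add: q funpow_mult)
qed

text \<open>A partial injection between points of finite classes is extended by closing up its chains to
  cycles: the end of a chain is mapped to its beginning.\<close>

locale chain_closing =
  fixes U :: "'x set" and F :: "('x \<times> 'x) set" and g i :: "'x \<Rightarrow> 'x"
  assumes F: "equiv U F" and fin: "x \<in> U \<Longrightarrow> finite (F `` {x})"
    and g: "x \<in> U \<Longrightarrow> g x \<in> U" "x \<in> U \<Longrightarrow> i x \<in> U" "x \<in> U \<Longrightarrow> i (g x) = x" "x \<in> U \<Longrightarrow> g (i x) = x"
begin

text \<open>The number of steps back along the inverse i before the chain leaves the class. It is
  evaluated only at the end of a chain, where such a number exists.\<close>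

definition chain_length :: "'x \<Rightarrow> nat" where
  "chain_length x = (LEAST k. ((i ^^ k) x, (i ^^ Suc k) x) \<notin> F)"

definition closing :: "'x \<Rightarrow> 'x" where
  "closing x = (if (x, g x) \<in> F then g x else (i ^^ chain_length x) x)"

lemma F_trans: "(x, y) \<in> F \<Longrightarrow> (y, z) \<in> F \<Longrightarrow> (x, z) \<in> F"
  using F by (auto simp: equiv_def dest: transD)

lemma F_sym: "(x, y) \<in> F \<Longrightarrow> (y, x) \<in> F"
  using F by (auto simp: equiv_def sym_def)

lemma F_refl: "x \<in> U \<Longrightarrow> (x, x) \<in> F"
  using F by (auto simp: equiv_def refl_on_def)

lemma F_U: "(x, y) \<in> F \<Longrightarrow> x \<in> U" "(x, y) \<in> F \<Longrightarrow> y \<in> U"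
  using F by (auto simp: equiv_def refl_on_def)

lemma i_funpow: "x \<in> U \<Longrightarrow> (i ^^ k) x \<in> U"
  by (induction k) (auto intro: g)

lemma i_funpow_inj: "x \<in> U \<Longrightarrow> y \<in> U \<Longrightarrow> (i ^^ k) x = (i ^^ k) y \<Longrightarrow> x = y"
proof (induction k)
  case (Suc k)
  then have "(i ^^ k) x = (i ^^ k) y" using g(4) i_funpow by (metis comp_apply funpow.simps(2))
  then show ?case using Suc by simp
qed simp

text \<open>A backward orbit that stays in a finite class repeats, and by injectivity it returns to
  x itself. The point reached just before the return is then g x, which would lie in the
  class.\<close>

lemma chain_end_exists:
  assumes x: "x \<in> U" and nF: "(x, g x) \<notin> F"
  shows "\<exists>k. ((i ^^ k) x, (i ^^ Suc k) x) \<notin> F"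
proof (rule ccontr)
  assume "\<not> ?thesis"
  then have st: "((i ^^ k) x, (i ^^ Suc k) x) \<in> F" for k by blast
  have cl: "(x, (i ^^ k) x) \<in> F" for k
  proof (induction k)
    case (Suc k)
    then show ?case using F_trans st by blast
  qed (simp add: F_refl x)
  then have "range (\<lambda>k. (i ^^ k) x) \<subseteq> F `` {x}" by auto
  then have "finite (range (\<lambda>k. (i ^^ k) x))" using fin[OF x] finite_subset by blast
  then have "\<not> inj (\<lambda>k. (i ^^ k) x)" using finite_imageD infinite_UNIV_nat by blast
  then obtain a b where ab: "a < b" "(i ^^ a) x = (i ^^ b) x"
    unfolding inj_def by (metis linorder_neqE_nat)
  then have "(i ^^ a) x = (i ^^ a) ((i ^^ (b - a)) x)"
    by (simp flip: funpow_add comp_apply[of "i ^^ a" "i ^^ (b - a)"])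
  then have "x = (i ^^ (b - a)) x" using i_funpow_inj x i_funpow by blast
  also have "\<dots> = i ((i ^^ (b - a - 1)) x)" using ab(1) by (cases "b - a") auto
  finally have "g x = (i ^^ (b - a - 1)) x" using g(4)[OF i_funpow[OF x]] by metis
  then show False using cl nF by metis
qed

lemma chain_length:
  assumes "x \<in> U" "(x, g x) \<notin> F"
  shows "((i ^^ chain_length x) x, (i ^^ Suc (chain_length x)) x) \<notin> F"
    and "k < chain_length x \<Longrightarrow> ((i ^^ k) x, (i ^^ Suc k) x) \<in> F"
proof -
  show "((i ^^ chain_length x) x, (i ^^ Suc (chain_length x)) x) \<notin> F"
    unfolding chain_length_def by (rule LeastI_ex) (rule chain_end_exists[OF assms])
  show "k < chain_length x \<Longrightarrow> ((i ^^ k) x, (i ^^ Suc k) x) \<in> F"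
    unfolding chain_length_def by (drule not_less_Least) simp
qed

lemma closing_F:
  assumes x: "x \<in> U" shows "(x, closing x) \<in> F"
proof (cases "(x, g x) \<in> F")
  case False
  have "(x, (i ^^ k) x) \<in> F" if "k \<le> chain_length x" for k
    using that
  proof (induction k)
    case (Suc k)
    then show ?case using chain_length(2)[OF x False, of k] F_trans by (meson Suc_le_lessD Suc_leD)
  qed (simp add: F_refl x)
  then show ?thesis using False by (simp add: closing_def)
qed (simp add: closing_def)

text \<open>If two ends of chains lead back to the same beginning, one of them lies on the chain of
  the other. Unless they coincide, it is an inner point, whose image under g remains in the
  class.\<close>

lemma closing_neq_aux:
  assumes "x \<in> U" "y \<in> U" "(x, g x) \<notin> F" "(y, g y) \<notin> F" "closing x = closing y"
    and le: "chain_length x \<le> chain_length y"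
  shows "x = y"
proof -
  define d where "d = chain_length y - chain_length x"
  have cy: "chain_length y = chain_length x + d" using le by (simp add: d_def)
  have "(i ^^ chain_length x) x = (i ^^ chain_length x) ((i ^^ d) y)"
    using assms by (simp add: closing_def cy funpow_add)
  then have xd: "x = (i ^^ d) y" using i_funpow_inj assms i_funpow by blast
  show ?thesis
  proof (cases d)
    case (Suc e)
    have ye: "(i ^^ e) y \<in> U" using assms i_funpow by blast
    have "((i ^^ e) y, x) \<in> F" using chain_length(2)[OF assms(2,4), of e] cy Suc xd by simp
    moreover have "g x = (i ^^ e) y" using xd Suc g(4)[OF ye] by simp
    ultimately have "(g x, x) \<in> F" by simp
    then show ?thesis using assms(3) F_sym by blast
  qed (use xd in simp)
qed

text \<open>The beginning of a chain has its predecessor outside the class, so it is not g x for a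
  point x with (x, g x) in \<open>F\<close>.\<close>

lemma closing_mixed:
  assumes "x \<in> U" "y \<in> U" "(x, g x) \<in> F" "(y, g y) \<notin> F"
  shows "closing x \<noteq> closing y"
proof
  assume "closing x = closing y"
  then have eq: "g x = (i ^^ chain_length y) y" using assms by (simp add: closing_def)
  define k where "k = chain_length y"
  have k: "((i ^^ k) y, (i ^^ Suc k) y) \<notin> F" unfolding k_def by (rule chain_length(1)[OF assms(2,4)])
  have gx: "(i ^^ k) y = g x" unfolding k_def by (rule eq[symmetric])
  then have "(i ^^ Suc k) y = x" using g(3)[OF assms(1)] by simp
  with k gx have "(g x, x) \<notin> F" by metis
  then show False using F_sym[OF assms(3)] by blast
qed

lemma closing_inj:
  assumes x: "x \<in> U" and y: "y \<in> U" and eq: "closing x = closing y"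
  shows "x = y"
proof (cases "(x, g x) \<in> F")
  case True
  then have "(y, g y) \<in> F" using closing_mixed[OF x y] eq by blast
  then have "g x = g y" using True eq by (simp add: closing_def)
  then have "i (g x) = i (g y)" by (rule arg_cong)
  then show ?thesis unfolding g(3)[OF x] g(3)[OF y] .
next
  case False
  then have "(y, g y) \<notin> F" using closing_mixed[OF y x] eq by metis
  with False show ?thesis
    using closing_neq_aux[OF x y] closing_neq_aux[OF y x] eq by (metis nat_le_linear)
qed

lemma closing_funpow_fact:
  assumes x: "x \<in> U" and K: "card (F `` {x}) \<le> K"
  shows "(closing ^^ fact K) x = x"
proof (rule funpow_fact_eq_self[OF fin[OF x] K])
  show "closing ` (F `` {x}) \<subseteq> F `` {x}" using closing_F F_trans F_U by blast
  show "inj_on closing (F `` {x})" using closing_inj F_U by (blast intro: inj_onI)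
  show "x \<in> F `` {x}" using F_refl[OF x] by simp
qed

end

primrec word_map :: "('x \<Rightarrow> 'x) list \<Rightarrow> 'x \<Rightarrow> 'x" where
  "word_map [] = id"
| "word_map (\<gamma> # ws) = \<gamma> \<circ> word_map ws"

lemma word_map_append: "word_map (v @ w) = word_map v \<circ> word_map w"
  by (induction v) (simp_all add: o_assoc)

text \<open>On a class with at most \<open>K\<close> elements a word acts through an automaton with at most \<open>K\<close> states,
  and there are only finitely many such automata.\<close>

lemma finite_words_of_bounded_classes:
  fixes \<Gamma> :: "('x \<Rightarrow> 'x) set"
  assumes F: "equiv U F" and fin: "\<And>x. x \<in> U \<Longrightarrow> finite (F `` {x}) \<and> card (F `` {x}) \<le> K"
    and \<Gamma>: "finite \<Gamma>" "\<And>\<gamma> x. \<gamma> \<in> \<Gamma> \<Longrightarrow> x \<in> U \<Longrightarrow> (x, \<gamma> x) \<in> F"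
  shows "finite ((\<lambda>ws. restrict (word_map ws) U) ` lists \<Gamma>)"
proof -
  have "\<exists>e. inj_on e C \<and> e ` C \<subseteq> {..<K}" if C: "finite C" "card C \<le> K" for C :: "'x set"
  proof -
    obtain e where "bij_betw e C {0..<card C}" using ex_bij_betw_finite_nat[OF C(1)] by blast
    then show ?thesis using C(2) by (intro exI[of _ e]) (auto simp: bij_betw_def)
  qed
  then obtain enc :: "'x set \<Rightarrow> 'x \<Rightarrow> nat" where
    enc: "\<And>C. finite C \<Longrightarrow> card C \<le> K \<Longrightarrow> inj_on (enc C) C \<and> enc C ` C \<subseteq> {..<K}" by metis
  define dec where "dec C = inv_into C (enc C)" for C
  \<comment> \<open>The transition table of a class in the numbering \<open>enc\<close>. Numbers
    that name no point get the entry 0, so that all tables belong to one finite set.\<close>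
  define \<tau> where "\<tau> C = (\<lambda>\<gamma>\<in>\<Gamma>. \<lambda>j\<in>{..<K}. if j \<in> enc C ` C then enc C (\<gamma> (dec C j)) else 0)" for C
  define cl where "cl x = F `` {x}" for x
  define run :: "('x \<Rightarrow> 'x) list \<Rightarrow> (('x \<Rightarrow> 'x) \<Rightarrow> nat \<Rightarrow> nat) \<times> nat \<Rightarrow> nat"
    where "run ws = (\<lambda>(t, p). foldr (\<lambda>\<gamma>. t \<gamma>) ws p)" for ws
  define Pat where "Pat = (\<Pi>\<^sub>E \<gamma>\<in>\<Gamma>. \<Pi>\<^sub>E j\<in>{..<K}. {..<K}) \<times> {..<K}"
  have finP: "finite Pat" unfolding Pat_def by (intro finite_cartesian_product finite_PiE \<Gamma>) auto
  have cl: "finite (cl x)" "card (cl x) \<le> K" "inj_on (enc (cl x)) (cl x)" "enc (cl x) ` cl x \<subseteq> {..<K}" "x \<in> cl x"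
    if "x \<in> U" for x
    using fin[OF that] enc[of "cl x"] F that by (auto simp: cl_def equiv_def refl_on_def)
  have clU: "y \<in> U \<and> cl y = cl x" if "y \<in> cl x" "x \<in> U" for x y
    using that F unfolding cl_def by (auto simp: equiv_def refl_on_def dest: transD symD)
  have step: "\<gamma> y \<in> cl x" if "\<gamma> \<in> \<Gamma>" "y \<in> cl x" "x \<in> U" for \<gamma> y x
    using \<Gamma>(2)[OF that(1), of y] clU[OF that(2,3)] by (auto simp: cl_def)
  have \<tau>: "(\<tau> (cl x), enc (cl x) x) \<in> Pat" if x: "x \<in> U" for x
  proof -
    have "K > 0" using cl(4,5)[OF x] by auto
    have "enc (cl x) (\<gamma> (dec (cl x) j)) < K" if "\<gamma> \<in> \<Gamma>" "j \<in> enc (cl x) ` cl x" for \<gamma> j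
    proof -
      have "dec (cl x) j \<in> cl x" unfolding dec_def by (rule inv_into_into[OF that(2)])
      then show ?thesis using step[OF that(1) _ x] cl(4)[OF x] by auto
    qed
    then show ?thesis using \<open>K > 0\<close> cl(4,5)[OF x] by (auto simp: Pat_def \<tau>_def)
  qed
  have word: "word_map ws x \<in> cl x \<and> enc (cl x) (word_map ws x) = run ws (\<tau> (cl x), enc (cl x) x)"
    if x: "x \<in> U" and ws: "ws \<in> lists \<Gamma>" for ws x
    using ws
  proof (induction ws)
    case Nil
    then show ?case using cl(5)[OF x] by (simp add: run_def)
  next
    case (Cons \<gamma> ws)
    let ?y = "word_map ws x"
    have y: "?y \<in> cl x" "enc (cl x) ?y = run ws (\<tau> (cl x), enc (cl x) x)" using Cons by auto
    have \<gamma>: "\<gamma> \<in> \<Gamma>" using Cons by simp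
    have d: "dec (cl x) (enc (cl x) ?y) = ?y" unfolding dec_def using cl(3)[OF x] y(1) by simp
    have m: "enc (cl x) ?y < K" "enc (cl x) ?y \<in> enc (cl x) ` cl x" using cl(4)[OF x] y(1) by auto
    have "run (\<gamma> # ws) (\<tau> (cl x), enc (cl x) x) = \<tau> (cl x) \<gamma> (enc (cl x) ?y)"
      unfolding y(2) by (simp add: run_def)
    also have "\<dots> = enc (cl x) (\<gamma> ?y)" unfolding \<tau>_def using \<gamma> m by (simp add: d)
    finally show ?case using step[OF \<gamma> y(1) x] by simp
  qed
  \<comment> \<open>Classes with equal tables are treated alike: the map of a word is determined by
    how the word runs on the finitely many pairs of a table and an initial state.\<close>
  define \<Phi> where "\<Phi> r = (\<lambda>x\<in>U. dec (cl x) (r (\<tau> (cl x), enc (cl x) x)))" for r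
  have eq: "restrict (word_map ws) U = \<Phi> (restrict (run ws) Pat)" if ws: "ws \<in> lists \<Gamma>" for ws
  proof (rule ext)
    fix x show "restrict (word_map ws) U x = \<Phi> (restrict (run ws) Pat) x"
    proof (cases "x \<in> U")
      case True
      have "dec (cl x) (enc (cl x) (word_map ws x)) = word_map ws x"
        unfolding dec_def by (rule inv_into_f_f[OF cl(3)[OF True]]) (use word[OF True ws] in blast)
      then have "dec (cl x) (run ws (\<tau> (cl x), enc (cl x) x)) = word_map ws x"
        using word[OF True ws] by metis
      then show ?thesis using True \<tau>[OF True] by (simp add: \<Phi>_def)
    qed (simp add: \<Phi>_def)
  qed
  have run: "run ws p < K" if "p \<in> Pat" "ws \<in> lists \<Gamma>" for ws p
  proof -
    obtain t q where p: "p = (t, q)" "t \<in> (\<Pi>\<^sub>E \<gamma>\<in>\<Gamma>. \<Pi>\<^sub>E j\<in>{..<K}. {..<K})" "q < K"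
      using \<open>p \<in> Pat\<close> by (auto simp: Pat_def)
    show ?thesis using that(2)
    proof (induction ws)
      case (Cons \<gamma> ws)
      then have "foldr (\<lambda>\<gamma>. t \<gamma>) ws q < K" "\<gamma> \<in> \<Gamma>" by (auto simp: run_def p)
      then have "t \<gamma> (foldr (\<lambda>\<gamma>. t \<gamma>) ws q) \<in> {..<K}" using PiE_mem[OF PiE_mem[OF p(2)]] by blast
      then show ?case by (simp add: run_def p)
    qed (simp add: run_def p)
  qed
  have "(\<lambda>ws. restrict (word_map ws) U) ` lists \<Gamma> \<subseteq> \<Phi> ` (\<Pi>\<^sub>E p\<in>Pat. {..<K})"
  proof
    fix m assume "m \<in> (\<lambda>ws. restrict (word_map ws) U) ` lists \<Gamma>"
    then obtain ws where "ws \<in> lists \<Gamma>" "m = restrict (word_map ws) U" by blast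
    moreover from this have "restrict (run ws) Pat \<in> (\<Pi>\<^sub>E p\<in>Pat. {..<K})" using run by auto
    ultimately show "m \<in> \<Phi> ` (\<Pi>\<^sub>E p\<in>Pat. {..<K})" using eq by blast
  qed
  then show ?thesis by (rule finite_subset) (intro finite_imageI finite_PiE finP, simp)
qed

text \<open>Adjoining one involution s to a finite subgroup \<open>H\<close> gives \<open>H\<close>
  together with its coset s \<open>H\<close>, at most doubling the size.\<close>

lemma (in comm_group) finite_generate_of_involutions:
  assumes inv: "\<And>x. x \<in> carrier G \<Longrightarrow> x \<otimes> x = \<one>" and S: "finite S" "S \<subseteq> carrier G"
  shows "finite (generate G S)"
proof -
  have "\<exists>H. finite H \<and> subgroup H G \<and> S \<subseteq> H" using S
  proof (induction S)
    case empty
    show ?case by (intro exI[of _ "{\<one>}"]) (auto simp: triv_subgroup)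
  next
    case (insert s S)
    then obtain H where H: "finite H" "subgroup H G" "S \<subseteq> H" by auto
    have s: "s \<in> carrier G" using insert by simp
    have HG: "H \<subseteq> carrier G" using H(2) by (rule subgroup.subset)
    define L where "L = H \<union> (\<lambda>h. s \<otimes> h) ` H"
    have LG: "L \<subseteq> carrier G" using HG s by (auto simp: L_def)
    have "x \<otimes> y \<in> L" if "x \<in> L" "y \<in> L" for x y
    proof -
      have c: "h \<otimes> k \<in> H" "h \<in> carrier G" if "h \<in> H" "k \<in> H" for h k
        using that HG subgroup.m_closed[OF H(2)] by auto
      have 1: "(s \<otimes> h) \<otimes> k \<in> L" "h \<otimes> (s \<otimes> k) \<in> L" "(s \<otimes> h) \<otimes> (s \<otimes> k) \<in> L" if "h \<in> H" "k \<in> H" for h k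
      proof -
        have hk: "h \<in> carrier G" "k \<in> carrier G" using that HG by auto
        have "(s \<otimes> h) \<otimes> k = s \<otimes> (h \<otimes> k)" "h \<otimes> (s \<otimes> k) = s \<otimes> (h \<otimes> k)" using hk s by (auto simp: m_ac)
        then show "(s \<otimes> h) \<otimes> k \<in> L" "h \<otimes> (s \<otimes> k) \<in> L" using c(1)[OF that] by (auto simp: L_def)
        have "(s \<otimes> h) \<otimes> (s \<otimes> k) = (s \<otimes> s) \<otimes> (h \<otimes> k)" using hk s by (simp add: m_ac)
        then show "(s \<otimes> h) \<otimes> (s \<otimes> k) \<in> L" using c(1)[OF that] inv[OF s] hk by (simp add: L_def)
      qed
      from that consider "x \<in> H" "y \<in> H" | h where "h \<in> H" "x = s \<otimes> h" "y \<in> H"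
        | k where "k \<in> H" "x \<in> H" "y = s \<otimes> k" | h k where "h \<in> H" "k \<in> H" "x = s \<otimes> h" "y = s \<otimes> k"
        unfolding L_def by blast
      then show ?thesis using 1 c(1) by cases (simp_all add: L_def)
    qed
    moreover have "inv x \<in> L" if "x \<in> L" for x
    proof -
      have "x \<in> carrier G" using that LG by auto
      then have "inv x = x" using inv by (intro inv_equality) auto
      then show ?thesis using that by simp
    qed
    moreover have "\<one> \<in> H" using subgroup.one_closed[OF H(2)] .
    ultimately have "subgroup L G" using LG by (intro subgroupI) (auto simp: L_def)
    moreover have "insert s S \<subseteq> L" using H(3) \<open>\<one> \<in> H\<close> s by (auto simp: L_def intro!: image_eqI[of _ _ \<one>])
    moreover have "finite L" using H(1) by (simp add: L_def)
    ultimately show ?case by blast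
  qed
  then obtain H where H: "finite H" "subgroup H G" "S \<subseteq> H" by blast
  show ?thesis by (rule finite_subset[OF generate_subgroup_incl[OF H(3,2)] H(1)])
qed

section \<open>Amenability from approximation by relations with bounded classes\<close>

context nonsingular_relation
begin

text \<open>An element is replaced by one whose graph lies in \<open>F\<close>, unchanged wherever
  it already respected \<open>F\<close>. Chains are closed within classes, so each class is
  permuted.\<close>

lemma invertible_closing:
  assumes g: "g \<in> full_maps M R" and F: "equiv (space M) F" "F \<subseteq> R" "F \<in> sets (M \<Otimes>\<^sub>M M)"
    and K: "\<And>x. x \<in> space M \<Longrightarrow> finite (F `` {x}) \<and> card (F `` {x}) \<le> K"
  shows "\<exists>\<gamma>. invertible_map \<gamma> \<and> (\<forall>x\<in>space M. (x, \<gamma> x) \<in> F) \<and> (\<forall>x. (x, g x) \<in> F \<longrightarrow> \<gamma> x = g x)"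
proof -
  define i where "i = the_inv_into (space M) g"
  have bij: "bij_betw g (space M) (space M)" and [measurable]: "g \<in> M \<rightarrow>\<^sub>M M" "i \<in> M \<rightarrow>\<^sub>M M"
    using g by (auto simp: full_maps_def Borel_automorphisms_def i_def)
  note FR = F
  interpret chain_closing "space M" F g i
  proof
    fix x assume x: "x \<in> space M"
    show "g x \<in> space M" "i x \<in> space M" using x by (auto intro: measurable_space)
    show "i (g x) = x" "g (i x) = x"
      unfolding i_def using bij x f_the_inv_into_f_bij_betw[OF bij, of x]
      by (auto simp: bij_betw_def intro: the_inv_into_f_f)
  qed (use F K in auto)
  have pF: "Measurable.pred M (\<lambda>x. (a x, b x) \<in> F)" if [measurable]: "a \<in> M \<rightarrow>\<^sub>M M" "b \<in> M \<rightarrow>\<^sub>M M" for a b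
  proof -
    have "(\<lambda>x. (a x, b x)) -` F \<inter> space M \<in> sets M" by (rule measurable_sets[OF _ FR(3)]) simp
    then show ?thesis by (simp add: pred_def vimage_def Int_def conj_commute)
  qed
  have fp[measurable]: "h ^^ n \<in> M \<rightarrow>\<^sub>M M" if "h \<in> M \<rightarrow>\<^sub>M M" for h n
    using that by (induction n) (auto intro: measurable_comp simp: id_def)
  have ip[measurable]: "i ^^ n \<in> M \<rightarrow>\<^sub>M M" for n by (rule fp) measurable
  have [measurable]: "chain_length \<in> measurable M (count_space UNIV)"
    unfolding chain_length_def
    by (rule measurable_Least) (rule pred_intros_logic, rule pF, rule ip, rule ip)
  have [measurable]: "(\<lambda>x. (i ^^ chain_length x) x) \<in> M \<rightarrow>\<^sub>M M"
    by (rule measurable_compose_countable) auto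
  note [measurable] = pF[OF measurable_ident_sets[OF refl] \<open>g \<in> M \<rightarrow>\<^sub>M M\<close>]
  have c[measurable]: "closing \<in> M \<rightarrow>\<^sub>M M" unfolding closing_def by measurable
  \<comment> \<open>The inverse is the power K! - 1 of the closing, hence measurable without a
    further argument.\<close>
  obtain n where n: "fact K = Suc n" using not0_implies_Suc[OF fact_nonzero[where 'a = nat, of K]] by blast
  define k where "k = closing ^^ n"
  have k[measurable]: "k \<in> M \<rightarrow>\<^sub>M M" unfolding k_def by (rule fp[OF c])
  have ck: "closing (k x) = x" "k (closing x) = x" if "x \<in> space M" for x
  proof -
    have e: "(closing ^^ Suc n) x = x"
      unfolding n[symmetric] by (rule closing_funpow_fact[OF that]) (rule K[OF that, THEN conjunct2])
    from e show "closing (k x) = x" by (simp add: k_def)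
    from e show "k (closing x) = x" unfolding k_def by (simp only: funpow_Suc_right o_apply)
  qed
  have kF: "(x, k x) \<in> F" if "x \<in> space M" for x
    using closing_F[OF measurable_space[OF k that]] unfolding ck(1)[OF that] by (rule F_sym)
  have "inverse_pair closing k"
    unfolding inverse_pair_def using closing_F kF FR(2) ck by (auto intro!: AE_I2)
  then show ?thesis using closing_F
    by (intro exI[of _ closing]) (auto simp: invertible_map_def closing_def)
qed

text \<open>Group parts are replaced by closings in one \<open>F n\<close>, and their words give a
  finite set \<Psi> of elements. The \<Psi>-orbits of the finitely many lamps generate a finite
  group \<open>D\<close>, as lamps are commuting involutions. Then \<open>D \<times> \<Psi>\<close>
  is a finite submonoid close to the given elements.\<close>

lemma amenable_lamplighter:
  fixes F :: "nat \<Rightarrow> ('x \<times> 'x) set" and K :: "nat \<Rightarrow> nat"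
  assumes F: "\<And>n. equiv (space M) (F n)" "\<And>n. F n \<subseteq> R" "\<And>n. F n \<in> sets (M \<Otimes>\<^sub>M M)"
    and K: "\<And>n x. x \<in> space M \<Longrightarrow> finite (F n `` {x}) \<and> card (F n `` {x}) \<le> K n"
    and approx: "\<And>g. g \<in> M \<rightarrow>\<^sub>M M \<Longrightarrow> AE x in M. (x, g x) \<in> R \<Longrightarrow>
      (\<lambda>n. prob {x \<in> space M. (x, g x) \<notin> F n}) \<longlonglongrightarrow> 0"
  shows "amenable_group (lamplighter M R) (lamplighter_topology M R)"
proof -
  interpret L: topological_group "lamplighter M R" "lamplighter_topology M R"
    by (rule topological_group_lamplighter)
  interpret G: group "full_group M R" by (rule group_full_group)
  interpret U: Metric_space "carrier (full_group M R)" "uniform_dist M" by (rule Metric_space_full_group)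
  interpret C: group "lamp_group M R" by (rule group_lamp_group)
  interpret C: comm_group "lamp_group M R"
    by (rule C.group_comm_groupI) (auto simp: carrier_lamp_group mult_lamp_group Un_commute)
  have invol: "c \<otimes>\<^bsub>lamp_group M R\<^esub> c = \<one>\<^bsub>lamp_group M R\<^esub>" if "c \<in> carrier (lamp_group M R)" for c
    using that by (auto simp: carrier_lamp_group mult_lamp_group one_lamp_group)
  have carL: "carrier (lamplighter M R) = carrier (lamp_group M R) \<times> carrier (full_group M R)"
    by (simp add: lamplighter_def semidirect_product_def)
  show ?thesis
  proof (rule L.amenableI_finite_submonoids)
    fix S N assume S: "finite S" "S \<subseteq> carrier (lamplighter M R)"
      and N: "\<And>s. s \<in> S \<Longrightarrow> openin (lamplighter_topology M R) (N s) \<and> s \<in> N s"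
    \<comment> \<open>The lamp part of s is kept exactly; only the group part is going to be
      perturbed.\<close>
    have "\<exists>\<epsilon>>0. \<forall>\<psi>\<in>carrier (full_group M R). uniform_dist M (snd s) \<psi> < \<epsilon> \<longrightarrow> (fst s, \<psi>) \<in> N s"
      if s: "s \<in> S" for s
    proof -
      have cs: "fst s \<in> carrier (lamp_group M R)" "snd s \<in> carrier (full_group M R)"
        using s S carL by auto
      obtain A B where AB: "openin (lamp_topology M R) A" "openin (uniform_topology M R) B"
          "fst s \<in> A" "snd s \<in> B" "A \<times> B \<subseteq> N s"
        using N[OF s] unfolding lamplighter_topology_def openin_prod_topology_alt
        by (metis prod.collapse)
      then obtain r where "r > 0" "U.mball (snd s) r \<subseteq> B"
        unfolding uniform_topology_def U.openin_mtopology by blast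
      then show ?thesis using AB cs by (intro exI[of _ r]) auto
    qed
    then obtain \<epsilon> where \<epsilon>: "\<And>s. s \<in> S \<Longrightarrow> \<epsilon> s > 0"
      "\<And>s \<psi>. s \<in> S \<Longrightarrow> \<psi> \<in> carrier (full_group M R) \<Longrightarrow> uniform_dist M (snd s) \<psi> < \<epsilon> s \<Longrightarrow> (fst s, \<psi>) \<in> N s"
      by metis
    define g where "g s = repr (snd s)" for s :: "('x \<times> 'x) set set \<times> ('x \<Rightarrow> 'x) set"
    have g: "g s \<in> full_maps M R" "invertible_map (g s)" "snd s = cls (g s)" if "s \<in> S" for s
    proof -
      have "snd s \<in> carrier (full_group M R)" using that S carL by auto
      then obtain h where h: "snd s = cls h" "invertible_map h" by (auto elim: carrierE)
      then show "g s \<in> full_maps M R" "invertible_map (g s)" "snd s = cls (g s)"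
        using repr_cls[OF h(2)] cls_eqI[OF repr_cls(2)[OF h(2)]] by (auto simp: g_def)
    qed
    have "\<forall>s\<in>S. eventually (\<lambda>n. prob {x \<in> space M. (x, g s x) \<notin> F n} < \<epsilon> s) sequentially"
      using \<epsilon>(1) by (intro ballI order_tendstoD(2)[OF approx]) (auto dest: g(2) intro: invertible_mapD)
    then have "eventually (\<lambda>n. \<forall>s\<in>S. prob {x \<in> space M. (x, g s x) \<notin> F n} < \<epsilon> s) sequentially"
      by (rule eventually_ball_finite[OF S(1)])
    then obtain n where n: "\<And>s. s \<in> S \<Longrightarrow> prob {x \<in> space M. (x, g s x) \<notin> F n} < \<epsilon> s"
      by (auto simp: eventually_sequentially)
    have "\<forall>s\<in>S. \<exists>\<gamma>. invertible_map \<gamma> \<and> (\<forall>x\<in>space M. (x, \<gamma> x) \<in> F n) \<and> (\<forall>x. (x, g s x) \<in> F n \<longrightarrow> \<gamma> x = g s x)"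
      by (intro ballI invertible_closing[OF g(1) F K])
    then obtain \<gamma> where \<gamma>: "\<And>s. s \<in> S \<Longrightarrow> invertible_map (\<gamma> s)" "\<And>s x. s \<in> S \<Longrightarrow> x \<in> space M \<Longrightarrow> (x, \<gamma> s x) \<in> F n"
      "\<And>s x. s \<in> S \<Longrightarrow> (x, g s x) \<in> F n \<Longrightarrow> \<gamma> s x = g s x"
      by metis
    define Ws where "Ws = (\<lambda>ws. word_map ws) ` lists (\<gamma> ` S)"
    define \<Psi> where "\<Psi> = cls ` Ws"
    have inv: "invertible_map w" if "w \<in> Ws" for w
    proof -
      have "invertible_map (word_map ws)" if "ws \<in> lists (\<gamma> ` S)" for ws
        using that
      proof (induction ws)
        case Nil
        show ?case unfolding word_map.simps by (rule invertible_map_id)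
      next
        case (Cons h ws)
        then have "invertible_map h" "invertible_map (word_map ws)" using \<gamma>(1) by auto
        then show ?case unfolding word_map.simps by (rule invertible_map_comp)
      qed
      then show ?thesis using that by (auto simp: Ws_def)
    qed
    have "finite \<Psi>"
    proof -
      have "finite ((\<lambda>ws. restrict (word_map ws) (space M)) ` lists (\<gamma> ` S))"
        using S(1) \<gamma>(2) K by (intro finite_words_of_bounded_classes[where K = "K n", OF F(1)]) auto
      then have "finite (cls ` (\<lambda>ws. restrict (word_map ws) (space M)) ` lists (\<gamma> ` S))"
        by (rule finite_imageI)
      also have "cls ` (\<lambda>ws. restrict (word_map ws) (space M)) ` lists (\<gamma> ` S) = \<Psi>"
        unfolding \<Psi>_def Ws_def image_image by (intro image_cong refl cls_eqI AE_I2) simp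
      finally show ?thesis .
    qed
    have \<Psi>G: "\<Psi> \<subseteq> carrier (full_group M R)" using inv by (auto simp: \<Psi>_def intro: cls_in_carrier)
    have \<Psi>_mult: "\<phi> \<otimes>\<^bsub>full_group M R\<^esub> \<psi> \<in> \<Psi>" if "\<phi> \<in> \<Psi>" "\<psi> \<in> \<Psi>" for \<phi> \<psi>
    proof -
      obtain v w where vw: "\<phi> = cls (word_map v)" "\<psi> = cls (word_map w)" "v \<in> lists (\<gamma> ` S)" "w \<in> lists (\<gamma> ` S)"
        using \<open>\<phi> \<in> \<Psi>\<close> \<open>\<psi> \<in> \<Psi>\<close> by (auto simp: \<Psi>_def Ws_def)
      have "\<phi> \<otimes>\<^bsub>full_group M R\<^esub> \<psi> = cls (word_map (v @ w))"
        using inv vw by (simp add: mult_full_group word_map_append Ws_def)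
      then show ?thesis using vw(3,4) by (auto simp: \<Psi>_def Ws_def)
    qed
    have id\<Psi>: "\<one>\<^bsub>full_group M R\<^esub> \<in> \<Psi>" unfolding one_full_group \<Psi>_def Ws_def
      by (auto intro!: image_eqI[of _ _ id] image_eqI[of _ _ "[]"])
    \<comment> \<open>Whole orbits under \<Psi> are taken, so that the group generated by them is
      invariant under \<Psi> and the product set is closed under the semidirect
      multiplication.\<close>
    define O' where "O' = (\<lambda>(\<psi>, s). lamp_action M R \<psi> (fst s)) ` (\<Psi> \<times> S)"
    have O': "finite O'" "O' \<subseteq> carrier (lamp_group M R)"
      using \<open>finite \<Psi>\<close> S \<Psi>G carL by (auto simp: O'_def intro!: lamp_action_closed)
    define D where "D = generate (lamp_group M R) O'"
    have "finite D" unfolding D_def by (rule C.finite_generate_of_involutions[OF invol O'])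
    have DG: "D \<subseteq> carrier (lamp_group M R)" unfolding D_def by (rule C.generate_incl[OF O'(2)])
    have D_act: "lamp_action M R \<psi> c \<in> D" if "c \<in> D" and \<psi>: "\<psi> \<in> \<Psi>" for c \<psi>
    proof -
      have \<psi>G: "\<psi> \<in> carrier (full_group M R)" using \<psi> \<Psi>G by auto
      have orb: "lamp_action M R \<psi> h \<in> D" if hO: "h \<in> O'" for h
      proof -
        obtain \<psi>' s where h: "h = lamp_action M R \<psi>' (fst s)" "\<psi>' \<in> \<Psi>" "s \<in> S"
          using hO by (auto simp: O'_def)
        have "fst s \<in> carrier (lamp_group M R)" using h(3) S carL by auto
        then have "lamp_action M R \<psi> h = lamp_action M R (\<psi> \<otimes>\<^bsub>full_group M R\<^esub> \<psi>') (fst s)"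
          using h \<psi>G \<Psi>G by (simp add: lamp_action_mult subset_iff)
        also have "\<dots> \<in> O'" using \<Psi>_mult[OF \<psi> h(2)] h(3) by (force simp: O'_def)
        finally show ?thesis unfolding D_def by (rule generate.incl)
      qed
      show ?thesis using \<open>c \<in> D\<close> unfolding D_def
      proof (induction rule: generate.induct)
        case one
        have "lamp_action M R \<psi> \<one>\<^bsub>lamp_group M R\<^esub> = \<one>\<^bsub>lamp_group M R\<^esub>"
          using lamp_action_hom[OF \<psi>G C.one_closed C.one_closed] lamp_action_closed[OF \<psi>G C.one_closed]
          by (simp add: C.r_cancel_one')
        then show ?case by (simp add: generate.one)
      next
        case (incl h)
        then show ?case using orb by (simp add: D_def)
      next
        case (inv h)
        then have "inv\<^bsub>lamp_group M R\<^esub> h = h" using O'(2) by (intro inv_lamp_group) auto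
        then show ?case using orb[OF inv] by (simp add: D_def)
      next
        case (eng h1 h2)
        then have "h1 \<in> carrier (lamp_group M R)" "h2 \<in> carrier (lamp_group M R)"
          using DG by (auto simp: D_def)
        then show ?case using eng lamp_action_hom[OF \<psi>G] by (simp add: generate.eng)
      qed
    qed
    show "\<exists>H. finite H \<and> H \<noteq> {} \<and> H \<subseteq> carrier (lamplighter M R) \<and>
        (\<forall>x\<in>H. \<forall>y\<in>H. x \<otimes>\<^bsub>lamplighter M R\<^esub> y \<in> H) \<and> (\<forall>s\<in>S. H \<inter> N s \<noteq> {})"
    proof (intro exI[of _ "D \<times> \<Psi>"] conjI ballI)
      show "finite (D \<times> \<Psi>)" using \<open>finite D\<close> \<open>finite \<Psi>\<close> by simp
      show "D \<times> \<Psi> \<noteq> {}" using id\<Psi> generate.one[of "lamp_group M R" O'] by (auto simp: D_def)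
      show "D \<times> \<Psi> \<subseteq> carrier (lamplighter M R)" using DG \<Psi>G carL by auto
      fix x y assume "x \<in> D \<times> \<Psi>" "y \<in> D \<times> \<Psi>"
      then show "x \<otimes>\<^bsub>lamplighter M R\<^esub> y \<in> D \<times> \<Psi>"
        using \<Psi>_mult D_act by (auto simp: lamplighter_def semidirect_product_def D_def intro: generate.eng)
    next
      fix s assume s: "s \<in> S"
      have cs: "fst s \<in> carrier (lamp_group M R)" using s S carL by auto
      have "fst s \<in> O'" unfolding O'_def
        by (rule image_eqI[of _ _ "(\<one>\<^bsub>full_group M R\<^esub>, s)"]) (use s id\<Psi> lamp_action_one[OF cs] in auto)
      then have 1: "fst s \<in> D" unfolding D_def by (rule generate.incl)
      have 2: "cls (\<gamma> s) \<in> \<Psi>" unfolding \<Psi>_def Ws_def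
        using s by (auto intro!: image_eqI[of _ _ "\<gamma> s"] image_eqI[of _ _ "[\<gamma> s]"])
      note [measurable] = invertible_mapD(1)[OF g(2)[OF s]] invertible_mapD(1)[OF \<gamma>(1)[OF s]]
      have "(\<lambda>x. (x, g s x)) -` F n \<inter> space M \<in> sets M" by (rule measurable_sets[OF _ F(3)]) simp
      then have "space M - ((\<lambda>x. (x, g s x)) -` F n \<inter> space M) \<in> sets M" by blast
      moreover have "space M - ((\<lambda>x. (x, g s x)) -` F n \<inter> space M) = {x \<in> space M. (x, g s x) \<notin> F n}" by auto
      ultimately have "prob {x \<in> space M. g s x \<noteq> \<gamma> s x} \<le> prob {x \<in> space M. (x, g s x) \<notin> F n}"
        using \<gamma>(3)[OF s] by (intro finite_measure_mono) auto
      also have "\<dots> < \<epsilon> s" by (rule n[OF s])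
      finally have "uniform_dist M (snd s) (cls (\<gamma> s)) < \<epsilon> s"
        using g[OF s] \<gamma>(1)[OF s] by (simp add: uniform_dist_cls)
      then have "(fst s, cls (\<gamma> s)) \<in> N s" using 2 \<Psi>G by (intro \<epsilon>(2)[OF s]) auto
      with 1 2 show "D \<times> \<Psi> \<inter> N s \<noteq> {}" by blast
    qed
  qed
qed

end

context nonsingular_relation
begin

text \<open>Equality of keys is an equivalence relation that eventually relates any two given points
  of an orbit, but its classes may be infinite. Requiring that the key be reached by one of
  boundedly many injective maps \<open>W i\<close> bounds them, since each map leads to a given key
  from at most one point.\<close>

lemma amenable_lamplighter_of_keys:
  fixes key :: "nat \<Rightarrow> 'x \<Rightarrow> 'x"
  assumes inj: "\<And>i. inj_on (W i) (space M)"
    and key [measurable]: "\<And>n. key n \<in> M \<rightarrow>\<^sub>M M"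
    and key_R: "\<And>n x. x \<in> space M \<Longrightarrow> (x, key n x) \<in> R"
    and key_ev: "\<And>x y. (x, y) \<in> R \<Longrightarrow> eventually (\<lambda>n. key n x = key n y) sequentially"
  shows "amenable_group (lamplighter M R) (lamplighter_topology M R)"
proof -
  define G where "G n m x \<longleftrightarrow> (\<exists>i\<le>m. key n x = W i x)" for n m x
  have [measurable]: "Measurable.pred M (G n m)" for n m unfolding G_def by measurable
  have "\<exists>m. prob {x \<in> space M. \<not> G n m x} < (1/2)^n" for n
  proof -
    have "eventually (\<lambda>m. x \<notin> {x \<in> space M. \<not> G n m x}) sequentially" if x: "x \<in> space M" for x
    proof -
      obtain i where "key n x = W i x" using R_W[OF key_R[OF x]] by blast
      then show ?thesis unfolding eventually_sequentially G_def by (intro exI[of _ i]) auto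
    qed
    then have "(\<lambda>m. prob {x \<in> space M. \<not> G n m x}) \<longlonglongrightarrow> 0"
      by (intro measure_tendsto_zeroI AE_I2) auto
    from order_tendstoD(2)[OF this, of "(1/2)^n"] show ?thesis by (auto simp: eventually_sequentially)
  qed
  \<comment> \<open>With errors below 2^(-n), Borel-Cantelli gives that almost every point fails the
    bound \<open>L n\<close> only finitely often.\<close>
  then obtain L where L: "\<And>n. prob {x \<in> space M. \<not> G n (L n) x} < (1/2)^n" by metis
  define F where "F n = {p \<in> space (M \<Otimes>\<^sub>M M). fst p = snd p \<or>
     G n (L n) (fst p) \<and> G n (L n) (snd p) \<and> key n (fst p) = key n (snd p)}" for n
  have F_iff: "(x, y) \<in> F n \<longleftrightarrow> x \<in> space M \<and> y \<in> space M \<and>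
      (x = y \<or> G n (L n) x \<and> G n (L n) y \<and> key n x = key n y)" for x y n
    by (auto simp: F_def space_pair_measure)
  have G_ev: "AE x in M. eventually (\<lambda>n. G n (L n) x) sequentially"
  proof -
    have "summable (\<lambda>n. prob {x \<in> space M. \<not> G n (L n) x})"
      by (rule summable_comparison_test'[OF summable_geometric[of "1/2"], of 0]) (use L less_imp_le in auto)
    then have "AE x in M. eventually (\<lambda>n. x \<in> space M - {x \<in> space M. \<not> G n (L n) x}) sequentially"
      by (intro borel_cantelli_AE1) (auto simp: less_top[symmetric])
    then show ?thesis by eventually_elim (auto elim: eventually_mono)
  qed
  show ?thesis
  \<comment> \<open>At most one point for each of the indices 0 to \<open>L n\<close>, and x itself,
    which is always related to itself.\<close>
  proof (rule amenable_lamplighter[of F "\<lambda>n. L n + 2"])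
    fix n
    show "equiv (space M) (F n)"
      by (rule equivI) (auto simp: refl_on_def sym_def trans_def F_iff)
    show "F n \<subseteq> R"
    proof
      fix p assume p: "p \<in> F n"
      obtain x y where xy: "p = (x, y)" by (cases p)
      have sp: "x \<in> space M" "y \<in> space M" using p by (auto simp: xy F_iff)
      have "x = y \<or> key n x = key n y" using p by (auto simp: xy F_iff)
      then show "p \<in> R"
      proof
        assume "key n x = key n y"
        then show ?thesis unfolding xy using R_trans[OF key_R[OF sp(1)]] R_sym[OF key_R[OF sp(2)]] by metis
      qed (use R_refl sp xy in auto)
    qed
    show "F n \<in> sets (M \<Otimes>\<^sub>M M)" unfolding F_def by measurable
    fix x assume x: "x \<in> space M"
    have sub: "F n `` {x} \<subseteq> insert x (\<Union>i\<in>{..L n}. {y \<in> space M. W i y = key n x})"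
    proof
      fix y assume "y \<in> F n `` {x}"
      then have "y = x \<or> (y \<in> space M \<and> G n (L n) y \<and> key n x = key n y)" by (auto simp: F_iff)
      then consider "y = x" | i where "y \<in> space M" "i \<le> L n" "W i y = key n x"
        unfolding G_def by metis
      then show "y \<in> insert x (\<Union>i\<in>{..L n}. {y \<in> space M. W i y = key n x})" by cases auto
    qed
    have c: "finite {y \<in> space M. W i y = key n x} \<and> card {y \<in> space M. W i y = key n x} \<le> 1" for i
    proof -
      have "\<exists>z. {y \<in> space M. W i y = key n x} \<subseteq> {z}"
      proof (cases "\<exists>z\<in>space M. W i z = key n x")
        case True
        then obtain z where "z \<in> space M" "W i z = key n x" by blast
        then have "y = z" if "y \<in> space M" "W i y = key n x" for y
          by (intro inj_onD[OF inj[of i] _ that(1)]) (simp_all add: that(2))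
        then have "{y \<in> space M. W i y = key n x} \<subseteq> {z}" by blast
        then show ?thesis by blast
      qed blast
      then obtain z where z: "{y \<in> space M. W i y = key n x} \<subseteq> {z}" by blast
      have "finite {z}" by simp
      from finite_subset[OF z this] card_mono[OF this z] show ?thesis by simp
    qed
    have fin: "finite (insert x (\<Union>i\<in>{..L n}. {y \<in> space M. W i y = key n x}))" using c by auto
    have "card (insert x (\<Union>i\<in>{..L n}. {y \<in> space M. W i y = key n x}))
        \<le> Suc (card (\<Union>i\<in>{..L n}. {y \<in> space M. W i y = key n x}))"
      by (rule card_insert_le_m1) auto
    also have "card (\<Union>i\<in>{..L n}. {y \<in> space M. W i y = key n x}) \<le> (\<Sum>i\<in>{..L n}. card {y \<in> space M. W i y = key n x})"
      by (rule card_UN_le) simp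
    also have "\<dots> \<le> (\<Sum>i\<in>{..L n}. 1)" by (intro sum_mono) (use c in blast)
    finally show "finite (F n `` {x}) \<and> card (F n `` {x}) \<le> L n + 2"
      using card_mono[OF fin sub] finite_subset[OF sub fin] by simp
  next
    fix g assume [measurable]: "g \<in> M \<rightarrow>\<^sub>M M" and gR: "AE x in M. (x, g x) \<in> R"
    show "(\<lambda>n. prob {x \<in> space M. (x, g x) \<notin> F n}) \<longlonglongrightarrow> 0"
    proof (rule measure_tendsto_zeroI)
      fix n
      have "Measurable.pred M (\<lambda>x. x = g x \<or> G n (L n) x \<and> G n (L n) (g x) \<and> key n x = key n (g x))"
        by measurable
      moreover have "{x \<in> space M. (x, g x) \<notin> F n} =
          {x \<in> space M. \<not> (x = g x \<or> G n (L n) x \<and> G n (L n) (g x) \<and> key n x = key n (g x))}"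
        using measurable_space[OF \<open>g \<in> M \<rightarrow>\<^sub>M M\<close>] by (auto simp: F_iff)
      ultimately show "{x \<in> space M. (x, g x) \<notin> F n} \<in> sets M" by simp
    next
      show "AE x in M. eventually (\<lambda>n. x \<notin> {x \<in> space M. (x, g x) \<notin> F n}) sequentially"
        using gR G_ev AE_compose[OF G_ev gR]
      proof eventually_elim
        case (elim x)
        have sp: "x \<in> space M" "g x \<in> space M" using elim(1) R_space by auto
        show ?case using elim(2,3) key_ev[OF elim(1)]
          by eventually_elim (use sp in \<open>auto simp: F_iff\<close>)
      qed
    qed
  qed
qed

end

section \<open>The free group acting on its boundary\<close>

instance letter :: countable by countable_datatype

lemma UNIV_letter: "(UNIV :: letter set) = {La, Lb, La', Lb'}"
  using letter.exhaust by auto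

instance letter :: finite by standard (simp add: UNIV_letter)

lemma inv_letter_inv_letter [simp]: "inv_letter (inv_letter s) = s"
  by (cases s) auto

lemma inv_letter_neq [simp]: "inv_letter s \<noteq> s" "s \<noteq> inv_letter s"
  by (cases s; simp)+

lemma inv_letter_eq_iff: "inv_letter s = t \<longleftrightarrow> s = inv_letter t"
  by (cases s; cases t) auto

lemma reduced_successively: "reduced w \<longleftrightarrow> successively (\<lambda>a b. b \<noteq> inv_letter a) w"
  by (simp add: reduced_def successively_conv_nth)

lemma reduced_Nil [simp]: "reduced []"
  by (simp add: reduced_def)

lemma reduced_Cons: "reduced (s # w) \<longleftrightarrow> reduced w \<and> (w = [] \<or> hd w \<noteq> inv_letter s)"
  by (cases w) (auto simp: reduced_successively)

lemma reduced_snoc: "reduced (w @ [s]) \<longleftrightarrow> reduced w \<and> (w = [] \<or> s \<noteq> inv_letter (last w))"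
  by (auto simp: reduced_successively successively_append_iff)

lemma reduced_butlast: "reduced w \<Longrightarrow> reduced (butlast w)"
  by (cases w rule: rev_cases) (auto simp: reduced_snoc)

lemma reduced_push: "reduced w \<Longrightarrow> reduced (push s w)"
  by (cases w) (auto simp: reduced_Cons)

lemma push_cancel: "reduced w \<Longrightarrow> push s (push (inv_letter s) w) = w"
  by (cases w; cases "tl w") (auto simp: reduced_Cons)

lemma reduced_foldr_push: "reduced v \<Longrightarrow> reduced (foldr push w v)"
  by (induction w) (auto simp: reduced_push)

text \<open>Associativity for a single letter on the left: if the letter cancels against the first
  letter of w, it also cancels after the rest of w has acted.\<close>

lemma foldr_push_push: "reduced v \<Longrightarrow> foldr push (push s w) v = push s (foldr push w v)"
  using push_cancel[OF reduced_foldr_push[of v "tl w"], of s] by (cases w) auto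

text \<open>Right multiplication of a reduced word by one letter, that is, one step of the random
  walk; \<open>push\<close> multiplies on the left.\<close>

definition rpush :: "letter list \<Rightarrow> letter \<Rightarrow> letter list" where
  "rpush w s = (if w \<noteq> [] \<and> last w = inv_letter s then butlast w else w @ [s])"

lemma foldr_push_single: "reduced w \<Longrightarrow> foldr push w [s] = rpush w s"
proof (induction w)
  case (Cons t w)
  then have IH: "foldr push w [s] = rpush w s" "reduced w" "w = [] \<or> hd w \<noteq> inv_letter t"
    by (auto simp: reduced_Cons)
  show ?case
  proof (cases "w = []")
    case True
    then show ?thesis by (auto simp: rpush_def inv_letter_eq_iff)
  next
    case False
    then obtain a w' where w: "w = a # w'" by (cases w) auto
    have "foldr push (t # w) [s] = push t (rpush w s)" by (simp add: IH(1))
    also have "\<dots> = rpush (t # w) s" using IH(3) by (cases "w' = []") (auto simp: w rpush_def)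
    finally show ?thesis .
  qed
qed (simp add: rpush_def)

lemma reduced_rpush: "reduced w \<Longrightarrow> reduced (rpush w s)"
  by (auto simp: rpush_def reduced_butlast reduced_snoc inv_letter_eq_iff)

text \<open>At a nonempty word one letter shortens and three lengthen, so the mean of 2^(-length) is
  multiplied by (2 + 3/2) / 4 = 7/8; at the empty word the factor is 1/2. Both the convergence of
  the walk and the failure of Kesten's property rest on this estimate.\<close>

lemma sum_half_length_rpush:
  "(\<Sum>s\<in>UNIV. (1/2 :: real) ^ length (rpush w s)) \<le> 4 * (7/8 * (1/2) ^ length w)"
proof (cases "w = []")
  case True
  then show ?thesis by (simp add: rpush_def UNIV_letter)
next
  case False
  then obtain m where m: "length w = Suc m" by (cases w) auto
  show ?thesis
    using False by (cases "last w") (simp_all add: rpush_def UNIV_letter m)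
qed

lemma stream_eqI: "(\<And>n. x !! n = y !! n) \<Longrightarrow> x = y"
  by (metis ext stream_smap_nats)

lemma boundary_Stream: "s ## x \<in> boundary \<longleftrightarrow> x \<in> boundary \<and> shd x \<noteq> inv_letter s"
proof
  assume *: "s ## x \<in> boundary"
  show "x \<in> boundary \<and> shd x \<noteq> inv_letter s"
  proof
    show "x \<in> boundary" unfolding boundary_def
    proof (clarify)
      fix i assume "x !! Suc i = inv_letter (x !! i)"
      then have "(s ## x) !! Suc (Suc i) = inv_letter ((s ## x) !! Suc i)" by simp
      then show False using * unfolding boundary_def by blast
    qed
    show "shd x \<noteq> inv_letter s" using * unfolding boundary_def by (auto dest: spec[of _ 0])
  qed
next
  assume *: "x \<in> boundary \<and> shd x \<noteq> inv_letter s"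
  have "(s ## x) !! Suc i \<noteq> inv_letter ((s ## x) !! i)" for i
    using * by (cases i) (auto simp: boundary_def)
  then show "s ## x \<in> boundary" by (simp add: boundary_def)
qed

lemma stl_boundary: "x \<in> boundary \<Longrightarrow> stl x \<in> boundary"
  using boundary_Stream[of "shd x" "stl x"] by simp

lemma sdrop_boundary: "x \<in> boundary \<Longrightarrow> sdrop n x \<in> boundary"
  by (induction n arbitrary: x) (auto intro: stl_boundary)

lemma push_boundary_in: "x \<in> boundary \<Longrightarrow> push_boundary s x \<in> boundary"
  by (simp add: push_boundary_def stl_boundary boundary_Stream)

lemma push_boundary_cancel:
  assumes "x \<in> boundary"
  shows "push_boundary s (push_boundary (inv_letter s) x) = x"
proof (cases "shd x = s")
  case True
  have "shd (stl x) \<noteq> inv_letter (shd x)" using boundary_Stream[of "shd x" "stl x"] assms by simp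
  then show ?thesis using True by (simp add: push_boundary_def) (metis stream.collapse)
qed (simp add: push_boundary_def)

lemma push_boundary_cancel': "x \<in> boundary \<Longrightarrow> push_boundary (inv_letter s) (push_boundary s x) = x"
  using push_boundary_cancel[of x "inv_letter s"] by simp

lemma boundary_action_simps [simp]:
  "boundary_action [] x = x"
  "boundary_action (s # w) x = push_boundary s (boundary_action w x)"
  by (simp_all add: boundary_action_def)

lemma boundary_action_append: "boundary_action (v @ w) x = boundary_action v (boundary_action w x)"
  by (simp add: boundary_action_def)

lemma boundary_action_in: "x \<in> boundary \<Longrightarrow> boundary_action w x \<in> boundary"
  by (induction w) (auto simp: push_boundary_in)

lemma boundary_action_push:
  assumes "x \<in> boundary"
  shows "boundary_action (push s w) x = push_boundary s (boundary_action w x)"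
  using push_boundary_cancel[OF boundary_action_in[OF assms, of "tl w"], of s] by (cases w) auto

definition inv_word :: "letter list \<Rightarrow> letter list" where
  "inv_word w = rev (map inv_letter w)"

lemma inv_word_Cons: "inv_word (s # w) = inv_word w @ [inv_letter s]"
  by (simp add: inv_word_def)

lemma boundary_action_inv_word:
  "x \<in> boundary \<Longrightarrow> boundary_action (inv_word w) (boundary_action w x) = x"
proof (induction w)
  case (Cons s w)
  then show ?case
    by (simp add: inv_word_Cons boundary_action_append push_boundary_cancel' boundary_action_in)
qed (simp add: inv_word_def)

lemma boundary_action_reduce:
  assumes "x \<in> boundary"
  shows "\<exists>v. reduced v \<and> boundary_action v x = boundary_action w x"
proof -
  have "boundary_action (foldr push w []) x = boundary_action w x"
    by (induction w) (simp_all add: boundary_action_push assms)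
  then show ?thesis using reduced_foldr_push[OF reduced_Nil] by blast
qed

lemma boundary_action_stake: "y \<in> boundary \<Longrightarrow> boundary_action (stake n y) (sdrop n y) = y"
proof (induction n arbitrary: y)
  case (Suc n)
  have "shd (stl y) \<noteq> inv_letter (shd y)" using boundary_Stream[of "shd y" "stl y"] Suc.prems by simp
  then show ?case using Suc.IH[OF stl_boundary[OF Suc.prems]] by (simp add: push_boundary_def)
qed simp

lemma push_boundary_tail: "\<exists>m n. sdrop m x = sdrop n (push_boundary s x)"
proof (cases "shd x = inv_letter s")
  case True
  then have "sdrop 1 x = sdrop 0 (push_boundary s x)" by (simp add: push_boundary_def)
  then show ?thesis by blast
next
  case False
  then have "sdrop 0 x = sdrop 1 (push_boundary s x)" by (simp add: push_boundary_def)
  then show ?thesis by blast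
qed

lemma tail_trans:
  assumes "\<exists>m n. sdrop m x = sdrop n y" "\<exists>m n. sdrop m y = sdrop n z"
  shows "\<exists>m n. sdrop m x = sdrop n z"
proof -
  obtain a b c d where "sdrop a x = sdrop b y" "sdrop c y = sdrop d z" using assms by blast
  then have "sdrop (a + c) x = sdrop (b + c) y" "sdrop (c + b) y = sdrop (d + b) z"
    by (metis sdrop_add)+
  then show ?thesis by (metis add.commute)
qed

lemma boundary_action_tail: "\<exists>m n. sdrop m x = sdrop n (boundary_action w x)"
proof (induction w)
  case (Cons s w)
  then show ?case using tail_trans push_boundary_tail[of "boundary_action w x" s] by simp
qed auto

lemma orbit_relation_iff_action:
  "(x, y) \<in> orbit_relation \<longleftrightarrow> x \<in> boundary \<and> (\<exists>w. y = boundary_action w x)"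
  using boundary_action_reduce[of x] by (auto simp: orbit_relation_def F2_def) metis

text \<open>A letter only adds or removes the first entry, so orbits preserve tails. Conversely,
  removing the prefix of x by its inverse word and adding the prefix of y carries x to y.\<close>

lemma orbit_relation_iff_tail:
  "(x, y) \<in> orbit_relation \<longleftrightarrow> x \<in> boundary \<and> y \<in> boundary \<and> (\<exists>m n. sdrop m x = sdrop n y)"
proof
  assume "(x, y) \<in> orbit_relation"
  then show "x \<in> boundary \<and> y \<in> boundary \<and> (\<exists>m n. sdrop m x = sdrop n y)"
    using boundary_action_in boundary_action_tail by (auto simp: orbit_relation_iff_action)
next
  assume *: "x \<in> boundary \<and> y \<in> boundary \<and> (\<exists>m n. sdrop m x = sdrop n y)"
  then obtain m n where mn: "sdrop m x = sdrop n y" by blast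
  have "sdrop m x = boundary_action (inv_word (stake m x)) x"
    using boundary_action_inv_word[OF sdrop_boundary[of x m], of "stake m x"] boundary_action_stake[of x m] * by simp
  then have "y = boundary_action (stake n y @ inv_word (stake m x)) x"
    using boundary_action_stake[of y n] * mn by (simp add: boundary_action_append)
  then show "(x, y) \<in> orbit_relation" using * by (auto simp: orbit_relation_iff_action)
qed

lemma equiv_orbit_relation: "equiv boundary orbit_relation"
proof (rule equivI)
  show "trans orbit_relation"
    unfolding trans_def orbit_relation_iff_tail using tail_trans by blast
  show "sym orbit_relation" unfolding sym_def orbit_relation_iff_tail by metis
qed (auto simp: refl_on_def orbit_relation_iff_tail)

text \<open>All words are enumerated, reduced or not; an unreduced word acts like its reduction, so
  the orbits are the same.\<close>

definition orbit_map :: "nat \<Rightarrow> letter stream \<Rightarrow> letter stream" where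
  "orbit_map n = boundary_action (from_nat n)"

lemma orbit_relation_eq_orbit_map:
  "orbit_relation = {(x, orbit_map n x) | x n. x \<in> boundary}"
proof -
  have "(\<exists>w. y = boundary_action w x) \<longleftrightarrow> (\<exists>n. y = orbit_map n x)" for x y
    unfolding orbit_map_def by (metis from_nat_to_nat)
  then show ?thesis by (auto simp: orbit_relation_iff_action)
qed

lemma boundary_action_inj: "inj_on (boundary_action w) boundary"
  by (rule inj_on_inverseI[of _ "boundary_action (inv_word w)"]) (rule boundary_action_inv_word)

section \<open>The hitting measure\<close>

abbreviation letters :: "letter stream measure" where
  "letters \<equiv> stream_space (count_space UNIV)"

abbreviation steps_space :: "letter list stream measure" where
  "steps_space \<equiv> stream_space (measure_pmf srw_step)"

lemma prob_space_steps: "prob_space steps_space"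
  by (rule prob_space.prob_space_stream_space[OF prob_space_measure_pmf])

lemma sets_steps_space [measurable_cong]: "sets steps_space = sets (stream_space (count_space UNIV))"
  by (rule sets_stream_space_cong) simp

lemma space_steps_space [simp]: "space steps_space = UNIV"
  by (simp add: space_stream_space)

lemma space_letters [simp]: "space letters = UNIV"
  by (simp add: space_stream_space)

lemma pred_letter_eq [measurable (raw)]:
  fixes f g :: "'a \<Rightarrow> letter"
  assumes [measurable]: "f \<in> measurable N (count_space UNIV)" "g \<in> measurable N (count_space UNIV)"
  shows "Measurable.pred N (\<lambda>x. f x = g x)"
proof -
  have "Measurable.pred N (\<lambda>x. \<exists>l. f x = l \<and> g x = l)" by measurable
  then show ?thesis by simp
qed

lemma boundary_sets [measurable]: "boundary \<in> sets letters"
proof -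
  have "Measurable.pred letters (\<lambda>x. \<forall>i. x !! Suc i \<noteq> inv_letter (x !! i))"
    by (intro pred_intros_countable pred_intros_logic pred_letter_eq measurable_compose[OF _ measurable_count_space])
       measurable
  then show ?thesis by (simp add: boundary_def pred_def)
qed

lemma space_boundary_space [simp]: "space boundary_space = boundary"
  by (simp add: boundary_space_def space_restrict_space)

text \<open>An arbitrary starting word allows induction on the number of steps by conditioning on
  the first one.\<close>

primrec walk_from :: "letter list \<Rightarrow> letter list stream \<Rightarrow> nat \<Rightarrow> letter list" where
  "walk_from u \<omega> 0 = u"
| "walk_from u \<omega> (Suc n) = foldr push (walk_from u \<omega> n) (\<omega> !! n)"

lemma walk_eq: "walk \<omega> n = walk_from [] \<omega> n"
  by (induction n) (simp_all add: F2_def)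

lemma walk_from_Stream: "walk_from u (v ## \<omega>) (Suc n) = walk_from (foldr push u v) \<omega> n"
  by (induction n) simp_all

lemma walk_Stream: "walk (v ## \<omega>) (Suc n) = walk_from v \<omega> n"
  unfolding walk_eq walk_from_Stream by simp

lemma measurable_walk_from [measurable]:
  "(\<lambda>\<omega>. walk_from u \<omega> n) \<in> measurable steps_space (count_space UNIV)"
proof (induction n)
  case (Suc n)
  show ?case
    unfolding walk_from.simps
  proof (rule measurable_compose_countable[OF _ Suc])
    fix w show "(\<lambda>\<omega>. foldr push w (\<omega> !! n)) \<in> measurable steps_space (count_space UNIV)"
      by (rule measurable_compose[of "\<lambda>\<omega>. \<omega> !! n" _ "count_space UNIV"]) measurable
  qed
qed simp

lemma measurable_walk [measurable]: "(\<lambda>\<omega>. walk \<omega> n) \<in> measurable steps_space (count_space UNIV)"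
  unfolding walk_eq by measurable

lemma nn_integral_srw_step:
  "(\<integral>\<^sup>+ v. f v \<partial>measure_pmf srw_step) = (\<Sum>s\<in>UNIV. f [s]) / 4"
proof -
  have "(\<integral>\<^sup>+ v. f v \<partial>measure_pmf srw_step) = (\<Sum>v\<in>{[La], [Lb], [La'], [Lb']}. f v) / 4"
    unfolding srw_step_def by (subst nn_integral_pmf_of_set) auto
  also have "(\<Sum>v\<in>{[La], [Lb], [La'], [Lb']}. f v) = (\<Sum>s\<in>UNIV. f [s])" by (simp add: UNIV_letter)
  finally show ?thesis .
qed

lemma sum_ennreal_quarter:
  fixes f :: "letter \<Rightarrow> real"
  assumes "\<And>s. 0 \<le> f s"
  shows "(\<Sum>s\<in>UNIV. ennreal (f s)) / 4 = ennreal ((\<Sum>s\<in>UNIV. f s) / 4)"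
proof -
  have "(\<Sum>s\<in>UNIV. ennreal (f s)) = ennreal (\<Sum>s\<in>UNIV. f s)" by (rule sum_ennreal) (rule assms)
  moreover have "0 \<le> (\<Sum>s\<in>UNIV. f s)" by (rule sum_nonneg) (rule assms)
  ultimately show ?thesis using divide_ennreal[of "\<Sum>s\<in>UNIV. f s" 4] by simp
qed

lemma nn_integral_half_length:
  "reduced u \<Longrightarrow> (\<integral>\<^sup>+ \<omega>. ennreal ((1/2) ^ length (walk_from u \<omega> n)) \<partial>steps_space)
     \<le> ennreal ((7/8) ^ n * (1/2) ^ length u)"
proof (induction n arbitrary: u)
  case 0
  interpret prob_space steps_space by (rule prob_space_steps)
  show ?case by (simp add: emeasure_space_1[unfolded space_steps_space])
next
  case (Suc n)
  have "(\<lambda>\<omega>. ennreal ((1/2) ^ length (walk_from u \<omega> (Suc n)))) \<in> borel_measurable steps_space"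
    by (rule measurable_compose[OF measurable_walk_from]) simp
  then have "(\<integral>\<^sup>+ \<omega>. ennreal ((1/2) ^ length (walk_from u \<omega> (Suc n))) \<partial>steps_space) =
      (\<integral>\<^sup>+ v. (\<integral>\<^sup>+ \<omega>. ennreal ((1/2) ^ length (walk_from u (v ## \<omega>) (Suc n))) \<partial>steps_space) \<partial>measure_pmf srw_step)"
    by (rule prob_space.nn_integral_stream_space[OF prob_space_measure_pmf])
  also have "\<dots> = (\<Sum>s\<in>UNIV. (\<integral>\<^sup>+ \<omega>. ennreal ((1/2) ^ length (walk_from (rpush u s) \<omega> n)) \<partial>steps_space)) / 4"
    unfolding walk_from_Stream nn_integral_srw_step foldr_push_single[OF Suc.prems] ..
  also have "\<dots> \<le> (\<Sum>s\<in>UNIV. ennreal ((7/8) ^ n * (1/2) ^ length (rpush u s))) / 4"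
    by (intro divide_right_mono_ennreal sum_mono Suc.IH reduced_rpush Suc.prems)
  also have "\<dots> = ennreal ((7/8) ^ n * ((\<Sum>s\<in>UNIV. (1/2) ^ length (rpush u s)) / 4))"
    by (subst sum_ennreal_quarter) (simp_all add: sum_distrib_left[symmetric])
  also have "\<dots> \<le> ennreal ((7/8) ^ n * (7/8 * (1/2) ^ length u))"
    using sum_half_length_rpush[of u] by (intro ennreal_leI mult_left_mono) auto
  finally show ?case by (simp add: mult_ac)
qed

text \<open>The means of 2^(-length) have a finite sum, so almost surely the series over the
  trajectory converges and its terms tend to 0.\<close>

lemma AE_length_walk: "AE \<omega> in steps_space. \<forall>k. eventually (\<lambda>n. k < length (walk \<omega> n)) sequentially"
proof -
  let ?h = "\<lambda>n \<omega>. ennreal ((1/2) ^ length (walk \<omega> n))"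
  have m: "?h n \<in> borel_measurable steps_space" for n
    by (rule measurable_compose[OF measurable_walk]) simp
  have "(\<integral>\<^sup>+ \<omega>. suminf (\<lambda>n. ?h n \<omega>) \<partial>steps_space) = suminf (\<lambda>n. \<integral>\<^sup>+ \<omega>. ?h n \<omega> \<partial>steps_space)"
    by (rule nn_integral_suminf[OF m])
  also have "\<dots> \<le> suminf (\<lambda>n. ennreal ((7/8) ^ n))"
  proof (rule suminf_le)
    fix n show "(\<integral>\<^sup>+ \<omega>. ?h n \<omega> \<partial>steps_space) \<le> ennreal ((7/8) ^ n)"
      using nn_integral_half_length[of "[]" n] by (simp only: walk_eq reduced_Nil list.size power_0 mult_1_right simp_thms)
  qed (rule summableI)+
  also have "\<dots> = ennreal (suminf (\<lambda>n. (7/8) ^ n))" 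
    by (rule suminf_ennreal2) (simp, rule summable_geometric, simp)
  finally have "(\<integral>\<^sup>+ \<omega>. suminf (\<lambda>n. ?h n \<omega>) \<partial>steps_space) < \<top>"
    by (rule le_less_trans) (rule ennreal_less_top)
  then have "(\<integral>\<^sup>+ \<omega>. suminf (\<lambda>n. ?h n \<omega>) \<partial>steps_space) \<noteq> \<infinity>"
    unfolding infinity_ennreal_def by (rule less_imp_neq)
  then have "AE \<omega> in steps_space. suminf (\<lambda>n. ?h n \<omega>) \<noteq> \<infinity>"
    by (rule nn_integral_PInf_AE[rotated]) (rule borel_measurable_suminf_order[OF m])
  then show ?thesis
  proof eventually_elim
    case (elim \<omega>)
    have "summable (\<lambda>n. (1/2 :: real) ^ length (walk \<omega> n))"
      by (rule summable_suminf_not_top[OF _ elim[unfolded infinity_ennreal_def]]) simp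
    then have "(\<lambda>n. (1/2 :: real) ^ length (walk \<omega> n)) \<longlonglongrightarrow> 0" by (rule summable_LIMSEQ_zero)
    then have "eventually (\<lambda>n. (1/2 :: real) ^ length (walk \<omega> n) < (1/2) ^ k) sequentially" for k
      by (rule order_tendstoD(2)) simp
    then show ?case by (intro allI) (rule eventually_mono, assumption, simp)
  qed
qed

lemma AE_steps_single: "AE \<omega> in steps_space. \<forall>n. \<exists>s. \<omega> !! n = [s]"
proof -
  have "AE v in measure_pmf srw_step. \<exists>s. v = [s]"
    unfolding srw_step_def by (subst AE_measure_pmf_iff) auto
  then have "AE \<omega> in steps_space. stream_all (\<lambda>v. \<exists>s. v = [s]) \<omega>"
    by (intro prob_space.AE_stream_all[OF prob_space_measure_pmf]) auto
  then show ?thesis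
  proof eventually_elim
    case (elim \<omega>)
    then show ?case using snth_sset[of \<omega>] by (auto simp: stream.pred_set)
  qed
qed

lemma walk_from_reduced: "(\<And>n. \<exists>s. \<omega> !! n = [s]) \<Longrightarrow> reduced u \<Longrightarrow> reduced (walk_from u \<omega> n)"
proof (induction n)
  case (Suc n)
  obtain s where "\<omega> !! n = [s]" using Suc.prems by blast
  then show ?case using Suc by (simp add: foldr_push_single reduced_rpush)
qed simp

text \<open>Convergence of a single letter. Events of this kind are countable combinations of events
  of the walk, which is what makes the exit point measurable.\<close>

definition letter_limit :: "(nat \<Rightarrow> letter list) \<Rightarrow> nat \<Rightarrow> letter \<Rightarrow> bool" where
  "letter_limit Z i l \<longleftrightarrow> eventually (\<lambda>n. i < length (Z n) \<and> Z n ! i = l) sequentially"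

lemma letter_limit_unique: "letter_limit Z i l \<Longrightarrow> letter_limit Z i l' \<Longrightarrow> l = l'"
proof -
  assume "letter_limit Z i l" "letter_limit Z i l'"
  then have "eventually (\<lambda>n. l = l') sequentially"
    unfolding letter_limit_def by eventually_elim auto
  then show ?thesis by simp
qed

lemma converges_to_boundary_iff:
  "converges_to_boundary Z x \<longleftrightarrow> x \<in> boundary \<and> (\<forall>i. letter_limit Z i (x !! i))"
proof -
  have "(\<forall>k. eventually (\<lambda>n. take k (Z n) = stake k x) sequentially) \<longleftrightarrow> (\<forall>i. letter_limit Z i (x !! i))"
  proof safe
    fix i assume "\<forall>k. eventually (\<lambda>n. take k (Z n) = stake k x) sequentially"
    then have "eventually (\<lambda>n. take (Suc i) (Z n) = stake (Suc i) x) sequentially" by blast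
    then show "letter_limit Z i (x !! i)"
      unfolding letter_limit_def
    proof eventually_elim
      case (elim n)
      have "length (take (Suc i) (Z n)) = Suc i" unfolding elim by (rule length_stake)
      moreover have "take (Suc i) (Z n) ! i = x !! i" unfolding elim by (rule stake_nth) simp
      ultimately show ?case by (simp add: min_def split: if_splits)
    qed
  next
    fix k assume *: "\<forall>i. letter_limit Z i (x !! i)"
    have "eventually (\<lambda>n. \<forall>i\<in>{..<Suc k}. i < length (Z n) \<and> Z n ! i = x !! i) sequentially"
      using * by (intro eventually_ball_finite) (auto simp: letter_limit_def)
    then show "eventually (\<lambda>n. take k (Z n) = stake k x) sequentially"
    proof eventually_elim
      case (elim n)
      then have "k < length (Z n)" by auto
      then show ?case using elim by (intro nth_equalityI) auto
    qed
  qed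
  then show ?thesis by (simp add: converges_to_boundary_def)
qed

lemma converges_unique: "converges_to_boundary Z x \<Longrightarrow> converges_to_boundary Z y \<Longrightarrow> x = y"
  by (rule stream_eqI) (auto simp: converges_to_boundary_iff intro: letter_limit_unique)

lemma exit_point_eq: "converges_to_boundary (walk \<omega>) x \<Longrightarrow> exit_point \<omega> = x"
  unfolding exit_point_def using converges_unique by (auto intro!: the_equality)

text \<open>Convergence is stated without a quantifier over streams, so that only countably many
  events are involved.\<close>

lemma converges_iff_letter_limits:
  "(\<exists>x. converges_to_boundary Z x) \<longleftrightarrow> (\<forall>i. \<exists>l. letter_limit Z i l) \<and>
     (\<forall>i l l'. letter_limit Z i l \<longrightarrow> letter_limit Z (Suc i) l' \<longrightarrow> l' \<noteq> inv_letter l)"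
proof safe
  fix x i l assume "converges_to_boundary Z x"
  then show "\<exists>l. letter_limit Z i l" by (auto simp: converges_to_boundary_iff)
next
  fix x i l assume x: "converges_to_boundary Z x" and "letter_limit Z i l" "letter_limit Z (Suc i) (inv_letter l)"
  then have "x !! i = l" "x !! Suc i = inv_letter l"
    unfolding converges_to_boundary_iff using letter_limit_unique by blast+
  then show False using x by (auto simp: converges_to_boundary_iff boundary_def)
next
  assume *: "\<forall>i. \<exists>l. letter_limit Z i l"
    "\<forall>i l l'. letter_limit Z i l \<longrightarrow> letter_limit Z (Suc i) l' \<longrightarrow> l' \<noteq> inv_letter l"
  then obtain x where x: "\<And>i. letter_limit Z i (x i)" by metis
  have xi: "to_stream x !! i = x i" for i by (simp add: to_stream_def)
  have "x (Suc i) \<noteq> inv_letter (x i)" for i using *(2) x by blast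
  then have "converges_to_boundary Z (to_stream x)"
    unfolding converges_to_boundary_iff boundary_def mem_Collect_eq xi using x by blast
  then show "\<exists>x. converges_to_boundary Z x" by blast
qed

text \<open>A step changes only the end of the word, so once the length stays above a position, the
  letter there no longer changes. The limit is reduced because every word of the walk is.\<close>

lemma walk_converges:
  assumes len: "\<forall>k. eventually (\<lambda>n. k < length (walk \<omega> n)) sequentially"
    and single: "\<And>n. \<exists>s. \<omega> !! n = [s]"
  shows "\<exists>x. converges_to_boundary (walk \<omega>) x"
proof -
  have red: "reduced (walk \<omega> n)" for n unfolding walk_eq by (rule walk_from_reduced[OF single]) simp
  have lim: "\<exists>l. letter_limit (walk \<omega>) i l" for i
  proof -
    \<comment> \<open>One letter of slack beyond position i is needed, because a cancelling step
      removes the last letter.\<close>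
    obtain N where N: "\<And>n. n \<ge> N \<Longrightarrow> Suc i < length (walk \<omega> n)"
      using len by (auto simp: eventually_sequentially)
    have step: "walk \<omega> (Suc n) ! i = walk \<omega> n ! i" if "n \<ge> N" for n
    proof -
      obtain s where "\<omega> !! n = [s]" using single by blast
      then have "walk \<omega> (Suc n) = rpush (walk \<omega> n) s"
        using foldr_push_single[OF red] by (simp add: F2_def)
      then show ?thesis using N[OF that] by (auto simp: rpush_def nth_butlast nth_append)
    qed
    have shift: "walk \<omega> (N + d) ! i = walk \<omega> N ! i" for d
    proof (induction d)
      case (Suc d)
      have "walk \<omega> (Suc (N + d)) ! i = walk \<omega> (N + d) ! i" by (rule step) simp
      then show ?case using Suc unfolding add_Suc_right by (rule trans)
    qed simp
    have "i < length (walk \<omega> n) \<and> walk \<omega> n ! i = walk \<omega> N ! i" if "n \<ge> N" for n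
      using N[OF that] shift[of "n - N"] that by simp
    then have "letter_limit (walk \<omega>) i (walk \<omega> N ! i)"
      unfolding letter_limit_def eventually_sequentially by blast
    then show ?thesis by blast
  qed
  have "l' \<noteq> inv_letter l" if "letter_limit (walk \<omega>) i l" "letter_limit (walk \<omega>) (Suc i) l'" for i l l'
  proof -
    have "eventually (\<lambda>n. l' \<noteq> inv_letter l) sequentially"
      using that unfolding letter_limit_def
    proof eventually_elim
      case (elim n)
      have "walk \<omega> n ! Suc i \<noteq> inv_letter (walk \<omega> n ! i)"
        using red[of n] elim unfolding reduced_def by blast
      then show ?case using elim by metis
    qed
    then show ?thesis by simp
  qed
  with lim show ?thesis unfolding converges_iff_letter_limits by blast
qed

lemma AE_walk_converges:
  "AE \<omega> in steps_space. (\<forall>n. \<exists>s. \<omega> !! n = [s]) \<and> (\<exists>x. converges_to_boundary (walk \<omega>) x)"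
  using AE_length_walk AE_steps_single by eventually_elim (auto intro: walk_converges)

lemma pred_letter_limit [measurable]:
  "Measurable.pred steps_space (\<lambda>\<omega>. letter_limit (walk \<omega>) i l)"
proof -
  have "Measurable.pred steps_space (\<lambda>\<omega>. i < length (walk \<omega> n) \<and> walk \<omega> n ! i = l)" for n
    by (rule measurable_compose[OF measurable_walk]) simp
  then show ?thesis unfolding letter_limit_def eventually_sequentially by measurable
qed

lemma sconst_boundary: "sconst s \<in> boundary"
proof -
  have "sconst s !! n = s" for n by (induction n) simp_all
  then show ?thesis unfolding boundary_def by (auto simp del: snth.simps)
qed

text \<open>A letter of the exit point is read off from the limits of the letters of the walk; on
  trajectories that do not converge it is the constant letter \<open>La\<close>.\<close>

lemma exit_point_measurable [measurable]: "exit_point \<in> steps_space \<rightarrow>\<^sub>M boundary_space"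
  unfolding boundary_space_def
proof (rule measurable_restrict_space2)
  show "exit_point \<in> space steps_space \<rightarrow> boundary"
  proof
    fix \<omega> :: "letter list stream"
    show "exit_point \<omega> \<in> boundary"
    proof (cases "\<exists>x. converges_to_boundary (walk \<omega>) x")
      case True
      then show ?thesis using exit_point_eq by (auto simp: converges_to_boundary_def)
    qed (simp add: exit_point_def sconst_boundary)
  qed
  show "exit_point \<in> steps_space \<rightarrow>\<^sub>M letters"
  proof (rule measurable_stream_space2)
    fix k
    have sc: "sconst La !! n = La" for n by (induction n) simp_all
    let ?C = "\<lambda>\<omega>. \<exists>x. converges_to_boundary (walk \<omega>) x"
    have C: "Measurable.pred steps_space ?C" unfolding converges_iff_letter_limits by measurable
    have "exit_point \<omega> !! k = l \<longleftrightarrow> (?C \<omega> \<and> letter_limit (walk \<omega>) k l) \<or> (\<not> ?C \<omega> \<and> l = La)" for \<omega> l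
    proof (cases "?C \<omega>")
      case True
      then obtain x where x: "converges_to_boundary (walk \<omega>) x" by blast
      then have "letter_limit (walk \<omega>) k (x !! k)" by (simp add: converges_to_boundary_iff)
      then show ?thesis using True exit_point_eq[OF x] letter_limit_unique by blast
    qed (auto simp: exit_point_def sc)
    then have "exit_point -` {x. x !! k = l} = {\<omega>. (?C \<omega> \<and> letter_limit (walk \<omega>) k l) \<or> (\<not> ?C \<omega> \<and> l = La)}" for l
      by auto
    moreover have "{\<omega> \<in> space steps_space. (?C \<omega> \<and> letter_limit (walk \<omega>) k l) \<or> (\<not> ?C \<omega> \<and> l = La)} \<in> sets steps_space" for l
      using C by measurable
    ultimately have "(\<lambda>\<omega>. exit_point \<omega> !! k) -` {l} \<inter> space steps_space \<in> sets steps_space" for l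
      by (simp add: vimage_def)
    then show "(\<lambda>\<omega>. exit_point \<omega> !! k) \<in> measurable steps_space (count_space UNIV)"
      by (subst measurable_count_space_eq2_countable) auto
  qed
qed


section \<open>Stationarity, quasi-invariance and absence of atoms\<close>

lemma sets_hitting [measurable_cong]: "sets hitting_measure = sets boundary_space"
  by (simp add: hitting_measure_def)

lemma space_hitting [simp]: "space hitting_measure = boundary"
  by (simp add: hitting_measure_def)

lemma prob_space_hitting: "prob_space hitting_measure"
  unfolding hitting_measure_def
  by (rule prob_space.prob_space_distr[OF prob_space_steps exit_point_measurable])

lemma measurable_snth_boundary [measurable]: "(\<lambda>x. x !! n) \<in> measurable boundary_space (count_space UNIV)"
  unfolding boundary_space_def by (rule measurable_restrict_space1) measurable

lemma measurable_into_boundary_space: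
  assumes "\<And>x. x \<in> space N \<Longrightarrow> f x \<in> boundary" "\<And>n. (\<lambda>x. f x !! n) \<in> measurable N (count_space UNIV)"
  shows "f \<in> N \<rightarrow>\<^sub>M boundary_space"
  unfolding boundary_space_def
  using assms by (intro measurable_restrict_space2 measurable_stream_space2) auto

lemma push_boundary_measurable [measurable]: "push_boundary s \<in> boundary_space \<rightarrow>\<^sub>M boundary_space"
proof (rule measurable_into_boundary_space)
  fix n
  have m: "Measurable.pred boundary_space (\<lambda>x. x !! 0 = inv_letter s)" by measurable
  have m': "(\<lambda>x. case n of 0 \<Rightarrow> s | Suc k \<Rightarrow> x !! k) \<in> measurable boundary_space (count_space UNIV)"
    by (cases n) (simp_all add: measurable_snth_boundary)
  have "(\<lambda>x. if x !! 0 = inv_letter s then x !! Suc n else (case n of 0 \<Rightarrow> s | Suc k \<Rightarrow> x !! k))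
      \<in> measurable boundary_space (count_space UNIV)"
    by (rule measurable_If[OF measurable_snth_boundary m' m[unfolded pred_def]])
  moreover have "push_boundary s x !! n = (if x !! 0 = inv_letter s then x !! Suc n else (case n of 0 \<Rightarrow> s | Suc k \<Rightarrow> x !! k))" for x
    by (cases n) (simp_all add: push_boundary_def)
  ultimately show "(\<lambda>x. push_boundary s x !! n) \<in> measurable boundary_space (count_space UNIV)" by simp
qed (simp add: push_boundary_in)

text \<open>An additional first step multiplies the whole walk on the left, and left multiplication
  by a letter commutes with passing to the limit.\<close>

lemma exit_point_Stream:
  assumes single: "\<And>n. \<exists>s. \<omega> !! n = [s]" and x: "converges_to_boundary (walk \<omega>) x"
  shows "exit_point ([s] ## \<omega>) = push_boundary s (exit_point \<omega>)"
proof -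
  have push: "walk_from [s] \<omega> n = push s (walk \<omega> n)" for n
  proof (induction n)
    case (Suc n)
    obtain t where t: "\<omega> !! n = [t]" using single by blast
    have "reduced [t]" by (simp add: reduced_def)
    have "walk_from [s] \<omega> (Suc n) = foldr push (push s (walk \<omega> n)) [t]"
      by (simp only: walk_from.simps Suc.IH t)
    also have "\<dots> = push s (foldr push (walk \<omega> n) [t])"
      by (rule foldr_push_push[OF \<open>reduced [t]\<close>])
    also have "foldr push (walk \<omega> n) [t] = walk \<omega> (Suc n)"
      by (simp only: walk_eq walk_from.simps t)
    finally show ?case .
  qed (simp add: walk_eq)
  have xb: "x \<in> boundary" and lim: "\<And>i. letter_limit (walk \<omega>) i (x !! i)"
    using x by (auto simp: converges_to_boundary_iff)
  have "letter_limit (walk ([s] ## \<omega>)) i (push_boundary s x !! i)" for i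
  proof -
    have "eventually (\<lambda>n. i < length (walk ([s] ## \<omega>) (Suc n)) \<and> walk ([s] ## \<omega>) (Suc n) ! i = push_boundary s x !! i) sequentially"
      unfolding walk_Stream push
      \<comment> \<open>The letter at position 0 decides whether s cancels; the new letter at
        position i then comes from position i + 1 or from position i - 1.\<close>
      using lim[of 0, unfolded letter_limit_def] lim[of i, unfolded letter_limit_def] lim[of "Suc i", unfolded letter_limit_def]
        lim[of "i - 1", unfolded letter_limit_def]
    proof eventually_elim
      case (elim n)
      then obtain t w where w: "walk \<omega> n = t # w" by (cases "walk \<omega> n") auto
      then have "t = shd x" using elim by simp
      then show ?case using elim w by (cases i) (auto simp: push_boundary_def)
    qed
    then show ?thesis unfolding letter_limit_def by (rule eventually_sequentially_Suc[THEN iffD1])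
  qed
  then have "converges_to_boundary (walk ([s] ## \<omega>)) (push_boundary s x)"
    by (simp add: converges_to_boundary_iff push_boundary_in xb)
  then show ?thesis using exit_point_eq[OF x] exit_point_eq by simp
qed

text \<open>Conditioning on the first step of the walk: the exit point is the first letter applied
  to the exit point of the remaining walk.\<close>

lemma hitting_stationary:
  assumes E: "E \<in> sets boundary_space"
  shows "emeasure hitting_measure E = (\<Sum>s\<in>UNIV. emeasure hitting_measure (push_boundary s -` E \<inter> boundary)) / 4"
proof -
  have em: "emeasure hitting_measure A = (\<integral>\<^sup>+ \<omega>. indicator A (exit_point \<omega>) \<partial>steps_space)" if A: "A \<in> sets boundary_space" for A
  proof -
    have "emeasure hitting_measure A = (\<integral>\<^sup>+ x. indicator A x \<partial>hitting_measure)"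
      using A by (simp add: sets_hitting)
    also have "\<dots> = (\<integral>\<^sup>+ \<omega>. indicator A (exit_point \<omega>) \<partial>steps_space)"
      unfolding hitting_measure_def using A by (intro nn_integral_distr) auto
    finally show ?thesis .
  qed
  have inner: "(\<integral>\<^sup>+ \<omega>. indicator E (exit_point ([s] ## \<omega>)) \<partial>steps_space)
      = emeasure hitting_measure (push_boundary s -` E \<inter> boundary)" for s
  proof -
    have pE: "push_boundary s -` E \<inter> boundary \<in> sets boundary_space"
      using measurable_sets[OF push_boundary_measurable E] by simp
    have "(\<integral>\<^sup>+ \<omega>. indicator E (exit_point ([s] ## \<omega>)) \<partial>steps_space) =
        (\<integral>\<^sup>+ \<omega>. indicator (push_boundary s -` E \<inter> boundary) (exit_point \<omega>) \<partial>steps_space)"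
    proof (rule nn_integral_cong_AE, use AE_walk_converges in eventually_elim)
      case (elim \<omega>)
      then obtain x where x: "converges_to_boundary (walk \<omega>) x" by blast
      have "exit_point \<omega> \<in> boundary" using x exit_point_eq[OF x] by (simp add: converges_to_boundary_def)
      moreover have "exit_point ([s] ## \<omega>) = push_boundary s (exit_point \<omega>)"
        by (rule exit_point_Stream[OF _ x]) (use elim in blast)
      ultimately show ?case by (simp add: indicator_def)
    qed
    then show ?thesis unfolding em[OF pE] .
  qed
  have "(\<lambda>\<omega>. indicator E (exit_point \<omega>) :: ennreal) \<in> borel_measurable steps_space"
    by (rule measurable_compose[OF exit_point_measurable]) (use E in simp)
  then have "emeasure hitting_measure E =
      (\<integral>\<^sup>+ v. (\<integral>\<^sup>+ \<omega>. indicator E (exit_point (v ## \<omega>)) \<partial>steps_space) \<partial>measure_pmf srw_step)"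
    unfolding em[OF E] by (rule prob_space.nn_integral_stream_space[OF prob_space_measure_pmf])
  also have "\<dots> = (\<Sum>s\<in>UNIV. (\<integral>\<^sup>+ \<omega>. indicator E (exit_point ([s] ## \<omega>)) \<partial>steps_space)) / 4"
    by (rule nn_integral_srw_step)
  finally show ?thesis unfolding inner .
qed

text \<open>Stationarity writes the measure of \<open>A\<close> as an average of the measures of its
  four preimages; an average of nonnegative numbers vanishes only if all of them do.\<close>

lemma push_boundary_null:
  assumes "A \<in> null_sets hitting_measure"
  shows "push_boundary s -` A \<inter> boundary \<in> null_sets hitting_measure"
proof -
  have A: "A \<in> sets boundary_space" "emeasure hitting_measure A = 0"
    using assms by (auto simp: null_sets_def sets_hitting)
  then have "(\<Sum>s\<in>UNIV. emeasure hitting_measure (push_boundary s -` A \<inter> boundary)) = 0"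
    using hitting_stationary[OF A(1)] by (simp add: ennreal_divide_eq_0_iff)
  then have "emeasure hitting_measure (push_boundary s -` A \<inter> boundary) = 0"
    by (subst (asm) sum_eq_0_iff) auto
  then show ?thesis
    using measurable_sets[OF push_boundary_measurable A(1)] by (simp add: null_sets_def sets_hitting)
qed

lemma boundary_action_measurable [measurable]: "boundary_action w \<in> boundary_space \<rightarrow>\<^sub>M boundary_space"
proof (induction w)
  case (Cons s w)
  from measurable_compose[OF Cons push_boundary_measurable] show ?case by (simp add: fun_eq_iff[symmetric])
qed (simp add: fun_eq_iff[symmetric])

lemma boundary_action_null:
  "A \<in> null_sets hitting_measure \<Longrightarrow> boundary_action w -` A \<inter> boundary \<in> null_sets hitting_measure"
proof (induction w arbitrary: A)
  case (Cons s w)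
  have eq: "boundary_action (s # w) -` A \<inter> boundary = boundary_action w -` (push_boundary s -` A \<inter> boundary) \<inter> boundary"
    using boundary_action_in by auto
  show ?case unfolding eq by (rule Cons.IH[OF push_boundary_null[OF Cons.prems]])
next
  case Nil
  have "A \<subseteq> boundary" using Nil sets.sets_into_space[of A hitting_measure] by (auto simp: null_sets_def)
  then have "boundary_action [] -` A \<inter> boundary = A" by auto
  then show ?case using Nil by (simp only:)
qed

lemma orbit_map_measurable: "orbit_map n \<in> hitting_measure \<rightarrow>\<^sub>M hitting_measure"
  unfolding orbit_map_def using boundary_action_measurable
  by (simp cong: measurable_cong_sets add: sets_hitting)

lemma diagonal_boundary:
  "{p \<in> space (hitting_measure \<Otimes>\<^sub>M hitting_measure). fst p = snd p} \<in> sets (hitting_measure \<Otimes>\<^sub>M hitting_measure)"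
proof -
  have [measurable]: "(\<lambda>x. x !! n) \<in> measurable hitting_measure (count_space UNIV)" for n
    using measurable_snth_boundary by (simp cong: measurable_cong_sets add: sets_hitting)
  have "Measurable.pred (hitting_measure \<Otimes>\<^sub>M hitting_measure) (\<lambda>p. \<forall>n. fst p !! n = snd p !! n)"
    by measurable
  moreover have "(\<forall>n. fst p !! n = snd p !! n) \<longleftrightarrow> fst p = snd p" for p :: "letter stream \<times> letter stream"
    using stream_eqI by auto
  ultimately show ?thesis by (simp add: pred_def)
qed

lemma nonsingular_relation_hitting: "nonsingular_relation hitting_measure orbit_map orbit_relation"
proof -
  interpret prob_space hitting_measure by (rule prob_space_hitting)
  show ?thesis
  proof
    show "orbit_map n \<in> hitting_measure \<rightarrow>\<^sub>M hitting_measure" for n by (rule orbit_map_measurable)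
    show "orbit_map n -` A \<inter> space hitting_measure \<in> null_sets hitting_measure"
      if "A \<in> null_sets hitting_measure" for A n
      using boundary_action_null[OF that] by (simp add: orbit_map_def)
    show "orbit_relation = {(x, orbit_map n x) |x n. x \<in> space hitting_measure}"
      unfolding space_hitting by (rule orbit_relation_eq_orbit_map)
    show "equiv (space hitting_measure) orbit_relation"
      unfolding space_hitting by (rule equiv_orbit_relation)
  qed (rule diagonal_boundary)
qed

lemma singleton_sets: "x \<in> boundary \<Longrightarrow> {x} \<in> sets boundary_space"
proof -
  assume x: "x \<in> boundary"
  have "Measurable.pred boundary_space (\<lambda>y. \<forall>n. y !! n = x !! n)" by measurable
  moreover have "{y \<in> boundary. \<forall>n. y !! n = x !! n} = {x}" using x stream_eqI by auto
  ultimately show ?thesis by (simp add: pred_def)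
qed

text \<open>A maximum principle: by stationarity the atoms of greatest mass form a finite set
  invariant under all letters. Doubling the first letter then permutes this set, so its members are
  constant streams, and another letter in front contradicts that.\<close>

lemma hitting_atomless: "measure hitting_measure {x} = 0"
proof (rule ccontr)
  interpret prob_space hitting_measure by (rule prob_space_hitting)
  assume "measure hitting_measure {x} \<noteq> 0"
  define a where "a y = measure hitting_measure {y}" for y
  have ax: "a x > 0" using \<open>measure hitting_measure {x} \<noteq> 0\<close> by (simp add: a_def zero_less_measure_iff)
  have "{x} \<in> sets hitting_measure" using \<open>measure hitting_measure {x} \<noteq> 0\<close> measure_notin_sets by blast
  then have xb: "x \<in> boundary" using sets.sets_into_space by fastforce
  \<comment> \<open>The total mass is one, so fewer than n atoms of mass at least c exist once n * c
    > 1. This is what lets the maximum be attained, and by finitely many points.\<close>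
  have fin: "finite {y \<in> boundary. c \<le> a y}" if "c > 0" for c
  proof (rule ccontr)
    assume inf: "infinite {y \<in> boundary. c \<le> a y}"
    obtain n :: nat where n: "1 < real n * c" using ex_less_of_nat_mult[OF \<open>c > 0\<close>] by blast
    obtain B where B: "finite B" "card B = n" "B \<subseteq> {y \<in> boundary. c \<le> a y}"
      using infinite_arbitrarily_large[OF inf] by blast
    have "real n * c = (\<Sum>y\<in>B. c)" by (simp add: B)
    also have "\<dots> \<le> (\<Sum>y\<in>B. a y)" by (rule sum_mono) (use B in auto)
    also have "\<dots> = prob B"
      unfolding a_def using B by (intro finite_measure_eq_sum_singleton[symmetric]) (auto simp: sets_hitting singleton_sets)
    also have "\<dots> \<le> 1" by simp
    finally show False using n by simp
  qed
  have avg: "4 * a y = (\<Sum>s\<in>UNIV. a (push_boundary (inv_letter s) y))" if y: "y \<in> boundary" for y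
  proof -
    have v: "push_boundary s -` {y} \<inter> boundary = {push_boundary (inv_letter s) y}" for s
      using push_boundary_cancel'[of _ s] push_boundary_cancel[OF y, of s] push_boundary_in[OF y] by auto
    have "emeasure hitting_measure {y} = (\<Sum>s\<in>UNIV. emeasure hitting_measure {push_boundary (inv_letter s) y}) / 4"
      using hitting_stationary[OF singleton_sets[OF y]] by (simp add: v)
    then have "ennreal (a y) = (\<Sum>s\<in>UNIV. ennreal (a (push_boundary (inv_letter s) y))) / 4"
      by (simp add: a_def emeasure_eq_measure)
    also have "\<dots> = ennreal ((\<Sum>s\<in>UNIV. a (push_boundary (inv_letter s) y)) / 4)"
      by (rule sum_ennreal_quarter) (simp add: a_def)
    finally have "a y = (\<Sum>s\<in>UNIV. a (push_boundary (inv_letter s) y)) / 4"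
      by (subst (asm) ennreal_inj) (auto simp: a_def sum_nonneg)
    then show ?thesis by simp
  qed
  define m where "m = Max (a ` {y \<in> boundary. a x \<le> a y})"
  have ne: "a ` {y \<in> boundary. a x \<le> a y} \<noteq> {}" using xb by auto
  have m_ge: "a y \<le> m" if "y \<in> boundary" for y
  proof (cases "a x \<le> a y")
    case True
    then show ?thesis unfolding m_def using fin[OF ax] that by (intro Max_ge) auto
  next
    case False
    have "a x \<le> m" unfolding m_def using fin[OF ax] xb by (intro Max_ge) auto
    with False show ?thesis by simp
  qed
  define S where "S = {y \<in> boundary. a y = m}"
  have "m > 0" using m_ge[OF xb] ax by simp
  have "S \<subseteq> {y \<in> boundary. m \<le> a y}" by (auto simp: S_def)
  then have finS: "finite S" using fin[OF \<open>m > 0\<close>] finite_subset by blast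
  have "m \<in> a ` {y \<in> boundary. a x \<le> a y}" unfolding m_def using fin[OF ax] ne by (intro Max_in) auto
  then have "S \<noteq> {}" by (auto simp: S_def)
  have S_push: "push_boundary s y \<in> S" if y: "y \<in> S" for s y
  proof -
    have yb: "y \<in> boundary" "a y = m" using y by (auto simp: S_def)
    \<comment> \<open>The four masses have mean m and none exceeds m, so all of them equal
      m.\<close>
    have "(\<Sum>s\<in>UNIV. m - a (push_boundary (inv_letter s) y)) = 0"
      using avg[OF yb(1)] yb(2) by (simp add: sum_subtractf UNIV_letter)
    then have "m - a (push_boundary (inv_letter (inv_letter s)) y) = 0"
      by (subst (asm) sum_nonneg_eq_0_iff) (auto simp: m_ge push_boundary_in yb(1) simp del: inv_letter_inv_letter)
    then show ?thesis using push_boundary_in[OF yb(1)] by (simp add: S_def)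
  qed
  \<comment> \<open>Doubling is injective and maps the finite set \<open>S\<close> into itself,
    hence onto. Every member of \<open>S\<close> is therefore a doubled stream of arbitrarily high
    order.\<close>
  define T where "T y = shd y ## y" for y :: "letter stream"
  have "T ` S \<subseteq> S"
  proof
    fix z assume "z \<in> T ` S"
    then obtain y where "y \<in> S" "z = T y" by blast
    then show "z \<in> S" using S_push[of y "shd y"] by (simp add: T_def push_boundary_def)
  qed
  moreover have "inj_on T S" by (rule inj_onI) (simp add: T_def)
  ultimately have TS: "T ` S = S" using finS endo_inj_surj by blast
  have const: "y !! n = shd y \<and> stl y \<in> S" if "y \<in> S" for y n
    using that
  proof (induction n arbitrary: y)
    case 0
    then obtain z where "z \<in> S" "y = T z" using TS by blast
    then show ?case by (simp add: T_def)
  next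
    case (Suc n)
    then obtain z where z: "z \<in> S" "y = T z" using TS by blast
    then show ?case using Suc.IH[OF z(1)] by (simp add: T_def)
  qed
  obtain y where y: "y \<in> S" using \<open>S \<noteq> {}\<close> by blast
  \<comment> \<open>A letter that neither equals the first letter of y nor cancels it, so that s
    followed by y lies in \<open>S\<close> without being constant.\<close>
  obtain s where s: "s \<noteq> shd y" "shd y \<noteq> inv_letter s"
    by (cases "shd y") (metis inv_letter.simps letter.distinct)+
  have "s ## y \<in> S" using S_push[OF y, of s] s by (simp add: push_boundary_def)
  from const[OF this, of 1] s show False by simp
qed

section \<open>The shift structure of the boundary\<close>

lemma measurable_hitting: "measurable hitting_measure N = measurable boundary_space N"
  by (rule measurable_cong_sets[OF sets_hitting refl])

lemma measurable_hitting_hitting: "measurable hitting_measure hitting_measure = measurable boundary_space boundary_space"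
  by (rule measurable_cong_sets[OF sets_hitting sets_hitting])

interpretation hm: nonsingular_relation hitting_measure orbit_map orbit_relation
  by (rule nonsingular_relation_hitting)

lemma AE_hitting_countable:
  assumes "countable C" shows "AE x in hitting_measure. x \<notin> C"
proof -
  have "AE x in hitting_measure. x \<noteq> c" for c
  proof (cases "c \<in> boundary")
    case True
    then have "{c} \<in> null_sets hitting_measure"
      using singleton_sets[OF True] hitting_atomless[of c]
      by (auto simp: null_sets_def sets_hitting hm.emeasure_eq_measure)
    from AE_not_in[OF this] show ?thesis by simp
  next
    case False
    then show ?thesis using AE_space[of hitting_measure] by (auto elim: AE_mp)
  qed
  then have "AE x in hitting_measure. \<forall>c\<in>C. x \<noteq> c" by (simp add: AE_ball_countable[OF assms])
  then show ?thesis by eventually_elim auto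
qed

primrec letter_code :: "letter \<Rightarrow> real" where
  "letter_code La = 0" | "letter_code Lb = 1" | "letter_code La' = 2" | "letter_code Lb' = 3"

text \<open>An expansion in base 5 with the digits 0 to 3. The scaled code of a tail is at most 3/4
  and so cannot reach the next digit, which makes the code injective with values below 1.\<close>

definition stream_code :: "letter stream \<Rightarrow> real" where
  "stream_code x = suminf (\<lambda>n. letter_code (x !! n) * (1/5) ^ Suc n)"

lemma letter_code_range: "0 \<le> letter_code s" "letter_code s \<le> 3"
  by (cases s; simp)+

lemma summable_code: "summable (\<lambda>n. letter_code (x !! n) * (1/5) ^ Suc n)"
proof (rule summable_comparison_test'[of "\<lambda>n. 3 * (1/5) ^ n" 0])
  show "summable (\<lambda>n. 3 * (1/5 :: real) ^ n)" by (intro summable_mult summable_geometric) simp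
  fix n
  have "letter_code (x !! n) * (1/5) ^ Suc n \<le> 3 * (1/5) ^ n"
    using letter_code_range[of "x !! n"] by (intro mult_mono) (auto simp: power_decreasing)
  then show "norm (letter_code (x !! n) * (1/5) ^ Suc n) \<le> 3 * (1/5) ^ n"
    using letter_code_range[of "x !! n"] by simp
qed

lemma stream_code_range: "0 \<le> stream_code x" "stream_code x \<le> 3/4"
proof -
  show "0 \<le> stream_code x" unfolding stream_code_def
    using letter_code_range by (intro suminf_nonneg[OF summable_code]) simp
  have g: "(\<lambda>n. 3/5 * (1/5 :: real) ^ n) sums (3/5 * (1 / (1 - 1/5)))"
    by (intro sums_mult geometric_sums) simp
  have "stream_code x \<le> suminf (\<lambda>n. 3/5 * (1/5 :: real) ^ n)"
    unfolding stream_code_def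
  proof (rule suminf_le[OF _ summable_code sums_summable[OF g]])
    fix n show "letter_code (x !! n) * (1/5) ^ Suc n \<le> 3/5 * (1/5) ^ n"
      using letter_code_range[of "x !! n"] by simp
  qed
  then show "stream_code x \<le> 3/4" using sums_unique[OF g] by simp
qed

lemma stream_code_rec: "stream_code x = (letter_code (shd x) + stream_code (stl x)) / 5"
proof -
  have "stream_code x = suminf (\<lambda>n. letter_code (x !! Suc n) * (1/5) ^ Suc (Suc n)) + letter_code (x !! 0) * (1/5) ^ Suc 0"
    unfolding stream_code_def by (subst suminf_split_head[OF summable_code]) simp
  also have "suminf (\<lambda>n. letter_code (x !! Suc n) * (1/5) ^ Suc (Suc n)) = suminf (\<lambda>n. (letter_code (stl x !! n) * (1/5) ^ Suc n) * (1/5))"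
    by (intro arg_cong[of _ _ suminf] ext) simp
  also have "\<dots> = stream_code (stl x) * (1/5)"
    unfolding stream_code_def by (rule suminf_mult2[OF summable_code, symmetric])
  finally show ?thesis by simp
qed

lemma letter_code_add_inj:
  "letter_code s + a = letter_code t + b \<Longrightarrow> 0 \<le> a \<Longrightarrow> a \<le> 3/4 \<Longrightarrow> 0 \<le> b \<Longrightarrow> b \<le> 3/4 \<Longrightarrow> s = t \<and> a = b"
  by (cases s; cases t; simp)

lemma stream_code_inj:
  assumes "stream_code x = stream_code y" shows "x = y"
proof (rule stream_eqI)
  have step: "shd x = shd y \<and> stream_code (stl x) = stream_code (stl y)"
    if "stream_code x = stream_code y" for x y
  proof (rule letter_code_add_inj)
    have "(letter_code (shd x) + stream_code (stl x)) / 5 = (letter_code (shd y) + stream_code (stl y)) / 5"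
      using that by (simp only: stream_code_rec[symmetric])
    then show "letter_code (shd x) + stream_code (stl x) = letter_code (shd y) + stream_code (stl y)"
      by simp
  qed (rule stream_code_range)+
  fix n show "x !! n = y !! n" using assms
  proof (induction n arbitrary: x y)
    case 0
    from step[OF 0] show ?case by simp
  next
    case (Suc n)
    from Suc.IH[of "stl x" "stl y"] step[OF Suc.prems] show ?case by simp
  qed
qed

definition double :: "letter stream \<Rightarrow> letter stream" where
  "double x = shd x ## x"

text \<open>The number of repetitions of the first letter at the beginning. It increases by one
  under doubling; on constant streams, which form a null set, the value is arbitrary.\<close>

definition level :: "letter stream \<Rightarrow> nat" where
  "level x = (LEAST k. x !! Suc k \<noteq> x !! k)"

text \<open>The code of the stream after its initial repetitions have been removed, hence unchanged
  by doubling. A value determines the remaining stream, so its fibre is countable and therefore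
  null.\<close>

definition base_code :: "letter stream \<Rightarrow> real" where
  "base_code x = stream_code (sdrop (level x) x)"

definition nonconstant :: "letter stream set" where
  "nonconstant = {x \<in> boundary. \<exists>k. x !! Suc k \<noteq> x !! k}"

lemma sdrop_measurable: "sdrop n \<in> boundary_space \<rightarrow>\<^sub>M boundary_space"
proof (rule measurable_into_boundary_space)
  fix k show "(\<lambda>x. sdrop n x !! k) \<in> measurable boundary_space (count_space UNIV)"
    unfolding sdrop_snth by measurable
qed (simp add: sdrop_boundary)

lemma level_measurable: "level \<in> measurable boundary_space (count_space UNIV)"
  unfolding level_def
  by (rule measurable_Least) (intro pred_intros_logic pred_letter_eq measurable_snth_boundary)

lemma stream_code_measurable: "stream_code \<in> borel_measurable boundary_space"
  unfolding stream_code_def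
proof (rule borel_measurable_suminf)
  fix n show "(\<lambda>x. letter_code (x !! n) * (1/5) ^ Suc n) \<in> borel_measurable boundary_space"
    by (rule measurable_compose[OF measurable_snth_boundary]) simp
qed

lemma double_boundary: "x \<in> boundary \<Longrightarrow> double x \<in> boundary"
  by (simp add: double_def boundary_Stream)

lemma level_double:
  assumes "x \<in> nonconstant"
  shows "level (double x) = Suc (level x)"
proof -
  obtain k where "x !! Suc k \<noteq> x !! k" using assms by (auto simp: nonconstant_def)
  then have "double x !! Suc (Suc k) \<noteq> double x !! Suc k" by (simp add: double_def)
  moreover have "\<not> double x !! Suc 0 \<noteq> double x !! 0" by (simp add: double_def)
  ultimately have "level (double x) = Suc (LEAST m. double x !! Suc (Suc m) \<noteq> double x !! Suc m)"
    unfolding level_def by (rule Least_Suc)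
  also have "(LEAST m. double x !! Suc (Suc m) \<noteq> double x !! Suc m) = level x"
    unfolding level_def double_def by simp
  finally show ?thesis .
qed

lemma shift_relation_hitting:
  "shift_relation hitting_measure orbit_map orbit_relation double stl level base_code nonconstant"
proof
  show "double \<in> hitting_measure \<rightarrow>\<^sub>M hitting_measure"
    unfolding measurable_hitting_hitting
  proof (rule measurable_into_boundary_space)
    fix n show "(\<lambda>x. double x !! n) \<in> measurable boundary_space (count_space UNIV)"
    proof (cases n)
      case 0
      then show ?thesis using measurable_snth_boundary[of 0] by (simp add: double_def)
    next
      case (Suc m)
      then show ?thesis using measurable_snth_boundary[of m] by (simp add: double_def)
    qed
  qed (simp add: double_boundary)
  show "stl \<in> hitting_measure \<rightarrow>\<^sub>M hitting_measure"
    unfolding measurable_hitting_hitting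
  proof (rule measurable_into_boundary_space)
    fix n show "(\<lambda>x. stl x !! n) \<in> measurable boundary_space (count_space UNIV)"
      using measurable_snth_boundary[of "Suc n"] by simp
  qed (simp add: stl_boundary)
  show "level \<in> measurable hitting_measure (count_space UNIV)"
    unfolding measurable_hitting by (rule level_measurable)
  show bm: "base_code \<in> borel_measurable hitting_measure"
    unfolding measurable_hitting base_code_def
    by (rule measurable_compose_countable[OF _ level_measurable])
      (rule measurable_compose[OF sdrop_measurable stream_code_measurable])
  have "Measurable.pred boundary_space (\<lambda>x. \<exists>k. x !! Suc k \<noteq> x !! k)"
    by (intro pred_intros_countable pred_intros_logic pred_letter_eq measurable_snth_boundary)
  then show "nonconstant \<in> sets hitting_measure"
    by (simp add: pred_def sets_hitting nonconstant_def)
  show "AE x in hitting_measure. x \<in> nonconstant"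
  proof -
    have "AE x in hitting_measure. x \<notin> range sconst" by (rule AE_hitting_countable) simp
    with AE_space show ?thesis
    proof eventually_elim
      case (elim x)
      have "\<exists>k. x !! Suc k \<noteq> x !! k"
      proof (rule ccontr)
        assume "\<not> (\<exists>k. x !! Suc k \<noteq> x !! k)"
        then have st: "x !! Suc k = x !! k" for k by blast
        have "x !! n = x !! 0" for n
        proof (induction n)
          case (Suc n)
          then show ?case using st[of n] by (rule trans[rotated])
        qed (rule refl)
        moreover have "sconst s !! n = s" for s :: letter and n by (induction n) simp_all
        ultimately have "x = sconst (x !! 0)" by (intro stream_eqI) metis
        then show False using elim(2) by blast
      qed
      then show ?case using elim by (simp add: nonconstant_def del: snth.simps)
    qed
  qed
  fix x :: "letter stream"
  show "0 \<le> base_code x" unfolding base_code_def by (rule stream_code_range)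
  show "base_code x < 1" unfolding base_code_def using stream_code_range(2)[of "sdrop (level x) x"] by simp
  show "(x, double x) \<in> orbit_relation" if "x \<in> space hitting_measure"
  proof -
    have "sdrop 0 x = sdrop 1 (double x)" by (simp add: double_def)
    then show ?thesis unfolding orbit_relation_iff_tail using that double_boundary[of x] by (metis space_hitting)
  qed
  show "(x, stl x) \<in> orbit_relation" if "x \<in> space hitting_measure"
  proof -
    have "sdrop 1 x = sdrop 0 (stl x)" by simp
    then show ?thesis unfolding orbit_relation_iff_tail using that stl_boundary[of x] by (metis space_hitting)
  qed
  show "stl (double x) = x" by (simp add: double_def)
  show "double x \<in> nonconstant \<and> level (double x) = Suc (level x) \<and> base_code (double x) = base_code x"
    if x: "x \<in> nonconstant"
  proof -
    obtain k where "x !! Suc k \<noteq> x !! k" using x by (auto simp: nonconstant_def)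
    then have "double x !! Suc (Suc k) \<noteq> double x !! Suc k" by (simp add: double_def)
    moreover have "double x \<in> boundary" using x double_boundary by (simp add: nonconstant_def)
    ultimately have "double x \<in> nonconstant" unfolding nonconstant_def by blast
    then show ?thesis using level_double[OF x] by (simp add: base_code_def double_def)
  qed
  show "stl x \<in> nonconstant \<and> double (stl x) = x" if x: "x \<in> nonconstant" and l: "0 < level x"
  proof -
    have "\<not> x !! Suc 0 \<noteq> x !! 0" using not_less_Least[OF l[unfolded level_def]] .
    then have "shd (stl x) = shd x" by simp
    then have d: "double (stl x) = x" by (simp add: double_def)
    obtain k where k: "x !! Suc k \<noteq> x !! k" using x by (auto simp: nonconstant_def)
    then obtain m where "k = Suc m" using \<open>\<not> x !! Suc 0 \<noteq> x !! 0\<close> by (cases k) auto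
    then have "stl x !! Suc m \<noteq> stl x !! m" using k by simp
    then show ?thesis using d x stl_boundary unfolding nonconstant_def by blast
  qed
  fix t
  have "AE x in hitting_measure. base_code x \<noteq> t"
  proof (cases "\<exists>z. stream_code z = t")
    case True
    then obtain z where z: "stream_code z = t" by blast
    \<comment> \<open>The streams with tail z are the finite words followed by z, and these are
      countably many.\<close>
    have "AE x in hitting_measure. x \<notin> range (\<lambda>w. w @- z)" by (rule AE_hitting_countable) simp
    then show ?thesis
    proof eventually_elim
      case (elim x)
      have "sdrop n x \<noteq> z" for n
        using elim stake_sdrop[of n x] by (metis rangeI)
      then show ?case unfolding base_code_def using stream_code_inj z by blast
    qed
  qed (auto simp: base_code_def)
  moreover have "{x \<in> space hitting_measure. base_code x = t} \<in> sets hitting_measure"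
    using bm by measurable
  ultimately show "measure hitting_measure {x \<in> space hitting_measure. base_code x = t} = 0"
    by (subst hm.prob_eq_0) auto
qed

section \<open>Approximation of tail equivalence by finite relations\<close>

lemma pred_countable_eq:
  fixes f g :: "'a \<Rightarrow> 'b :: countable"
  assumes [measurable]: "f \<in> measurable N (count_space UNIV)" "g \<in> measurable N (count_space UNIV)"
  shows "Measurable.pred N (\<lambda>x. f x = g x)"
proof -
  have "Measurable.pred N (\<lambda>x. \<exists>l. f x = l \<and> g x = l)" by measurable
  then show ?thesis by simp
qed

text \<open>Occurrence at infinitely many positions is a property of the tail, hence shared by a
  whole orbit.\<close>

definition recurrent :: "letter list \<Rightarrow> letter stream \<Rightarrow> bool" where
  "recurrent w x \<longleftrightarrow> (\<forall>m. \<exists>i\<ge>m. stake (length w) (sdrop i x) = w)"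

text \<open>The first letter, in the order \<open>La\<close>, \<open>Lb\<close>, \<open>La'\<close>,
  \<open>Lb'\<close>, that keeps the word recurrent. The final default is correct for recurrent
  words, as one of the four extensions must be recurrent.\<close>

definition next_letter :: "letter list \<Rightarrow> letter stream \<Rightarrow> letter" where
  "next_letter w x = (if recurrent (w @ [La]) x then La else if recurrent (w @ [Lb]) x then Lb
     else if recurrent (w @ [La']) x then La' else Lb')"

text \<open>The lexicographically least recurrent word of each length. These words extend one
  another and depend only on the orbit.\<close>

primrec least_word :: "nat \<Rightarrow> letter stream \<Rightarrow> letter list" where
  "least_word 0 x = []"
| "least_word (Suc n) x = least_word n x @ [next_letter (least_word n x) x]"

definition least_stream :: "letter stream \<Rightarrow> letter stream" where
  "least_stream x = to_stream (\<lambda>n. least_word (Suc n) x ! n)"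

definition meets_least :: "letter stream \<Rightarrow> bool" where
  "meets_least x \<longleftrightarrow> (\<exists>i j. sdrop i x = sdrop j (least_stream x))"

definition first_occurrence :: "nat \<Rightarrow> letter stream \<Rightarrow> nat" where
  "first_occurrence n x = (LEAST i. stake n (sdrop i x) = least_word n x)"

text \<open>First occurrences of the least recurrent words may depend on the point of the orbit if the
  limit of these words lies in the orbit; in that case the limit itself serves as the key.\<close>

definition key :: "nat \<Rightarrow> letter stream \<Rightarrow> letter stream" where
  "key n x = (if meets_least x then least_stream x else sdrop (first_occurrence n x) x)"

lemma snth_to_stream: "to_stream X' !! n = X' n"
  by (simp add: to_stream_def)

lemma length_least_word [simp]: "length (least_word n x) = n"
  by (induction n) auto

text \<open>The pigeonhole principle: infinitely many occurrences are followed by one of four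
  letters.\<close>

lemma recurrent_extend:
  assumes "recurrent w x" shows "\<exists>s. recurrent (w @ [s]) x"
proof (rule ccontr)
  assume "\<not> ?thesis"
  then have "\<forall>s. \<exists>m. \<forall>i\<ge>m. stake (length (w @ [s])) (sdrop i x) \<noteq> w @ [s]"
    unfolding recurrent_def by blast
  then obtain m where m: "\<And>s i. i \<ge> m s \<Longrightarrow> stake (length (w @ [s])) (sdrop i x) \<noteq> w @ [s]" by metis
  obtain i where i: "i \<ge> Max (range m)" "stake (length w) (sdrop i x) = w"
    using assms unfolding recurrent_def by blast
  define s where "s = sdrop i x !! length w"
  have "m s \<le> Max (range m)" by (rule Max_ge) auto
  then have "i \<ge> m s" using i(1) by simp
  moreover have "stake (length (w @ [s])) (sdrop i x) = w @ [s]"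
    using i(2) by (simp add: stake_Suc s_def del: stake.simps)
  ultimately show False using m by blast
qed

lemma recurrent_least_word: "recurrent (least_word n x) x"
proof (induction n)
  case 0
  show ?case by (auto simp: recurrent_def)
next
  case (Suc n)
  obtain s where "recurrent (least_word n x @ [s]) x" using recurrent_extend[OF Suc] by blast
  then show ?case by (cases s) (auto simp: next_letter_def)
qed

lemma recurrent_sdrop: "recurrent w (sdrop k x) \<longleftrightarrow> recurrent w x"
proof
  assume r: "recurrent w (sdrop k x)"
  show "recurrent w x" unfolding recurrent_def
  proof
    fix m obtain i where "i \<ge> m" "stake (length w) (sdrop i (sdrop k x)) = w"
      using r unfolding recurrent_def by blast
    then show "\<exists>i\<ge>m. stake (length w) (sdrop i x) = w"
      by (intro exI[of _ "k + i"]) (simp add: sdrop_add)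
  qed
next
  assume r: "recurrent w x"
  show "recurrent w (sdrop k x)" unfolding recurrent_def
  proof
    fix m obtain i where "i \<ge> k + m" "stake (length w) (sdrop i x) = w"
      using r unfolding recurrent_def by blast
    then show "\<exists>i\<ge>m. stake (length w) (sdrop i (sdrop k x)) = w"
      by (intro exI[of _ "i - k"]) (simp add: sdrop_add)
  qed
qed

lemma least_word_sdrop: "least_word n (sdrop k x) = least_word n x"
  by (induction n) (simp_all add: next_letter_def recurrent_sdrop)

lemma least_stream_sdrop: "least_stream (sdrop k x) = least_stream x"
  by (simp only: least_stream_def least_word_sdrop)

lemma take_least_word: "m \<le> n \<Longrightarrow> take m (least_word n x) = least_word m x"
  by (induction rule: inc_induct) (auto simp: take_Suc_conv_app_nth elim: subst)

lemma stake_least_stream: "stake n (least_stream x) = least_word n x"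
proof (rule nth_equalityI)
  fix i assume "i < length (stake n (least_stream x))"
  then have i: "i < n" by simp
  have "least_word (Suc i) x = take (Suc i) (least_word n x)" using take_least_word[of "Suc i" n x] i by simp
  then have "least_word (Suc i) x ! i = least_word n x ! i" by simp
  moreover have "least_stream x !! i = least_word (Suc i) x ! i" by (simp only: least_stream_def snth_to_stream)
  ultimately show "stake n (least_stream x) ! i = least_word n x ! i" using i by simp
qed simp

lemma least_stream_boundary:
  assumes "x \<in> boundary" shows "least_stream x \<in> boundary"
  unfolding boundary_def
proof (intro CollectI allI)
  fix n
  obtain i where i: "stake (Suc (Suc n)) (sdrop i x) = least_word (Suc (Suc n)) x"
    using recurrent_least_word[of "Suc (Suc n)" x] unfolding recurrent_def length_least_word by blast
  have "sdrop i x !! k = least_stream x !! k" if "k < Suc (Suc n)" for k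
    using stake_nth[OF that, of "sdrop i x"] stake_nth[OF that, of "least_stream x"]
    unfolding i stake_least_stream by simp
  then have "least_stream x !! n = sdrop i x !! n" "least_stream x !! Suc n = sdrop i x !! Suc n"
    by (metis lessI less_SucI)+
  moreover have "sdrop i x \<in> boundary" by (rule sdrop_boundary[OF assms])
  ultimately show "least_stream x !! Suc n \<noteq> inv_letter (least_stream x !! n)"
    unfolding boundary_def by (simp del: snth.simps)
qed

lemma first_occurrence: "stake n (sdrop (first_occurrence n x) x) = least_word n x"
proof -
  have "\<exists>i. stake n (sdrop i x) = least_word n x"
    using recurrent_least_word[of n x] unfolding recurrent_def length_least_word by blast
  then show ?thesis unfolding first_occurrence_def by (rule LeastI_ex)
qed

text \<open>An occurrence at position i for all large n would make the tail from i equal to the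
  least stream. If the tails never meet, each position is excluded from some length on.\<close>

lemma eventually_first_occurrence_ge:
  assumes "\<not> meets_least x"
  shows "eventually (\<lambda>n. a \<le> first_occurrence n x) sequentially"
proof -
  have "eventually (\<lambda>n. first_occurrence n x \<noteq> i) sequentially" for i
  proof -
    have "sdrop i x \<noteq> least_stream x"
      using assms unfolding meets_least_def by (metis sdrop.simps(1))
    then obtain k where k: "sdrop i x !! k \<noteq> least_stream x !! k" using stream_eqI by blast
    have "first_occurrence n x \<noteq> i" if "n \<ge> Suc k" for n
    proof
      assume "first_occurrence n x = i"
      then have "stake n (sdrop i x) = stake n (least_stream x)"
        using first_occurrence[of n x] by (simp add: stake_least_stream)
      then have "stake n (sdrop i x) ! k = stake n (least_stream x) ! k" by simp
      then show False using k that by simp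
    qed
    then show ?thesis unfolding eventually_sequentially by blast
  qed
  then have "eventually (\<lambda>n. \<forall>i\<in>{..<a}. first_occurrence n x \<noteq> i) sequentially"
    by (intro eventually_ball_finite) auto
  then show ?thesis by eventually_elim (use not_le in blast)
qed

lemma first_occurrence_sdrop:
  assumes "a \<le> first_occurrence n x"
  shows "first_occurrence n x = a + first_occurrence n (sdrop a x)"
proof -
  obtain j where j: "first_occurrence n x = a + j" using assms le_Suc_ex by blast
  have "first_occurrence n (sdrop a x) = j"
    unfolding first_occurrence_def[of n "sdrop a x"]
  proof (rule Least_equality)
    show "stake n (sdrop j (sdrop a x)) = least_word n (sdrop a x)"
      using first_occurrence[of n x] by (simp add: sdrop_add j least_word_sdrop)
    fix i assume "stake n (sdrop i (sdrop a x)) = least_word n (sdrop a x)"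
    then have "stake n (sdrop (a + i) x) = least_word n x" by (simp add: sdrop_add least_word_sdrop)
    then have "first_occurrence n x \<le> a + i" unfolding first_occurrence_def by (rule Least_le)
    then show "j \<le> i" using j by simp
  qed
  then show ?thesis using j by simp
qed

lemma meets_least_sdrop: "meets_least (sdrop a x) \<longleftrightarrow> meets_least x"
proof
  assume "meets_least (sdrop a x)"
  then obtain i j where "sdrop i (sdrop a x) = sdrop j (least_stream x)"
    by (auto simp: meets_least_def least_stream_sdrop)
  then have "sdrop (a + i) x = sdrop j (least_stream x)" by (simp add: sdrop_add)
  then show "meets_least x" unfolding meets_least_def by blast
next
  assume "meets_least x"
  then obtain i j where "sdrop i x = sdrop j (least_stream x)" by (auto simp: meets_least_def)
  then have "sdrop a (sdrop i x) = sdrop a (sdrop j (least_stream x))" by simp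
  then have "sdrop i (sdrop a x) = sdrop (j + a) (least_stream x)" by (simp add: sdrop_add add.commute)
  then show "meets_least (sdrop a x)" unfolding meets_least_def least_stream_sdrop by blast
qed

text \<open>Once the first occurrence lies beyond the first a letters, deleting these letters only
  shifts its position, and the tail beginning there is the same.\<close>

lemma eventually_key_sdrop: "eventually (\<lambda>n. key n x = key n (sdrop a x)) sequentially"
proof (cases "meets_least x")
  case True
  then show ?thesis by (simp add: key_def meets_least_sdrop least_stream_sdrop)
next
  case False
  from eventually_first_occurrence_ge[OF this, of a] show ?thesis
  proof eventually_elim
    case (elim n)
    then show ?case using False first_occurrence_sdrop[OF elim]
      by (simp add: key_def meets_least_sdrop sdrop_add)
  qed
qed

lemma key_orbit:
  assumes "x \<in> boundary" shows "(x, key n x) \<in> orbit_relation"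
proof (cases "meets_least x")
  case True
  then show ?thesis using assms least_stream_boundary
    by (simp add: key_def orbit_relation_iff_tail meets_least_def)
next
  case False
  have "sdrop (first_occurrence n x) x = sdrop 0 (key n x)" using False by (simp add: key_def)
  then show ?thesis using assms False sdrop_boundary
    unfolding orbit_relation_iff_tail by (auto simp: key_def)
qed

lemma stake_sdrop_measurable:
  "(\<lambda>x. stake n (sdrop i x)) \<in> measurable boundary_space (count_space UNIV)"
proof -
  have "(\<lambda>x. stake n (sdrop i x)) \<in> measurable letters (count_space UNIV)"
    by (rule measurable_compose[OF measurable_sdrop measurable_stake])
  then show ?thesis unfolding boundary_space_def by (rule measurable_restrict_space1)
qed

lemma recurrent_measurable: "Measurable.pred boundary_space (recurrent w)"
proof -
  have "Measurable.pred boundary_space (\<lambda>x. stake (length w) (sdrop i x) = w)" for i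
    by (rule pred_countable_eq[OF stake_sdrop_measurable]) simp
  then show ?thesis unfolding recurrent_def by measurable
qed

lemma least_word_measurable: "least_word n \<in> measurable boundary_space (count_space UNIV)"
proof (induction n)
  case (Suc n)
  note [measurable] = recurrent_measurable
  have "(\<lambda>x. w @ [next_letter w x]) \<in> measurable boundary_space (count_space UNIV)" for w
    unfolding next_letter_def by measurable
  from measurable_compose_countable[OF this Suc] show ?case by simp
qed simp

lemma least_stream_measurable: "least_stream \<in> boundary_space \<rightarrow>\<^sub>M boundary_space"
proof (rule measurable_into_boundary_space)
  fix n
  have "least_stream x !! n = least_word (Suc n) x ! n" for x
    by (simp only: least_stream_def snth_to_stream)
  then show "(\<lambda>x. least_stream x !! n) \<in> measurable boundary_space (count_space UNIV)"
    using measurable_compose[OF least_word_measurable[of "Suc n"], of "\<lambda>w. w ! n" "count_space UNIV"] by simp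
qed (simp add: least_stream_boundary)

lemma key_measurable: "key n \<in> boundary_space \<rightarrow>\<^sub>M boundary_space"
proof -
  have "Measurable.pred boundary_space (\<lambda>x. sdrop i x !! k = sdrop j (least_stream x) !! k)" for i j k
    by (intro pred_letter_eq measurable_compose[OF sdrop_measurable measurable_snth_boundary]
      measurable_compose[OF measurable_compose[OF least_stream_measurable sdrop_measurable] measurable_snth_boundary])
  then have "Measurable.pred boundary_space (\<lambda>x. \<exists>i j. \<forall>k. sdrop i x !! k = sdrop j (least_stream x) !! k)"
    by measurable
  moreover have "(\<exists>i j. \<forall>k. sdrop i x !! k = sdrop j (least_stream x) !! k) \<longleftrightarrow> meets_least x" for x
    unfolding meets_least_def using stream_eqI by metis
  ultimately have m: "{x \<in> space boundary_space. meets_least x} \<in> sets boundary_space" by (simp only: pred_def)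
  have "first_occurrence n \<in> measurable boundary_space (count_space UNIV)"
    unfolding first_occurrence_def
    by (rule measurable_Least) (intro pred_countable_eq stake_sdrop_measurable least_word_measurable)
  then have "(\<lambda>x. sdrop (first_occurrence n x) x) \<in> boundary_space \<rightarrow>\<^sub>M boundary_space"
    by (rule measurable_compose_countable[OF sdrop_measurable])
  then show ?thesis unfolding key_def
    by (intro measurable_If least_stream_measurable m)
qed

lemma amenable_hitting:
  "amenable_group (lamplighter hitting_measure orbit_relation) (lamplighter_topology hitting_measure orbit_relation)"
proof (rule hm.amenable_lamplighter_of_keys[of key])
  fix n x y
  show "inj_on (orbit_map n) (space hitting_measure)" by (simp add: orbit_map_def boundary_action_inj)
  show "key n \<in> hitting_measure \<rightarrow>\<^sub>M hitting_measure" unfolding measurable_hitting_hitting by (rule key_measurable)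
  show "(x, key n x) \<in> orbit_relation" if "x \<in> space hitting_measure" using that key_orbit by simp
  assume "(x, y) \<in> orbit_relation"
  then obtain a b where "sdrop a x = sdrop b y" by (auto simp: orbit_relation_iff_tail)
  with eventually_key_sdrop[of x a] eventually_key_sdrop[of y b]
  show "eventually (\<lambda>n. key n x = key n y) sequentially" by (auto elim: eventually_elim2)
qed

section \<open>The algebra of cylinders\<close>

text \<open>Finite sets of words keep the family countable. There are finitely many words of each
  length, so every condition on a fixed prefix is of this form, and complements and unions remain
  inside.\<close>

definition cylinder_algebra :: "letter stream set set" where
  "cylinder_algebra = (\<lambda>(n, A). {x \<in> boundary. stake n x \<in> A}) ` (UNIV \<times> Collect finite)"

lemma countable_cylinder_algebra: "countable cylinder_algebra"
  unfolding cylinder_algebra_def by (intro countable_image countable_SIGMA countable_Collect_finite) auto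

lemma finite_length_eq: "finite {w :: letter list. length w = n}"
  using finite_lists_length_eq[of "UNIV :: letter set" n] by simp

lemma cylinder_in_algebra: "{x \<in> boundary. stake n x \<in> A} \<in> cylinder_algebra"
proof -
  have "{x \<in> boundary. stake n x \<in> A} = {x \<in> boundary. stake n x \<in> A \<inter> {w. length w = n}}" by auto
  then show ?thesis unfolding cylinder_algebra_def
    using finite_length_eq by (intro image_eqI[of _ _ "(n, A \<inter> {w. length w = n})"]) auto
qed

lemma algebra_cylinder_algebra: "Sigma_Algebra.algebra (space hitting_measure) cylinder_algebra"
  unfolding algebra_iff_Un
proof (intro conjI ballI)
  show "cylinder_algebra \<subseteq> Pow (space hitting_measure)" by (auto simp: cylinder_algebra_def)
  show "{} \<in> cylinder_algebra" using cylinder_in_algebra[of 0 "{}"] by simp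
  fix a assume "a \<in> cylinder_algebra"
  then obtain n A where a: "a = {x \<in> boundary. stake n x \<in> A}" by (auto simp: cylinder_algebra_def)
  have "space hitting_measure - a = {x \<in> boundary. stake n x \<in> - A}" by (auto simp: a)
  then show "space hitting_measure - a \<in> cylinder_algebra" by (simp only: cylinder_in_algebra)
  fix b assume "b \<in> cylinder_algebra"
  then obtain m B where b: "b = {x \<in> boundary. stake m x \<in> B}" by (auto simp: cylinder_algebra_def)
  have "a \<union> b = {x \<in> boundary. stake (max n m) x \<in> {w. take n w \<in> A \<or> take m w \<in> B}}"
    by (auto simp: a b take_stake min_def max_def)
  then show "a \<union> b \<in> cylinder_algebra" by (simp only: cylinder_in_algebra)
qed

lemma sets_cylinder_algebra: "sets hitting_measure = sigma_sets (space hitting_measure) cylinder_algebra"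
proof
  have sub: "cylinder_algebra \<subseteq> Pow boundary" by (auto simp: cylinder_algebra_def)
  have "cylinder_algebra \<subseteq> sets boundary_space"
  proof
    fix a assume "a \<in> cylinder_algebra"
    then obtain n A where a: "a = {x \<in> boundary. stake n x \<in> A}" by (auto simp: cylinder_algebra_def)
    have "Measurable.pred boundary_space (\<lambda>x. stake n (sdrop 0 x) \<in> A)"
      by (rule measurable_compose[OF stake_sdrop_measurable]) simp
    then show "a \<in> sets boundary_space" by (simp add: pred_def a)
  qed
  then show "sigma_sets (space hitting_measure) cylinder_algebra \<subseteq> sets hitting_measure"
    using sets.sigma_sets_subset[of cylinder_algebra hitting_measure] by (simp add: sets_hitting)
  \<comment> \<open>Coordinates are measurable for the generated sigma-algebra, hence so is the
    identity into the boundary; this is the inclusion still missing.\<close>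
  have "(\<lambda>x. x) \<in> sigma boundary cylinder_algebra \<rightarrow>\<^sub>M boundary_space"
  proof (rule measurable_into_boundary_space)
    fix n
    have "(\<lambda>x. x !! n) -` {l} \<inter> boundary \<in> sigma_sets boundary cylinder_algebra" for l
    proof -
      have "(\<lambda>x. x !! n) -` {l} \<inter> boundary = {x \<in> boundary. stake (Suc n) x \<in> {w. w ! n = l}}"
        by (auto simp: stake_nth simp del: stake.simps)
      then show ?thesis by (simp only: sigma_sets.Basic cylinder_in_algebra)
    qed
    then show "(\<lambda>x. x !! n) \<in> measurable (sigma boundary cylinder_algebra) (count_space UNIV)"
      using sub by (subst measurable_count_space_eq2_countable) (auto simp: space_measure_of_conv sets_measure_of)
  qed (simp add: space_measure_of_conv)
  then show "sets hitting_measure \<subseteq> sigma_sets (space hitting_measure) cylinder_algebra"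
  proof (intro subsetI)
    fix E assume id: "(\<lambda>x. x) \<in> sigma boundary cylinder_algebra \<rightarrow>\<^sub>M boundary_space" and E: "E \<in> sets hitting_measure"
    have "E \<subseteq> boundary" using sets.sets_into_space[OF E] by simp
    have "(\<lambda>x. x) -` E \<inter> space (sigma boundary cylinder_algebra) \<in> sets (sigma boundary cylinder_algebra)"
      by (rule measurable_sets[OF id]) (use E sets_hitting in simp)
    then show "E \<in> sigma_sets (space hitting_measure) cylinder_algebra"
      using sub \<open>E \<subseteq> boundary\<close> by (simp add: space_measure_of_conv sets_measure_of Int_absorb2)
  qed
qed

section \<open>Failure of the Kesten property\<close>

text \<open>If the tails at m and at n > m coincide, every letter from position n on repeats an
  earlier one. The stream is thus determined by its first n letters, and there are only countably
  many such streams.\<close>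

lemma tail_periodic_eqI:
  assumes "m < n" "sdrop m x = sdrop n x" "sdrop m y = sdrop n y" "stake n x = stake n y"
  shows "x = y"
proof (rule stream_eqI)
  fix i show "x !! i = y !! i"
  proof (induction i rule: less_induct)
    case (less i)
    show ?case
    proof (cases "i < n")
      case True
      then have "stake n x ! i = x !! i" "stake n y ! i = y !! i" by (rule stake_nth)+
      then show ?thesis using assms(4) by simp
    next
      case False
      have "z !! i = z !! (m + (i - n))" if "sdrop m z = sdrop n z" for z :: "'a stream"
      proof -
        have "sdrop n z !! (i - n) = sdrop m z !! (i - n)" using that by simp
        then show ?thesis using False by (simp add: sdrop_snth)
      qed
      moreover have "m + (i - n) < i" using False assms(1) by simp
      ultimately show ?thesis using less assms(2,3) by metis
    qed
  qed
qed

lemma countable_eventually_periodic: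
  "countable {x :: letter stream. \<exists>m n. m < n \<and> sdrop m x = sdrop n x}"
proof -
  have "countable {x :: letter stream. sdrop m x = sdrop n x}" if "m < n" for m n
  proof (rule countableI')
    show "inj_on (stake n) {x :: letter stream. sdrop m x = sdrop n x}"
      using tail_periodic_eqI[OF that] by (intro inj_onI) auto
  qed
  moreover have "{x :: letter stream. \<exists>m n. m < n \<and> sdrop m x = sdrop n x} =
      (\<Union>m. \<Union>n\<in>{m<..}. {x. sdrop m x = sdrop n x})" by auto
  ultimately show ?thesis by auto
qed

text \<open>Letters of u act from the last to the first. They cancel against a prefix of x until one
  survives; after that nothing cancels, because u is reduced. Here j letters cancel and k
  remain.\<close>

lemma boundary_action_cancellation:
  "reduced u \<Longrightarrow> x \<in> boundary \<Longrightarrow>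
    \<exists>k j. k + j = length u \<and> boundary_action u x = take k u @- sdrop j x \<and> drop k u = inv_word (stake j x)"
proof (induction u)
  case Nil
  then show ?case by (simp add: inv_word_def)
next
  case (Cons s u)
  then obtain k j where kj: "k + j = length u" "boundary_action u x = take k u @- sdrop j x"
      "drop k u = inv_word (stake j x)" by (auto simp: reduced_Cons)
  show ?case
  proof (cases k)
    case 0
    have act: "boundary_action u x = sdrop j x" using kj(2) 0 by simp
    show ?thesis
    proof (cases "shd (sdrop j x) = inv_letter s")
      case True
      have "stake (Suc j) x = stake j x @ [shd (sdrop j x)]"
        by (simp only: stake_Suc sdrop_simps)
      then have "drop 0 (s # u) = inv_word (stake (Suc j) x)"
        using kj(3) 0 True by (simp add: inv_word_def del: stake.simps)
      moreover have "boundary_action (s # u) x = sdrop (Suc j) x"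
        by (simp only: boundary_action_simps act push_boundary_def True if_True simp_thms sdrop_simps(2))
      moreover have "0 + Suc j = length (s # u)" using kj(1) 0 by simp
      ultimately have "0 + Suc j = length (s # u) \<and> boundary_action (s # u) x = take 0 (s # u) @- sdrop (Suc j) x \<and>
          drop 0 (s # u) = inv_word (stake (Suc j) x)"
        by (simp only: take_0 shift.simps simp_thms)
      then show ?thesis by blast
    next
      case False
      then have "boundary_action (s # u) x = s ## sdrop j x" using act by (simp add: push_boundary_def)
      then show ?thesis using kj 0 by (rule_tac x = 1 in exI, rule_tac x = j in exI) simp
    qed
  next
    case (Suc k')
    then obtain t u' where u: "u = t # u'" using kj(1) by (cases u) auto
    have "t \<noteq> inv_letter s" using Cons.prems(1) u by (simp add: reduced_Cons)
    then have "boundary_action (s # u) x = take (Suc k) (s # u) @- sdrop j x"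
      using kj(2) by (simp add: push_boundary_def u Suc)
    then show ?thesis using kj by (rule_tac x = "Suc k" in exI, rule_tac x = j in exI) simp
  qed
qed

text \<open>Comparing x with its image gives equal tails at positions k and j. If k = j, then u
  would be a word followed by its own inverse, which is not reduced.\<close>

lemma boundary_action_fixed_point:
  assumes u: "reduced u" "u \<noteq> []" and x: "x \<in> boundary" and fix_x: "boundary_action u x = x"
  shows "\<exists>m n. m < n \<and> sdrop m x = sdrop n x"
proof -
  obtain k j where kj: "k + j = length u" "boundary_action u x = take k u @- sdrop j x"
      "drop k u = inv_word (stake j x)" using boundary_action_cancellation[OF u(1) x] by blast
  have len: "length (take k u) = k" using kj(1) by simp
  have xk: "x = take k u @- sdrop j x" using kj(2) fix_x by simp
  have "sdrop k x = sdrop k (take k u @- sdrop j x)" using xk by simp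
  also have "\<dots> = sdrop j x" using sdrop_shift[of k "take k u" "sdrop j x"] len by simp
  finally have dr: "sdrop k x = sdrop j x" .
  have "k \<noteq> j"
  proof
    assume "k = j"
    have "stake k x = stake k (take k u @- sdrop j x)" using xk by simp
    also have "\<dots> = take k u" using stake_shift[of k "take k u" "sdrop j x"] len by simp
    finally have "u = take k u @ inv_word (take k u)"
      using kj(3) \<open>k = j\<close> append_take_drop_id[of k u] by simp
    moreover have "length u > 0" using u(2) by simp
    then have "k > 0" using kj(1) \<open>k = j\<close> by linarith
    then have "take k u \<noteq> []" using u(2) by simp
    then obtain v a where "take k u = v @ [a]" using rev_exhaust by blast
    ultimately have "u = v @ a # inv_letter a # inv_word v" by (simp add: inv_word_def)
    then show False using u(1) by (simp add: reduced_successively successively_append_iff)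
  qed
  then show ?thesis using dr by (metis linorder_neqE_nat)
qed

text \<open>The action is essentially free: fixed points of nontrivial reduced words are eventually
  periodic streams, and these form a countable, hence null, set.\<close>

lemma AE_prefixes_distinct:
  "AE x in hitting_measure. \<forall>v u. reduced (v @ u) \<longrightarrow> u \<noteq> [] \<longrightarrow> boundary_action (v @ u) x \<noteq> boundary_action v x"
  using AE_hitting_countable[OF countable_eventually_periodic] AE_space
proof eventually_elim
  case (elim x)
  then have x: "x \<in> boundary" by simp
  show ?case
  proof (intro allI impI notI)
    fix v u assume "reduced (v @ u)" "u \<noteq> []" "boundary_action (v @ u) x = boundary_action v x"
    moreover from this have "boundary_action u x = x"
      using inj_onD[OF boundary_action_inj[of v], of "boundary_action u x" x] x
      by (simp add: boundary_action_append boundary_action_in)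
    moreover have "reduced u" using \<open>reduced (v @ u)\<close> by (simp add: reduced_successively successively_append_iff)
    ultimately have "\<exists>m n. m < n \<and> sdrop m x = sdrop n x" using boundary_action_fixed_point x by blast
    then show False using elim(1) by blast
  qed
qed

text \<open>The lamps record the edges of the Cayley tree between the identity and a group element: an
  edge labelled by \<open>La\<close> is identified with its initial vertex and uses the lamps over points
  beginning with \<open>La\<close> or its inverse, and similarly for \<open>Lb\<close>.  Crossing an edge twice cancels, so
  this is a cocycle whose norm grows linearly.\<close>

definition positive :: "letter \<Rightarrow> bool" where
  "positive s \<longleftrightarrow> s = La \<or> s = Lb"

definition colour :: "letter \<Rightarrow> letter stream set" where
  "colour s = {x \<in> boundary. shd x = s \<or> shd x = inv_letter s}"

definition graph_over :: "letter list \<Rightarrow> letter stream set \<Rightarrow> (letter stream \<times> letter stream) set" where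
  "graph_over w B = {p \<in> space hitting_measure \<times> space hitting_measure. fst p \<in> B \<and> snd p = boundary_action w (fst p)}"

definition edge :: "letter list \<Rightarrow> letter \<Rightarrow> (letter stream \<times> letter stream) set" where
  "edge w s = graph_over (if positive s then w else w @ [s]) (colour s)"

definition path_lamps :: "letter list \<Rightarrow> (letter stream \<times> letter stream) set" where
  "path_lamps w = (\<Union>i<length w. edge (take i w) (w ! i))"

lemma colour_inv: "colour (inv_letter s) = colour s"
  by (auto simp: colour_def)

lemma positive_inv: "positive (inv_letter s) \<longleftrightarrow> \<not> positive s"
  by (cases s) (auto simp: positive_def)

lemma colour_sets [measurable]: "colour s \<in> sets hitting_measure"
proof -
  have "Measurable.pred boundary_space (\<lambda>x. x !! 0 = s \<or> x !! 0 = inv_letter s)"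
    by (intro pred_intros_logic pred_letter_eq measurable_snth_boundary measurable_const) auto
  then show ?thesis by (simp add: pred_def sets_hitting colour_def)
qed

lemma action_measurable: "boundary_action w \<in> hitting_measure \<rightarrow>\<^sub>M hitting_measure"
  unfolding measurable_hitting_hitting by (rule boundary_action_measurable)

lemma action_R: "x \<in> boundary \<Longrightarrow> (x, boundary_action w x) \<in> orbit_relation"
  by (auto simp: orbit_relation_iff_action)

lemma graph_over_fmeasurable:
  assumes [measurable]: "B \<in> sets hitting_measure"
  shows "graph_over w B \<in> fmeasurable hm.\<nu>" "measure hm.\<nu> (graph_over w B) = measure hitting_measure B"
proof -
  note [measurable] = action_measurable[of w]
  have "{p \<in> space (hitting_measure \<Otimes>\<^sub>M hitting_measure). fst p \<in> B \<and> snd p = boundary_action w (fst p)}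
      \<in> sets (hitting_measure \<Otimes>\<^sub>M hitting_measure)" by measurable
  then have s: "graph_over w B \<in> sets hm.\<nu>" by (simp add: graph_over_def space_pair_measure)
  have e: "emeasure hm.\<nu> (graph_over w B) = emeasure hitting_measure B"
    unfolding graph_over_def by (intro hm.emeasure_\<nu>_graph action_measurable assms AE_I2) (simp add: action_R)
  show "graph_over w B \<in> fmeasurable hm.\<nu>"
    by (rule fmeasurableI[OF s]) (simp add: e less_top[symmetric])
  show "measure hm.\<nu> (graph_over w B) = measure hitting_measure B" by (simp add: measure_def e)
qed

lemma edge_fmeasurable: "edge w s \<in> fmeasurable hm.\<nu>" "measure hm.\<nu> (edge w s) = measure hitting_measure (colour s)"
  unfolding edge_def by (rule graph_over_fmeasurable[OF colour_sets])+

lemma path_lamps_fmeasurable: "path_lamps w \<in> fmeasurable hm.\<nu>"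
  unfolding path_lamps_def by (intro fmeasurable.finite_UN edge_fmeasurable) auto

lemma path_lamps_snoc: "path_lamps (w @ [s]) = path_lamps w \<union> edge w s"
proof -
  have "path_lamps (w @ [s]) = (\<Union>i<length w. edge (take i (w @ [s])) ((w @ [s]) ! i)) \<union> edge w s"
    by (auto simp: path_lamps_def lessThan_Suc)
  also have "(\<Union>i<length w. edge (take i (w @ [s])) ((w @ [s]) ! i)) = path_lamps w"
    unfolding path_lamps_def by (intro SUP_cong refl) (simp add: nth_append)
  finally show ?thesis .
qed

text \<open>By essential freeness, lamps of edges attached to different vertices are disjoint. Two
  edges of the path may be attached to the same vertex; then they carry different colours, since
  equal ones would mean that the path turns back.\<close>

lemma path_lamps_disjoint:
  assumes "reduced (w @ [s])"
  shows "AE x in hitting_measure. \<forall>y. (x, y) \<notin> path_lamps w \<inter> edge w s"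
  using AE_prefixes_distinct AE_space
proof eventually_elim
  case (elim x)
  have red: "reduced (take m (w @ [s]))" for m
    using assms append_take_drop_id[of m "w @ [s]"] by (metis reduced_successively successively_append_iff)
  have neq: "boundary_action (take m (w @ [s])) x \<noteq> boundary_action (take n (w @ [s])) x"
    if "m < n" "n \<le> Suc (length w)" for m n
  proof -
    have "take n (w @ [s]) = take m (w @ [s]) @ drop m (take n (w @ [s]))"
      using append_take_drop_id[of m "take n (w @ [s])"] that by (simp add: take_take min_def del: take_append)
    moreover have "drop m (take n (w @ [s])) \<noteq> []" using that by (auto simp: min_def)
    ultimately show ?thesis using elim(1) red[of n] by metis
  qed
  show ?case
  proof (intro allI notI)
    fix y assume "(x, y) \<in> path_lamps w \<inter> edge w s"
    then obtain i where i: "i < length w" "(x, y) \<in> edge (take i w) (w ! i)" and e: "(x, y) \<in> edge w s"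
      by (auto simp: path_lamps_def)
    define a where "a = (if positive (w ! i) then i else Suc i)"
    define b where "b = (if positive s then length w else Suc (length w))"
    have ta: "(if positive (w ! i) then take i w else take i w @ [w ! i]) = take a (w @ [s])"
      using i(1) by (simp add: a_def take_Suc_conv_app_nth)
    have tb: "(if positive s then w else w @ [s]) = take b (w @ [s])" by (simp add: b_def)
    have ya: "y = boundary_action (take a (w @ [s])) x" using i(2) unfolding edge_def ta by (simp add: graph_over_def)
    have yb: "y = boundary_action (take b (w @ [s])) x" using e unfolding edge_def tb by (simp add: graph_over_def)
    show False
    proof (cases "a < b")
      case True
      then show ?thesis using neq[of a b] ya yb by (simp add: b_def split: if_splits)
    next
      case False
      \<comment> \<open>The only coincidence: the last edge of w is traversed against its
        orientation, the new one along it, so both are attached to the vertex where they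
        meet.\<close>
      then have ab: "Suc i = length w" "\<not> positive (w ! i)" "positive s"
        using i(1) by (auto simp: a_def b_def split: if_splits)
      have "x \<in> colour (w ! i)" "x \<in> colour s" using i(2) e by (auto simp: edge_def graph_over_def)
      then have "s = w ! i \<or> s = inv_letter (w ! i)"
        using ab by (cases s; cases "w ! i") (auto simp: colour_def positive_def)
      then have "s = inv_letter (w ! i)" using ab by auto
      moreover have "w ! i = last w" using ab(1) last_conv_nth[of w] i(1) by (metis diff_Suc_1 length_0_conv not_less_zero)
      ultimately show False using assms i(1) by (auto simp: reduced_snoc)
    qed
  qed
qed

text \<open>Off the set \<open>colour s\<close>, putting s in front does not cancel and leads into
  the set. If the set were null, quasi-invariance would exclude almost every point.\<close>

lemma colour_positive: "measure hitting_measure (colour s) > 0"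
proof (rule ccontr)
  assume "\<not> ?thesis"
  then have "colour s \<in> null_sets hitting_measure"
    using colour_sets by (auto simp: null_sets_def hm.emeasure_eq_measure zero_less_measure_iff)
  then have 1: "AE x in hitting_measure. x \<notin> colour s" by (rule AE_not_in)
  have "AE x in hitting_measure. push_boundary s x \<notin> colour s"
  proof (rule hm.AE_compose[OF 1 AE_I2])
    fix x show "x \<in> space hitting_measure \<Longrightarrow> (x, push_boundary s x) \<in> orbit_relation"
      using action_R[of x "[s]"] by simp
  qed
  with 1 AE_space have "AE x in hitting_measure. False"
  proof eventually_elim
    case (elim x)
    then have "push_boundary s x = s ## x" by (auto simp: colour_def push_boundary_def)
    then show ?case using elim push_boundary_in[of x s] by (simp add: colour_def)
  qed
  then show False by simp
qed

lemma measure_path_lamps: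
  assumes c: "\<And>s. c \<le> measure hitting_measure (colour s)"
  shows "reduced w \<Longrightarrow> c * real (length w) \<le> measure hm.\<nu> (path_lamps w)"
proof (induction w rule: rev_induct)
  case (snoc s w)
  have "emeasure hm.\<nu> (path_lamps w \<inter> edge w s) = 0"
  proof (subst hm.\<nu>_zero_iff)
    show "path_lamps w \<inter> edge w s \<in> sets (hitting_measure \<Otimes>\<^sub>M hitting_measure)"
      using path_lamps_fmeasurable[of w] edge_fmeasurable(1)[of w s] by (auto dest!: fmeasurableD)
    show "AE x in hitting_measure. \<forall>y. (x, y) \<in> orbit_relation \<longrightarrow> (x, y) \<notin> path_lamps w \<inter> edge w s"
      using path_lamps_disjoint[OF snoc.prems] by eventually_elim blast
  qed
  then have i0: "measure hm.\<nu> (path_lamps w \<inter> edge w s) = 0" by (simp add: measure_def)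
  have "measure hm.\<nu> (path_lamps w \<union> edge w s) = measure hm.\<nu> (path_lamps w) + measure hm.\<nu> (edge w s) - measure hm.\<nu> (path_lamps w \<inter> edge w s)"
    by (rule measure_Un3[OF path_lamps_fmeasurable edge_fmeasurable(1)])
  then show ?case
    using snoc c[of s] i0 by (simp add: path_lamps_snoc edge_fmeasurable(2) reduced_snoc algebra_simps)
qed simp

section \<open>A copy of the free group in the lamplighter\<close>

abbreviation LL :: "((letter stream \<times> letter stream) set set \<times> (letter stream \<Rightarrow> letter stream) set) monoid"
  where "LL \<equiv> lamplighter hitting_measure orbit_relation"

definition path_element :: "letter list \<Rightarrow> (letter stream \<times> letter stream) set set \<times> (letter stream \<Rightarrow> letter stream) set" where
  "path_element w = (hm.lamp_cls (path_lamps w), hm.cls (boundary_action w))"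

lemma inverse_pair_action: "hm.inverse_pair (boundary_action w) (boundary_action (inv_word w))"
proof -
  have "inv_word (inv_word w) = w" by (simp add: inv_word_def rev_map o_def)
  then have "boundary_action w (boundary_action (inv_word w) x) = x" if "x \<in> boundary" for x
    using boundary_action_inv_word[OF that, of "inv_word w"] by simp
  then show ?thesis unfolding hm.inverse_pair_def
    using action_measurable action_R boundary_action_inv_word by (auto intro!: AE_I2)
qed

lemma invertible_action: "hm.invertible_map (boundary_action w)"
  unfolding hm.invertible_map_def using inverse_pair_action by blast

lemma carrier_LL: "carrier LL = carrier (lamp_group hitting_measure orbit_relation) \<times> carrier (full_group hitting_measure orbit_relation)"
  by (simp add: lamplighter_def semidirect_product_def)

lemma mult_LL: "(c, g) \<otimes>\<^bsub>LL\<^esub> (d, h) =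
    (c \<otimes>\<^bsub>lamp_group hitting_measure orbit_relation\<^esub> lamp_action hitting_measure orbit_relation g d,
     g \<otimes>\<^bsub>full_group hitting_measure orbit_relation\<^esub> h)"
  by (simp add: lamplighter_def semidirect_product_def)

lemma path_element_carrier: "path_element w \<in> carrier LL"
  using hm.cls_in_carrier[OF invertible_action] path_lamps_fmeasurable
  by (auto simp: path_element_def carrier_LL hm.carrier_lamp_group)

text \<open>The lamps of edges are equivariant, which is the cocycle identity for a single
  edge.\<close>

lemma act_edge: "hm.act_set (boundary_action (inv_word w)) (edge [] s) = edge w s"
proof -
  have "boundary_action (inv_word w) y = boundary_action v x \<longleftrightarrow> y = boundary_action (w @ v) x"
    if "x \<in> boundary" "y \<in> boundary" for x y v
  proof -
    have "inv_word (inv_word w) = w" by (simp add: inv_word_def rev_map o_def)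
    then show ?thesis
      using boundary_action_inv_word[OF that(2), of "inv_word w"]
        boundary_action_inv_word[OF boundary_action_in[OF that(1)], of w v]
      by (auto simp: boundary_action_append)
  qed
  from this[of _ _ "[]"] this[of _ _ "[s]"] show ?thesis
    by (auto simp: hm.act_set_def edge_def graph_over_def space_pair_measure boundary_action_in boundary_action_append)
qed

lemma path_element_mult_edge:
  "path_element w \<otimes>\<^bsub>LL\<^esub> path_element [s] =
     (hm.lamp_cls (sym_diff (path_lamps w) (edge w s)), hm.cls (boundary_action (w @ [s])))"
proof -
  have "path_lamps [s] = edge [] s" by (simp add: path_lamps_def lessThan_Suc)
  moreover have "hm.cls (boundary_action w \<circ> boundary_action [s]) = hm.cls (boundary_action (w @ [s]))"
    by (rule hm.cls_eqI) (simp add: boundary_action_append)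
  ultimately show ?thesis
    unfolding path_element_def mult_LL hm.mult_full_group[OF invertible_action invertible_action]
    by (simp only: hm.lamp_action_cls[OF inverse_pair_action edge_fmeasurable(1)] act_edge
      hm.mult_lamp_group[OF path_lamps_fmeasurable edge_fmeasurable(1)])
qed

lemma path_element_snoc:
  assumes "reduced (w @ [s])"
  shows "path_element w \<otimes>\<^bsub>LL\<^esub> path_element [s] = path_element (w @ [s])"
proof -
  have "hm.lamp_cls (sym_diff (path_lamps w) (edge w s)) = hm.lamp_cls (path_lamps (w @ [s]))"
  proof (rule hm.lamp_cls_eqI)
    show "AE x in hitting_measure. \<forall>y. (x, y) \<in> orbit_relation \<longrightarrow>
        ((x, y) \<in> sym_diff (path_lamps w) (edge w s) \<longleftrightarrow> (x, y) \<in> path_lamps (w @ [s]))"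
      unfolding path_lamps_snoc using path_lamps_disjoint[OF assms] by eventually_elim blast
  qed (intro hm.fmeasurable_sym_diff path_lamps_fmeasurable edge_fmeasurable)+
  then show ?thesis unfolding path_element_mult_edge by (simp add: path_element_def)
qed

lemma one_LL: "\<one>\<^bsub>LL\<^esub> = path_element []"
proof -
  have "hm.cls id = hm.cls (boundary_action [])" by (rule hm.cls_eqI) simp
  then show ?thesis
    by (simp add: lamplighter_def semidirect_product_def path_element_def path_lamps_def
      hm.one_lamp_group hm.one_full_group)
qed

text \<open>An edge and its reversal are attached to the same vertex and have the same colour, so
  their lamps coincide and cancel.\<close>

lemma path_element_inv: "path_element [s] \<otimes>\<^bsub>LL\<^esub> path_element [inv_letter s] = \<one>\<^bsub>LL\<^esub>"
proof -
  have c: "boundary_action [s, inv_letter s] x = x" if "x \<in> boundary" for x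
    using push_boundary_cancel[OF that] by simp
  have "edge [s] (inv_letter s) = edge [] s"
    using c by (auto simp: edge_def graph_over_def colour_inv positive_inv)
  then have "path_lamps [s] = edge [s] (inv_letter s)" by (simp add: path_lamps_def lessThan_Suc)
  moreover have "hm.cls (boundary_action [s, inv_letter s]) = hm.cls (boundary_action [])"
    using c by (intro hm.cls_eqI AE_I2) simp
  ultimately show ?thesis
    using path_element_mult_edge[of "[s]" "inv_letter s"] by (simp add: one_LL path_element_def path_lamps_def)
qed

text \<open>Right multiplication in the free group is respected letter by letter, which suffices to
  transport a random walk. The cancelling case reduces to an edge followed by its reversal.\<close>

lemma path_element_rpush:
  assumes "reduced w"
  shows "path_element w \<otimes>\<^bsub>LL\<^esub> path_element [s] = path_element (rpush w s)"
proof (cases "w \<noteq> [] \<and> last w = inv_letter s")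
  case True
  interpret L: topological_group LL "lamplighter_topology hitting_measure orbit_relation"
    by (rule hm.topological_group_lamplighter)
  have w: "w = butlast w @ [inv_letter s]" using True by (metis append_butlast_last_id)
  have "path_element w = path_element (butlast w) \<otimes>\<^bsub>LL\<^esub> path_element [inv_letter s]"
    using path_element_snoc[of "butlast w" "inv_letter s"] assms w by simp
  then have "path_element w \<otimes>\<^bsub>LL\<^esub> path_element [s] =
      path_element (butlast w) \<otimes>\<^bsub>LL\<^esub> (path_element [inv_letter s] \<otimes>\<^bsub>LL\<^esub> path_element [s])"
    by (simp add: L.m_assoc path_element_carrier)
  also have "\<dots> = path_element (butlast w)"
    using path_element_inv[of "inv_letter s"] by (simp add: path_element_carrier)
  finally show ?thesis using True by (simp add: rpush_def)
next
  case False
  then have "reduced (w @ [s])" using assms by (auto simp: reduced_snoc inv_letter_eq_iff)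
  from path_element_snoc[OF this] have "path_element w \<otimes>\<^bsub>LL\<^esub> path_element [s] = path_element (w @ [s])" .
  moreover have "rpush w s = w @ [s]" using False by (auto simp: rpush_def)
  ultimately show ?thesis by simp
qed

section \<open>Length estimates for the walk and the failure of Kesten's property\<close>

primrec word_walk :: "nat \<Rightarrow> letter list pmf" where
  "word_walk 0 = return_pmf []"
| "word_walk (Suc n) = map_pmf (\<lambda>(w, s). rpush w s) (pair_pmf (word_walk n) (pmf_of_set UNIV))"

lemma word_walk_reduced: "w \<in> set_pmf (word_walk n) \<Longrightarrow> reduced w"
  by (induction n arbitrary: w) (auto simp: reduced_rpush)

definition kesten_pmf :: "((letter stream \<times> letter stream) set set \<times> (letter stream \<Rightarrow> letter stream) set) pmf" where
  "kesten_pmf = map_pmf (\<lambda>s. path_element [s]) (pmf_of_set UNIV)"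

lemma conv_power_kesten: "conv_power LL kesten_pmf n = map_pmf path_element (word_walk n)"
proof (induction n)
  case 0
  then show ?case by (simp add: one_LL)
next
  case (Suc n)
  have "conv_power LL kesten_pmf (Suc n) =
      map_pmf (\<lambda>(w, s). path_element w \<otimes>\<^bsub>LL\<^esub> path_element [s]) (pair_pmf (word_walk n) (pmf_of_set UNIV))"
    unfolding conv_power.simps Suc unfolding kesten_pmf_def pair_map_pmf1 pair_map_pmf2
    by (simp add: pmf.map_comp o_def case_prod_unfold)
  also have "\<dots> = map_pmf (\<lambda>(w, s). path_element (rpush w s)) (pair_pmf (word_walk n) (pmf_of_set UNIV))"
    by (intro map_pmf_cong refl) (auto simp: path_element_rpush dest!: word_walk_reduced)
  also have "\<dots> = map_pmf path_element (word_walk (Suc n))"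
    by (simp add: pmf.map_comp o_def case_prod_unfold)
  finally show ?case .
qed

lemma nn_integral_word_walk:
  "(\<integral>\<^sup>+ w. ennreal ((1/2) ^ length w) \<partial>measure_pmf (word_walk n)) \<le> ennreal ((7/8) ^ n)"
proof (induction n)
  case (Suc n)
  have "(\<integral>\<^sup>+ w. ennreal ((1/2) ^ length w) \<partial>measure_pmf (word_walk (Suc n))) =
      (\<integral>\<^sup>+ w. (\<integral>\<^sup>+ s. ennreal ((1/2) ^ length (rpush w s)) \<partial>measure_pmf (pmf_of_set UNIV)) \<partial>measure_pmf (word_walk n))"
    by (simp add: nn_integral_pair_pmf')
  also have "\<dots> = (\<integral>\<^sup>+ w. (\<Sum>s\<in>UNIV. ennreal ((1/2) ^ length (rpush w s))) / 4 \<partial>measure_pmf (word_walk n))"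
  proof -
    have "card (UNIV :: letter set) = 4" by (simp add: UNIV_letter)
    then show ?thesis by (subst nn_integral_pmf_of_set) auto
  qed
  also have "\<dots> \<le> (\<integral>\<^sup>+ w. ennreal (7/8) * ennreal ((1/2) ^ length w) \<partial>measure_pmf (word_walk n))"
  proof (rule nn_integral_mono)
    fix w
    have "(\<Sum>s\<in>UNIV. ennreal ((1/2) ^ length (rpush w s))) / 4 = ennreal ((\<Sum>s\<in>UNIV. (1/2) ^ length (rpush w s)) / 4)"
      by (rule sum_ennreal_quarter) simp
    also have "\<dots> \<le> ennreal (7/8 * (1/2) ^ length w)"
      using sum_half_length_rpush[of w] by (intro ennreal_leI) simp
    also have "\<dots> = ennreal (7/8) * ennreal ((1/2) ^ length w)"
      by (rule ennreal_mult) simp_all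
    finally show "(\<Sum>s\<in>UNIV. ennreal ((1/2) ^ length (rpush w s))) / 4 \<le> ennreal (7/8) * ennreal ((1/2) ^ length w)" .
  qed
  also have "\<dots> = ennreal (7/8) * (\<integral>\<^sup>+ w. ennreal ((1/2) ^ length w) \<partial>measure_pmf (word_walk n))"
    by (rule nn_integral_cmult) simp
  also have "\<dots> \<le> ennreal (7/8) * ennreal ((7/8) ^ n)" by (intro mult_left_mono Suc) simp
  finally show ?case by (simp add: ennreal_mult[symmetric])
qed simp

text \<open>Markov's inequality for 2^(-length): with r the eighth root of 1/2, length at most n/8
  means 2^(-length) is at least r^n, while its mean is at most (7/8)^n.\<close>

lemma word_walk_small_length:
  "measure_pmf.prob (word_walk n) {w. 8 * length w \<le> n} \<le> (7/8 / root 8 (1/2)) ^ n"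
proof -
  define r where "r = root 8 (1/2 :: real)"
  have r: "0 < r" "r < 1" "r ^ 8 = 1/2"
    by (simp_all add: r_def real_root_lt_1_iff real_root_pow_pos2)
  let ?A = "{w :: letter list. 8 * length w \<le> n}"
  have "ennreal (r ^ n) * emeasure (measure_pmf (word_walk n)) ?A =
      (\<integral>\<^sup>+ w. ennreal (r ^ n) * indicator ?A w \<partial>measure_pmf (word_walk n))"
    by (rule nn_integral_cmult_indicator[symmetric]) simp
  also have "\<dots> \<le> (\<integral>\<^sup>+ w. ennreal ((1/2) ^ length w) \<partial>measure_pmf (word_walk n))"
  proof (rule nn_integral_mono)
    fix w :: "letter list"
    have "r ^ n \<le> (1/2) ^ length w" if "8 * length w \<le> n"
    proof -
      have "r ^ n \<le> r ^ (8 * length w)" using that r by (intro power_decreasing) auto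
      then show ?thesis by (simp add: power_mult r(3))
    qed
    then show "ennreal (r ^ n) * indicator ?A w \<le> ennreal ((1/2) ^ length w)"
      by (auto simp: indicator_def intro: ennreal_leI)
  qed
  also have "\<dots> \<le> ennreal ((7/8) ^ n)" by (rule nn_integral_word_walk)
  finally have "ennreal (r ^ n * measure_pmf.prob (word_walk n) ?A) \<le> ennreal ((7/8) ^ n)"
    using r by (simp add: measure_pmf.emeasure_eq_measure ennreal_mult)
  then have "r ^ n * measure_pmf.prob (word_walk n) ?A \<le> (7/8) ^ n" by (subst (asm) ennreal_le_iff) auto
  then show ?thesis using r unfolding r_def[symmetric] by (simp add: power_divide field_simps)
qed

lemma not_Kesten_hitting:
  "\<not> Kesten_property LL (lamplighter_topology hitting_measure orbit_relation)"
proof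
  assume K: "Kesten_property LL (lamplighter_topology hitting_measure orbit_relation)"
  let ?C = "lamp_group hitting_measure orbit_relation" and ?F = "full_group hitting_measure orbit_relation"
  let ?d = "lamp_dist hitting_measure"
  interpret L: topological_group LL "lamplighter_topology hitting_measure orbit_relation"
    by (rule hm.topological_group_lamplighter)
  interpret C: Metric_space "carrier ?C" ?d by (rule hm.Metric_space_lamp_group)
  interpret CG: group ?C by (rule hm.group_lamp_group)
  define c where "c = Min (range (\<lambda>s. measure hitting_measure (colour s)))"
  have "c > 0" unfolding c_def using colour_positive by (subst Min_gr_iff) auto
  have c: "c \<le> measure hitting_measure (colour s)" for s unfolding c_def by (rule Min_le) auto
  \<comment> \<open>Words in the n-th power of the ball have lamps of measure at most n * c / 8,
    while a reduced word has lamps of measure at least c times its length; so its length is at most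
    n / 8.\<close>
  define \<delta> where "\<delta> = c / 8"
  have "\<delta> > 0" using \<open>c > 0\<close> by (simp add: \<delta>_def)
  \<comment> \<open>Only the lamps are restricted. The group part is arbitrary, because the norm of
    the lamps alone controls the length.\<close>
  define U where "U = C.mball \<one>\<^bsub>?C\<^esub> \<delta> \<times> carrier ?F"
  have "openin (uniform_topology hitting_measure orbit_relation) (carrier ?F)"
    using openin_topspace[of "uniform_topology hitting_measure orbit_relation"]
      topological_group.topspace_eq_carrier[OF hm.topological_group_full_group] by simp
  then have U_open: "openin (lamplighter_topology hitting_measure orbit_relation) U"
    unfolding U_def lamplighter_topology_def lamp_topology_def
    by (intro openin_prod_Times_iff[THEN iffD2] disjI2 conjI C.openin_mball)
  have U_one: "\<one>\<^bsub>LL\<^esub> \<in> U"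
    using \<open>\<delta> > 0\<close> L.one_closed by (auto simp: U_def lamplighter_def semidirect_product_def)
  \<comment> \<open>The norm of the lamp part is subadditive on the semidirect product, because the
    action preserves the measure of lamps.\<close>
  have d_mult: "?d \<one>\<^bsub>?C\<^esub> (fst (x \<otimes>\<^bsub>LL\<^esub> y)) \<le> ?d \<one>\<^bsub>?C\<^esub> (fst x) + ?d \<one>\<^bsub>?C\<^esub> (fst y)"
    if xy: "x \<in> carrier LL" "y \<in> carrier LL" for x y
  proof -
    obtain a \<phi> b \<psi> where x: "x = (a, \<phi>)" "a \<in> carrier ?C" "\<phi> \<in> carrier ?F" and y: "y = (b, \<psi>)" "b \<in> carrier ?C"
      using xy by (cases x; cases y) (auto simp: carrier_LL)
    obtain A B where A: "A \<in> fmeasurable hm.\<nu>" "a = hm.lamp_cls A" and B: "B \<in> fmeasurable hm.\<nu>" "b = hm.lamp_cls B"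
      using x(2) y(2) by (auto simp: hm.carrier_lamp_group)
    obtain g k where g: "\<phi> = hm.cls g" "hm.inverse_pair g k" using x(3) by (rule hm.carrierE)
    note kB = hm.fmeasurable_act_set[OF g(2) B(1)]
    have "measure hm.\<nu> (sym_diff {} (sym_diff A (hm.act_set k B))) \<le>
        measure hm.\<nu> (sym_diff {} A) + measure hm.\<nu> (sym_diff A (sym_diff A (hm.act_set k B)))"
      by (intro hm.measure_sym_diff_triangle hm.fmeasurable_sym_diff A kB hm.empty_fmeasurable)
    moreover have "sym_diff A (sym_diff A (hm.act_set k B)) = hm.act_set k B" by auto
    ultimately have "measure hm.\<nu> (sym_diff {} (sym_diff A (hm.act_set k B))) \<le> measure hm.\<nu> A + measure hm.\<nu> B"
      using hm.measure_act_set[OF g(2) B(1)] by simp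
    moreover have "fst (x \<otimes>\<^bsub>LL\<^esub> y) = hm.lamp_cls (sym_diff A (hm.act_set k B))"
      unfolding x(1) y(1) mult_LL A(2) B(2) g(1)
      by (simp only: fst_conv hm.lamp_action_cls[OF g(2) B(1)] hm.mult_lamp_group[OF A(1) kB])
    ultimately show ?thesis
      unfolding hm.one_lamp_group x(1) y(1) fst_conv A(2) B(2)
        hm.lamp_dist_cls[OF hm.empty_fmeasurable A(1)] hm.lamp_dist_cls[OF hm.empty_fmeasurable B(1)]
      by (simp add: hm.lamp_dist_cls[OF hm.empty_fmeasurable hm.fmeasurable_sym_diff[OF A(1) kB]])
  qed
  have U_sub: "U \<subseteq> carrier LL" by (auto simp: U_def carrier_LL)
  have power: "x \<in> carrier LL \<and> ?d \<one>\<^bsub>?C\<^esub> (fst x) \<le> real n * \<delta>" if "x \<in> set_power LL U n" for x n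
    using that
  proof (induction n arbitrary: x)
    case 0
    then have "x = \<one>\<^bsub>LL\<^esub>" by simp
    moreover have "fst \<one>\<^bsub>LL\<^esub> = \<one>\<^bsub>?C\<^esub>" by (simp add: lamplighter_def semidirect_product_def)
    ultimately show ?case by simp
  next
    case (Suc n)
    then obtain y u where yu: "y \<in> set_power LL U n" "u \<in> U" "x = y \<otimes>\<^bsub>LL\<^esub> u"
      by (auto simp: set_mult_def)
    have u: "u \<in> carrier LL" "?d \<one>\<^bsub>?C\<^esub> (fst u) < \<delta>" using yu(2) U_sub by (auto simp: U_def)
    have y: "y \<in> carrier LL" "?d \<one>\<^bsub>?C\<^esub> (fst y) \<le> real n * \<delta>" using Suc.IH[OF yu(1)] by auto
    have "?d \<one>\<^bsub>?C\<^esub> (fst x) \<le> real n * \<delta> + \<delta>" using d_mult[OF y(1) u(1)] y(2) u(2) yu(3) by simp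
    moreover have "x \<in> carrier LL" using yu(3) y(1) u(1) by simp
    ultimately show ?case by (simp add: algebra_simps)
  qed
  define \<kappa> where "\<kappa> = 7/8 / root 8 (1/2 :: real)"
  have r: "root 8 (1/2 :: real) > 0" "root 8 (1/2 :: real) ^ 8 = 1/2" by (simp_all add: real_root_pow_pos2)
  have \<kappa>: "0 < \<kappa>" "\<kappa> < 1"
  proof -
    show "0 < \<kappa>" using r by (simp add: \<kappa>_def)
    \<comment> \<open>The eighth power of 7/8 is about 0.34, below 1/2; this is why the bound n / 8
      on the length suffices for exponential decay.\<close>
    have "(7/8 :: real) < root 8 (1/2)"
    proof (rule power_less_imp_less_base)
      show "(7/8 :: real) ^ 8 < root 8 (1/2) ^ 8" unfolding r(2) by (simp add: power_divide)
    qed (use r in simp)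
    then show "\<kappa> < 1" using r by (simp add: \<kappa>_def)
  qed
  have le: "measure_pmf.prob (conv_power LL kesten_pmf n) (set_power LL U n) \<le> \<kappa> ^ n" for n
  proof -
    have "measure_pmf.prob (conv_power LL kesten_pmf n) (set_power LL U n) =
        measure_pmf.prob (word_walk n) (path_element -` set_power LL U n)"
      by (simp add: conv_power_kesten measure_map_pmf)
    also have "\<dots> = measure_pmf.prob (word_walk n) (path_element -` set_power LL U n \<inter> set_pmf (word_walk n))"
      by (simp add: measure_Int_set_pmf)
    also have "\<dots> \<le> measure_pmf.prob (word_walk n) {w. 8 * length w \<le> n}"
    proof (rule measure_pmf.finite_measure_mono)
      show "path_element -` set_power LL U n \<inter> set_pmf (word_walk n) \<subseteq> {w. 8 * length w \<le> n}"
      proof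
        fix w assume w: "w \<in> path_element -` set_power LL U n \<inter> set_pmf (word_walk n)"
        then have "?d \<one>\<^bsub>?C\<^esub> (hm.lamp_cls (path_lamps w)) \<le> real n * \<delta>"
          using power[of "path_element w" n] by (simp add: path_element_def)
        then have "measure hm.\<nu> (path_lamps w) \<le> real n * \<delta>"
          by (simp add: hm.one_lamp_group hm.lamp_dist_cls[OF hm.empty_fmeasurable path_lamps_fmeasurable])
        moreover have "c * real (length w) \<le> measure hm.\<nu> (path_lamps w)"
          using w word_walk_reduced by (intro measure_path_lamps[OF c]) auto
        ultimately have "c * real (length w) \<le> real n * \<delta>" by linarith
        then have "c * real (length w) \<le> c * (real n / 8)" by (simp add: \<delta>_def mult.commute)
        then have "real (length w) \<le> real n / 8" using \<open>c > 0\<close> by simp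
        then show "w \<in> {w. 8 * length w \<le> n}" by simp
      qed
    qed simp
    also have "\<dots> \<le> \<kappa> ^ n" unfolding \<kappa>_def by (rule word_walk_small_length)
    finally show ?thesis .
  qed
  have set_k: "set_pmf kesten_pmf \<subseteq> carrier LL" by (auto simp: kesten_pmf_def path_element_carrier)
  have sym: "map_pmf (\<lambda>x. inv\<^bsub>LL\<^esub> x) kesten_pmf = kesten_pmf"
  proof -
    have "inv\<^bsub>LL\<^esub> path_element [s] = path_element [inv_letter s]" for s
      using path_element_inv[of "inv_letter s"] by (intro L.inv_equality) (simp_all add: path_element_carrier)
    then have "map_pmf (\<lambda>x. inv\<^bsub>LL\<^esub> x) kesten_pmf = map_pmf (\<lambda>s. path_element [s]) (map_pmf inv_letter (pmf_of_set UNIV))"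
      by (simp add: kesten_pmf_def pmf.map_comp o_def)
    also have "map_pmf inv_letter (pmf_of_set UNIV) = pmf_of_set (inv_letter ` UNIV)"
      by (rule map_pmf_of_set_inj) (auto intro: inj_on_inverseI[of _ inv_letter])
    also have "inv_letter ` UNIV = UNIV" by (rule surjI) (rule inv_letter_inv_letter)
    finally show ?thesis by (simp add: kesten_pmf_def)
  qed
  have "limsup (\<lambda>n. ereal (root n (measure_pmf.prob (conv_power LL kesten_pmf n) (set_power LL U n)))) \<le> ereal \<kappa>"
  proof (rule Limsup_bounded)
    have "root n (measure_pmf.prob (conv_power LL kesten_pmf n) (set_power LL U n)) \<le> \<kappa>" if "n > 0" for n
    proof -
      have "root n (measure_pmf.prob (conv_power LL kesten_pmf n) (set_power LL U n)) \<le> root n (\<kappa> ^ n)"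
        using that le[of n] by simp
      also have "\<dots> = \<kappa>" using that \<kappa>(1) by (simp add: real_root_power_cancel)
      finally show ?thesis .
    qed
    then show "eventually (\<lambda>n. ereal (root n (measure_pmf.prob (conv_power LL kesten_pmf n) (set_power LL U n))) \<le> ereal \<kappa>) sequentially"
      unfolding eventually_sequentially by (intro exI[of _ 1]) simp
  qed
  moreover have "limsup (\<lambda>n. ereal (root n (measure_pmf.prob (conv_power LL kesten_pmf n) (set_power LL U n)))) = 1"
    using K U_open U_one set_k sym unfolding Kesten_property_def by blast
  ultimately have "1 \<le> ereal \<kappa>" by simp
  then show False using \<kappa>(2) by (simp add: one_ereal_def)
qed

theorem corollary6p5:
  fixes \<mu> :: "letter stream measure" and R :: "(letter stream \<times> letter stream) set"
  assumes "\<mu> = hitting_measure" and "R = orbit_relation"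
  shows "topological_group (lamplighter \<mu> R) (lamplighter_topology \<mu> R) \<and>
    Polish_topology (lamplighter_topology \<mu> R) \<and>
    contractible_space (lamplighter_topology \<mu> R) \<and>
    locally_generated (lamplighter \<mu> R) (lamplighter_topology \<mu> R) \<and>
    amenable_group (lamplighter \<mu> R) (lamplighter_topology \<mu> R) \<and>
    \<not> Kesten_property (lamplighter \<mu> R) (lamplighter_topology \<mu> R)"
proof -
  have "contractible_space (lamplighter_topology hitting_measure orbit_relation)"
    by (rule shift_relation.contractible_lamplighter[OF shift_relation_hitting])
  moreover from this have "connected_space (lamplighter_topology hitting_measure orbit_relation)"
    by (rule contractible_imp_connected_space)
  ultimately show ?thesis
    unfolding assms
    using hm.topological_group_lamplighter amenable_hitting not_Kesten_hitting
      hm.Polish_lamplighter[OF algebra_cylinder_algebra sets_cylinder_algebra countable_cylinder_algebra]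
      topological_group.connected_imp_locally_generated[OF hm.topological_group_lamplighter]
    by blast
qed

end
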